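(* Let $(\Pi,\underline\mu)$ be a Baker--Akhieser weighted line arrangement, $A=A(\Pi,\underline\mu)$, and let $\vec\xi=(\rho_0\cos\varphi_0,\rho_0\sin\varphi_0)$ with $\rho_0\in\mathbb C^\ast$, $\varphi_0\in\mathbb C$, such that $\sin(2(\alpha-\varphi_0))\neq 0$ for all $\alpha\in\Pi$. Let $W\subset R$ be the spectral module defined below. Then $W\cong P(-\xi_1z_1-\xi_2z_2):=\{f\in R:\exp(-\xi_1z_1-\xi_2z_2)f\text{ is }(\Pi,\underline\mu)\text{-quasi-invariant}\}$ as $A$-modules. In particular $W$ is a projective $A$-module.
   Context: $R=\mathbb C[z_1,z_2]$, polar coordinates $z_1=\rho\cos\varphi$, $z_2=\rho\sin\varphi$, $g^{(k)}_\alpha=\partial^kg/\partial\varphi^k|_{\varphi=\alpha}$. A weighted line arrangement: $\Pi\subset\mathbb C$ finite, $\alpha-\beta\notin\pi\mathbb Z$ for $\alpha\ne\beta$, $\underline\mu:\Pi\to\mathbb N_0$; $l_\alpha=-\sin(\alpha)z_1+\cos(\alpha)z_2$, $s_\alpha$ the involution of $R$ induced by the reflection fixing $\{l_\alpha=0\}$, $A(\Pi,\underline\mu)=\{f\in R:l_\alpha^{2\mu_\alpha+1}\mid f-s_\alpha(f)\ \forall\alpha\}$. An analytic function $g$ is $(\Pi,\underline\mu)$-quasi-invariant if $g^{(2l-1)}_\alpha=0$ for all $\alpha\in\Pi$, $1\le l\le\mu_\alpha$. With $e(\alpha)=\exp(2i\alpha)$, $(\Pi,\underline\mu)$ is Baker--Akhieser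 if for all $\alpha\in\Pi$ and $1\le k\le\mu_\alpha$: $\sum_{\beta\ne\alpha}\mu_\beta\frac{(e(\beta)+e(\alpha))^{2k-1}}{(e(\beta)-e(\alpha))^{2k-1}}=0$ and $\sum_{\beta\ne\alpha}\mu_\beta(\mu_\beta+1)\frac{e(\beta)(e(\beta)+e(\alpha))^{2k-1}}{(e(\beta)-e(\alpha))^{2k+1}}=0$. Let $\mu=\sum_\alpha\mu_\alpha$, $\delta(z_1,z_2)=\prod_\alpha l_\alpha^{\mu_\alpha}$, $H=\partial_{x_1}^2+\partial_{x_2}^2-\sum_{\alpha\in\Pi}\frac{\mu_\alpha(\mu_\alpha+1)}{l_\alpha^2(\vec x-\vec\xi)}$, and $\Psi(\vec x;\vec z;\vec\xi)=\frac{1}{2^\mu\mu!}(H-z_1^2-z_2^2)^\mu\big(\delta(x_1-\xi_1,x_2-\xi_2)\exp(x_1z_1+x_2z_2)\big)$ (operators acting in $\vec x$). For $(p_1,p_2)\in\mathbb N_0^2$, $w_{(p_1,p_2)}=\frac{\partial^{p_1+p_2}\Psi}{\partial x_1^{p_1}\partial x_2^{p_2}}\big|_{\vec x=0}$; these are polynomials in $z_1,z_2$, and $W=\langle w_{(p_1,p_2)}:(p_1,p_2)\in\mathbb N_0^2\rangle_{\mathbb C}\subset R$ is an $A$-module under multiplication. *)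

theory Defs
  imports "HOL-Analysis.Analysis" "HOL-Library.Function_Algebras"
begin

text \<open>Functions of two complex variables are modelled curried:
  complex \<Rightarrow> complex \<Rightarrow> complex.  The ring R = C[z1,z2] is modelled
  as the ring of polynomial functions on C^2 (isomorphic to C[z1,z2]).\<close>

type_synonym cfun2 = "complex \<Rightarrow> complex \<Rightarrow> complex"

definition poly2 :: "cfun2 \<Rightarrow> bool" where
  "poly2 f \<longleftrightarrow> (\<exists>S c. finite (S :: (nat \<times> nat) set) \<and>
      f = (\<lambda>z1 z2. \<Sum>(i,j)\<in>S. c (i,j) * z1 ^ i * z2 ^ j))"

definition lin :: "complex \<Rightarrow> cfun2" where
  "lin \<alpha> = (\<lambda>z1 z2. - sin \<alpha> * z1 + cos \<alpha> * z2)"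

text \<open>Reflection of C^2 fixing the line l_alpha = 0 (i.e. the line spanned by
  (cos alpha, sin alpha)); the involution s_alpha of R is f \<mapsto> f \<circ> reflection.\<close>
definition refl_fun :: "complex \<Rightarrow> cfun2 \<Rightarrow> cfun2" where
  "refl_fun \<alpha> f = (\<lambda>z1 z2. f (cos (2*\<alpha>) * z1 + sin (2*\<alpha>) * z2)
                             (sin (2*\<alpha>) * z1 - cos (2*\<alpha>) * z2))"

definition arrangement :: "complex set \<Rightarrow> bool" where
  "arrangement Pa \<longleftrightarrow> finite Pa \<and>
     (\<forall>\<alpha>\<in>Pa. \<forall>\<beta>\<in>Pa. \<alpha> \<noteq> \<beta> \<longrightarrow> (\<forall>k::int. \<alpha> - \<beta> \<noteq> of_int k * of_real pi))"

definition ringA :: "complex set \<Rightarrow> (complex \<Rightarrow> nat) \<Rightarrow> cfun2 set" where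
  "ringA Pa \<mu> = {f. poly2 f \<and> (\<forall>\<alpha>\<in>Pa. \<exists>g. poly2 g \<and>
       (\<forall>z1 z2. f z1 z2 - refl_fun \<alpha> f z1 z2 = (lin \<alpha> z1 z2) ^ (2 * \<mu> \<alpha> + 1) * g z1 z2))}"

definition quasi_invariant :: "complex set \<Rightarrow> (complex \<Rightarrow> nat) \<Rightarrow> cfun2 \<Rightarrow> bool" where
  "quasi_invariant Pa \<mu> g \<longleftrightarrow>
     (\<forall>\<alpha>\<in>Pa. \<forall>l. 1 \<le> l \<and> l \<le> \<mu> \<alpha> \<longrightarrow>
        (\<forall>\<rho>. (deriv ^^ (2 * l - 1)) (\<lambda>\<phi>. g (\<rho> * cos \<phi>) (\<rho> * sin \<phi>)) \<alpha> = 0))"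

definition eA :: "complex \<Rightarrow> complex" where
  "eA \<alpha> = exp (2 * \<i> * \<alpha>)"

definition baker_akhieser :: "complex set \<Rightarrow> (complex \<Rightarrow> nat) \<Rightarrow> bool" where
  "baker_akhieser Pa \<mu> \<longleftrightarrow> arrangement Pa \<and>
     (\<forall>\<alpha>\<in>Pa. \<forall>k. 1 \<le> k \<and> k \<le> \<mu> \<alpha> \<longrightarrow>
        (\<Sum>\<beta>\<in>Pa - {\<alpha>}. of_nat (\<mu> \<beta>) *
            (eA \<beta> + eA \<alpha>) ^ (2*k - 1) / (eA \<beta> - eA \<alpha>) ^ (2*k - 1)) = 0 \<and>
        (\<Sum>\<beta>\<in>Pa - {\<alpha>}. of_nat (\<mu> \<beta> * (\<mu> \<beta> + 1)) *
            eA \<beta> * (eA \<beta> + eA \<alpha>) ^ (2*k - 1) / (eA \<beta> - eA \<alpha>) ^ (2*k + 1)) = 0)"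

definition pd1 :: "cfun2 \<Rightarrow> cfun2" where
  "pd1 u = (\<lambda>x1 x2. deriv (\<lambda>t. u t x2) x1)"
definition pd2 :: "cfun2 \<Rightarrow> cfun2" where
  "pd2 u = (\<lambda>x1 x2. deriv (\<lambda>t. u x1 t) x2)"

definition opL :: "complex set \<Rightarrow> (complex \<Rightarrow> nat) \<Rightarrow> complex \<Rightarrow> complex
                    \<Rightarrow> complex \<Rightarrow> complex \<Rightarrow> cfun2 \<Rightarrow> cfun2" where
  "opL Pa \<mu> \<xi>1 \<xi>2 z1 z2 u = (\<lambda>x1 x2.
      pd1 (pd1 u) x1 x2 + pd2 (pd2 u) x1 x2
      - (\<Sum>\<alpha>\<in>Pa. of_nat (\<mu> \<alpha> * (\<mu> \<alpha> + 1)) / (lin \<alpha> (x1 - \<xi>1) (x2 - \<xi>2)) ^ 2) * u x1 x2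
      - (z1 ^ 2 + z2 ^ 2) * u x1 x2)"

definition Psi :: "complex set \<Rightarrow> (complex \<Rightarrow> nat) \<Rightarrow> complex \<Rightarrow> complex
                    \<Rightarrow> complex \<Rightarrow> complex \<Rightarrow> cfun2" where
  "Psi Pa \<mu> \<xi>1 \<xi>2 z1 z2 =
     (let m = (\<Sum>\<alpha>\<in>Pa. \<mu> \<alpha>) in
      (\<lambda>x1 x2. (1 / (2 ^ m * of_nat (fact m))) *
        (opL Pa \<mu> \<xi>1 \<xi>2 z1 z2 ^^ m)
          (\<lambda>y1 y2. (\<Prod>\<alpha>\<in>Pa. (lin \<alpha> (y1 - \<xi>1) (y2 - \<xi>2)) ^ (\<mu> \<alpha>)) * exp (y1 * z1 + y2 * z2))
          x1 x2))"

definition wfun :: "complex set \<Rightarrow> (complex \<Rightarrow> nat) \<Rightarrow> complex \<Rightarrow> complex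
                    \<Rightarrow> nat \<times> nat \<Rightarrow> cfun2" where
  "wfun Pa \<mu> \<xi>1 \<xi>2 p = (\<lambda>z1 z2. (pd1 ^^ fst p) ((pd2 ^^ snd p) (Psi Pa \<mu> \<xi>1 \<xi>2 z1 z2)) 0 0)"

definition spectral_module :: "complex set \<Rightarrow> (complex \<Rightarrow> nat) \<Rightarrow> complex \<Rightarrow> complex \<Rightarrow> cfun2 set" where
  "spectral_module Pa \<mu> \<xi>1 \<xi>2 = {f. \<exists>S c. finite (S :: (nat \<times> nat) set) \<and>
       f = (\<lambda>z1 z2. \<Sum>p\<in>S. c p * wfun Pa \<mu> \<xi>1 \<xi>2 p z1 z2)}"

definition Pmod :: "complex set \<Rightarrow> (complex \<Rightarrow> nat) \<Rightarrow> complex \<Rightarrow> complex \<Rightarrow> cfun2 set" where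
  "Pmod Pa \<mu> \<xi>1 \<xi>2 = {f. poly2 f \<and>
      quasi_invariant Pa \<mu> (\<lambda>z1 z2. exp (- \<xi>1 * z1 - \<xi>2 * z2) * f z1 z2)}"

definition A_mod_iso :: "cfun2 set \<Rightarrow> cfun2 set \<Rightarrow> cfun2 set \<Rightarrow> bool" where
  "A_mod_iso A M N \<longleftrightarrow> (\<exists>\<Phi>. bij_betw \<Phi> M N \<and>
     (\<forall>u\<in>M. \<forall>v\<in>M. \<Phi> (\<lambda>z1 z2. u z1 z2 + v z1 z2) = (\<lambda>z1 z2. \<Phi> u z1 z2 + \<Phi> v z1 z2)) \<and>
     (\<forall>a\<in>A. \<forall>u\<in>M. \<Phi> (\<lambda>z1 z2. a z1 z2 * u z1 z2) = (\<lambda>z1 z2. a z1 z2 * \<Phi> u z1 z2)))"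

definition is_A_module :: "cfun2 set \<Rightarrow> 'b::ab_group_add set \<Rightarrow> (cfun2 \<Rightarrow> 'b \<Rightarrow> 'b) \<Rightarrow> bool" where
  "is_A_module A M act \<longleftrightarrow>
     0 \<in> M \<and> (\<forall>x\<in>M. \<forall>y\<in>M. x + y \<in> M) \<and> (\<forall>x\<in>M. - x \<in> M) \<and>
     (\<forall>a\<in>A. \<forall>x\<in>M. act a x \<in> M) \<and>
     (\<forall>a\<in>A. \<forall>x\<in>M. \<forall>y\<in>M. act a (x + y) = act a x + act a y) \<and>
     (\<forall>a\<in>A. \<forall>b\<in>A. \<forall>x\<in>M. act (\<lambda>z1 z2. a z1 z2 + b z1 z2) x = act a x + act b x) \<and>
     (\<forall>a\<in>A. \<forall>b\<in>A. \<forall>x\<in>M. act (\<lambda>z1 z2. a z1 z2 * b z1 z2) x = act a (act b x)) \<and>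
     (\<forall>x\<in>M. act (\<lambda>z1 z2. 1) x = x)"

definition is_A_hom :: "cfun2 set \<Rightarrow> 'b::ab_group_add set \<Rightarrow> (cfun2 \<Rightarrow> 'b \<Rightarrow> 'b)
                        \<Rightarrow> 'c::ab_group_add set \<Rightarrow> (cfun2 \<Rightarrow> 'c \<Rightarrow> 'c) \<Rightarrow> ('b \<Rightarrow> 'c) \<Rightarrow> bool" where
  "is_A_hom A M actM N actN h \<longleftrightarrow>
     (\<forall>x\<in>M. h x \<in> N) \<and> (\<forall>x\<in>M. \<forall>y\<in>M. h (x + y) = h x + h y) \<and>
     (\<forall>a\<in>A. \<forall>x\<in>M. h (actM a x) = actN a (h x))"

text \<open>Projectivity (lifting property) of an A-submodule W of the function space,
  tested against all A-modules living in an arbitrary type 'b.\<close>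
definition A_projective :: "'b::ab_group_add itself \<Rightarrow> cfun2 set \<Rightarrow> cfun2 set \<Rightarrow> bool" where
  "A_projective _ A W \<longleftrightarrow>
     (\<forall>(M::'b set) actM (N::'b set) actN p h.
        is_A_module A M actM \<and> is_A_module A N actN \<and>
        is_A_hom A M actM N actN p \<and> p ` M = N \<and>
        is_A_hom A W (\<lambda>a u z1 z2. a z1 z2 * u z1 z2) N actN h \<longrightarrow>
        (\<exists>g. is_A_hom A W (\<lambda>a u z1 z2. a z1 z2 * u z1 z2) M actM g \<and> (\<forall>w\<in>W. p (g w) = h w)))"

end

theory Submission
  imports Defs "HOL-Complex_Analysis.Cauchy_Integral_Formula"
begin

text \<open>
  After conjugation by \<open>exp (x1 z1 + x2 z2)\<close> and clearing denominators, the iterates of the operator on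
  \<open>\<delta> exp (x1 z1 + x2 z2)\<close> become polynomials \<open>Qs n\<close> in \<open>x - \<xi>\<close> and \<open>z\<close>. The cotangent sums in the
  Baker--Akhieser condition ensure that the operator preserves quasi-invariance in \<open>x\<close>, and each step lowers the
  degree in \<open>x\<close>. The leading form of a quasi-invariant is divisible by \<open>\<delta>\<close>, so the iteration stops after \<open>\<mu>\<close> steps,
  and the same principle shows that the last iterate is annihilated by the dual operator in \<open>z\<close>. So it is
  quasi-invariant in \<open>z\<close>, which gives one inclusion between \<open>W\<close> and \<open>P(-\<xi>1 z1 - \<xi>2 z2)\<close>. As the leading form of
  \<open>w (p1, p2)\<close> is \<open>z1 ^ p1 * z2 ^ p2 * \<delta> z1 z2\<close>, the other inclusion follows by induction on the degree, and the
  isomorphism is the identity.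

  For projectivity, \<open>P(-\<xi>1 z1 - \<xi>2 z2)\<close> is multiplied into \<open>A\<close> by \<open>P(\<xi>1 z1 + \<xi>2 z2)\<close>, and the products generate the
  unit ideal of \<open>A\<close>: at the origin this is seen from truncated exponentials, and away from the origin the lines are
  disjoint, so that they can be treated one at a time.
\<close>

subsection \<open>Polynomial functions\<close>

text \<open>The construction of \<open>Qs\<close> yields quasi-invariance in \<open>x\<close> only;
  the obstacle is the passage to \<open>z\<close>. Counting degrees bounds the value of the dual
  operator on the last iterate \<open>Qf\<close> but leaves a possible leading form of
  \<open>x\<close>-degree exactly \<open>deg\<close>, namely \<delta> in \<open>x\<close> times a
  polynomial in \<open>z\<close>. A symmetry excludes it: \<open>Qf\<close> is invariant under
  scaling \<open>x - \<xi>\<close> by \<open>t\<close> and \<open>z\<close> by \<open>1 / t\<close>,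
  its top part is a multiple of the symmetric product of \<delta> in \<open>x\<close> and \<delta>
  in \<open>z\<close>, and comparing the next part with its image under the exchange of both sets of
  variables shows that the leading form vanishes where the two sets agree. The constant
  \<open>cN\<close> of that multiple is \<open>2 ^ N * fact N\<close>, since \<open>N\<close>
  derivatives of \<delta> along \<open>2 z\<close> produce it; this is the normalisation of
  \<open>Psi\<close>. All conditions along a line are recast as divisibility of
  \<open>p - exp (-2 \<kappa> l) s(p)\<close> by \<open>l ^ (2 k)\<close>, with the exponential
  truncated. In this form the constants \<kappa> add when elements are multiplied, so the pairing of
  the modules for \<xi> and -\<xi> lands in the ring.\<close>

inductive polyfun :: "(('v \<Rightarrow> complex) \<Rightarrow> complex) \<Rightarrow> bool" where
  const: "polyfun (\<lambda>v. c)"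
| var: "polyfun (\<lambda>v. v i)"
| add: "polyfun f \<Longrightarrow> polyfun g \<Longrightarrow> polyfun (\<lambda>v. f v + g v)"
| mult: "polyfun f \<Longrightarrow> polyfun g \<Longrightarrow> polyfun (\<lambda>v. f v * g v)"

lemma polyfun_uminus: "polyfun f \<Longrightarrow> polyfun (\<lambda>v. - f v)"
  using polyfun.mult[OF polyfun.const[of "-1"], of f] by simp

lemma polyfun_diff: "polyfun f \<Longrightarrow> polyfun g \<Longrightarrow> polyfun (\<lambda>v. f v - g v)"
  using polyfun.add[OF _ polyfun_uminus, of f g] by simp

lemma polyfun_line: "polyfun f \<Longrightarrow> \<exists>p. \<forall>t. f (\<lambda>i. a i + t * b i) = poly p t"
proof (induction rule: polyfun.induct)
  case (const c)
  show ?case by (rule exI[of _ "[:c:]"]) simp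
next
  case (var i)
  show ?case by (rule exI[of _ "[:a i, b i:]"]) simp
next
  case (add f g)
  then obtain p q where "\<forall>t. f (\<lambda>i. a i + t * b i) = poly p t" "\<forall>t. g (\<lambda>i. a i + t * b i) = poly q t"
    by blast
  then show ?case by (intro exI[of _ "p + q"]) simp
next
  case (mult f g)
  then obtain p q where "\<forall>t. f (\<lambda>i. a i + t * b i) = poly p t" "\<forall>t. g (\<lambda>i. a i + t * b i) = poly q t"
    by blast
  then show ?case by (intro exI[of _ "p * q"]) simp
qed

typedef 'v pfun = "{f :: ('v \<Rightarrow> complex) \<Rightarrow> complex. polyfun f}"
  morphisms ev Pfun
  using polyfun.const by blast

setup_lifting type_definition_pfun

lemma polyfun_ev: "polyfun (ev p)"
  using ev[of p] by simp

lemma pfun_eqI: "(\<And>v. ev p v = ev q v) \<Longrightarrow> p = q"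
  by (simp add: ev_inject[symmetric] fun_eq_iff)

instantiation pfun :: (type) comm_ring_1
begin
lift_definition zero_pfun :: "'a pfun" is "\<lambda>v. 0" by (rule polyfun.const)
lift_definition one_pfun :: "'a pfun" is "\<lambda>v. 1" by (rule polyfun.const)
lift_definition plus_pfun :: "'a pfun \<Rightarrow> 'a pfun \<Rightarrow> 'a pfun" is "\<lambda>f g v. f v + g v"
  by (rule polyfun.add)
lift_definition times_pfun :: "'a pfun \<Rightarrow> 'a pfun \<Rightarrow> 'a pfun" is "\<lambda>f g v. f v * g v"
  by (rule polyfun.mult)
lift_definition uminus_pfun :: "'a pfun \<Rightarrow> 'a pfun" is "\<lambda>f v. - f v"
  by (rule polyfun_uminus)
lift_definition minus_pfun :: "'a pfun \<Rightarrow> 'a pfun \<Rightarrow> 'a pfun" is "\<lambda>f g v. f v - g v"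
  by (rule polyfun_diff)
instance
  by standard (transfer; simp add: fun_eq_iff algebra_simps)+
end

lift_definition Const :: "complex \<Rightarrow> 'v pfun" is "\<lambda>c v. c" by (rule polyfun.const)
lift_definition Var :: "'v \<Rightarrow> 'v pfun" is "\<lambda>i v. v i" by (rule polyfun.var)

lemma ev_simps [simp]:
  "ev 0 v = 0" "ev 1 v = 1" "ev (p + q) v = ev p v + ev q v" "ev (p * q) v = ev p v * ev q v"
  "ev (- p) v = - ev p v" "ev (p - q) v = ev p v - ev q v" "ev (Const c) v = c" "ev (Var i) v = v i"
  by (transfer; simp)+

lemma ev_power [simp]: "ev (p ^ n) v = ev p v ^ n"
  by (induction n) auto

lemma ev_sum [simp]: "ev (sum f A) v = (\<Sum>a\<in>A. ev (f a) v)"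
  by (induction A rule: infinite_finite_induct) auto

lemma ev_prod [simp]: "ev (prod f A) v = (\<Prod>a\<in>A. ev (f a) v)"
  by (induction A rule: infinite_finite_induct) auto

lemma ev_of_nat [simp]: "ev (of_nat n) v = of_nat n"
  by (induction n) auto

lemma ev_numeral [simp]: "ev (numeral n) v = numeral n"
  using ev_of_nat[of "numeral n" v] by simp

lemma Const_simps:
  "Const (a + b) = Const a + Const b" "Const (a * b) = Const a * Const b"
  "Const (a - b) = Const a - Const b" "Const (- a) = - Const a" "Const 0 = 0" "Const 1 = 1"
  "Const (a ^ n) = Const a ^ n" "Const (of_nat n) = of_nat n" "Const (numeral m) = numeral m"
  by (auto intro!: pfun_eqI)

lemma Const_sum: "Const (sum f A) = (\<Sum>a\<in>A. Const (f a))"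
  by (auto intro!: pfun_eqI)

lemma Const_eq_0_iff [simp]: "Const c = (0::'v pfun) \<longleftrightarrow> c = 0"
proof
  assume "Const c = (0::'v pfun)"
  then have "ev (Const c) (\<lambda>i::'v. 0) = ev 0 (\<lambda>i::'v. 0)" by simp
  then show "c = 0" by simp
qed (auto intro: pfun_eqI)

lemma pfun_induct [case_names Const Var add mult]:
  assumes "\<And>c. P (Const c)" "\<And>i. P (Var i)" "\<And>p q. P p \<Longrightarrow> P q \<Longrightarrow> P (p + q)"
    "\<And>p q. P p \<Longrightarrow> P q \<Longrightarrow> P (p * q)"
  shows "P p"
proof -
  have "P (Pfun f)" if "polyfun f" for f
    using that
  proof (induction rule: polyfun.induct)
    case (const c)
    then show ?case using assms(1) by (simp add: Const.abs_eq)
  next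
    case (var i)
    then show ?case using assms(2) by (simp add: Var.abs_eq)
  next
    case (add f g)
    then show ?case using assms(3)[of "Pfun f" "Pfun g"]
      by (simp add: plus_pfun.abs_eq eq_onp_same_args)
  next
    case (mult f g)
    then show ?case using assms(4)[of "Pfun f" "Pfun g"]
      by (simp add: times_pfun.abs_eq eq_onp_same_args)
  qed
  from this[OF polyfun_ev, of p] show ?thesis by (simp add: ev_inverse)
qed

lemma ev_line_poly: "\<exists>q. \<forall>t. ev p (\<lambda>i. a i + t * b i) = poly q t"
  by (rule polyfun_line[OF polyfun_ev])

text \<open>Two nonzero functions need not be visibly nonzero at a common point. Both are restricted
  to the line joining a point where the first is nonzero to one where the second is; there they
  become nonzero univariate polynomials.\<close>

instance pfun :: (type) idom
proof
  fix p q :: "'a pfun"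
  assume nz: "p \<noteq> 0" "q \<noteq> 0"
  obtain a b where a: "ev p a \<noteq> 0" and b: "ev q b \<noteq> 0"
    using nz pfun_eqI[of p 0] pfun_eqI[of q 0] by auto
  obtain p' where p': "\<And>t. ev p (\<lambda>i. a i + t * (b i - a i)) = poly p' t"
    using ev_line_poly[of p a "\<lambda>i. b i - a i"] by blast
  obtain q' where q': "\<And>t. ev q (\<lambda>i. a i + t * (b i - a i)) = poly q' t"
    using ev_line_poly[of q a "\<lambda>i. b i - a i"] by blast
  have "p' \<noteq> 0" using p'[of 0] a by auto
  moreover have "q' \<noteq> 0" using q'[of 1] b by auto
  ultimately have "p' * q' \<noteq> 0" by simp
  then obtain t where "poly (p' * q') t \<noteq> 0" using poly_all_0_iff_0 by blast
  then have "ev (p * q) (\<lambda>i. a i + t * (b i - a i)) \<noteq> 0" by (simp add: p' q')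
  then show "p * q \<noteq> 0" using ev_simps(1) by metis
qed

instance pfun :: (type) ring_char_0
proof
  show "inj (of_nat :: nat \<Rightarrow> 'a pfun)"
  proof (rule injI)
    fix m n :: nat
    assume "of_nat m = (of_nat n :: 'a pfun)"
    then have "ev (of_nat m) (\<lambda>i::'a. 0) = ev (of_nat n) (\<lambda>i::'a. 0)" by simp
    then show "m = n" by simp
  qed
qed

lemma polyfun_comp: "polyfun f \<Longrightarrow> polyfun (\<lambda>w. f (\<lambda>i. ev (\<theta> i) w))"
  by (induction rule: polyfun.induct) (auto intro: polyfun.intros polyfun_ev)

lift_definition subst :: "('v \<Rightarrow> 'w pfun) \<Rightarrow> 'v pfun \<Rightarrow> 'w pfun" is
  "\<lambda>\<theta> f w. f (\<lambda>i. \<theta> i w)"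
proof -
  fix \<theta> :: "'v \<Rightarrow> ('w \<Rightarrow> complex) \<Rightarrow> complex" and f :: "('v \<Rightarrow> complex) \<Rightarrow> complex"
  assume "\<And>i. polyfun (\<theta> i)" and f: "polyfun f"
  then have "\<And>i. \<theta> i = ev (Pfun (\<theta> i))" by (simp add: Pfun_inverse)
  then show "polyfun (\<lambda>w. f (\<lambda>i. \<theta> i w))"
    using polyfun_comp[OF f, of "\<lambda>i. Pfun (\<theta> i)"] by simp
qed

lemma ev_subst [simp]: "ev (subst \<theta> p) w = ev p (\<lambda>i. ev (\<theta> i) w)"
  by transfer simp

lemma subst_simps [simp]:
  "subst \<theta> 0 = 0" "subst \<theta> 1 = 1" "subst \<theta> (p + q) = subst \<theta> p + subst \<theta> q"
  "subst \<theta> (p * q) = subst \<theta> p * subst \<theta> q" "subst \<theta> (- p) = - subst \<theta> p"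
  "subst \<theta> (p - q) = subst \<theta> p - subst \<theta> q" "subst \<theta> (Const c) = Const c" "subst \<theta> (Var i) = \<theta> i"
  "subst \<theta> (p ^ n) = subst \<theta> p ^ n" "subst \<theta> (of_nat n) = of_nat n" "subst \<theta> (numeral k) = numeral k"
  by (auto intro!: pfun_eqI)

lemma subst_sum: "subst \<theta> (sum f A) = (\<Sum>a\<in>A. subst \<theta> (f a))"
  and subst_prod: "subst \<theta> (prod f A) = (\<Prod>a\<in>A. subst \<theta> (f a))"
  by (auto intro!: pfun_eqI)

text \<open>Taken from \<open>deriv\<close>, so that no expansion into monomials is needed;
  \<open>pdiff_aux\<close> shows that the result is again polynomial, hence that \<open>Pfun\<close>
  is applied inside its domain.\<close>

definition pdiff :: "'v \<Rightarrow> 'v pfun \<Rightarrow> 'v pfun" where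
  "pdiff i p = Pfun (\<lambda>v. deriv (\<lambda>t. ev p (v(i := t))) (v i))"

lemma pdiff_aux:
  "polyfun (\<lambda>v. deriv (\<lambda>t. ev p (v(i := t))) (v i)) \<and>
    (\<forall>v. (\<lambda>t. ev p (v(i := t))) field_differentiable at (v i))"
proof (induction p rule: pfun_induct)
  case (Const c)
  then show ?case by (simp add: polyfun.const)
next
  case (Var j)
  have *: "(\<lambda>t. (v(i := t)) j) = (if i = j then (\<lambda>t. t) else (\<lambda>t. v j))" for v :: "'a \<Rightarrow> complex"
    by auto
  show ?case unfolding ev_simps * by (cases "i = j") (simp_all add: polyfun.const)
next
  case (add p q)
  then show ?case by (simp add: field_differentiable_add polyfun.add)
next
  case (mult p q)
  have "deriv (\<lambda>t. ev (p * q) (v(i := t))) (v i)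
      = ev p v * deriv (\<lambda>t. ev q (v(i := t))) (v i) + deriv (\<lambda>t. ev p (v(i := t))) (v i) * ev q v" for v
    unfolding ev_simps
    by (subst deriv_mult) (use mult in \<open>simp_all only: fun_upd_triv\<close>)
  moreover have "(\<lambda>t. ev (p * q) (v(i := t))) field_differentiable at (v i)" for v
    unfolding ev_simps by (rule field_differentiable_mult) (use mult in blast)+
  ultimately show ?case
    using mult by (simp only:) (intro conjI polyfun.add polyfun.mult polyfun_ev allI; simp only: simp_thms)
qed

lemma ev_pdiff: "ev (pdiff i p) v = deriv (\<lambda>t. ev p (v(i := t))) (v i)"
  unfolding pdiff_def using pdiff_aux[of p i] by (simp add: Pfun_inverse)

lemma pdiff_simps [simp]:
  "pdiff i (Const c) = 0" "pdiff i (p + q) = pdiff i p + pdiff i q"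
proof -
  show "pdiff i (Const c) = 0" by (rule pfun_eqI) (simp add: ev_pdiff)
  show "pdiff i (p + q) = pdiff i p + pdiff i q"
    using pdiff_aux[of p i] pdiff_aux[of q i] by (intro pfun_eqI) (simp add: ev_pdiff)
qed

lemma pdiff_Var: "pdiff i (Var j) = (if i = j then 1 else 0)"
proof (rule pfun_eqI)
  fix v :: "'a \<Rightarrow> complex"
  have "(\<lambda>t. (v(i := t)) j) = (if i = j then (\<lambda>t. t) else (\<lambda>t. v j))" by auto
  then show "ev (pdiff i (Var j)) v = ev (if i = j then 1 else 0) v"
    by (simp add: ev_pdiff)
qed

lemma pdiff_mult: "pdiff i (p * q) = pdiff i p * q + p * pdiff i q"
  using pdiff_aux[of p i] pdiff_aux[of q i] by (intro pfun_eqI) (simp add: ev_pdiff algebra_simps)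

lemma pdiff_more [simp]:
  "pdiff i 0 = 0" "pdiff i 1 = 0" "pdiff i (- p) = - pdiff i p" "pdiff i (p - q) = pdiff i p - pdiff i q"
  "pdiff i (of_nat n) = 0" "pdiff i (numeral k) = 0"
proof -
  show 0: "pdiff i 0 = 0" and "pdiff i 1 = 0"
    and "pdiff i (of_nat n) = 0" "pdiff i (numeral k) = 0"
    using pdiff_simps(1)[of i 0] pdiff_simps(1)[of i 1] pdiff_simps(1)[of i "of_nat n"]
      pdiff_simps(1)[of i "numeral k"] by (simp_all add: Const_simps)
  show *: "pdiff i (- p) = - pdiff i p" for p :: "'a pfun"
    using pdiff_simps(2)[of i p "- p"] 0 by (simp add: eq_neg_iff_add_eq_0 add.commute)
  show "pdiff i (p - q) = pdiff i p - pdiff i q"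
    using pdiff_simps(2)[of i p "- q"] * by simp
qed

lemma pdiff_commute: "pdiff i (pdiff j p) = pdiff j (pdiff i p)"
  by (induction p rule: pfun_induct) (auto simp: pdiff_Var pdiff_mult algebra_simps)

lemma ev_chain:
  fixes p :: "'v::finite pfun"
  assumes "\<And>i. ((\<lambda>t. \<gamma> t i) has_field_derivative \<gamma>' i) (at t)"
  shows "((\<lambda>t. ev p (\<gamma> t)) has_field_derivative (\<Sum>i\<in>UNIV. ev (pdiff i p) (\<gamma> t) * \<gamma>' i)) (at t)"
proof (induction p rule: pfun_induct)
  case (Var j)
  have "(\<Sum>i\<in>UNIV. (if i = j then 1 else 0) * \<gamma>' i) = (\<Sum>i\<in>UNIV. if i = j then \<gamma>' i else 0)"
    by (intro sum.cong) auto
  then show ?case using assms[of j] by (simp add: pdiff_Var if_distrib[of "\<lambda>x. ev x _"] if_distrib[of "\<lambda>x. x * _"] cong: if_cong)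
next
  case (add p q)
  then show ?case by (auto intro!: derivative_eq_intros simp: sum.distrib algebra_simps)
next
  case (mult p q)
  show ?case unfolding ev_simps
    by (rule derivative_eq_intros mult refl)+
      (simp add: pdiff_mult sum.distrib sum_distrib_left sum_distrib_right algebra_simps)
qed auto

lemma pdiff_subst:
  fixes p :: "'v::finite pfun"
  shows "pdiff j (subst \<theta> p) = (\<Sum>i\<in>UNIV. subst \<theta> (pdiff i p) * pdiff j (\<theta> i))"
proof (induction p rule: pfun_induct)
  case (Var k)
  have "(\<Sum>i\<in>UNIV. subst \<theta> (if i = k then 1 else 0) * pdiff j (\<theta> i))
      = (\<Sum>i\<in>UNIV. if i = k then pdiff j (\<theta> i) else 0)"
    by (intro sum.cong) auto
  then show ?case by (simp add: pdiff_Var)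
next
  case (add p q)
  then show ?case by (simp add: algebra_simps sum.distrib)
next
  case (mult p q)
  then show ?case by (simp add: pdiff_mult algebra_simps sum.distrib sum_distrib_left)
qed auto

subsection \<open>Twisted derivatives and quasi-invariants\<close>

text \<open>The differences \<open>Var i - \<theta> i\<close> generate an ideal containing
  \<open>p - subst \<theta> p\<close>: sums and products telescope. This takes the place of Taylor
  expansion across a line.\<close>

lemma dvd_diff_subst:
  assumes "\<And>i. l dvd Var i - \<theta> i"
  shows "l dvd p - subst \<theta> p"
proof (induction p rule: pfun_induct)
  case (add p q)
  have "p + q - subst \<theta> (p + q) = (p - subst \<theta> p) + (q - subst \<theta> q)" by simp
  then show ?case using add by (simp only: dvd_add)
next
  case (mult p q)
  have "p * q - subst \<theta> (p * q) = (p - subst \<theta> p) * q + subst \<theta> p * (q - subst \<theta> q)"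
    by (simp add: algebra_simps)
  then show ?case using mult by (simp only: dvd_add dvd_mult dvd_mult2)
qed (simp_all add: assms)

lemma subst_subst: "subst \<theta> (subst \<eta> p) = subst (\<lambda>i. subst \<theta> (\<eta> i)) p"
  by (rule pfun_eqI) simp

text \<open>The map \<open>x\<close> selects the variables that serve as first
  (\<open>False\<close>) and second (\<open>True\<close>) coordinate, so that one set of lemmas
  covers both pairs of variables of \<open>idx\<close> and the plane itself.\<close>

definition glf :: "(bool \<Rightarrow> 'v) \<Rightarrow> complex \<Rightarrow> 'v pfun" where
  "glf x \<alpha> = Const (cos \<alpha>) * Var (x True) - Const (sin \<alpha>) * Var (x False)"

definition gtf :: "(bool \<Rightarrow> 'v) \<Rightarrow> complex \<Rightarrow> 'v pfun" where
  "gtf x \<alpha> = Const (cos \<alpha>) * Var (x False) + Const (sin \<alpha>) * Var (x True)"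

definition gdn :: "(bool \<Rightarrow> 'v) \<Rightarrow> complex \<Rightarrow> 'v pfun \<Rightarrow> 'v pfun" where
  "gdn x \<alpha> Q = Const (cos \<alpha>) * pdiff (x True) Q - Const (sin \<alpha>) * pdiff (x False) Q"

text \<open>Restriction to the line, parametrised by its tangential coordinate; the variable
  \<open>x False\<close> is reused as the parameter.\<close>

definition grs :: "(bool \<Rightarrow> 'v) \<Rightarrow> complex \<Rightarrow> 'v pfun \<Rightarrow> 'v pfun" where
  "grs x \<alpha> = subst (\<lambda>i. if i = x False then Const (cos \<alpha>) * Var (x False)
                      else if i = x True then Const (sin \<alpha>) * Var (x False) else Var i)"

lemma grs_simps [simp]:
  "grs x \<alpha> 0 = 0" "grs x \<alpha> 1 = 1" "grs x \<alpha> (p + q) = grs x \<alpha> p + grs x \<alpha> q"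
  "grs x \<alpha> (p * q) = grs x \<alpha> p * grs x \<alpha> q" "grs x \<alpha> (- p) = - grs x \<alpha> p"
  "grs x \<alpha> (p - q) = grs x \<alpha> p - grs x \<alpha> q" "grs x \<alpha> (Const c) = Const c"
  "grs x \<alpha> (p ^ n) = grs x \<alpha> p ^ n" "grs x \<alpha> (of_nat n) = of_nat n" "grs x \<alpha> (numeral k) = numeral k"
  by (simp_all add: grs_def)

lemma grs_sum: "grs x \<alpha> (sum f A) = (\<Sum>a\<in>A. grs x \<alpha> (f a))"
  by (simp add: grs_def subst_sum)

lemma grs_Var:
  "grs x \<alpha> (Var (x False)) = Const (cos \<alpha>) * Var (x False)"
  "x True \<noteq> x False \<Longrightarrow> grs x \<alpha> (Var (x True)) = Const (sin \<alpha>) * Var (x False)"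
  "i \<noteq> x False \<Longrightarrow> i \<noteq> x True \<Longrightarrow> grs x \<alpha> (Var i) = Var i"
  by (simp_all add: grs_def)

lemma grs_glf: "x True \<noteq> x False \<Longrightarrow> grs x \<alpha> (glf x \<beta>) = Const (sin (\<alpha> - \<beta>)) * Var (x False)"
  unfolding glf_def by (simp add: grs_Var sin_diff Const_simps algebra_simps)

lemma grs_glf_self [simp]: "x True \<noteq> x False \<Longrightarrow> grs x \<alpha> (glf x \<alpha>) = 0"
  by (simp add: grs_glf Const_simps)

text \<open>Orthogonal projection onto the line changes each coordinate by a multiple of
  \<open>glf x \<alpha>\<close>, so \<open>Q\<close> is congruent to its projected version, and that
  one is determined by \<open>grs x \<alpha> Q\<close>.\<close>

lemma glf_dvd_iff:
  assumes x: "x True \<noteq> x False"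
  shows "glf x \<alpha> dvd Q \<longleftrightarrow> grs x \<alpha> Q = 0"
proof
  assume "glf x \<alpha> dvd Q"
  then show "grs x \<alpha> Q = 0" using x by (auto simp: dvd_def)
next
  assume 0: "grs x \<alpha> Q = 0"
  let ?\<theta> = "\<lambda>i. if i = x False then Const (cos \<alpha>) * gtf x \<alpha>
                 else if i = x True then Const (sin \<alpha>) * gtf x \<alpha> else Var i"
  have "glf x \<alpha> dvd Q - subst ?\<theta> Q"
  proof (rule dvd_diff_subst)
    fix i
    have "Var (x False) - ?\<theta> (x False) = - Const (sin \<alpha>) * glf x \<alpha>"
      "Var (x True) - ?\<theta> (x True) = Const (cos \<alpha>) * glf x \<alpha>"
      by (intro pfun_eqI; simp add: glf_def gtf_def x; use sin_squared_eq[of \<alpha>] in algebra)+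
    then show "glf x \<alpha> dvd Var i - ?\<theta> i"
      by (cases "i = x False"; cases "i = x True") simp_all
  qed
  moreover have "subst ?\<theta> Q = subst (\<lambda>i. if i = x False then gtf x \<alpha> else Var i) (grs x \<alpha> Q)"
    unfolding grs_def subst_subst by (rule arg_cong[of _ _ "\<lambda>\<theta>. subst \<theta> Q"]) (auto simp: fun_eq_iff)
  ultimately show "glf x \<alpha> dvd Q" using 0 by simp
qed

lemma glf_neq_0 [simp]:
  assumes x: "x True \<noteq> x False"
  shows "glf x \<alpha> \<noteq> 0"
proof
  assume "glf x \<alpha> = 0"
  then have "ev (glf x \<alpha>) v = 0" for v by simp
  from this[of "\<lambda>i. if i = x True then cos \<alpha> else - sin \<alpha>"]
  have "cos \<alpha> * cos \<alpha> + sin \<alpha> * sin \<alpha> = 0" using x by (simp add: glf_def)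
  then show False using sin_cos_squared_add3[of \<alpha>] by simp
qed

lemma gdn_simps [simp]: "gdn x \<alpha> (Const c) = 0" "gdn x \<alpha> 0 = 0" "gdn x \<alpha> (p + q) = gdn x \<alpha> p + gdn x \<alpha> q"
  "gdn x \<alpha> (p - q) = gdn x \<alpha> p - gdn x \<alpha> q" "gdn x \<alpha> (- p) = - gdn x \<alpha> p"
  "gdn x \<alpha> (of_nat n) = 0" "gdn x \<alpha> (numeral k) = 0" "gdn x \<alpha> 1 = 0"
  by (simp_all add: gdn_def algebra_simps)

lemma gdn_mult: "gdn x \<alpha> (p * q) = gdn x \<alpha> p * q + p * gdn x \<alpha> q"
  by (simp add: gdn_def pdiff_mult algebra_simps)

lemma gdn_glf: "x True \<noteq> x False \<Longrightarrow> gdn x \<alpha> (glf x \<beta>) = Const (cos (\<alpha> - \<beta>))"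
  by (simp add: gdn_def glf_def pdiff_mult pdiff_Var cos_diff Const_simps)

text \<open>The variable \<open>(s, b)\<close> is a coordinate of \<open>x - \<xi>\<close> if \<open>s = False\<close> and of \<open>z\<close> if \<open>s = True\<close>; the
  first coordinate of either is \<open>b = False\<close>. The operator \<open>tw s b\<close> is the partial derivative conjugated
  by \<open>exp (x1 z1 + x2 z2)\<close>, and \<open>qi\<close> is quasi-invariance of \<open>exp (x1 z1 + x2 z2) Q\<close>.\<close>

type_synonym idx = "bool \<times> bool"

abbreviation lf :: "bool \<Rightarrow> complex \<Rightarrow> idx pfun" where "lf s \<equiv> glf (Pair s)"
abbreviation tf :: "bool \<Rightarrow> complex \<Rightarrow> idx pfun" where "tf s \<equiv> gtf (Pair s)"
abbreviation dn :: "bool \<Rightarrow> complex \<Rightarrow> idx pfun \<Rightarrow> idx pfun" where "dn s \<equiv> gdn (Pair s)"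
abbreviation rs :: "bool \<Rightarrow> complex \<Rightarrow> idx pfun \<Rightarrow> idx pfun" where "rs s \<equiv> grs (Pair s)"

definition tw :: "bool \<Rightarrow> bool \<Rightarrow> idx pfun \<Rightarrow> idx pfun" where
  "tw s b Q = pdiff (s, b) Q + Var (\<not> s, b) * Q"

definition nd :: "bool \<Rightarrow> complex \<Rightarrow> idx pfun \<Rightarrow> idx pfun" where
  "nd s \<alpha> Q = Const (cos \<alpha>) * tw s True Q - Const (sin \<alpha>) * tw s False Q"

definition td :: "bool \<Rightarrow> complex \<Rightarrow> idx pfun \<Rightarrow> idx pfun" where
  "td s \<alpha> Q = Const (cos \<alpha>) * tw s False Q + Const (sin \<alpha>) * tw s True Q"

definition qi :: "bool \<Rightarrow> complex \<Rightarrow> nat \<Rightarrow> idx pfun \<Rightarrow> bool" where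
  "qi s \<alpha> k Q \<longleftrightarrow> (\<forall>i. odd i \<and> i < 2 * k \<longrightarrow> rs s \<alpha> ((nd s \<alpha> ^^ i) Q) = 0)"

lemma tw_add: "tw s b (p + q) = tw s b p + tw s b q"
  and tw_diff: "tw s b (p - q) = tw s b p - tw s b q"
  and tw_0 [simp]: "tw s b 0 = 0"
  and tw_mult: "tw s b (p * q) = pdiff (s, b) p * q + p * tw s b q"
  by (simp_all add: tw_def algebra_simps pdiff_mult)

lemma tw_commute: "tw s b (tw s' b' Q) = tw s' b' (tw s b Q)"
  by (auto simp: tw_def pdiff_mult pdiff_commute[of "(s, b)"] pdiff_Var algebra_simps)

lemma nd_add: "nd s \<alpha> (p + q) = nd s \<alpha> p + nd s \<alpha> q"
  and nd_diff: "nd s \<alpha> (p - q) = nd s \<alpha> p - nd s \<alpha> q"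
  and nd_0 [simp]: "nd s \<alpha> 0 = 0"
  and nd_mult: "nd s \<alpha> (p * q) = dn s \<alpha> p * q + p * nd s \<alpha> q"
  by (simp_all add: nd_def gdn_def tw_add tw_diff tw_mult algebra_simps)

lemma tw_Const: "tw s b (Const c * p) = Const c * tw s b p"
  by (simp add: tw_mult)

lemma nd_Const: "nd s \<alpha> (Const c * p) = Const c * nd s \<alpha> p"
  by (simp add: nd_mult)

lemma nd_tw: "nd s \<alpha> (tw s' b Q) = tw s' b (nd s \<alpha> Q)"
  by (simp add: nd_def tw_commute[of s _ s'] tw_diff tw_Const)

lemma nd_td: "nd s \<alpha> (td s' \<beta> Q) = td s' \<beta> (nd s \<alpha> Q)"
  by (simp add: td_def nd_add nd_Const nd_tw)

lemma nd_nd: "nd s \<alpha> (nd s' \<beta> Q) = nd s' \<beta> (nd s \<alpha> Q)"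
  by (simp add: nd_def[of s' \<beta>] nd_diff nd_Const nd_tw)

lemma ndn_add: "(nd s \<alpha> ^^ n) (p + q) = (nd s \<alpha> ^^ n) p + (nd s \<alpha> ^^ n) q"
  by (induction n) (auto simp: nd_add)

lemma ndn_diff: "(nd s \<alpha> ^^ n) (p - q) = (nd s \<alpha> ^^ n) p - (nd s \<alpha> ^^ n) q"
  by (induction n) (auto simp: nd_diff)

lemma ndn_0 [simp]: "(nd s \<alpha> ^^ n) 0 = 0"
  by (induction n) auto

lemma ndn_mult_const: "dn s \<alpha> c = 0 \<Longrightarrow> (nd s \<alpha> ^^ n) (c * p) = c * (nd s \<alpha> ^^ n) p"
  by (induction n) (auto simp: nd_mult)

lemma ndn_sum: "(nd s \<alpha> ^^ n) (sum f A) = (\<Sum>a\<in>A. (nd s \<alpha> ^^ n) (f a))"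
  by (induction A rule: infinite_finite_induct) (auto simp: ndn_add)

lemma ndn_tw: "(nd s \<alpha> ^^ n) (tw s' b Q) = tw s' b ((nd s \<alpha> ^^ n) Q)"
  by (induction n) (auto simp: nd_tw)

lemma ndn_td: "(nd s \<alpha> ^^ n) (td s' b Q) = td s' b ((nd s \<alpha> ^^ n) Q)"
  by (induction n) (auto simp: nd_td)

lemma ndn_nd: "(nd s \<alpha> ^^ n) (nd s' \<beta> Q) = nd s' \<beta> ((nd s \<alpha> ^^ n) Q)"
  by (induction n) (auto simp: nd_nd[of s \<alpha>])

text \<open>Leibniz rule with two terms only, as the normal derivative of a linear form is constant.
  The truncated index at \<open>n = 0\<close> is harmless: its term carries the factor
  \<open>n\<close>.\<close>

lemma ndn_lf_mult: "(nd s \<alpha> ^^ n) (lf s \<beta> * g)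
    = lf s \<beta> * (nd s \<alpha> ^^ n) g + of_nat n * Const (cos (\<alpha> - \<beta>)) * (nd s \<alpha> ^^ (n - 1)) g"
proof (induction n)
  case (Suc n)
  show ?case
  proof (cases n)
    case 0
    then show ?thesis by (simp add: nd_mult gdn_glf)
  next
    case (Suc m)
    then show ?thesis using \<open>(nd s \<alpha> ^^ n) (lf s \<beta> * g) = _\<close>
      by (simp add: nd_add nd_mult gdn_glf gdn_mult algebra_simps)
  qed
qed auto

lemma ndn_lf_self: "(nd s \<alpha> ^^ n) (lf s \<alpha> * g)
    = lf s \<alpha> * (nd s \<alpha> ^^ n) g + of_nat n * (nd s \<alpha> ^^ (n - 1)) g"
  using ndn_lf_mult[of n s \<alpha> \<alpha> g] by (simp add: Const_simps)

lemma rs_ndn_lf_power: "i < k \<Longrightarrow> rs s \<alpha> ((nd s \<alpha> ^^ i) (lf s \<alpha> ^ k * g)) = 0"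
proof (induction k arbitrary: i g)
  case (Suc k)
  have "lf s \<alpha> ^ Suc k * g = lf s \<alpha> * (lf s \<alpha> ^ k * g)" by simp
  then show ?case using Suc.IH[of "i - 1" g] Suc.prems
    by (cases i) (simp_all only: ndn_lf_self, auto)
qed auto

lemma qi_lf_power: "qi s \<alpha> k (lf s \<alpha> ^ (2 * k) * g)"
  by (simp add: qi_def rs_ndn_lf_power)

text \<open>The tangential derivation annihilates the linear form of the line, so it preserves the
  multiples of that form.\<close>

lemma rs_td: "rs s \<alpha> Q = 0 \<Longrightarrow> rs s \<alpha> (td s \<alpha> Q) = 0"
proof -
  assume "rs s \<alpha> Q = 0"
  then obtain g where "Q = lf s \<alpha> * g" by (auto simp: glf_dvd_iff[symmetric] dvd_def)
  moreover have "td s \<alpha> (lf s \<alpha> * g) = lf s \<alpha> * td s \<alpha> g"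
    unfolding td_def tw_mult by (simp add: glf_def pdiff_mult pdiff_Var algebra_simps)
  ultimately show ?thesis by simp
qed

lemma nd_rotate: "nd s \<beta> Q = Const (sin (\<alpha> - \<beta>)) * td s \<alpha> Q + Const (cos (\<alpha> - \<beta>)) * nd s \<alpha> Q"
proof -
  have 1: "sin \<alpha> * sin \<alpha> = 1 - cos \<alpha> * cos \<alpha>" by (simp add: sin_squared_eq[of \<alpha>, unfolded power2_eq_square])
  have "Const (cos \<beta>) * a - Const (sin \<beta>) * b = Const (sin (\<alpha> - \<beta>)) * (Const (cos \<alpha>) * b + Const (sin \<alpha>) * a)
      + Const (cos (\<alpha> - \<beta>)) * (Const (cos \<alpha>) * a - Const (sin \<alpha>) * b)" for a b :: "idx pfun"
    by (rule pfun_eqI) (simp add: sin_diff cos_diff, use 1 in algebra)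
  then show ?thesis by (simp add: nd_def td_def)
qed

lemma laplace_rotate: "tw s False (tw s False Q) + tw s True (tw s True Q)
    = nd s \<alpha> (nd s \<alpha> Q) + td s \<alpha> (td s \<alpha> Q)"
proof -
  let ?c = "Const (cos \<alpha>) :: idx pfun" and ?s = "Const (sin \<alpha>) :: idx pfun"
  have "x + y = ?c * (?c * y - ?s * z) - ?s * (?c * z - ?s * x) + (?c * (?c * x + ?s * z) + ?s * (?c * z + ?s * y))"
    for x y z :: "idx pfun"
    using sin_squared_eq[of \<alpha>] by (intro pfun_eqI) (simp, algebra)
  then show ?thesis
    by (simp add: nd_def td_def tw_diff tw_add tw_Const tw_commute[of s True s False])
qed

text \<open>Differentiating the factorisation normally to \<alpha> and restricting gives a two-term
  recursion for the normal derivatives of the quotient \<open>g\<close>; on the line,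
  \<open>lf s \<beta>\<close> becomes \<open>sin (\<alpha> - \<beta>)\<close> times the tangential
  coordinate.\<close>

lemma rs_ndn_of_factor:
  assumes g: "lf s \<beta> * g = nd s \<beta> Q"
  shows "Const (sin (\<alpha> - \<beta>)) * Var (s, False) * rs s \<alpha> ((nd s \<alpha> ^^ i) g)
      + of_nat i * Const (cos (\<alpha> - \<beta>)) * rs s \<alpha> ((nd s \<alpha> ^^ (i - 1)) g)
    = Const (sin (\<alpha> - \<beta>)) * rs s \<alpha> (td s \<alpha> ((nd s \<alpha> ^^ i) Q))
      + Const (cos (\<alpha> - \<beta>)) * rs s \<alpha> ((nd s \<alpha> ^^ Suc i) Q)"
proof -
  have "rs s \<alpha> ((nd s \<alpha> ^^ i) (lf s \<beta> * g)) = rs s \<alpha> ((nd s \<alpha> ^^ i) (nd s \<beta> Q))" by (simp add: g)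
  then show ?thesis
    unfolding ndn_lf_mult nd_rotate[of s \<beta> Q \<alpha>]
    by (simp add: ndn_add ndn_mult_const ndn_td ndn_nd grs_glf)
qed

text \<open>After multiplication by a power of the tangential coordinate, the normal derivatives of \<open>g \<beta>\<close> along the
  line \<open>\<alpha>\<close> are polynomials in \<open>cot (\<alpha> - \<beta>)\<close>, independent of \<open>\<beta>\<close> and of definite parity. So the vanishing of
  the odd cotangent sums makes the weighted sum of the odd normal derivatives vanish.\<close>

lemma parity_expansion:
  assumes g: "\<And>\<beta>. \<beta> \<in> B \<Longrightarrow> lf s \<beta> * g \<beta> = nd s \<beta> Q"
    and sin: "\<And>\<beta>. \<beta> \<in> B \<Longrightarrow> sin (\<alpha> - \<beta>) \<noteq> 0"
    and N: "\<And>j. odd j \<Longrightarrow> j \<le> n \<Longrightarrow> rs s \<alpha> ((nd s \<alpha> ^^ j) Q) = 0"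
    and "odd n" "i \<le> n"
  shows "\<exists>e. (\<forall>j. odd j \<noteq> odd i \<longrightarrow> coeff e j = 0) \<and> degree e \<le> i + 1 \<and>
    (\<forall>\<beta>\<in>B. Var (s, False) ^ (i + 1) * rs s \<alpha> ((nd s \<alpha> ^^ i) (g \<beta>)) = poly e (Const (cot (\<alpha> - \<beta>))))"
  using \<open>i \<le> n\<close>
proof (induction i)
  case 0
  have "rs s \<alpha> (nd s \<alpha> Q) = 0" using N[of 1] \<open>odd n\<close> by (cases n) auto
  then have "Var (s, False) * rs s \<alpha> (g \<beta>) = rs s \<alpha> (td s \<alpha> Q)" if "\<beta> \<in> B" for \<beta>
    using rs_ndn_of_factor[OF g[OF that], of \<alpha> 0] sin[OF that] by simp
  then show ?case by (intro exI[of _ "[:rs s \<alpha> (td s \<alpha> Q):]"]) (auto simp: coeff_pCons split: nat.splits)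
next
  case (Suc i)
  let ?X = "Var (s, False) :: idx pfun"
  obtain e where e: "\<And>j. odd j \<noteq> odd i \<Longrightarrow> coeff e j = 0" "degree e \<le> i + 1"
    "\<And>\<beta>. \<beta> \<in> B \<Longrightarrow> ?X ^ (i + 1) * rs s \<alpha> ((nd s \<alpha> ^^ i) (g \<beta>)) = poly e (Const (cot (\<alpha> - \<beta>)))"
    using Suc.IH[OF Suc_leD[OF Suc.prems]] by blast
  define u where "u = rs s \<alpha> (td s \<alpha> ((nd s \<alpha> ^^ Suc i) Q))"
  define w where "w = rs s \<alpha> ((nd s \<alpha> ^^ Suc (Suc i)) Q)"
  have u: "even i \<Longrightarrow> u = 0"
    unfolding u_def by (rule rs_td, rule N) (use Suc.prems in auto)
  have w: "w = 0" if "odd i"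
  proof -
    have "Suc i \<noteq> n" using that \<open>odd n\<close> by auto
    then have "Suc (Suc i) \<le> n" using Suc.prems by simp
    then show ?thesis unfolding w_def using that by (intro N) simp_all
  qed
  \<comment> \<open>This is the recursion divided by \<open>sin (\<alpha> - \<beta>)\<close>;
    \<open>pCons\<close> supplies the factor \<open>cot (\<alpha> - \<beta>)\<close> that switches
    the parity, and \<open>u\<close> and \<open>w\<close> do not involve \<beta>. For even
    \<open>i\<close>, \<open>u\<close> is a tangential derivative of a vanishing odd normal
    derivative; for odd \<open>i\<close>, \<open>w\<close> is itself an odd one.\<close>
  define e' where "e' = pCons (?X ^ Suc i * u) (smult (- of_nat (Suc i)) e + [:?X ^ Suc i * w:])"
  have "coeff e' j = 0" if "odd j \<noteq> odd (Suc i)" for j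
    using that u w e(1) by (auto simp: e'_def coeff_pCons split: nat.splits)
  moreover have "degree e' \<le> Suc i + 1"
  proof -
    have "degree (smult (- of_nat (Suc i)) e) \<le> i + 1"
      using e(2) degree_smult_le order.trans by blast
    then have "degree (smult (- of_nat (Suc i)) e + [:?X ^ Suc i * w:]) \<le> i + 1"
      by (intro degree_add_le) auto
    then show ?thesis
      unfolding e'_def by (intro order.trans[OF degree_pCons_le]) simp
  qed
  moreover have "?X ^ (Suc i + 1) * rs s \<alpha> ((nd s \<alpha> ^^ Suc i) (g \<beta>)) = poly e' (Const (cot (\<alpha> - \<beta>)))"
    if \<beta>: "\<beta> \<in> B" for \<beta>
  proof -
    define k a b where "k = (Const (cot (\<alpha> - \<beta>)) :: idx pfun)"
      and "a = rs s \<alpha> ((nd s \<alpha> ^^ Suc i) (g \<beta>))" and "b = rs s \<alpha> ((nd s \<alpha> ^^ i) (g \<beta>))"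
    have k: "Const (cos (\<alpha> - \<beta>)) = Const (sin (\<alpha> - \<beta>)) * k"
      unfolding k_def using sin[OF \<beta>] by (auto intro!: pfun_eqI simp: cot_def)
    have "Const (sin (\<alpha> - \<beta>)) * (?X * a + of_nat (Suc i) * k * b) = Const (sin (\<alpha> - \<beta>)) * (u + k * w)"
      using rs_ndn_of_factor[OF g[OF \<beta>], of \<alpha> "Suc i"]
      unfolding k u_def[symmetric] w_def[symmetric] a_def[symmetric]
      by (simp add: b_def algebra_simps)
    then have "?X * a + of_nat (Suc i) * k * b = u + k * w"
      by (rule mult_left_cancel[THEN iffD1, rotated]) (use sin[OF \<beta>] in simp)
    then have "?X * a = u + k * w - of_nat (Suc i) * k * b"
      by (rule eq_diff_eq[THEN iffD2])
    then have "?X ^ Suc i * (?X * a) = ?X ^ Suc i * (u + k * w - of_nat (Suc i) * k * b)" by simp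
    then have "?X ^ (Suc i + 1) * a = ?X ^ Suc i * u + k * (?X ^ Suc i * w - of_nat (Suc i) * (?X ^ (i + 1) * b))"
      by (simp add: algebra_simps)
    also have "?X ^ (i + 1) * b = poly e k" unfolding b_def k_def by (rule e(3)[OF \<beta>])
    finally show ?thesis unfolding a_def k_def e'_def by (simp add: algebra_simps)
  qed
  ultimately show ?case by (intro exI[of _ e'] conjI allI ballI impI)
qed

lemma parity_sum:
  assumes g: "\<And>\<beta>. \<beta> \<in> B \<Longrightarrow> lf s \<beta> * g \<beta> = nd s \<beta> Q"
    and sin: "\<And>\<beta>. \<beta> \<in> B \<Longrightarrow> sin (\<alpha> - \<beta>) \<noteq> 0"
    and N: "\<And>j. odd j \<Longrightarrow> j \<le> i \<Longrightarrow> rs s \<alpha> ((nd s \<alpha> ^^ j) Q) = 0"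
    and cot: "\<And>j. odd j \<Longrightarrow> j \<le> i \<Longrightarrow> (\<Sum>\<beta>\<in>B. m \<beta> * cot (\<alpha> - \<beta>) ^ j) = 0"
    and i: "odd i"
  shows "(\<Sum>\<beta>\<in>B. Const (m \<beta>) * rs s \<alpha> ((nd s \<alpha> ^^ i) (g \<beta>))) = 0"
proof -
  obtain e where e: "\<And>j. odd j \<noteq> odd i \<Longrightarrow> coeff e j = 0" "degree e \<le> i + 1"
    "\<And>\<beta>. \<beta> \<in> B \<Longrightarrow> Var (s, False) ^ (i + 1) * rs s \<alpha> ((nd s \<alpha> ^^ i) (g \<beta>)) = poly e (Const (cot (\<alpha> - \<beta>)))"
  proof -
    have "\<exists>e. (\<forall>j. odd j \<noteq> odd i \<longrightarrow> coeff e j = 0) \<and> degree e \<le> i + 1 \<and>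
      (\<forall>\<beta>\<in>B. Var (s, False) ^ (i + 1) * rs s \<alpha> ((nd s \<alpha> ^^ i) (g \<beta>)) = poly e (Const (cot (\<alpha> - \<beta>))))"
      by (rule parity_expansion[where n = i and Q = Q]) (fact g sin N i order_refl)+
    then show ?thesis using that by blast
  qed
  have "Var (s, False) ^ (i + 1) * (\<Sum>\<beta>\<in>B. Const (m \<beta>) * rs s \<alpha> ((nd s \<alpha> ^^ i) (g \<beta>)))
      = (\<Sum>\<beta>\<in>B. Const (m \<beta>) * poly e (Const (cot (\<alpha> - \<beta>))))"
    unfolding sum_distrib_left by (intro sum.cong refl) (simp add: e(3)[symmetric] algebra_simps)
  also have "\<dots> = (\<Sum>\<beta>\<in>B. \<Sum>j\<le>degree e. coeff e j * Const (m \<beta> * cot (\<alpha> - \<beta>) ^ j))"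
    by (simp add: poly_altdef sum_distrib_left Const_simps algebra_simps)
  also have "\<dots> = (\<Sum>j\<le>degree e. coeff e j * Const (\<Sum>\<beta>\<in>B. m \<beta> * cot (\<alpha> - \<beta>) ^ j))"
    by (subst sum.swap) (simp add: Const_sum sum_distrib_left)
  also have "\<dots> = 0"
  proof (intro sum.neutral ballI)
    \<comment> \<open>The degree bound \<open>i + 1\<close> is even while only odd coefficients
      occur, so every relevant exponent is at most \<open>i\<close>, the range of the hypothesis on
      the cotangent sums.\<close>
    fix j assume "j \<in> {..degree e}"
    then have "j \<le> i + 1" using e(2) by auto
    then have "odd j \<Longrightarrow> j \<le> i" using i by (cases "j = i + 1") auto
    then show "coeff e j * Const (\<Sum>\<beta>\<in>B. m \<beta> * cot (\<alpha> - \<beta>) ^ j) = 0"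
      using cot[of j] e(1)[of j] i by (cases "odd j") auto
  qed
  moreover have "Var (s, False) \<noteq> (0 :: idx pfun)"
  proof
    assume "Var (s, False) = (0 :: idx pfun)"
    then have "ev (Var (s, False)) (\<lambda>_. 1) = ev (0 :: idx pfun) (\<lambda>_. 1)" by simp
    then show False by simp
  qed
  ultimately show ?thesis by simp
qed

subsection \<open>Homogeneous parts\<close>

text \<open>Integer weights with \<open>powi\<close> admit the weight -1 that \<open>balw\<close>
  needs; hence \<open>whom\<close> tests the scaling only at \<open>t \<noteq> 0\<close>.\<close>

definition scale :: "('v \<Rightarrow> int) \<Rightarrow> complex \<Rightarrow> 'v pfun \<Rightarrow> 'v pfun" where
  "scale w t = subst (\<lambda>i. Const (t powi w i) * Var i)"

definition whom :: "('v \<Rightarrow> int) \<Rightarrow> int \<Rightarrow> 'v pfun \<Rightarrow> bool" where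
  "whom w k p \<longleftrightarrow> (\<forall>t. t \<noteq> 0 \<longrightarrow> scale w t p = Const (t powi k) * p)"

abbreviation hom :: "('v \<Rightarrow> bool) \<Rightarrow> int \<Rightarrow> 'v pfun \<Rightarrow> bool" where
  "hom G \<equiv> whom (\<lambda>i. if G i then 1 else 0)"

text \<open>Stands for: the degree in the variables selected by \<open>G\<close> is less than
  \<open>n\<close>. The zero polynomial qualifies for every \<open>n\<close>, so no degree function
  with a special value at zero is needed.\<close>

inductive lower :: "('v \<Rightarrow> bool) \<Rightarrow> int \<Rightarrow> 'v pfun \<Rightarrow> bool" for G n where
  lower_0: "lower G n 0"
| lower_hom: "hom G k p \<Longrightarrow> k < n \<Longrightarrow> lower G n p"
| lower_add: "lower G n p \<Longrightarrow> lower G n q \<Longrightarrow> lower G n (p + q)"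

lemma homD:
  assumes "hom G k p" "t \<noteq> 0"
  shows "ev p (\<lambda>i. if G i then t * v i else v i) = t powi k * ev p v"
proof -
  have "(\<lambda>i. if G i then t * v i else v i) = (\<lambda>i. t powi (if G i then 1 else 0) * v i)" by auto
  moreover have "ev (scale (\<lambda>i. if G i then 1 else 0) t p) v = ev (Const (t powi k) * p) v"
    using assms by (simp add: whom_def)
  ultimately show ?thesis by (simp add: scale_def)
qed

lemma hom_add: "whom w k p \<Longrightarrow> whom w k q \<Longrightarrow> whom w k (p + q)"
  and hom_diff: "whom w k p \<Longrightarrow> whom w k q \<Longrightarrow> whom w k (p - q)"
  and hom_uminus: "whom w k p \<Longrightarrow> whom w k (- p)"
  and hom_0 [simp]: "whom w k 0"
  and hom_Const [simp]: "whom w 0 (Const c)"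
  by (simp_all add: whom_def scale_def algebra_simps Const_simps)

lemma hom_1 [simp]: "whom w 0 1"
  using hom_Const[of w 1] by (simp only: Const_simps)

lemma hom_of_nat [simp]: "whom w 0 (of_nat n)"
  using hom_Const[of w "of_nat n"] by (simp only: Const_simps)

lemma hom_numeral [simp]: "whom w 0 (numeral n)"
  using hom_Const[of w "numeral n"] by (simp only: Const_simps)

lemma hom_Var: "whom w (w i) (Var i)"
  by (simp add: whom_def scale_def)

lemma hom_mult: "whom w k p \<Longrightarrow> whom w l q \<Longrightarrow> whom w (k + l) (p * q)"
  by (simp add: whom_def scale_def algebra_simps Const_simps power_int_add)

lemma hom_mult_eq: "whom w k p \<Longrightarrow> whom w l q \<Longrightarrow> k + l = m \<Longrightarrow> whom w m (p * q)"
  using hom_mult by blast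

lemma hom_Const_mult: "whom w k p \<Longrightarrow> whom w k (Const c * p)"
  using hom_mult[of w 0 "Const c" k p] by simp

lemma hom_sum: "(\<And>a. a \<in> A \<Longrightarrow> whom w k (f a)) \<Longrightarrow> whom w k (sum f A)"
  by (induction A rule: infinite_finite_induct) (auto intro: hom_add)

lemma hom_power: "whom w k p \<Longrightarrow> whom w (of_nat n * k) (p ^ n)"
  by (induction n) (auto intro: hom_mult simp: algebra_simps)

lemma hom_prod: "(\<And>a. a \<in> A \<Longrightarrow> whom w (k a) (f a)) \<Longrightarrow> whom w (sum k A) (prod f A)"
  by (induction A rule: infinite_finite_induct) (auto intro: hom_mult)

lemma hom_pdiff:
  fixes p :: "'v::finite pfun"
  assumes "whom w k p"
  shows "whom w (k - w i) (pdiff i p)"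
  unfolding whom_def
proof (intro allI impI)
  fix t :: complex assume t: "t \<noteq> 0"
  define c where "c = t powi w i"
  have "pdiff i (Const (t powi w j) * Var j) = (if j = i then Const c else 0)" for j
    by (auto simp: pdiff_mult pdiff_Var c_def Const_simps)
  then have "pdiff i (scale w t p) = (\<Sum>j\<in>UNIV. if j = i then scale w t (pdiff j p) * Const c else 0)"
    unfolding scale_def pdiff_subst by (intro sum.cong) auto
  then have "scale w t (pdiff i p) * Const c = Const (t powi k) * pdiff i p"
    using assms t by (simp add: whom_def pdiff_mult)
  then have "Const (1 / c) * (scale w t (pdiff i p) * Const c) = Const (1 / c) * (Const (t powi k) * pdiff i p)"
    by simp
  moreover have "Const (1 / c) * Const c = (1 :: 'v pfun)"
    using t by (auto intro!: pfun_eqI simp: c_def)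
  moreover have "1 / c * t powi k = t powi (k - w i)"
    using t by (simp add: c_def power_int_diff)
  ultimately show "scale w t (pdiff i p) = Const (t powi (k - w i)) * pdiff i p"
    by (metis (no_types, opaque_lifting) Const_simps(2) mult.assoc mult.commute mult_1)
qed

lemma ev_scale_poly:
  "\<exists>q. \<forall>t. ev p (\<lambda>i. if G i then t * v i else v i) = poly q t"
proof -
  obtain q where "\<And>t. ev p (\<lambda>i. (if G i then 0 else v i) + t * (if G i then v i else 0)) = poly q t"
    using ev_line_poly[of p "\<lambda>i. if G i then 0 else v i" "\<lambda>i. if G i then v i else 0"] by blast
  moreover have "(\<lambda>i. (if G i then 0 else v i) + t * (if G i then v i else 0))
      = (\<lambda>i. if G i then t * v i else v i)" for t by auto
  ultimately show ?thesis by auto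
qed

lemma poly_eq_away_from_0:
  fixes p q :: "complex poly"
  assumes "\<And>t. t \<noteq> 0 \<Longrightarrow> poly p t = poly q t"
  shows "p = q"
proof (rule ccontr)
  assume "p \<noteq> q"
  then have "finite {t. poly (p - q) t = 0}" by (intro poly_roots_finite) simp
  moreover have "UNIV - {0} \<subseteq> {t. poly (p - q) t = 0}" using assms by auto
  ultimately have "finite (UNIV - {0 :: complex})" using finite_subset by blast
  then show False using infinite_UNIV_char_0[where 'a = complex] by simp
qed

text \<open>Along a scaling orbit \<open>p\<close> is a polynomial in \<open>t\<close>. Multiplied
  by \<open>t ^ nat (- k)\<close> it becomes the constant \<open>ev p v\<close>, which must vanish
  because the product does at \<open>t = 0\<close>.\<close>

lemma hom_neg:
  assumes "hom G k p" "k < 0"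
  shows "p = 0"
proof (rule pfun_eqI)
  fix v
  obtain q where q: "\<And>t. ev p (\<lambda>i. if G i then t * v i else v i) = poly q t"
    using ev_scale_poly by blast
  have "poly (q * [:0, 1:] ^ nat (- k)) t = poly [:ev p v:] t" if "t \<noteq> 0" for t
  proof -
    have "t powi k * t ^ nat (- k) = 1"
      using that assms(2) by (simp add: power_int_def field_simps)
    then show ?thesis using homD[OF assms(1) that, of v] q[of t] by simp
  qed
  then have "q * [:0, 1:] ^ nat (- k) = [:ev p v:]" by (rule poly_eq_away_from_0)
  from arg_cong[OF this, of "\<lambda>q. poly q 0"] show "ev p v = ev 0 v"
    using assms(2) by (simp add: power_0_left)
qed

text \<open>Along a scaling orbit the summands contribute to distinct powers of \<open>t\<close>,
  whose coefficients can be compared. Negative degrees carry only the zero polynomial and are set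
  aside first, so that \<open>nat\<close> is injective on the rest.\<close>

lemma hom_unique:
  assumes "finite A" "\<And>k. k \<in> A \<Longrightarrow> hom G k (f k)" "(\<Sum>k\<in>A. f k) = 0" "k \<in> A"
  shows "f k = 0"
proof (cases "k < 0")
  case True
  then show ?thesis using hom_neg assms by blast
next
  case k: False
  let ?B = "{k \<in> A. k \<ge> 0}"
  have 0: "(\<Sum>k\<in>?B. f k) = 0"
  proof -
    have "(\<Sum>k\<in>?B. f k) = (\<Sum>k\<in>A. f k)"
    proof (rule sum.mono_neutral_left)
      show "\<forall>i\<in>A - ?B. f i = 0"
        proof
        fix i assume "i \<in> A - ?B"
        then have "i \<in> A" "i < 0" by auto
        then show "f i = 0" using hom_neg[OF assms(2)] by blast
      qed
    qed (use assms in auto)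
    then show ?thesis using assms by simp
  qed
  show ?thesis
  proof (rule pfun_eqI)
    fix v
    define q where "q = (\<Sum>k\<in>?B. monom (ev (f k) v) (nat k))"
    have "poly q t = poly 0 t" if t: "t \<noteq> 0" for t
    proof -
      have "poly q t = (\<Sum>k\<in>?B. ev (f k) (\<lambda>i. if G i then t * v i else v i))"
        unfolding q_def poly_sum
        using homD[OF assms(2) t] by (intro sum.cong) (auto simp: poly_monom power_int_def)
      also have "\<dots> = ev (\<Sum>k\<in>?B. f k) (\<lambda>i. if G i then t * v i else v i)" by simp
      finally show ?thesis unfolding 0 by simp
    qed
    then have "q = 0" by (rule poly_eq_away_from_0)
    then have "0 = coeff q (nat k)" by simp
    also have "\<dots> = (\<Sum>j\<in>?B. if j = k then ev (f j) v else 0)"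
      unfolding q_def coeff_sum using k by (intro sum.cong) auto
    also have "\<dots> = ev (f k) v" using assms k by simp
    finally show "ev (f k) v = ev 0 v" by simp
  qed
qed

lemma lower_mono: "lower G m p \<Longrightarrow> m \<le> n \<Longrightarrow> lower G n p"
  by (induction rule: lower.induct) (auto intro: lower.intros)

lemma lower_decomp:
  assumes "lower G n p"
  shows "\<exists>f. (\<forall>k. hom G k (f k)) \<and> p = (\<Sum>k\<in>{0..<n}. f k)"
  using assms
proof (induction rule: lower.induct)
  case lower_0
  show ?case by (rule exI[of _ "\<lambda>_. 0"]) simp
next
  case (lower_hom k p)
  show ?case
  proof (cases "k < 0")
    case True
    then have "p = 0" using hom_neg lower_hom by blast
    then show ?thesis by (intro exI[of _ "\<lambda>_. 0"]) simp
  next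
    case False
    then show ?thesis using lower_hom by (intro exI[of _ "\<lambda>j. if j = k then p else 0"]) auto
  qed
next
  case (lower_add p q)
  then obtain f g where "(\<forall>k. hom G k (f k)) \<and> p = (\<Sum>k\<in>{0..<n}. f k)"
    "(\<forall>k. hom G k (g k)) \<and> q = (\<Sum>k\<in>{0..<n}. g k)" by blast
  then show ?case by (intro exI[of _ "\<lambda>k. f k + g k"]) (auto simp: sum.distrib intro: hom_add)
qed

lemma lower_sum: "(\<And>a. a \<in> A \<Longrightarrow> lower G n (f a)) \<Longrightarrow> lower G n (sum f A)"
  by (induction A rule: infinite_finite_induct) (auto intro: lower.intros)

lemma lower_hom_mult: "lower G n p \<Longrightarrow> hom G k a \<Longrightarrow> n + k = m \<Longrightarrow> lower G m (a * p)"
proof (induction rule: lower.induct)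
  case (lower_hom l p)
  then show ?case using lower.lower_hom[OF hom_mult[OF lower_hom(3,1)]] by auto
qed (auto simp: distrib_left intro: lower.intros)

lemma lower_Const_mult: "lower G n p \<Longrightarrow> lower G n (Const c * p)"
  by (rule lower_hom_mult) auto

lemma lower_uminus: "lower G n p \<Longrightarrow> lower G n (- p)"
  using lower_Const_mult[of G n p "-1"] by (simp add: Const_simps)

lemma lower_diff: "lower G n p \<Longrightarrow> lower G n q \<Longrightarrow> lower G n (p - q)"
  using lower.lower_add[OF _ lower_uminus, of G n p q] by simp

lemma lower_pdiff:
  fixes p :: "'v::finite pfun"
  shows "lower G n p \<Longrightarrow> lower G (if G i then n - 1 else n) (pdiff i p)"
proof (induction rule: lower.induct)
  case (lower_hom k p)
  then show ?case by (intro lower.lower_hom[OF hom_pdiff[OF lower_hom(1)]]) auto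
qed (auto intro: lower.intros)

lemma lower_exists: "\<exists>n. lower G n p"
proof (induction p rule: pfun_induct)
  case (Const c)
  show ?case by (intro exI[of _ 1] lower_hom[OF hom_Const]) simp
next
  case (Var i)
  show ?case by (intro exI[of _ 2] lower_hom[OF hom_Var]) simp
next
  case (add p q)
  then obtain m n where "lower G m p" "lower G n q" by blast
  then show ?case by (intro exI[of _ "max m n"] lower_add) (auto elim: lower_mono)
next
  case (mult p q)
  then obtain m n where m: "lower G m p" and n: "lower G n q" by blast
  from m have "lower G (m + n) (p * q)"
  proof (induction rule: lower.induct)
    case (lower_hom k p)
    then have "lower G (n + k) (p * q)" using n by (intro lower_hom_mult) auto
    then show ?case by (rule lower_mono) (use lower_hom in simp)
  qed (auto simp: distrib_right intro: lower.intros)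
  then show ?case by blast
qed

lemma lower_nonpos: "lower G n p \<Longrightarrow> n \<le> 0 \<Longrightarrow> p = 0"
  using lower_decomp[of G n p] by auto

lemma hom_sum_lower:
  assumes "finite A" "\<And>k. k \<in> A \<Longrightarrow> hom G k (f k)" "\<And>k. k \<in> A \<Longrightarrow> m \<le> k"
    "lower G m (\<Sum>k\<in>A. f k)" "k \<in> A"
  shows "f k = 0"
proof -
  obtain g where g: "\<And>k. hom G k (g k)" "(\<Sum>k\<in>A. f k) = (\<Sum>k\<in>{0..<m}. g k)"
    using lower_decomp[OF assms(4)] by blast
  have disj: "A \<inter> {0..<m} = {}" using assms(3) by force
  let ?h = "\<lambda>k. if k \<in> A then f k else - g k"
  have "(\<Sum>k\<in>A \<union> {0..<m}. ?h k) = (\<Sum>k\<in>A. ?h k) + (\<Sum>k\<in>{0..<m}. ?h k)"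
    using assms(1) disj by (intro sum.union_disjoint) auto
  also have "(\<Sum>k\<in>{0..<m}. ?h k) = (\<Sum>k\<in>{0..<m}. - g k)"
    using disj by (intro sum.cong) auto
  finally have "(\<Sum>k\<in>A \<union> {0..<m}. ?h k) = 0"
    using g(2) by (simp add: sum_negf)
  then have "?h k = 0"
    using assms g(1) by (intro hom_unique[of "A \<union> {0..<m}" G ?h k]) (auto intro: hom_uminus)
  then show ?thesis using assms(5) by simp
qed

lemma hom_lower_0: "hom G k p \<Longrightarrow> lower G n p \<Longrightarrow> n \<le> k \<Longrightarrow> p = 0"
  using hom_sum_lower[of "{k}" G "\<lambda>_. p" n k] by simp

lemma lower_top:
  assumes "lower G (n + 1) p"
  shows "\<exists>h r. hom G n h \<and> lower G n r \<and> p = h + r"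
  using assms
proof (induction rule: lower.induct)
  case lower_0
  show ?case by (intro exI[of _ 0]) (auto intro: lower.intros)
next
  case (lower_hom k p)
  show ?case
  proof (cases "k = n")
    case True
    then show ?thesis using lower_hom by (intro exI[of _ p] exI[of _ 0]) (auto intro: lower.intros)
  next
    case False
    then show ?thesis using lower_hom by (intro exI[of _ 0] exI[of _ p]) (auto intro: lower.intros)
  qed
next
  case (lower_add p q)
  then obtain h r h' r' where "hom G n h \<and> lower G n r \<and> p = h + r" "hom G n h' \<and> lower G n r' \<and> q = h' + r'"
    by blast
  then show ?case
    by (intro exI[of _ "h + h'"] exI[of _ "r + r'"]) (auto intro: hom_add lower.intros)
qed

text \<open>In an integral domain, multiplication by \<open>a\<close> shifts every homogeneous part
  by \<open>d\<close> and kills none; so a part of \<open>p\<close> of degree at least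
  \<open>n\<close> would survive in \<open>a * p\<close>.\<close>

lemma lower_div:
  assumes a: "hom G d a" "a \<noteq> 0" and p: "lower G (n + d) (a * p)"
  shows "lower G n p"
proof -
  obtain m where "lower G m p" using lower_exists by blast
  then obtain f where f: "\<And>k. hom G k (f k)" "p = (\<Sum>k\<in>{0..<m}. f k)"
    using lower_decomp by blast
  let ?A = "{k \<in> {0..<m}. n \<le> k}" and ?B = "{k \<in> {0..<m}. k < n}"
  have split: "p = (\<Sum>k\<in>?A. f k) + (\<Sum>k\<in>?B. f k)"
  proof -
    have "(\<Sum>k\<in>?A. f k) + (\<Sum>k\<in>?B. f k) = (\<Sum>k\<in>?A \<union> ?B. f k)"
      by (rule sum.union_disjoint[symmetric]) (auto intro: finite_subset[of _ "{0..<m}"])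
    also have "?A \<union> ?B = {0..<m}" by auto
    finally show ?thesis using f(2) by simp
  qed
  have B: "lower G n (\<Sum>k\<in>?B. f k)"
    by (intro lower_sum lower_hom[OF f(1)]) auto
  have "a * (\<Sum>k\<in>?A. f k) = a * p - a * (\<Sum>k\<in>?B. f k)"
    by (simp add: split algebra_simps)
  then have low: "lower G (n + d) (a * (\<Sum>k\<in>?A. f k))"
    using lower_diff[OF p lower_hom_mult[OF B a(1) refl]] by simp
  have "f k = 0" if "k \<in> ?A" for k
  proof -
    have "(\<lambda>j. a * f (j - d)) (k + d) = 0"
    proof (rule hom_sum_lower[of "(\<lambda>k. k + d) ` ?A" G "\<lambda>j. a * f (j - d)" "n + d" "k + d"])
      show "hom G j (a * f (j - d))" for j
        by (rule hom_mult_eq[OF a(1) f(1)]) simp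
      have "(\<Sum>j\<in>(\<lambda>k. k + d) ` ?A. a * f (j - d)) = a * (\<Sum>k\<in>?A. f k)"
        by (subst sum.reindex) (auto simp: sum_distrib_left inj_on_def)
      then show "lower G (n + d) (\<Sum>j\<in>(\<lambda>k. k + d) ` ?A. a * f (j - d))" using low by simp
    qed (use that in \<open>auto intro!: finite_imageI intro: finite_subset[of _ "{0..<m}"]\<close>)
    then show ?thesis using a(2) by simp
  qed
  then show ?thesis using split B by simp
qed

lemma hom_factor:
  assumes a: "whom w d a" "a \<noteq> 0" and p: "whom w n (a * p)"
  shows "whom w (n - d) p"
  unfolding whom_def
proof (intro allI impI)
  fix t :: complex assume t: "t \<noteq> 0"
  have "Const (t powi d) * a * scale w t p = Const (t powi n) * (a * p)"
    using a p t unfolding whom_def by (simp add: scale_def)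
  also have "\<dots> = Const (t powi d) * a * (Const (t powi (n - d)) * p)"
    using t by (auto intro!: pfun_eqI simp: power_int_diff)
  finally show "scale w t p = Const (t powi (n - d)) * p"
    using a(2) t by (simp add: mult.assoc)
qed

text \<open>Differentiate the scaling identity of \<open>p\<close> at \<open>t = 1\<close>.\<close>

lemma euler:
  fixes p :: "'v::finite pfun"
  assumes "hom G k p"
  shows "(\<Sum>i\<in>{i. G i}. Var i * pdiff i p) = of_int k * p"
proof (rule pfun_eqI)
  fix v :: "'v \<Rightarrow> complex"
  have ev_int: "ev (of_int k) v = of_int k" for v :: "'v \<Rightarrow> complex"
    by (cases k) auto
  have "((\<lambda>t. ev p (\<lambda>i. if G i then t * v i else v i)) has_field_derivative
      (\<Sum>i\<in>UNIV. ev (pdiff i p) (\<lambda>i. if G i then 1 * v i else v i) * (if G i then v i else 0))) (at 1)"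
    by (rule ev_chain) (auto intro!: derivative_eq_intros)
  moreover have "((\<lambda>t. ev p (\<lambda>i. if G i then t * v i else v i)) has_field_derivative of_int k * ev p v) (at 1)"
  proof (rule has_field_derivative_transform_within_open)
    show "((\<lambda>t. t powi k * ev p v) has_field_derivative of_int k * ev p v) (at 1)"
      by (auto intro!: derivative_eq_intros)
    show "open (- {0 :: complex})" by auto
  qed (use homD[OF assms] in auto)
  ultimately have "(\<Sum>i\<in>UNIV. ev (pdiff i p) (\<lambda>i. if G i then 1 * v i else v i) * (if G i then v i else 0))
      = of_int k * ev p v" by (rule DERIV_unique)
  moreover have "(\<Sum>i\<in>UNIV. ev (pdiff i p) (\<lambda>i. if G i then 1 * v i else v i) * (if G i then v i else 0))
     = (\<Sum>i\<in>{i. G i}. v i * ev (pdiff i p) v)"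
  proof -
    have *: "(\<lambda>i. if G i then 1 * v i else v i) = v" by auto
    show ?thesis unfolding * by (intro sum.mono_neutral_cong_right) (auto simp: mult.commute)
  qed
  ultimately show "ev (\<Sum>i\<in>{i. G i}. Var i * pdiff i p) v = ev (of_int k * p) v"
    by (simp add: ev_int)
qed

subsection \<open>Reflections and truncated exponentials\<close>

definition texp :: "nat \<Rightarrow> 'v pfun \<Rightarrow> 'v pfun" where
  "texp M y = (\<Sum>j<M. Const (1 / fact j) * y ^ j)"

lemma texp_Suc: "texp (Suc M) y = texp M y + Const (1 / fact M) * y ^ M"
  by (simp add: texp_def)

lemma texp_0: "texp (Suc M) 0 = 1"
  by (induction M) (auto simp: texp_def Const_simps)

text \<open>The square of index pairs exceeds the triangle belonging to \<open>y + w\<close> by the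
  listed terms. They are kept explicit because two estimates are read off from them: divisibility by
  a power of a linear form, and membership in an ideal with two generators.\<close>

lemma texp_mult:
  fixes y w :: "'v pfun"
  shows "texp M y * texp M w - texp M (y + w) =
    (\<Sum>(i, j)\<in>{(i, j). i < M \<and> j < M \<and> M \<le> i + j}. Const (1 / (fact i * fact j)) * y ^ i * w ^ j)"
proof -
  let ?g = "\<lambda>i j. Const (1 / (fact i * fact j)) * y ^ i * w ^ j"
  have "Const (1 / fact n) * (y + w) ^ n = (\<Sum>i\<le>n. ?g i (n - i))" for n
  proof -
    have "Const (1 / fact n) * (of_nat (n choose i) * y ^ i * w ^ (n - i)) = ?g i (n - i)"
      if "i \<le> n" for i
      using that by (auto intro!: pfun_eqI simp: binomial_fact)
    then show ?thesis unfolding binomial_ring sum_distrib_left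
      by (intro sum.cong) (simp_all only: atMost_iff)
  qed
  then have "texp M (y + w) = (\<Sum>(i, j)\<in>{(i, j). i + j < M}. ?g i j)"
    unfolding texp_def by (simp add: sum.triangle_reindex)
  moreover have "texp M y * texp M w = (\<Sum>(i, j)\<in>{..<M} \<times> {..<M}. ?g i j)"
  proof -
    have "Const (1 / (fact i * fact j)) = Const (1 / fact i) * (Const (1 / fact j) :: 'v pfun)" for i j :: nat
      by (auto intro!: pfun_eqI)
    then show ?thesis
      unfolding texp_def sum_product sum.cartesian_product
      by (intro sum.cong) (simp_all add: split_beta mult_ac)
  qed
  moreover have "(\<Sum>(i, j)\<in>{..<M} \<times> {..<M}. ?g i j)
      = (\<Sum>(i, j)\<in>{(i, j). i + j < M}. ?g i j) + (\<Sum>(i, j)\<in>{(i, j). i < M \<and> j < M \<and> M \<le> i + j}. ?g i j)"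
    by (subst sum.union_disjoint[symmetric])
      (auto intro!: sum.cong intro: finite_subset[of _ "{..<M} \<times> {..<M}"])
  ultimately show ?thesis by simp
qed

lemma texp_mult_dvd: "l ^ M dvd texp M (a * l) * texp M (b * l) - texp M ((a + b) * l)"
proof -
  have "l ^ M dvd (\<Sum>(i, j)\<in>{(i, j). i < M \<and> j < M \<and> M \<le> i + j}.
      Const (1 / (fact i * fact j)) * (a * l) ^ i * (b * l) ^ j)"
  proof (rule dvd_sum, clarify)
    fix i j :: nat assume "M \<le> i + j"
    then have "l ^ M dvd l ^ (i + j)" by (rule le_imp_power_dvd)
    also have "l ^ (i + j) dvd Const (1 / (fact i * fact j)) * (a * l) ^ i * (b * l) ^ j"
      by (rule dvdI[of _ _ "Const (1 / (fact i * fact j)) * a ^ i * b ^ j"])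
        (simp add: power_mult_distrib power_add algebra_simps)
    finally show "l ^ M dvd Const (1 / (fact i * fact j)) * (a * l) ^ i * (b * l) ^ j" .
  qed
  then show ?thesis by (simp add: texp_mult distrib_right)
qed

text \<open>For \<open>a\<close> free of the two variables this is the normal derivative conjugated
  by \<open>exp (a * glf x \<alpha>)\<close>; in \<open>nd\<close> the role of \<open>a\<close> is
  played by the linear form in the dual variables.\<close>

definition nt :: "(bool \<Rightarrow> 'v) \<Rightarrow> complex \<Rightarrow> 'v pfun \<Rightarrow> 'v pfun \<Rightarrow> 'v pfun" where
  "nt x \<alpha> a p = gdn x \<alpha> p + a * p"

lemma nd_eq_nt: "nd s \<alpha> = nt (Pair s) \<alpha> (lf (\<not> s) \<alpha>)"
  by (rule ext) (simp add: nd_def nt_def gdn_def tw_def glf_def algebra_simps)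

text \<open>Elements that do not involve the two variables \<open>x False\<close> and \<open>x True\<close>.\<close>

definition free :: "(bool \<Rightarrow> 'v) \<Rightarrow> 'v pfun \<Rightarrow> bool" where
  "free x c \<longleftrightarrow> (\<forall>\<theta> :: 'v \<Rightarrow> 'v pfun. (\<forall>i. i \<noteq> x False \<longrightarrow> i \<noteq> x True \<longrightarrow> \<theta> i = Var i) \<longrightarrow> subst \<theta> c = c) \<and>
    (\<forall>b. pdiff (x b) c = 0)"

lemma free_Const [simp]: "free x (Const c)"
  by (simp add: free_def)

lemma free_diff: "free x c \<Longrightarrow> free x d \<Longrightarrow> free x (c - d)"
  and free_uminus: "free x c \<Longrightarrow> free x (- c)"
  and free_mult: "free x c \<Longrightarrow> free x d \<Longrightarrow> free x (c * d)"
  by (simp_all add: free_def pdiff_mult)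

lemma free_Var: "(\<And>b. i \<noteq> x b) \<Longrightarrow> free x (Var i)"
  by (force simp: free_def pdiff_Var)

lemma free_lf: "s \<noteq> s' \<Longrightarrow> free (Pair s) (lf s' \<alpha>)"
  unfolding glf_def by (intro free_diff free_mult free_Const free_Var) auto

lemma free_gdn: "free x c \<Longrightarrow> gdn x \<alpha> c = 0"
  by (simp add: free_def gdn_def)

lemma free_grs: "free x c \<Longrightarrow> grs x \<alpha> c = c"
  by (simp add: free_def grs_def)

definition refl :: "(bool \<Rightarrow> 'v) \<Rightarrow> complex \<Rightarrow> 'v pfun \<Rightarrow> 'v pfun" where
  "refl x \<alpha> = subst (\<lambda>i. if i = x False then Const (cos (2 * \<alpha>)) * Var (x False) + Const (sin (2 * \<alpha>)) * Var (x True)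
     else if i = x True then Const (sin (2 * \<alpha>)) * Var (x False) - Const (cos (2 * \<alpha>)) * Var (x True) else Var i)"

lemma refl_simps [simp]:
  "refl x \<alpha> 0 = 0" "refl x \<alpha> 1 = 1" "refl x \<alpha> (p + q) = refl x \<alpha> p + refl x \<alpha> q"
  "refl x \<alpha> (p * q) = refl x \<alpha> p * refl x \<alpha> q" "refl x \<alpha> (- p) = - refl x \<alpha> p"
  "refl x \<alpha> (p - q) = refl x \<alpha> p - refl x \<alpha> q" "refl x \<alpha> (Const c) = Const c"
  "refl x \<alpha> (p ^ n) = refl x \<alpha> p ^ n" "refl x \<alpha> (of_nat n) = of_nat n" "refl x \<alpha> (numeral k) = numeral k"
  by (simp_all add: refl_def)

lemma free_refl: "free x c \<Longrightarrow> refl x \<alpha> c = c"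
  by (simp add: free_def refl_def)

section \<open>Order of vanishing along a line, and quasi-invariance as a congruence under the
  reflection\<close>

context
  fixes x :: "bool \<Rightarrow> 'v::finite"
  assumes x: "x True \<noteq> x False"
begin

lemma refl_glf [simp]: "refl x \<alpha> (glf x \<alpha>) = - glf x \<alpha>"
  by (rule pfun_eqI, simp add: refl_def glf_def x sin_double cos_double)
    (use sin_squared_eq[of \<alpha>] in algebra)

lemma refl_gtf [simp]: "refl x \<alpha> (gtf x \<alpha>) = gtf x \<alpha>"
  by (rule pfun_eqI, simp add: refl_def gtf_def x sin_double cos_double)
    (use sin_squared_eq[of \<alpha>] in algebra)

lemma refl_refl [simp]: "refl x \<alpha> (refl x \<alpha> p) = p"
proof (rule pfun_eqI)
  fix v
  have 1: "sin (2 * \<alpha>) * sin (2 * \<alpha>) = 1 - cos (2 * \<alpha>) * cos (2 * \<alpha>)"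
    using sin_squared_eq[of "2 * \<alpha>"] by (simp add: power2_eq_square)
  let ?\<theta> = "\<lambda>i. if i = x False then Const (cos (2 * \<alpha>)) * Var (x False) + Const (sin (2 * \<alpha>)) * Var (x True)
     else if i = x True then Const (sin (2 * \<alpha>)) * Var (x False) - Const (cos (2 * \<alpha>)) * Var (x True) else Var i"
  have "(\<lambda>i. ev (subst ?\<theta> (?\<theta> i)) v) = v"
  proof
    fix i
    have "ev (subst ?\<theta> (?\<theta> (x False))) v = v (x False)" "ev (subst ?\<theta> (?\<theta> (x True))) v = v (x True)"
      by (simp add: x, use 1 in algebra)+
    then show "ev (subst ?\<theta> (?\<theta> i)) v = v i"
      by (cases "i = x False"; cases "i = x True") simp_all
  qed
  then show "ev (refl x \<alpha> (refl x \<alpha> p)) v = ev p v"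
    unfolding refl_def subst_subst ev_subst[of "\<lambda>i. subst _ _"] by simp
qed

lemma grs_refl [simp]: "grs x \<alpha> (refl x \<alpha> p) = grs x \<alpha> p"
proof -
  have "(\<lambda>i. grs x \<alpha> (if i = x False then Const (cos (2 * \<alpha>)) * Var (x False) + Const (sin (2 * \<alpha>)) * Var (x True)
     else if i = x True then Const (sin (2 * \<alpha>)) * Var (x False) - Const (cos (2 * \<alpha>)) * Var (x True) else Var i))
    = (\<lambda>i. if i = x False then Const (cos \<alpha>) * Var (x False)
                      else if i = x True then Const (sin \<alpha>) * Var (x False) else Var i)" (is "?l = ?r")
  proof
    fix i
    have "?l (x False) = ?r (x False)" "?l (x True) = ?r (x True)"
      by (rule pfun_eqI, simp add: x grs_Var sin_double cos_double, use sin_squared_eq[of \<alpha>] in algebra)+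
    then show "?l i = ?r i"
      by (cases "i = x False"; cases "i = x True") (simp_all add: grs_Var)
  qed
  then show ?thesis unfolding refl_def grs_def subst_subst by simp
qed

lemma gdn_refl: "gdn x \<alpha> (refl x \<alpha> p) = - refl x \<alpha> (gdn x \<alpha> p)"
proof -
  let ?\<theta> = "\<lambda>i. if i = x False then Const (cos (2 * \<alpha>)) * Var (x False) + Const (sin (2 * \<alpha>)) * Var (x True)
     else if i = x True then Const (sin (2 * \<alpha>)) * Var (x False) - Const (cos (2 * \<alpha>)) * Var (x True) else Var i"
  have \<theta>: "gdn x \<alpha> (?\<theta> i) = (if i = x False then Const (sin \<alpha>) else if i = x True then - Const (cos \<alpha>) else 0)"
    if "i = x False \<or> i = x True" for i
  proof -
    have "gdn x \<alpha> (?\<theta> (x False)) = Const (sin \<alpha>)" "gdn x \<alpha> (?\<theta> (x True)) = - Const (cos \<alpha>)"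
      by (rule pfun_eqI, simp add: gdn_def pdiff_mult pdiff_Var x x[symmetric] sin_double cos_double,
        use sin_squared_eq[of \<alpha>] in algebra)+
    then show ?thesis using that x by auto
  qed
  have "gdn x \<alpha> (refl x \<alpha> p) = (\<Sum>i\<in>UNIV. subst ?\<theta> (pdiff i p) * gdn x \<alpha> (?\<theta> i))"
    unfolding refl_def gdn_def pdiff_subst sum_distrib_left sum_subtractf[symmetric]
    by (intro sum.cong) (simp_all add: algebra_simps)
  also have "\<dots> = (\<Sum>i\<in>{x False, x True} \<union> - {x False, x True}. subst ?\<theta> (pdiff i p) * gdn x \<alpha> (?\<theta> i))"
    by (rule arg_cong[of _ _ "sum _"]) auto
  also have "\<dots> = (\<Sum>i\<in>{x False, x True}. subst ?\<theta> (pdiff i p) * gdn x \<alpha> (?\<theta> i))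
      + (\<Sum>i\<in>- {x False, x True}. subst ?\<theta> (pdiff i p) * gdn x \<alpha> (?\<theta> i))"
    by (rule sum.union_disjoint) auto
  also have "(\<Sum>i\<in>- {x False, x True}. subst ?\<theta> (pdiff i p) * gdn x \<alpha> (?\<theta> i)) = 0"
    by (intro sum.neutral) (auto simp: gdn_def pdiff_Var)
  also have "(\<Sum>i\<in>{x False, x True}. subst ?\<theta> (pdiff i p) * gdn x \<alpha> (?\<theta> i))
     = refl x \<alpha> (pdiff (x False) p) * Const (sin \<alpha>) - refl x \<alpha> (pdiff (x True) p) * Const (cos \<alpha>)"
    using x \<theta>[of "x False"] \<theta>[of "x True"] by (simp add: refl_def)
  finally show ?thesis by (simp add: gdn_def algebra_simps)
qed

lemma gdn_power: "gdn x \<alpha> (p ^ Suc n) = of_nat (Suc n) * p ^ n * gdn x \<alpha> p"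
  by (induction n) (simp_all add: gdn_mult algebra_simps)

lemma nt_add: "nt x \<alpha> a (p + q) = nt x \<alpha> a p + nt x \<alpha> a q"
  and nt_diff: "nt x \<alpha> a (p - q) = nt x \<alpha> a p - nt x \<alpha> a q"
  and nt_mult: "nt x \<alpha> a (p * q) = gdn x \<alpha> p * q + p * nt x \<alpha> a q"
  and nt_0 [simp]: "nt x \<alpha> a 0 = 0"
  by (simp_all add: nt_def gdn_mult algebra_simps)

lemma ntn_diff: "(nt x \<alpha> a ^^ n) (p - q) = (nt x \<alpha> a ^^ n) p - (nt x \<alpha> a ^^ n) q"
  by (induction n) (auto simp: nt_add nt_diff)

lemma nt_glf_power: "nt x \<alpha> a (glf x \<alpha> ^ Suc m * g) = glf x \<alpha> ^ m * (of_nat (Suc m) * g + glf x \<alpha> * nt x \<alpha> a g)"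
  unfolding nt_mult gdn_power by (simp add: gdn_glf x Const_simps algebra_simps)

lemma nt_dvd: "glf x \<alpha> ^ Suc m dvd p \<Longrightarrow> glf x \<alpha> ^ m dvd nt x \<alpha> a p"
  unfolding dvd_def using nt_glf_power by blast

lemma grs_ntn_glf_power: "grs x \<alpha> ((nt x \<alpha> a ^^ k) (glf x \<alpha> ^ k * g)) = of_nat (fact k) * grs x \<alpha> g"
proof (induction k arbitrary: g)
  case (Suc k)
  show ?case
    unfolding funpow_Suc_right o_def nt_glf_power Suc.IH using x by (simp add: algebra_simps)
qed auto

text \<open>Taylor criterion: once \<open>glf x \<alpha> ^ k\<close> divides \<open>p\<close>, the
  \<open>k\<close>-th twisted derivative restricted to the line is \<open>fact k\<close> times the
  restricted cofactor, so one more power splits off when it vanishes.\<close>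

lemma glf_power_dvdI:
  assumes "\<And>i. i < k \<Longrightarrow> grs x \<alpha> ((nt x \<alpha> a ^^ i) p) = 0"
  shows "glf x \<alpha> ^ k dvd p"
  using assms
proof (induction k)
  case (Suc k)
  then obtain g where g: "p = glf x \<alpha> ^ k * g" by (auto simp: dvd_def)
  have "of_nat (fact k) * grs x \<alpha> g = 0" using Suc.prems[of k] g grs_ntn_glf_power by simp
  then have "grs x \<alpha> g = 0" by simp
  then have "glf x \<alpha> dvd g" using glf_dvd_iff[of x, OF x] by blast
  then show ?case using g by (auto simp: dvd_def algebra_simps)
qed auto

lemma gdn_texp:
  assumes "free x c"
  shows "gdn x \<alpha> (texp (Suc m) (c * glf x \<alpha>)) = c * texp m (c * glf x \<alpha>)"
proof (induction m)
  case (Suc m)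
  have "Const (1 / fact (Suc m)) * of_nat (Suc m) = (Const (1 / fact m) :: 'v pfun)"
    by (intro pfun_eqI) (simp add: divide_simps del: of_nat_Suc)
  moreover have "gdn x \<alpha> (c * glf x \<alpha>) = c"
    using assms by (simp add: gdn_mult free_gdn gdn_glf x Const_simps)
  ultimately have "gdn x \<alpha> (Const (1 / fact (Suc m)) * (c * glf x \<alpha>) ^ Suc m) = c * (Const (1 / fact m) * (c * glf x \<alpha>) ^ m)"
    unfolding gdn_mult[of _ _ "Const _"] gdn_power by (simp add: mult.assoc[symmetric])
  then show ?case using Suc unfolding texp_Suc[of "Suc m"] by (simp add: texp_Suc[of m] algebra_simps)
qed (simp add: texp_def)

text \<open>The full exponential would intertwine \<open>nt x \<alpha> a\<close> with
  \<open>nt x \<alpha> (a + c)\<close> exactly. The derivative of the truncation misses one term, of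
  order \<open>M - 1\<close> in the linear form, and every further derivative costs one more
  power.\<close>

lemma ntn_texp:
  assumes a: "free x a" and c: "free x c" and "i \<le> M"
  shows "glf x \<alpha> ^ (M - i) dvd (nt x \<alpha> a ^^ i) (texp M (c * glf x \<alpha>) * f)
      - texp M (c * glf x \<alpha>) * (nt x \<alpha> (a + c) ^^ i) f"
  using \<open>i \<le> M\<close>
proof (induction i)
  case (Suc i)
  obtain m where M: "M = Suc m" using Suc.prems by (cases M) auto
  let ?l = "glf x \<alpha>" and ?E = "texp M (c * glf x \<alpha>)" and ?g = "(nt x \<alpha> (a + c) ^^ i) f"
  have "?l ^ Suc (M - Suc i) dvd (nt x \<alpha> a ^^ i) (?E * f) - ?E * ?g"
    using Suc by (simp add: Suc_diff_Suc del: power_Suc)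
  then have "?l ^ (M - Suc i) dvd nt x \<alpha> a ((nt x \<alpha> a ^^ i) (?E * f) - ?E * ?g)"
    by (rule nt_dvd)
  moreover have "?l ^ (M - Suc i) dvd Const (1 / fact m) * (c * ?l) ^ m * (c * ?g)"
  proof -
    have "?l ^ (M - Suc i) dvd ?l ^ m" by (rule le_imp_power_dvd) (simp add: M)
    then show ?thesis by (simp add: power_mult_distrib)
  qed
  moreover have "(nt x \<alpha> a ^^ Suc i) (?E * f) - ?E * (nt x \<alpha> (a + c) ^^ Suc i) f
      = nt x \<alpha> a ((nt x \<alpha> a ^^ i) (?E * f) - ?E * ?g) - Const (1 / fact m) * (c * ?l) ^ m * (c * ?g)"
  proof -
    have "gdn x \<alpha> ?E = c * ?E - c * (Const (1 / fact m) * (c * ?l) ^ m)"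
      unfolding M gdn_texp[OF c] by (simp add: texp_Suc algebra_simps)
    then show ?thesis by (simp add: nt_diff nt_mult) (simp add: nt_def algebra_simps)
  qed
  ultimately show ?case by (simp only: dvd_diff)
qed auto

text \<open>This encodes that \<open>exp (\<kappa> l) p\<close> minus its reflection vanishes to
  order \<open>2 * k\<close> on the line, for \<kappa> free of the two variables. Division by
  \<open>exp (\<kappa> l)\<close> leaves the factor \<open>exp (-2 \<kappa> l)\<close>, whose terms
  from order \<open>2 * k\<close> on do not matter.\<close>

definition qc :: "complex \<Rightarrow> 'v pfun \<Rightarrow> nat \<Rightarrow> 'v pfun \<Rightarrow> bool" where
  "qc \<alpha> \<kappa> k p \<longleftrightarrow> glf x \<alpha> ^ (2 * k) dvd p - texp (2 * k) (- (2 * \<kappa>) * glf x \<alpha>) * refl x \<alpha> p"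

lemma free_2\<kappa>: "free x \<kappa> \<Longrightarrow> free x (2 * \<kappa>)"
  using free_mult[OF free_Const[of x 2], of \<kappa>] by (simp add: Const_simps)

lemma ntn_refl:
  assumes "free x \<kappa>"
  shows "(nt x \<alpha> (- \<kappa>) ^^ i) (refl x \<alpha> p) = (- 1) ^ i * refl x \<alpha> ((nt x \<alpha> \<kappa> ^^ i) p)"
proof (induction i)
  case (Suc i)
  have "nt x \<alpha> (- \<kappa>) (refl x \<alpha> q) = - refl x \<alpha> (nt x \<alpha> \<kappa> q)" for q
    using assms by (simp add: nt_def gdn_refl free_refl algebra_simps)
  moreover have "nt x \<alpha> (- \<kappa>) ((- 1) ^ i * q) = (- 1) ^ i * nt x \<alpha> (- \<kappa>) q" for q
    by (cases "even i") (auto simp: nt_def)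
  ultimately show ?case using Suc by simp
qed auto

text \<open>On the line, the \<open>i\<close>-th twisted derivative of the exponential times the
  reflection is \<open>(-1) ^ i\<close> times that of \<open>p\<close>. In the difference the even
  derivatives cancel, and the odd ones vanish by hypothesis.\<close>

lemma qcI:
  assumes \<kappa>: "free x \<kappa>" and N: "\<And>i. odd i \<Longrightarrow> i < 2 * k \<Longrightarrow> grs x \<alpha> ((nt x \<alpha> \<kappa> ^^ i) p) = 0"
  shows "qc \<alpha> \<kappa> k p"
  unfolding qc_def
proof (rule glf_power_dvdI[where a = \<kappa>])
  fix i assume i: "i < 2 * k"
  let ?E = "texp (2 * k) (- (2 * \<kappa>) * glf x \<alpha>)"
  have "\<kappa> + - (2 * \<kappa>) = - \<kappa>" by simp
  moreover have "glf x \<alpha> ^ (2 * k - i) dvd (nt x \<alpha> \<kappa> ^^ i) (?E * refl x \<alpha> p)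
      - ?E * (nt x \<alpha> (\<kappa> + - (2 * \<kappa>)) ^^ i) (refl x \<alpha> p)"
    by (rule ntn_texp[OF \<kappa> free_uminus[OF free_2\<kappa>[OF \<kappa>]]]) (use i in simp)
  ultimately have "glf x \<alpha> ^ (2 * k - i) dvd (nt x \<alpha> \<kappa> ^^ i) (?E * refl x \<alpha> p)
      - ?E * ((- 1) ^ i * refl x \<alpha> ((nt x \<alpha> \<kappa> ^^ i) p))"
    by (simp only: ntn_refl[OF \<kappa>])
  moreover have "glf x \<alpha> dvd glf x \<alpha> ^ (2 * k - i)" using i by (intro dvd_power) simp
  ultimately have "glf x \<alpha> dvd (nt x \<alpha> \<kappa> ^^ i) (?E * refl x \<alpha> p)
      - ?E * ((- 1) ^ i * refl x \<alpha> ((nt x \<alpha> \<kappa> ^^ i) p))"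
    by (rule dvd_trans[rotated])
  then have "grs x \<alpha> ((nt x \<alpha> \<kappa> ^^ i) (?E * refl x \<alpha> p)) = grs x \<alpha> (?E * ((- 1) ^ i * refl x \<alpha> ((nt x \<alpha> \<kappa> ^^ i) p)))"
    unfolding glf_dvd_iff[of x, OF x] by (simp del: grs_refl)
  also have "\<dots> = grs x \<alpha> ?E * ((- 1) ^ i * grs x \<alpha> ((nt x \<alpha> \<kappa> ^^ i) p))" by simp
  also have "grs x \<alpha> ?E = 1"
  proof -
    obtain m where "2 * k = Suc m" using i by (cases "2 * k") auto
    then have "grs x \<alpha> ?E = texp (Suc m) 0"
      unfolding texp_def grs_sum using x by simp
    then show ?thesis by (simp add: texp_0)
  qed
  finally show "grs x \<alpha> ((nt x \<alpha> \<kappa> ^^ i) (p - ?E * refl x \<alpha> p)) = 0"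
    using N[of i] i by (cases "even i") (simp_all add: ntn_diff)
qed

lemma texp_dvd: "glf x \<alpha> ^ m dvd texp (m + j) (c * glf x \<alpha>) - texp m (c * glf x \<alpha>)"
proof (induction j)
  case (Suc j)
  have "glf x \<alpha> ^ m dvd (c * glf x \<alpha>) ^ (m + j)"
    by (simp add: power_mult_distrib power_add)
  then have "glf x \<alpha> ^ m dvd (texp (m + j) (c * glf x \<alpha>) - texp m (c * glf x \<alpha>)) + Const (1 / fact (m + j)) * (c * glf x \<alpha>) ^ (m + j)"
    using Suc by (intro dvd_add dvd_mult)
  then show ?case by (simp add: texp_Suc algebra_simps)
qed auto

lemma ntn_dvd: "glf x \<alpha> ^ (m + k) dvd p \<Longrightarrow> glf x \<alpha> ^ m dvd (nt x \<alpha> a ^^ k) p"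
proof (induction k arbitrary: m)
  case (Suc k)
  from Suc.IH[of "Suc m"] Suc.prems have "glf x \<alpha> ^ Suc m dvd (nt x \<alpha> a ^^ k) p" by simp
  then show ?case using nt_dvd by simp
qed auto

context
  fixes G :: "'v \<Rightarrow> bool"
  assumes G: "\<And>i. G i \<longleftrightarrow> i = x False \<or> i = x True"
begin

lemma hom_free: "free x c \<Longrightarrow> hom G 0 c"
  using G by (simp add: whom_def scale_def free_def Const_simps)

lemma hom_Var_x: "hom G 1 (Var (x b))"
  using hom_Var[of "\<lambda>i. if G i then 1 else 0" "x b"] G by (cases b) simp_all

lemma hom_glf: "hom G 1 (glf x \<alpha>)"
  unfolding glf_def by (intro hom_diff hom_Const_mult hom_Var_x)

lemma lower_gdn: "lower G n p \<Longrightarrow> lower G (n - 1) (gdn x \<alpha> p)"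
  using lower_pdiff[of G n p "x True"] lower_pdiff[of G n p "x False"] G
  by (auto simp: gdn_def intro!: lower_diff lower_Const_mult)

lemma lower_nt: "lower G n p \<Longrightarrow> hom G 0 a \<Longrightarrow> lower G n (nt x \<alpha> a p)"
  unfolding nt_def
proof -
  assume "lower G n p" "hom G 0 a"
  then show "lower G n (gdn x \<alpha> p + a * p)"
    by (intro lower_add lower_mono[OF lower_gdn[of n p \<alpha>]] lower_hom_mult[of G n p 0 a]) simp_all
qed

lemma hom_refl:
  assumes "hom G k p"
  shows "hom G k (refl x \<alpha> p)"
  unfolding whom_def
proof (intro allI impI)
  fix t :: complex assume "t \<noteq> 0"
  have "scale (\<lambda>i. if G i then 1 else 0) t (refl x \<alpha> q) = refl x \<alpha> (scale (\<lambda>i. if G i then 1 else 0) t q)" for q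
    unfolding scale_def refl_def subst_subst
    by (rule arg_cong[of _ _ "\<lambda>\<theta>. subst \<theta> q"]) (rule ext, auto simp: G algebra_simps)
  then show "scale (\<lambda>i. if G i then 1 else 0) t (refl x \<alpha> p) = Const (t powi k) * refl x \<alpha> p"
    using assms \<open>t \<noteq> 0\<close> by (simp add: whom_def)
qed

lemma lower_refl: "lower G n p \<Longrightarrow> lower G n (refl x \<alpha> p)"
  by (induction rule: lower.induct) (auto intro: lower.intros hom_refl)

end

end

subsection \<open>Leading forms of quasi-invariants\<close>

text \<open>Modulo a power of the linear form, a quasi-invariant \<open>p\<close> is \<open>exp (-2 \<kappa> l)\<close> times its reflection.
  Applying \<open>(d/dl + 2 \<kappa>)\<^sup>k\<close> turns the right-hand side into something of smaller degree, while the
  left-hand side keeps the leading form of \<open>p\<close> up to the factor \<open>(2 \<kappa>)\<^sup>k\<close>.\<close>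

lemma qc_leading_form:
  fixes x :: "bool \<Rightarrow> 'v::finite"
  assumes x: "x True \<noteq> x False" and G: "\<And>i. G i \<longleftrightarrow> i = x False \<or> i = x True"
    and \<kappa>: "free x \<kappa>" and qc: "qc x \<alpha> \<kappa> k p" and h: "hom G n h" and r: "lower G n r" and p: "p = h + r"
  shows "glf x \<alpha> ^ k dvd \<kappa> ^ k * h"
proof -
  note ntn_dvd = ntn_dvd[OF x] and ntn_texp = ntn_texp[OF x] and texp_dvd = texp_dvd[OF x]
    and ntn_diff = ntn_diff[OF x] and free_2\<kappa> = free_2\<kappa>[OF x] and hom_free = hom_free[OF x G]
    and hom_glf = hom_glf[OF x G] and lower_gdn = lower_gdn[OF x G] and lower_nt = lower_nt[OF x G]
    and lower_refl = lower_refl[OF x G]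
  let ?l = "glf x \<alpha>" and ?c = "- (2 * \<kappa>)"
  let ?E = "texp (2 * k) (?c * ?l)" and ?T = "nt x \<alpha> (2 * \<kappa>)" and ?D = "nt x \<alpha> 0"
  have \<kappa>0: "hom G 0 (2 * \<kappa>)" by (intro hom_free free_2\<kappa> \<kappa>)
  have pl: "lower G (n + 1) p"
    unfolding p by (intro lower_add lower_hom[OF h] lower_mono[OF r]) auto
  have 1: "?l ^ k dvd (?T ^^ k) (p - ?E * refl x \<alpha> p)"
    using qc unfolding qc_def[OF x] mult_2[of k] by (rule ntn_dvd)
  have 2: "?l ^ k dvd (?T ^^ k) (?E * refl x \<alpha> p) - ?E * (?D ^^ k) (refl x \<alpha> p)"
    using ntn_texp[of "2 * \<kappa>" ?c k "2 * k" \<alpha> "refl x \<alpha> p"] \<kappa> by (simp add: free_2\<kappa> free_uminus)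
  have 3: "?l ^ k dvd (?E - texp k (?c * ?l)) * (?D ^^ k) (refl x \<alpha> p)"
    using texp_dvd[of \<alpha> k k ?c] unfolding mult_2[of k, symmetric] by (rule dvd_mult2)
  \<comment> \<open>When \<open>?T\<close> passes the exponential it becomes the plain derivative
    \<open>?D\<close>. Cutting the exponential from \<open>2 * k\<close> to \<open>k\<close> terms
    afterwards is allowed modulo \<open>?l ^ k\<close>, and the degree count below depends on
    it.\<close>
  define Z where "Z = (?T ^^ k) p - texp k (?c * ?l) * (?D ^^ k) (refl x \<alpha> p)"
  have eq: "Z = (?T ^^ k) (p - ?E * refl x \<alpha> p) + ((?T ^^ k) (?E * refl x \<alpha> p) - ?E * (?D ^^ k) (refl x \<alpha> p))
      + (?E - texp k (?c * ?l)) * (?D ^^ k) (refl x \<alpha> p)"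
    by (simp add: Z_def ntn_diff algebra_simps)
  have "?l ^ k dvd Z" unfolding eq by (intro dvd_add 1 2 3)
  then obtain r2 where r2: "Z = ?l ^ k * r2" by (elim dvdE)
  have T: "lower G (n + 1) ((?T ^^ j) p) \<and> lower G n ((?T ^^ j) p - (2 * \<kappa>) ^ j * p)" for j
  proof (induction j)
    case (Suc j)
    have eq: "(?T ^^ Suc j) p - (2 * \<kappa>) ^ Suc j * p
        = gdn x \<alpha> ((?T ^^ j) p) + 2 * \<kappa> * ((?T ^^ j) p - (2 * \<kappa>) ^ j * p)"
      by (simp add: nt_def algebra_simps)
    have "lower G n (gdn x \<alpha> ((?T ^^ j) p))"
      using lower_gdn[OF conjunct1[OF Suc.IH], of \<alpha>] by simp
    moreover have "lower G n (2 * \<kappa> * ((?T ^^ j) p - (2 * \<kappa>) ^ j * p))"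
      by (rule lower_hom_mult[OF conjunct2[OF Suc.IH] \<kappa>0]) simp
    ultimately have 1: "lower G n ((?T ^^ Suc j) p - (2 * \<kappa>) ^ Suc j * p)"
      unfolding eq by (rule lower_add)
    have "lower G (n + 1) ((?T ^^ Suc j) p)"
      using lower_nt[OF conjunct1[OF Suc.IH] \<kappa>0, of \<alpha>] by simp
    then show ?case using 1 by (rule conjI)
  qed (simp add: pl lower_0)
  have "lower G (n + 1 - int j) ((?D ^^ j) (refl x \<alpha> p))" for j
  proof (induction j)
    case (Suc j)
    then show ?case using lower_gdn[OF Suc, of \<alpha>] by (simp add: nt_def algebra_simps)
  qed (use lower_refl[OF pl] in simp)
  then have D: "lower G (n + 1 - int k) ((?D ^^ k) (refl x \<alpha> p))" .
  \<comment> \<open>The \<open>k\<close> plain derivatives lower the degree by \<open>k\<close>, and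
    the exponential with \<open>k\<close> terms has degree at most \<open>k - 1\<close>; together
    this stays below the degree of \<open>p\<close>.\<close>
  have low: "lower G n (texp k (?c * ?l) * (?D ^^ k) (refl x \<alpha> p))"
    unfolding texp_def sum_distrib_right
  proof (rule lower_sum)
    fix j assume j: "j \<in> {..<k}"
    have "hom G (int j * (0 + 1)) ((?c * ?l) ^ j)"
      by (intro hom_power hom_mult hom_glf hom_uminus \<kappa>0)
    then have "hom G (int j) (Const (1 / fact j) * (?c * ?l) ^ j)"
      by (intro hom_Const_mult) simp
    from lower_hom_mult[OF D this HOL.refl]
    show "lower G n (Const (1 / fact j) * (?c * ?l) ^ j * (?D ^^ k) (refl x \<alpha> p))"
      by (rule lower_mono) (use j in auto)
  qed
  have "lower G n (((?T ^^ k) p - (2 * \<kappa>) ^ k * p) - texp k (?c * ?l) * (?D ^^ k) (refl x \<alpha> p) + (2 * \<kappa>) ^ k * r)"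
  proof (rule lower_add, rule lower_diff)
    show "lower G n ((2 * \<kappa>) ^ k * r)"
      by (rule lower_hom_mult[OF r hom_power[OF \<kappa>0]]) simp
  qed (use T[of k] low in simp_all)
  then have Zn: "lower G n (Z - (2 * \<kappa>) ^ k * h)"
    by (simp add: Z_def p algebra_simps)
  have hn: "hom G n ((2 * \<kappa>) ^ k * h)"
    using hom_mult[OF hom_power[OF \<kappa>0, of k] h] by simp
  have "lower G (n + 1) ((Z - (2 * \<kappa>) ^ k * h) + (2 * \<kappa>) ^ k * h)"
    by (intro lower_add lower_mono[OF Zn] lower_hom[OF hn]) auto
  then have "lower G (n + 1) (?l ^ k * r2)" by (simp add: r2)
  moreover have lk: "hom G (int k) (?l ^ k)" using hom_power[OF hom_glf, of k \<alpha>] by simp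
  moreover have "?l ^ k \<noteq> 0" using x by simp
  ultimately have "lower G (n - int k + 1) r2"
    using lower_div[of G "int k" "?l ^ k" "n - int k + 1" r2] by (simp add: algebra_simps)
  then obtain h2 r3 where r3: "hom G (n - int k) h2" "lower G (n - int k) r3" "r2 = h2 + r3"
    using lower_top[of G "n - int k" r2] by auto
  \<comment> \<open>Comparison of the parts of degree \<open>n\<close> in
    \<open>Z = ?l ^ k * r2\<close>: in \<open>Z\<close> only \<open>(2 * \<kappa>) ^ k * h\<close>
    has that degree.\<close>
  have "hom G n (?l ^ k * h2 - (2 * \<kappa>) ^ k * h)"
    by (intro hom_diff hn hom_mult_eq[OF lk r3(1)]) simp
  moreover have "lower G n (?l ^ k * h2 - (2 * \<kappa>) ^ k * h)"
  proof -
    have "lower G n ((Z - (2 * \<kappa>) ^ k * h) - ?l ^ k * r3)"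
      by (intro lower_diff Zn lower_hom_mult[OF r3(2) lk]) simp
    then show ?thesis by (simp add: r2 r3(3) algebra_simps)
  qed
  ultimately have "?l ^ k * h2 - (2 * \<kappa>) ^ k * h = 0" by (rule hom_lower_0) simp
  then have "(2 * \<kappa>) ^ k * h = ?l ^ k * h2" by simp
  then have "?l ^ k dvd (2 * \<kappa>) ^ k * h" by (rule dvdI)
  then have "?l ^ k dvd Const (1 / 2 ^ k) * ((2 * \<kappa>) ^ k * h)" by (rule dvd_mult)
  moreover have "Const (1 / 2 ^ k) * ((2 * \<kappa>) ^ k * h) = \<kappa> ^ k * h"
    by (rule pfun_eqI) (simp add: power_mult_distrib)
  ultimately show ?thesis by (simp only:)
qed

text \<open>The multiples of the linear form are the kernel of \<open>grs x \<alpha>\<close>, a ring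
  homomorphism into an integral domain.\<close>

lemma prime_elem_glf:
  assumes x: "x True \<noteq> x False"
  shows "prime_elem (glf x \<alpha>)"
  unfolding prime_elem_def
proof (intro conjI allI impI)
  show "glf x \<alpha> \<noteq> 0" using x by simp
  show "\<not> glf x \<alpha> dvd 1" unfolding glf_dvd_iff[of x, OF x] by simp
  fix a b assume "glf x \<alpha> dvd a * b"
  then show "glf x \<alpha> dvd a \<or> glf x \<alpha> dvd b" unfolding glf_dvd_iff[of x, OF x] by simp
qed

lemma prime_elem_power_dvd:
  fixes p :: "'a::idom"
  assumes p: "prime_elem p" and q: "\<not> p dvd q" and "p ^ n dvd q * r"
  shows "p ^ n dvd r"
  using \<open>p ^ n dvd q * r\<close>
proof (induction n)
  case (Suc n)
  have "p ^ n dvd p ^ Suc n" by (rule le_imp_power_dvd) simp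
  then have "p ^ n dvd r" using Suc by (metis dvd_trans)
  then obtain c where c: "r = p ^ n * c" by (elim dvdE)
  have "p ^ n * p dvd p ^ n * (q * c)" using Suc.prems c by (simp add: mult_ac)
  moreover have "p \<noteq> 0" using p unfolding prime_elem_def by blast
  then have "p ^ n \<noteq> 0" by simp
  ultimately have "p dvd q * c" by (simp only: dvd_mult_cancel_left simp_thms)
  then have "p dvd c" using p q unfolding prime_elem_def by blast
  then have "p ^ n * p dvd p ^ n * c" by (rule mult_dvd_mono[OF dvd_refl])
  then show ?case unfolding c by (simp add: mult.commute)
qed auto

text \<open>On the line \<alpha> the forms of the other lines restrict to nonzero multiples of the
  parameter, so the prime \<open>glf x \<alpha>\<close> divides no product of them and the powers
  can be split off one at a time.\<close>

lemma prod_glf_power_dvd: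
  assumes x: "x True \<noteq> x False" and "finite B"
    and sin: "\<And>\<alpha> \<beta>. \<alpha> \<in> B \<Longrightarrow> \<beta> \<in> B \<Longrightarrow> \<alpha> \<noteq> \<beta> \<Longrightarrow> sin (\<alpha> - \<beta>) \<noteq> 0"
    and dvd: "\<And>\<alpha>. \<alpha> \<in> B \<Longrightarrow> glf x \<alpha> ^ m \<alpha> dvd h"
  shows "(\<Prod>\<alpha>\<in>B. glf x \<alpha> ^ m \<alpha>) dvd h"
proof -
  have not_dvd: "\<not> glf x \<alpha> dvd (\<Prod>\<beta>\<in>C. glf x \<beta> ^ m \<beta>)" if "C \<subseteq> B" "\<alpha> \<in> B" "\<alpha> \<notin> C" for \<alpha> C
  proof -
    have "Var (x False) \<noteq> (0 :: 'a pfun)"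
    proof
      assume "Var (x False) = (0 :: 'a pfun)"
      from arg_cong[OF this, of "\<lambda>p. ev p (\<lambda>_. 1)"] show False by simp
    qed
    then have "grs x \<alpha> (glf x \<beta> ^ m \<beta>) \<noteq> 0" if "\<beta> \<in> C" for \<beta>
      using sin[of \<alpha> \<beta>] that \<open>C \<subseteq> B\<close> \<open>\<alpha> \<in> B\<close> \<open>\<alpha> \<notin> C\<close> by (auto simp: grs_glf[of x, OF x])
    then have "(\<Prod>\<beta>\<in>C. grs x \<alpha> (glf x \<beta> ^ m \<beta>)) \<noteq> 0"
      using finite_subset[OF \<open>C \<subseteq> B\<close> \<open>finite B\<close>] by simp
    then show ?thesis unfolding glf_dvd_iff[of x, OF x] by (simp only: grs_def subst_prod not_False_eq_True)
  qed
  have "C \<subseteq> B \<Longrightarrow> (\<Prod>\<alpha>\<in>C. glf x \<alpha> ^ m \<alpha>) dvd h" if "finite C" for C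
    using that
  proof (induction C)
    case (insert \<alpha> C)
    then obtain c where c: "h = (\<Prod>\<alpha>\<in>C. glf x \<alpha> ^ m \<alpha>) * c" by (auto elim: dvdE)
    have "glf x \<alpha> ^ m \<alpha> dvd (\<Prod>\<alpha>\<in>C. glf x \<alpha> ^ m \<alpha>) * c"
      unfolding c[symmetric] by (rule dvd) (use insert.prems in simp)
    then have "glf x \<alpha> ^ m \<alpha> dvd c"
      by (rule prime_elem_power_dvd[OF prime_elem_glf[of x, OF x] not_dvd, rotated -1])
        (use insert in auto)
    then have "(\<Prod>\<alpha>\<in>C. glf x \<alpha> ^ m \<alpha>) * glf x \<alpha> ^ m \<alpha> dvd h"
      unfolding c by (rule mult_dvd_mono[OF dvd_refl])
    then show ?case using insert.hyps by (simp add: mult.commute)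
  qed simp
  from this[OF \<open>finite B\<close>] show ?thesis by simp
qed

subsection \<open>The conjugated Calogero--Moser operator\<close>

abbreviation own :: "bool \<Rightarrow> idx \<Rightarrow> bool" where "own s i \<equiv> fst i = s"

lemma own_iff: "own s i \<longleftrightarrow> i = (s, False) \<or> i = (s, True)"
  by (cases i) auto

definition lapl :: "bool \<Rightarrow> idx pfun \<Rightarrow> idx pfun" where
  "lapl s Q = tw s False (tw s False Q) + tw s True (tw s True Q)"

definition nsq :: "bool \<Rightarrow> idx pfun" where
  "nsq s = Var (s, False) ^ 2 + Var (s, True) ^ 2"

text \<open>For \<open>s = False\<close> this substitutes \<open>z\<close> for
  \<open>x - \<xi>\<close>, that is, restricts to the diagonal; for \<open>s = True\<close>
  conversely.\<close>

definition diag :: "bool \<Rightarrow> idx pfun \<Rightarrow> idx pfun" where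
  "diag s = subst (\<lambda>(s', b). Var (\<not> s, b))"

text \<open>Degree 0 makes \<open>p\<close> constant along each scaling orbit and hence, by
  polynomiality, equal to its value at \<open>t = 0\<close>, where the selected variables are
  gone.\<close>

lemma hom_0_ev:
  assumes "hom G 0 p"
  shows "ev p v = ev p (\<lambda>i. if G i then w i else v i)"
proof -
  have *: "ev p v = ev p (\<lambda>i. if G i then 0 else v i)" for v
  proof -
    obtain q where q: "\<And>t. ev p (\<lambda>i. if G i then t * v i else v i) = poly q t"
      using ev_scale_poly by blast
    have "q = [:ev p v:]"
      by (rule poly_eq_away_from_0) (use homD[OF assms] q in \<open>simp add: q[symmetric]\<close>)
    then have "ev p (\<lambda>i. if G i then 0 * v i else v i) = ev p v" using q[of 0] by simp
    then show ?thesis by (simp cong: if_cong)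
  qed
  show ?thesis
    by (subst (1 2) *) (rule arg_cong[of _ _ "ev p"], auto)
qed

text \<open>\<open>B\<close> is to be the set of lines of positive multiplicity, so that each of
  them forces at least the first normal derivative to vanish. \<open>cot_sum\<close> is the first
  Baker--Akhieser identity with \<open>j = 2 * k - 1\<close>, its quotients of exponentials being
  \<open>\<i> * cot (\<alpha> - \<beta>)\<close>.\<close>

locale ba =
  fixes B :: "complex set" and mu :: "complex \<Rightarrow> nat"
  assumes finite_B: "finite B"
    and mu_pos: "\<And>\<alpha>. \<alpha> \<in> B \<Longrightarrow> mu \<alpha> > 0"
    and sin_neq_0: "\<And>\<alpha> \<beta>. \<alpha> \<in> B \<Longrightarrow> \<beta> \<in> B \<Longrightarrow> \<alpha> \<noteq> \<beta> \<Longrightarrow> sin (\<alpha> - \<beta>) \<noteq> 0"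
    and cot_sum: "\<And>\<alpha> j. \<alpha> \<in> B \<Longrightarrow> odd j \<Longrightarrow> j < 2 * mu \<alpha> \<Longrightarrow>
      (\<Sum>\<beta>\<in>B - {\<alpha>}. of_nat (mu \<beta>) * cot (\<alpha> - \<beta>) ^ j) = 0"
begin

definition QI :: "bool \<Rightarrow> idx pfun \<Rightarrow> bool" where
  "QI s Q \<longleftrightarrow> (\<forall>\<alpha>\<in>B. qi s \<alpha> (mu \<alpha>) Q)"

definition dl :: "bool \<Rightarrow> idx pfun" where
  "dl s = (\<Prod>\<alpha>\<in>B. lf s \<alpha> ^ mu \<alpha>)"

definition dD :: "bool \<Rightarrow> idx pfun" where
  "dD s = (\<Prod>\<alpha>\<in>B. lf s \<alpha>)"

definition dR :: "bool \<Rightarrow> complex \<Rightarrow> idx pfun" where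
  "dR s \<alpha> = (\<Prod>\<beta>\<in>B - {\<alpha>}. lf s \<beta>)"

definition deg :: int where "deg = (\<Sum>\<alpha>\<in>B. int (mu \<alpha>))"

text \<open>For a function written as \<open>exp (x1 z1 + x2 z2) Q / \<delta>\<close>, the operator
  \<open>H - z1^2 - z2^2\<close> acts on the numerator by \<open>lapl - nsq\<close> minus the sum of
  \<open>2 \<mu> nd / l\<close> over the lines; the potential is absorbed by the derivatives of
  \<open>1 / \<delta>\<close>, see \<open>Op_eval\<close>. The factor \<open>dD\<close> clears the
  simple poles.\<close>

definition Op :: "bool \<Rightarrow> idx pfun \<Rightarrow> idx pfun" where
  "Op s Q = dD s * (lapl s Q - nsq (\<not> s) * Q)
    - (\<Sum>\<alpha>\<in>B. Const (2 * of_nat (mu \<alpha>)) * dR s \<alpha> * nd s \<alpha> Q)"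

lemma dD_eq: "\<alpha> \<in> B \<Longrightarrow> dD s = lf s \<alpha> * dR s \<alpha>"
  unfolding dD_def dR_def using finite_B by (rule prod.remove)

lemma dD_neq_0: "dD s \<noteq> 0"
  unfolding dD_def using finite_B by simp

lemma dl_neq_0: "dl s \<noteq> 0"
  unfolding dl_def using finite_B by simp

lemma dn_nsq: "dn s \<alpha> (nsq (\<not> s)) = 0"
  by (simp add: nsq_def power2_eq_square gdn_def pdiff_mult pdiff_Var)

lemma Op_factor:
  assumes "\<And>\<alpha>. \<alpha> \<in> B \<Longrightarrow> lf s \<alpha> * g \<alpha> = nd s \<alpha> Q"
  shows "Op s Q = dD s * (lapl s Q - nsq (\<not> s) * Q - (\<Sum>\<alpha>\<in>B. Const (2 * of_nat (mu \<alpha>)) * g \<alpha>))"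
proof -
  have "(\<Sum>\<alpha>\<in>B. Const (2 * of_nat (mu \<alpha>)) * dR s \<alpha> * nd s \<alpha> Q)
      = (\<Sum>\<alpha>\<in>B. dD s * (Const (2 * of_nat (mu \<alpha>)) * g \<alpha>))"
    by (intro sum.cong HOL.refl) (simp add: assms[symmetric] dD_eq mult_ac)
  then show ?thesis by (simp add: Op_def right_diff_distrib sum_distrib_left)
qed

text \<open>On the line \<alpha> only the second normal derivative and the pole along \<alpha>
  survive: tangential derivatives of a vanishing odd derivative vanish,
  \<open>nsq (\<not> s)\<close> passes the normal derivatives, and the poles along the other lines
  cancel by \<open>parity_sum\<close>. The second relation is the factorisation at \<alpha>,
  differentiated \<open>Suc i\<close> times.\<close>

lemma local_expansion:
  assumes g: "\<And>\<beta>. \<beta> \<in> B \<Longrightarrow> lf s \<beta> * g \<beta> = nd s \<beta> Q"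
    and \<alpha>: "\<alpha> \<in> B" and i: "odd i" "i < 2 * mu \<alpha>"
    and N: "\<And>j. odd j \<Longrightarrow> j \<le> i \<Longrightarrow> rs s \<alpha> ((nd s \<alpha> ^^ j) Q) = 0"
  shows "rs s \<alpha> ((nd s \<alpha> ^^ i) (lapl s Q - nsq (\<not> s) * Q - (\<Sum>\<alpha>\<in>B. Const (2 * of_nat (mu \<alpha>)) * g \<alpha>)))
      = rs s \<alpha> ((nd s \<alpha> ^^ Suc (Suc i)) Q) - Const (2 * of_nat (mu \<alpha>)) * rs s \<alpha> ((nd s \<alpha> ^^ i) (g \<alpha>))"
    and "of_nat (Suc i) * rs s \<alpha> ((nd s \<alpha> ^^ i) (g \<alpha>)) = rs s \<alpha> ((nd s \<alpha> ^^ Suc (Suc i)) Q)"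
proof -
  have "rs s \<alpha> ((nd s \<alpha> ^^ Suc i) (lf s \<alpha> * g \<alpha>)) = rs s \<alpha> ((nd s \<alpha> ^^ Suc i) (nd s \<alpha> Q))"
    by (simp only: g[OF \<alpha>])
  then show "of_nat (Suc i) * rs s \<alpha> ((nd s \<alpha> ^^ i) (g \<alpha>)) = rs s \<alpha> ((nd s \<alpha> ^^ Suc (Suc i)) Q)"
    unfolding ndn_lf_self by (simp add: funpow_swap1)
  have "(nd s \<alpha> ^^ i) (lapl s Q) = (nd s \<alpha> ^^ Suc (Suc i)) Q + td s \<alpha> (td s \<alpha> ((nd s \<alpha> ^^ i) Q))"
    unfolding lapl_def laplace_rotate[of s Q \<alpha>] ndn_add ndn_td by (simp add: funpow_swap1)
  moreover have "rs s \<alpha> (td s \<alpha> (td s \<alpha> ((nd s \<alpha> ^^ i) Q))) = 0"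
    by (intro rs_td N) (use i in auto)
  ultimately have 1: "rs s \<alpha> ((nd s \<alpha> ^^ i) (lapl s Q)) = rs s \<alpha> ((nd s \<alpha> ^^ Suc (Suc i)) Q)" by simp
  have 2: "rs s \<alpha> ((nd s \<alpha> ^^ i) (nsq (\<not> s) * Q)) = 0"
    unfolding ndn_mult_const[OF dn_nsq] using N[of i] i by simp
  have 3: "(\<Sum>\<beta>\<in>B - {\<alpha>}. Const (of_nat (mu \<beta>)) * rs s \<alpha> ((nd s \<alpha> ^^ i) (g \<beta>))) = 0"
  proof (rule parity_sum[where Q = Q])
    fix \<beta> assume "\<beta> \<in> B - {\<alpha>}"
    then show "lf s \<beta> * g \<beta> = nd s \<beta> Q" "sin (\<alpha> - \<beta>) \<noteq> 0"
      using g sin_neq_0 \<alpha> by auto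
  next
    fix j assume "odd j" "j \<le> i"
    then show "(\<Sum>\<beta>\<in>B - {\<alpha>}. of_nat (mu \<beta>) * cot (\<alpha> - \<beta>) ^ j) = 0"
      using cot_sum[OF \<alpha>] i by simp
  qed (fact N i)+
  have "rs s \<alpha> ((nd s \<alpha> ^^ i) (\<Sum>\<beta>\<in>B. Const (2 * of_nat (mu \<beta>)) * g \<beta>))
      = (\<Sum>\<beta>\<in>B. Const (2 * of_nat (mu \<beta>)) * rs s \<alpha> ((nd s \<alpha> ^^ i) (g \<beta>)))"
    by (simp add: ndn_sum grs_sum ndn_mult_const)
  also have "\<dots> = Const (2 * of_nat (mu \<alpha>)) * rs s \<alpha> ((nd s \<alpha> ^^ i) (g \<alpha>))
      + 2 * (\<Sum>\<beta>\<in>B - {\<alpha>}. Const (of_nat (mu \<beta>)) * rs s \<alpha> ((nd s \<alpha> ^^ i) (g \<beta>)))"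
    by (subst sum.remove[OF finite_B \<alpha>]) (simp add: sum_distrib_left Const_simps mult_ac)
  finally show "rs s \<alpha> ((nd s \<alpha> ^^ i) (lapl s Q - nsq (\<not> s) * Q - (\<Sum>\<alpha>\<in>B. Const (2 * of_nat (mu \<alpha>)) * g \<alpha>)))
      = rs s \<alpha> ((nd s \<alpha> ^^ Suc (Suc i)) Q) - Const (2 * of_nat (mu \<alpha>)) * rs s \<alpha> ((nd s \<alpha> ^^ i) (g \<alpha>))"
    unfolding ndn_diff grs_simps(6) 1 2 3 by simp
qed

lemma exists_factors:
  assumes "\<And>\<alpha>. \<alpha> \<in> B \<Longrightarrow> rs s \<alpha> (nd s \<alpha> Q) = 0"
  obtains g where "\<And>\<alpha>. \<alpha> \<in> B \<Longrightarrow> lf s \<alpha> * g \<alpha> = nd s \<alpha> Q"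
proof -
  have "\<exists>h. lf s \<alpha> * h = nd s \<alpha> Q" if "\<alpha> \<in> B" for \<alpha>
  proof -
    have "lf s \<alpha> dvd nd s \<alpha> Q" using assms[OF that] by (subst glf_dvd_iff) simp_all
    then obtain h where "nd s \<alpha> Q = lf s \<alpha> * h" by (elim dvdE)
    then show ?thesis by (intro exI[of _ h]) simp
  qed
  then have "\<forall>\<alpha>\<in>B. \<exists>h. lf s \<alpha> * h = nd s \<alpha> Q" by blast
  from bchoice[OF this] obtain g where "\<forall>\<alpha>\<in>B. lf s \<alpha> * g \<alpha> = nd s \<alpha> Q" by (elim exE)
  then show ?thesis using that[of g] by simp
qed

lemma QI_step:
  assumes QI: "QI s Q"
  shows "\<exists>Q'. dD s * Q' = Op s Q \<and> QI s Q'"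
proof -
  have N: "rs s \<alpha> ((nd s \<alpha> ^^ j) Q) = 0" if "\<alpha> \<in> B" "odd j" "j < 2 * mu \<alpha>" for \<alpha> j
    using QI that by (simp add: QI_def qi_def)
  have "rs s \<alpha> (nd s \<alpha> Q) = 0" if "\<alpha> \<in> B" for \<alpha>
    using N[OF that, of 1] mu_pos[OF that] by simp
  then obtain g where g: "\<And>\<alpha>. \<alpha> \<in> B \<Longrightarrow> lf s \<alpha> * g \<alpha> = nd s \<alpha> Q"
    using exists_factors by blast
  define Q' where "Q' = lapl s Q - nsq (\<not> s) * Q - (\<Sum>\<alpha>\<in>B. Const (2 * of_nat (mu \<alpha>)) * g \<alpha>)"
  have "qi s \<alpha> (mu \<alpha>) Q'" if \<alpha>: "\<alpha> \<in> B" for \<alpha>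
    unfolding qi_def
  proof (intro allI impI, elim conjE)
    fix i assume i: "odd i" "i < 2 * mu \<alpha>"
    let ?a = "rs s \<alpha> ((nd s \<alpha> ^^ i) (g \<alpha>))" and ?N = "rs s \<alpha> ((nd s \<alpha> ^^ Suc (Suc i)) Q)"
    have Ni: "\<And>j. odd j \<Longrightarrow> j \<le> i \<Longrightarrow> rs s \<alpha> ((nd s \<alpha> ^^ j) Q) = 0"
      using N[OF \<alpha>] i by simp
    have 1: "rs s \<alpha> ((nd s \<alpha> ^^ i) Q') = ?N - Const (2 * of_nat (mu \<alpha>)) * ?a"
      unfolding Q'_def by (rule local_expansion(1)[OF g \<alpha> i Ni])
    have 2: "of_nat (Suc i) * ?a = ?N" by (rule local_expansion(2)[OF g \<alpha> i Ni])
    show "rs s \<alpha> ((nd s \<alpha> ^^ i) Q') = 0"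
    proof (cases "Suc (Suc i) < 2 * mu \<alpha>")
      case True
      then have "?N = 0" using N[OF \<alpha>, of "Suc (Suc i)"] i by simp
      moreover have "?a = 0" using 2 unfolding \<open>?N = 0\<close> by (simp only: mult_eq_0_iff of_nat_eq_0_iff nat.distinct simp_thms)
      ultimately show ?thesis by (simp only: 1 mult_zero_right diff_self)
    next
      case False
      \<comment> \<open>At the last index nothing is known about \<open>?N\<close>. Instead, the two
        coefficients of \<open>?a\<close> coincide; this is why the number of conditions is
        preserved.\<close>
      then have "Suc i = 2 * mu \<alpha>" using i by presburger
      then have "Const (2 * of_nat (mu \<alpha>)) = (of_nat (Suc i) :: idx pfun)"
        by (simp only: Const_simps of_nat_mult of_nat_numeral)
      then show ?thesis by (simp only: 1 2 diff_self)
    qed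
  qed
  then have "QI s Q'" by (simp add: QI_def)
  moreover have "dD s * Q' = Op s Q" unfolding Q'_def by (rule Op_factor[OF g, symmetric])
  ultimately show ?thesis by blast
qed

text \<open>The first normal derivative vanishes because nothing cancels a simple pole along
  \<alpha>. After that the relations of \<open>local_expansion\<close> read
  \<open>(Suc j - 2 * mu \<alpha>) * ?a = 0\<close> with a nonzero factor in the relevant range, and
  the odd derivatives vanish one after the other.\<close>

lemma Op_0_imp_QI:
  assumes "Op s Q = 0"
  shows "QI s Q"
proof -
  have "rs s \<alpha> (nd s \<alpha> Q) = 0" if \<alpha>: "\<alpha> \<in> B" for \<alpha>
  proof -
    have D0: "rs s \<alpha> (dD s) = 0" unfolding dD_eq[OF \<alpha>] by simp
    have R0: "rs s \<alpha> (dR s \<beta>) = 0" if "\<beta> \<in> B - {\<alpha>}" for \<beta>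
    proof -
      have "dR s \<beta> = lf s \<alpha> * (\<Prod>\<gamma>\<in>B - {\<beta>} - {\<alpha>}. lf s \<gamma>)"
        unfolding dR_def by (rule prod.remove) (use finite_B \<alpha> that in auto)
      then show ?thesis by simp
    qed
    have "rs s \<alpha> (Op s Q) = - (\<Sum>\<beta>\<in>B. Const (2 * of_nat (mu \<beta>)) * rs s \<alpha> (dR s \<beta>) * rs s \<alpha> (nd s \<beta> Q))"
      unfolding Op_def by (simp add: D0 grs_sum)
    also have "\<dots> = - (Const (2 * of_nat (mu \<alpha>)) * rs s \<alpha> (dR s \<alpha>) * rs s \<alpha> (nd s \<alpha> Q))"
      by (subst sum.remove[OF finite_B \<alpha>]) (simp add: R0)
    finally have "Const (2 * of_nat (mu \<alpha>)) * rs s \<alpha> (dR s \<alpha>) * rs s \<alpha> (nd s \<alpha> Q) = 0"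
      using assms by simp
    moreover have "Const (2 * of_nat (mu \<alpha>)) \<noteq> (0 :: idx pfun)" using mu_pos[OF \<alpha>] by simp
    moreover have "rs s \<alpha> (dR s \<alpha>) \<noteq> 0"
    proof -
      have "Var (s, False) \<noteq> (0 :: idx pfun)"
      proof
        assume "Var (s, False) = (0 :: idx pfun)"
        from arg_cong[OF this, of "\<lambda>p. ev p (\<lambda>_. 1)"] show False by simp
      qed
      then have "rs s \<alpha> (lf s \<beta>) \<noteq> 0" if "\<beta> \<in> B - {\<alpha>}" for \<beta>
        using sin_neq_0[OF \<alpha>, of \<beta>] that by (auto simp: grs_glf)
      then have "(\<Prod>\<beta>\<in>B - {\<alpha>}. rs s \<alpha> (lf s \<beta>)) \<noteq> 0" using finite_B by simp
      then show ?thesis by (simp only: dR_def grs_def subst_prod not_False_eq_True)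
    qed
    ultimately show ?thesis by simp
  qed
  then obtain g where g: "\<And>\<alpha>. \<alpha> \<in> B \<Longrightarrow> lf s \<alpha> * g \<alpha> = nd s \<alpha> Q"
    using exists_factors by blast
  have E: "lapl s Q - nsq (\<not> s) * Q - (\<Sum>\<alpha>\<in>B. Const (2 * of_nat (mu \<alpha>)) * g \<alpha>) = 0"
    using Op_factor[OF g] assms dD_neq_0[of s] by simp
  have "i < 2 * mu \<alpha> \<Longrightarrow> rs s \<alpha> ((nd s \<alpha> ^^ i) Q) = 0" if \<alpha>: "\<alpha> \<in> B" and "odd i" for \<alpha> i
    using \<open>odd i\<close>
  proof (induction i rule: less_induct)
    case (less i)
    show ?case
    proof (cases "i = 1")
      case True
      have "rs s \<alpha> (nd s \<alpha> Q) = rs s \<alpha> (lf s \<alpha>) * rs s \<alpha> (g \<alpha>)" by (simp only: g[OF \<alpha>, symmetric] grs_simps)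
      then show ?thesis using True by simp
    next
      case False
      define j where "j = i - 2"
      have j: "i = Suc (Suc j)" "odd j" "j < 2 * mu \<alpha>"
        using False less.prems unfolding j_def by presburger+
      have Nj: "\<And>k. odd k \<Longrightarrow> k \<le> j \<Longrightarrow> rs s \<alpha> ((nd s \<alpha> ^^ k) Q) = 0"
        using less.IH less.prems j(1) by simp
      let ?a = "rs s \<alpha> ((nd s \<alpha> ^^ j) (g \<alpha>))" and ?N = "rs s \<alpha> ((nd s \<alpha> ^^ Suc (Suc j)) Q)"
      have 1: "?N - Const (2 * of_nat (mu \<alpha>)) * ?a = 0"
        using local_expansion(1)[OF g \<alpha> j(2,3) Nj] unfolding E by simp
      have 2: "of_nat (Suc j) * ?a = ?N" by (rule local_expansion(2)[OF g \<alpha> j(2,3) Nj])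
      have "Const (of_nat (Suc j) - 2 * of_nat (mu \<alpha>)) * ?a = 0"
        using 1 unfolding 2[symmetric] by (simp only: Const_simps left_diff_distrib)
      moreover have "of_nat (Suc j) - 2 * of_nat (mu \<alpha>) \<noteq> (0 :: complex)"
      proof
        assume "of_nat (Suc j) - 2 * of_nat (mu \<alpha>) = (0 :: complex)"
        then have "of_nat (Suc j) = (of_nat (2 * mu \<alpha>) :: complex)" by simp
        then have "Suc j = 2 * mu \<alpha>" by (simp only: of_nat_eq_iff)
        then show False using less.prems j(1) by simp
      qed
      ultimately have "?a = 0" by (simp only: mult_eq_0_iff Const_eq_0_iff simp_thms)
      then show ?thesis using 2 by (simp only: j(1) mult_zero_right)
    qed
  qed
  then show ?thesis by (simp add: QI_def qi_def)
qed

lemma hom_lf: "hom (own s) 1 (lf s \<alpha>)"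
  by (rule hom_glf) (auto simp: own_iff)

lemma hom_dl: "hom (own s) deg (dl s)"
  unfolding dl_def deg_def
proof (rule hom_prod)
  show "hom (own s) (int (mu \<alpha>)) (lf s \<alpha> ^ mu \<alpha>)" for \<alpha>
    using hom_power[OF hom_lf, of s "mu \<alpha>" \<alpha>] by simp
qed

text \<open>The factor \<open>?\<kappa> ^ mu \<alpha>\<close> in \<open>qc_leading_form\<close> is a
  power of a form in the dual variables; it is prime to \<open>lf s \<alpha>\<close> and can be
  cancelled.\<close>

lemma QI_leading_form:
  assumes QI: "QI s f" and h: "hom (own s) n h" "lower (own s) n r" "f = h + r"
  shows "dl s dvd h"
  unfolding dl_def
proof (rule prod_glf_power_dvd)
  fix \<alpha> assume \<alpha>: "\<alpha> \<in> B"
  let ?\<kappa> = "lf (\<not> s) \<alpha>"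
  have fr: "free (Pair s) ?\<kappa>" by (rule free_lf) simp
  have "qc (Pair s) \<alpha> ?\<kappa> (mu \<alpha>) f"
    by (rule qcI) (use QI \<alpha> fr in \<open>auto simp: QI_def qi_def nd_eq_nt\<close>)
  from qc_leading_form[OF _ own_iff fr this h]
  have "lf s \<alpha> ^ mu \<alpha> dvd ?\<kappa> ^ mu \<alpha> * h" by simp
  moreover have "\<not> lf s \<alpha> dvd ?\<kappa> ^ mu \<alpha>"
    using free_grs[OF fr, of \<alpha>] by (subst glf_dvd_iff) simp_all
  moreover have "prime_elem (lf s \<alpha>)" by (rule prime_elem_glf) simp
  ultimately show "lf s \<alpha> ^ mu \<alpha> dvd h"
    using prime_elem_power_dvd[of "lf s \<alpha>" "?\<kappa> ^ mu \<alpha>"] by blast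
qed (use finite_B sin_neq_0 in auto)

text \<open>A leading form divisible by \<open>dl s\<close> is zero or has degree at least
  \<open>deg\<close>; below that degree the leading forms are removed one by one.\<close>

lemma QI_lower_0:
  assumes "QI s f" "lower (own s) (int m) f" "int m \<le> deg"
  shows "f = 0"
  using assms(2,3)
proof (induction m)
  case 0
  then show ?case using lower_nonpos by fastforce
next
  case (Suc m)
  then have "lower (own s) (int m + 1) f" by (simp add: add.commute)
  then obtain h r where h: "hom (own s) (int m) h" "lower (own s) (int m) r" "f = h + r"
    using lower_top by blast
  from QI_leading_form[OF assms(1) this] obtain q where q: "h = dl s * q" by (elim dvdE)
  have "hom (own s) (int m - deg) q"
    by (rule hom_factor[OF hom_dl dl_neq_0]) (use h q in simp)
  then have "q = 0" by (rule hom_neg) (use Suc.prems in simp)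
  then have "lower (own s) (int m) f" using h q by simp
  then show ?case using Suc by simp
qed

lemma deg_nonneg: "deg \<ge> 0"
  unfolding deg_def by (rule sum_nonneg) simp

text \<open>In degree exactly \<open>deg\<close> the leading form is \<open>dl s\<close> times a
  polynomial in the dual variables alone. Restriction to the diagonal fixes this cofactor and maps
  \<open>dl s\<close> to the nonzero \<open>dl (\<not> s)\<close>.\<close>

lemma QI_diag_0:
  assumes "QI s f" "hom (own s) deg h" "lower (own s) deg r" "f = h + r" "diag s h = 0"
  shows "f = 0"
proof -
  obtain q where q: "h = dl s * q" using QI_leading_form[OF assms(1-4)] by (elim dvdE)
  have "hom (own s) (deg - deg) q"
    by (rule hom_factor[OF hom_dl dl_neq_0]) (use assms q in simp)
  then have q0: "hom (own s) 0 q" by simp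
  have "diag s q = q"
  proof (rule pfun_eqI)
    fix v
    have "ev (diag s q) v = ev q (\<lambda>(s', b). v (\<not> s, b))"
      unfolding diag_def by (simp add: case_prod_unfold)
    also have "(\<lambda>(s', b). v (\<not> s, b)) = (\<lambda>i. if own s i then (\<lambda>i. v (\<not> s, snd i)) i else v i)"
      by (rule ext) (auto split: prod.splits)
    also have "ev q \<dots> = ev q v" by (rule hom_0_ev[OF q0, symmetric])
    finally show "ev (diag s q) v = ev q v" .
  qed
  moreover have "diag s (lf s \<alpha>) = lf (\<not> s) \<alpha>" for \<alpha>
    by (simp add: diag_def glf_def)
  then have "diag s (dl s) = dl (\<not> s)" by (simp add: dl_def diag_def subst_prod)
  moreover have "diag s h = diag s (dl s) * diag s q" by (simp add: q diag_def)
  ultimately have "dl (\<not> s) * q = 0" using assms(5) by simp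
  then have "q = 0" using dl_neq_0 by simp
  then have "lower (own s) (int (nat deg)) f" using assms q deg_nonneg by simp
  then show ?thesis by (rule QI_lower_0[OF assms(1)]) (use deg_nonneg in simp)
qed

end

subsection \<open>Duality\<close>

definition lap0 :: "bool \<Rightarrow> idx pfun \<Rightarrow> idx pfun" where
  "lap0 s Q = pdiff (s, False) (pdiff (s, False) Q) + pdiff (s, True) (pdiff (s, True) Q)"

definition Eu :: "bool \<Rightarrow> idx pfun \<Rightarrow> idx pfun" where
  "Eu s Q = Var (\<not> s, False) * pdiff (s, False) Q + Var (\<not> s, True) * pdiff (s, True) Q"

definition swap :: "idx pfun \<Rightarrow> idx pfun" where
  "swap = subst (\<lambda>i. Var (\<not> fst i, snd i))"

text \<open>Weight 1 for \<open>x - \<xi>\<close> and -1 for \<open>z\<close>. Weight 0 forces the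
  degrees in both sets of variables to agree, which carries degree bounds from one set to the
  other.\<close>

definition balw :: "idx \<Rightarrow> int" where
  "balw i = (if fst i then - 1 else 1)"

lemma lapl_eq: "lapl s Q - nsq (\<not> s) * Q = lap0 s Q + 2 * Eu s Q"
  by (simp add: lapl_def nsq_def lap0_def Eu_def tw_def pdiff_mult pdiff_Var power2_eq_square algebra_simps)

lemma Eu_mult: "Eu s (p * q) = Eu s p * q + p * Eu s q"
  and Eu_add: "Eu s (p + q) = Eu s p + Eu s q"
  and Eu_diff: "Eu s (p - q) = Eu s p - Eu s q"
  and Eu_Const [simp]: "Eu s (Const c) = 0"
  and Eu_0 [simp]: "Eu s 0 = 0"
  and Eu_1 [simp]: "Eu s 1 = 0"
  by (simp_all add: Eu_def pdiff_mult algebra_simps)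

lemma Eu_lf: "Eu s (lf s \<alpha>) = lf (\<not> s) \<alpha>" "s \<noteq> s' \<Longrightarrow> Eu s (lf s' \<alpha>) = 0"
  by (simp_all add: Eu_def glf_def pdiff_mult pdiff_Var algebra_simps)

lemma Eu_power: "Eu s (p ^ Suc n) = of_nat (Suc n) * p ^ n * Eu s p"
  by (induction n) (simp_all add: Eu_mult algebra_simps)

lemma swap_simps [simp]:
  "swap 0 = 0" "swap 1 = 1" "swap (p + q) = swap p + swap q" "swap (p * q) = swap p * swap q"
  "swap (- p) = - swap p" "swap (p - q) = swap p - swap q" "swap (Const c) = Const c"
  "swap (Var i) = Var (\<not> fst i, snd i)" "swap (numeral k) = numeral k" "swap (p ^ n) = swap p ^ n"
  by (simp_all add: swap_def)

lemma swap_pdiff: "swap (pdiff (s, b) Q) = pdiff (\<not> s, b) (swap Q)"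
proof -
  have "pdiff (\<not> s, b) (swap Q) = (\<Sum>i\<in>UNIV. if i = (s, b) then swap (pdiff i Q) else 0)"
    unfolding swap_def pdiff_subst by (intro sum.cong) (auto simp: pdiff_Var)
  then show ?thesis by simp
qed

lemma swap_lf [simp]: "swap (lf s \<alpha>) = lf (\<not> s) \<alpha>"
  by (simp add: glf_def)

lemma diag_simps [simp]:
  "diag s 0 = 0" "diag s (p + q) = diag s p + diag s q" "diag s (p * q) = diag s p * diag s q"
  "diag s (p - q) = diag s p - diag s q" "diag s (Const c) = Const c" "diag s (Var i) = Var (\<not> s, snd i)"
  "diag s (numeral k) = numeral k"
  by (simp_all add: diag_def case_prod_unfold)

lemma diag_swap: "diag s (swap p) = diag s p"
  unfolding diag_def swap_def subst_subst
  by (rule arg_cong[of _ _ "\<lambda>\<theta>. subst \<theta> p"]) (auto simp: fun_eq_iff)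

lemma whom_lf: "(\<And>b. w (s, b) = k) \<Longrightarrow> whom w k (lf s \<alpha>)"
  using hom_Var[of w "(s, True)"] hom_Var[of w "(s, False)"]
  unfolding glf_def by (intro hom_diff hom_Const_mult) simp_all

lemma hom_scale: "whom w k p \<Longrightarrow> whom w k (scale v t p)"
proof -
  assume p: "whom w k p"
  have "scale w r (scale v t p) = scale v t (scale w r p)" for r
    unfolding scale_def subst_subst
    by (rule arg_cong[of _ _ "\<lambda>\<theta>. subst \<theta> p"]) (simp add: fun_eq_iff mult_ac)
  then show ?thesis using p by (simp add: whom_def) (simp add: scale_def)
qed

lemma lower_scale: "lower G n p \<Longrightarrow> lower G n (scale v t p)"
proof (induction rule: lower.induct)
  case (lower_add p q)
  then show ?case using lower.lower_add by (simp add: scale_def)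
next
  case (lower_hom k p)
  then show ?case using lower.lower_hom[OF hom_scale] by blast
qed (simp add: scale_def lower.intros)

text \<open>Scalings commute with the grading by \<open>G\<close>, so they respect the decomposition
  into top part and rest.\<close>

lemma bal_top:
  assumes h: "hom G k h" and r: "lower G k r" and b: "whom w 0 (h + r)"
  shows "whom w 0 h" "whom w 0 r"
proof -
  have "scale w t h = h" if t: "t \<noteq> 0" for t
  proof -
    have "scale w t (h + r) = h + r" using b t by (simp add: whom_def Const_simps)
    then have eq: "scale w t h - h = r - scale w t r" by (simp add: scale_def algebra_simps)
    have "scale w t h - h = 0"
    proof (rule hom_lower_0)
      show "hom G k (scale w t h - h)" by (intro hom_diff hom_scale h)
      show "lower G k (scale w t h - h)" unfolding eq by (intro lower_diff r lower_scale)
    qed simp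
    then show ?thesis by simp
  qed
  then show *: "whom w 0 h" by (simp add: whom_def Const_simps)
  show "whom w 0 r" using hom_diff[OF b *] by simp
qed

text \<open>Scaling \<open>z\<close> by \<open>t\<close> is scaling \<open>x - \<xi>\<close> by
  \<open>t\<close> combined with the balanced scaling by \<open>1 / t\<close>.\<close>

lemma bal_hom:
  assumes "hom (own False) k p" "whom balw 0 p"
  shows "hom (own True) k p"
  unfolding whom_def
proof (intro allI impI)
  fix t :: complex assume t: "t \<noteq> 0"
  have "scale (\<lambda>i. if own True i then 1 else 0) t p
      = scale (\<lambda>i. if own False i then 1 else 0) t (scale balw (1 / t) p)"
    unfolding scale_def subst_subst
    by (rule arg_cong[of _ _ "\<lambda>\<theta>. subst \<theta> p"], rule ext, rule pfun_eqI)
      (use t in \<open>auto simp: balw_def power_int_minus\<close>)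
  also have "scale balw (1 / t) p = p" using assms(2) t by (simp add: whom_def Const_simps)
  also have "scale (\<lambda>i. if own False i then 1 else 0) t p = Const (t powi k) * p"
    using assms(1) t by (simp add: whom_def)
  finally show "scale (\<lambda>i. if own True i then 1 else 0) t p = Const (t powi k) * p" .
qed

lemma bal_lower:
  assumes "lower (own False) (int n) p" "whom balw 0 p"
  shows "lower (own True) (int n) p"
  using assms
proof (induction n arbitrary: p)
  case 0
  then have "p = 0" using lower_nonpos[of _ "int 0" p] by simp
  then show ?case by (simp add: lower_0)
next
  case (Suc n)
  then have "lower (own False) (int n + 1) p" by (simp add: add.commute)
  then obtain h r where h: "hom (own False) (int n) h" "lower (own False) (int n) r" "p = h + r"
    using lower_top[of "own False" "int n" p] by auto
  have b: "whom balw 0 h" "whom balw 0 r" using bal_top[OF h(1,2)] Suc.prems h(3) by simp_all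
  have "lower (own True) (int (Suc n)) h" by (rule lower_hom[OF bal_hom[OF h(1) b(1)]]) simp
  moreover have "lower (own True) (int (Suc n)) r" by (rule lower_mono[OF Suc.IH[OF h(2) b(2)]]) simp
  ultimately show ?case unfolding h(3) by (rule lower_add)
qed

lemma hom_swap: "hom (own False) k p \<Longrightarrow> hom (own True) k (swap p)"
proof -
  assume p: "hom (own False) k p"
  have "scale (\<lambda>i. if own True i then 1 else 0) t (swap p) = swap (scale (\<lambda>i. if own False i then 1 else 0) t p)" for t
    unfolding scale_def swap_def subst_subst
    by (rule arg_cong[of _ _ "\<lambda>\<theta>. subst \<theta> p"]) (auto simp: fun_eq_iff)
  then show ?thesis using p by (simp add: whom_def)
qed

lemma nsq_rotate: "nsq s = lf s \<alpha> * lf s \<alpha> + tf s \<alpha> * tf s \<alpha>"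
  by (rule pfun_eqI, simp add: nsq_def glf_def gtf_def, use sin_squared_eq[of \<alpha>] in algebra)

text \<open>The squared length is \<open>lf s \<alpha> ^ 2 + tf s \<alpha> ^ 2\<close>. The
  tangential square passes the normal derivatives; on the line the normal one lowers their number by
  two, which keeps it odd.\<close>

lemma qi_nsq:
  assumes "qi s \<alpha> k Q"
  shows "qi s \<alpha> k (nsq s * Q)"
  unfolding qi_def
proof (intro allI impI, elim conjE)
  fix i assume i: "odd i" "i < 2 * k"
  have N: "\<And>j. odd j \<Longrightarrow> j < 2 * k \<Longrightarrow> rs s \<alpha> ((nd s \<alpha> ^^ j) Q) = 0"
    using assms by (simp add: qi_def)
  have dt: "dn s \<alpha> (tf s \<alpha> * tf s \<alpha>) = 0"
    by (simp add: gdn_def gtf_def pdiff_mult pdiff_Var algebra_simps)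
  have "rs s \<alpha> ((nd s \<alpha> ^^ i) (lf s \<alpha> * (lf s \<alpha> * Q)))
      = of_nat i * (of_nat (i - 1) * rs s \<alpha> ((nd s \<alpha> ^^ (i - 1 - 1)) Q))"
    unfolding ndn_lf_self by simp
  also have "\<dots> = 0"
  proof (cases "i = 1")
    case False
    then have "odd (i - 1 - 1)" "i - 1 - 1 < 2 * k" using i by presburger+
    then have "rs s \<alpha> ((nd s \<alpha> ^^ (i - 1 - 1)) Q) = 0" by (rule N)
    then show ?thesis by (simp only: mult_zero_right)
  qed simp
  finally show "rs s \<alpha> ((nd s \<alpha> ^^ i) (nsq s * Q)) = 0"
    unfolding nsq_rotate[of s \<alpha>] distrib_right mult.assoc[of "lf s \<alpha>"] ndn_add ndn_mult_const[OF dt]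
    using N[OF i] by simp
qed

lemma qi_mult_free:
  assumes "qi s \<alpha> k Q" "pdiff (s, False) c = 0" "pdiff (s, True) c = 0"
  shows "qi s \<alpha> k (c * Q)"
proof -
  have "dn s \<alpha> c = 0" using assms by (simp add: gdn_def)
  then show ?thesis using assms by (simp add: qi_def ndn_mult_const)
qed

text \<open>The twisted derivatives in the dual variables commute with \<open>nd s \<alpha>\<close>
  and do not differentiate \<open>lf s \<alpha>\<close>, so vanishing on the line is
  inherited.\<close>

lemma qi_tw_dual:
  assumes "qi s \<alpha> k Q"
  shows "qi s \<alpha> k (tw (\<not> s) b Q)"
  unfolding qi_def
proof (intro allI impI, elim conjE)
  fix i assume i: "odd i" "i < 2 * k"
  then have "rs s \<alpha> ((nd s \<alpha> ^^ i) Q) = 0" using assms by (simp add: qi_def)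
  then have "lf s \<alpha> dvd (nd s \<alpha> ^^ i) Q" by (subst glf_dvd_iff) simp_all
  then obtain g where g: "(nd s \<alpha> ^^ i) Q = lf s \<alpha> * g" by (elim dvdE)
  have "tw (\<not> s) b (lf s \<alpha> * g) = lf s \<alpha> * tw (\<not> s) b g"
    unfolding tw_mult by (simp add: glf_def pdiff_mult pdiff_Var)
  then show "rs s \<alpha> ((nd s \<alpha> ^^ i) (tw (\<not> s) b Q)) = 0"
    unfolding ndn_tw g by simp
qed

context ba
begin

lemma QI_add: "QI s p \<Longrightarrow> QI s q \<Longrightarrow> QI s (p + q)"
  and QI_diff: "QI s p \<Longrightarrow> QI s q \<Longrightarrow> QI s (p - q)"
  and QI_0: "QI s 0"
  by (simp_all add: QI_def qi_def ndn_add ndn_diff)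

lemma QI_sum: "(\<And>a. a \<in> A \<Longrightarrow> QI s (f a)) \<Longrightarrow> QI s (sum f A)"
  by (induction A rule: infinite_finite_induct) (auto intro: QI_add QI_0)

lemma QI_mult_free: "QI s Q \<Longrightarrow> pdiff (s, False) c = 0 \<Longrightarrow> pdiff (s, True) c = 0 \<Longrightarrow> QI s (c * Q)"
  by (simp add: QI_def qi_mult_free)

lemma QI_nsq: "QI s Q \<Longrightarrow> QI s (nsq s * Q)"
  by (simp add: QI_def qi_nsq)

lemma QI_tw_dual: "QI s Q \<Longrightarrow> QI s (tw (\<not> s) b Q)"
  by (simp add: QI_def qi_tw_dual)

lemma pdiff_prod_lf: "s \<noteq> s' \<Longrightarrow> pdiff (s, b) (prod (lf s') A) = 0"
  by (induction A rule: infinite_finite_induct) (auto simp: pdiff_mult glf_def pdiff_Var)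

lemma pdiff_dl: "pdiff (s, b) (dl (\<not> s)) = 0"
proof -
  have pow: "pdiff (s, b) (lf (\<not> s) \<alpha> ^ n) = 0" for \<alpha> n
    by (induction n) (simp_all add: pdiff_mult glf_def pdiff_Var)
  have "pdiff (s, b) (\<Prod>\<alpha>\<in>A. lf (\<not> s) \<alpha> ^ mu \<alpha>) = 0" for A
    by (induction A rule: infinite_finite_induct) (simp_all add: pdiff_mult pow)
  then show ?thesis by (simp add: dl_def)
qed

lemma QI_nd_dual: "QI s Q \<Longrightarrow> QI s (nd (\<not> s) \<beta> Q)"
  unfolding nd_def by (intro QI_diff QI_mult_free QI_tw_dual) simp_all

text \<open>Written through \<open>tw\<close>, the dual operator has coefficients free of the
  variables \<open>s\<close>, apart from \<open>nsq s\<close>, which is the case of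
  \<open>QI_nsq\<close>.\<close>

lemma QI_Op_dual:
  assumes "QI s Q"
  shows "QI s (Op (\<not> s) Q)"
proof -
  have "QI s (nsq (\<not> \<not> s) * Q)" using QI_nsq[OF assms] by simp
  moreover have "QI s (lapl (\<not> s) Q)" unfolding lapl_def by (intro QI_add QI_tw_dual assms)
  ultimately have 1: "QI s (dD (\<not> s) * (lapl (\<not> s) Q - nsq (\<not> \<not> s) * Q))"
    by (intro QI_mult_free[OF QI_diff]) (simp_all add: dD_def pdiff_prod_lf)
  have "QI s (Const (2 * of_nat (mu \<alpha>)) * dR (\<not> s) \<alpha> * nd (\<not> s) \<alpha> Q)" for \<alpha>
    by (intro QI_mult_free QI_nd_dual assms) (simp_all add: dR_def pdiff_mult pdiff_prod_lf)
  then show ?thesis unfolding Op_def by (intro QI_diff QI_sum 1)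
qed

text \<open>\<open>Sec\<close> collects the terms of \<open>Op\<close> without dual variables and,
  relative to \<open>dD\<close>, lowers the degree in \<open>s\<close> by two. \<open>Fir\<close>
  collects those linear in the dual variables and trades one degree in \<open>s\<close> for one in
  the dual variables.\<close>

definition Sec :: "bool \<Rightarrow> idx pfun \<Rightarrow> idx pfun" where
  "Sec s Q = dD s * lap0 s Q - (\<Sum>\<alpha>\<in>B. Const (2 * of_nat (mu \<alpha>)) * dR s \<alpha> * dn s \<alpha> Q)"

definition Fir :: "bool \<Rightarrow> idx pfun \<Rightarrow> idx pfun" where
  "Fir s Q = 2 * (dD s * Eu s Q) - (\<Sum>\<alpha>\<in>B. Const (2 * of_nat (mu \<alpha>)) * dR s \<alpha> * lf (\<not> s) \<alpha>) * Q"

lemma Op_eq: "Op s Q = Sec s Q + Fir s Q"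
proof -
  have nd: "nd s \<alpha> Q = dn s \<alpha> Q + lf (\<not> s) \<alpha> * Q" for \<alpha> by (simp add: nd_eq_nt nt_def)
  show ?thesis
    unfolding Op_def Sec_def Fir_def lapl_eq nd
    by (simp add: distrib_left sum.distrib sum_distrib_left algebra_simps)
qed

lemma Sec_add: "Sec s (p + q) = Sec s p + Sec s q"
  and Sec_0 [simp]: "Sec s 0 = 0"
  by (simp_all add: Sec_def lap0_def algebra_simps sum.distrib)

lemma Fir_add: "Fir s (p + q) = Fir s p + Fir s q"
  and Fir_diff: "Fir s (p - q) = Fir s p - Fir s q"
  and Fir_0 [simp]: "Fir s 0 = 0"
  by (simp_all add: Fir_def Eu_add Eu_diff algebra_simps)

lemma
  assumes w: "\<And>s b. w (s, b) = u s"
  shows whom_dD: "whom w (int (card B) * u s) (dD s)"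
    and whom_dR: "\<alpha> \<in> B \<Longrightarrow> whom w ((int (card B) - 1) * u s) (dR s \<alpha>)"
    and whom_dl: "whom w (deg * u s) (dl s)"
proof -
  have lf: "whom w (u s) (lf s \<alpha>)" for \<alpha> by (rule whom_lf) (rule w)
  show "whom w (int (card B) * u s) (dD s)"
    using hom_prod[of B w "\<lambda>_. u s" "lf s"] lf by (simp add: dD_def)
  show "whom w ((int (card B) - 1) * u s) (dR s \<alpha>)" if "\<alpha> \<in> B"
  proof -
    have "int (card (B - {\<alpha>})) = int (card B) - 1"
      using that finite_B card_gt_0_iff[of B] by (subst card_Diff_singleton) (auto simp: of_nat_diff Suc_leI)
    then show ?thesis using hom_prod[of "B - {\<alpha>}" w "\<lambda>_. u s" "lf s"] lf by (simp add: dR_def)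
  qed
  show "whom w (deg * u s) (dl s)"
    using hom_prod[of B w "\<lambda>\<alpha>. int (mu \<alpha>) * u s" "\<lambda>\<alpha>. lf s \<alpha> ^ mu \<alpha>"] hom_power[OF lf]
    by (simp add: dl_def deg_def sum_distrib_right)
qed

lemma
  assumes w: "\<And>s b. w (s, b) = u s" and Q: "whom w k Q"
  shows whom_Sec: "whom w (k + (int (card B) - 2) * u s) (Sec s Q)"
    and whom_Fir: "whom w (k + (int (card B) - 1) * u s + u (\<not> s)) (Fir s Q)"
proof -
  have pd: "whom w (j - u s) (pdiff (s, b) p)" if "whom w j p" for j p b
    using hom_pdiff[OF that, of "(s, b)"] w by simp
  have lf: "whom w (u s) (lf s \<alpha>)" for s \<alpha> by (rule whom_lf) (rule w)
  have V: "whom w (u s) (Var (s, b))" for s b using hom_Var[of w "(s, b)"] w by simp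
  have lap: "whom w (k - u s - u s) (lap0 s Q)"
    unfolding lap0_def by (intro hom_add pd Q)
  have dn: "whom w (k - u s) (dn s \<alpha> Q)" for \<alpha>
    unfolding gdn_def by (intro hom_diff hom_Const_mult pd Q)
  have Eu: "whom w (u (\<not> s) + (k - u s)) (Eu s Q)"
    unfolding Eu_def by (intro hom_add hom_mult V pd Q)
  show "whom w (k + (int (card B) - 2) * u s) (Sec s Q)"
    unfolding Sec_def
  proof (intro hom_diff hom_sum)
    show "whom w (k + (int (card B) - 2) * u s) (dD s * lap0 s Q)"
      by (rule hom_mult_eq[OF whom_dD[where w = w and u = u, OF w] lap]) (simp add: algebra_simps)
    fix \<alpha> assume "\<alpha> \<in> B"
    from hom_Const_mult[OF whom_dR[where w = w and u = u, OF w this]]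
    show "whom w (k + (int (card B) - 2) * u s) (Const (2 * of_nat (mu \<alpha>)) * dR s \<alpha> * dn s \<alpha> Q)"
      by (rule hom_mult_eq[OF _ dn]) (simp add: algebra_simps)
  qed
  show "whom w (k + (int (card B) - 1) * u s + u (\<not> s)) (Fir s Q)"
    unfolding Fir_def
  proof (rule hom_diff)
    show "whom w (k + (int (card B) - 1) * u s + u (\<not> s)) (2 * (dD s * Eu s Q))"
      by (rule hom_mult_eq[OF hom_numeral hom_mult[OF whom_dD[where w = w and u = u, OF w] Eu]]) (simp add: algebra_simps)
    have "whom w ((int (card B) - 1) * u s + u (\<not> s)) (\<Sum>\<alpha>\<in>B. Const (2 * of_nat (mu \<alpha>)) * dR s \<alpha> * lf (\<not> s) \<alpha>)"
      by (intro hom_sum hom_mult hom_Const_mult whom_dR[where w = w and u = u, OF w] lf)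
    then show "whom w (k + (int (card B) - 1) * u s + u (\<not> s))
        ((\<Sum>\<alpha>\<in>B. Const (2 * of_nat (mu \<alpha>)) * dR s \<alpha> * lf (\<not> s) \<alpha>) * Q)"
      by (rule hom_mult_eq[OF _ Q]) (simp add: algebra_simps)
  qed
qed

lemma own_weight: "(if own g (s, b) then 1 else 0 :: int) = (if s = g then 1 else 0)"
  by simp

lemmas hom_Sec = whom_Sec[where w = "\<lambda>i. if own g i then 1 else 0" and u = "\<lambda>s. if s = g then 1 else 0" for g, OF own_weight]
lemmas hom_Fir = whom_Fir[where w = "\<lambda>i. if own g i then 1 else 0" and u = "\<lambda>s. if s = g then 1 else 0" for g, OF own_weight]

lemma lower_Sec: "lower (own g) n Q \<Longrightarrow> lower (own g) (n + (int (card B) - 2) * (if s = g then 1 else 0)) (Sec s Q)"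
proof (induction rule: lower.induct)
  case (lower_hom k p)
  show ?case by (rule lower.lower_hom[OF hom_Sec[OF lower_hom(1)]]) (use lower_hom(2) in simp)
qed (simp_all add: Sec_add lower.intros)

lemma lower_Fir: "lower (own g) n Q \<Longrightarrow>
  lower (own g) (n + (int (card B) - 1) * (if s = g then 1 else 0) + (if (\<not> s) = g then 1 else 0)) (Fir s Q)"
proof (induction rule: lower.induct)
  case (lower_hom k p)
  show ?case by (rule lower.lower_hom[OF hom_Fir[OF lower_hom(1)]]) (use lower_hom(2) in simp)
qed (simp_all add: Fir_add lower.intros)

lemma hom_dD: "hom (own s) (int (card B)) (dD s)"
  using whom_dD[of "\<lambda>i. if own s i then 1 else 0" "\<lambda>s'. if s' = s then 1 else 0" s] by simp

lemma dD_Eu_prod: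
  assumes "C \<subseteq> B"
  shows "dD s * Eu s (\<Prod>\<alpha>\<in>C. lf s \<alpha> ^ mu \<alpha>)
    = (\<Sum>\<alpha>\<in>C. Const (of_nat (mu \<alpha>)) * dR s \<alpha> * lf (\<not> s) \<alpha>) * (\<Prod>\<alpha>\<in>C. lf s \<alpha> ^ mu \<alpha>)"
  using finite_subset[OF assms finite_B] assms
proof (induction C)
  case (insert \<alpha> C)
  let ?P = "\<Prod>\<alpha>\<in>C. lf s \<alpha> ^ mu \<alpha>"
  have \<alpha>: "\<alpha> \<in> B" using insert by simp
  have "dD s * Eu s (lf s \<alpha> ^ mu \<alpha>) = Const (of_nat (mu \<alpha>)) * dR s \<alpha> * lf (\<not> s) \<alpha> * lf s \<alpha> ^ mu \<alpha>"
  proof -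
    obtain m where m: "mu \<alpha> = Suc m" using mu_pos[OF \<alpha>] by (cases "mu \<alpha>") auto
    show ?thesis
      unfolding m Eu_power Eu_lf dD_eq[OF \<alpha>] Const_simps(8) by (simp only: mult_ac power_Suc)
  qed
  then have "dD s * Eu s (lf s \<alpha> ^ mu \<alpha> * ?P)
      = Const (of_nat (mu \<alpha>)) * dR s \<alpha> * lf (\<not> s) \<alpha> * lf s \<alpha> ^ mu \<alpha> * ?P + lf s \<alpha> ^ mu \<alpha> * (dD s * Eu s ?P)"
    by (simp add: Eu_mult distrib_left mult.assoc[symmetric] mult.commute[of "dD s"])
  also have "dD s * Eu s ?P = (\<Sum>\<alpha>\<in>C. Const (of_nat (mu \<alpha>)) * dR s \<alpha> * lf (\<not> s) \<alpha>) * ?P"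
    using insert by simp
  finally show ?case using insert.hyps by (simp add: algebra_simps)
qed simp

text \<open>The multiplicative term of \<open>Fir\<close> is twice the logarithmic derivative of
  \<open>dl s\<close> along \<open>Eu\<close>, with denominators cleared; it cancels when
  \<open>dl s\<close> is factored out, and a pure derivation remains.\<close>

lemma Fir_dl: "Fir s (dl s * f) = 2 * (dD s * dl s * Eu s f)"
proof -
  have 1: "dD s * Eu s (dl s) = (\<Sum>\<alpha>\<in>B. Const (of_nat (mu \<alpha>)) * dR s \<alpha> * lf (\<not> s) \<alpha>) * dl s"
    unfolding dl_def by (rule dD_Eu_prod) simp
  have 2: "(\<Sum>\<alpha>\<in>B. Const (2 * of_nat (mu \<alpha>)) * dR s \<alpha> * lf (\<not> s) \<alpha>)
      = 2 * (\<Sum>\<alpha>\<in>B. Const (of_nat (mu \<alpha>)) * dR s \<alpha> * lf (\<not> s) \<alpha>)"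
    by (simp add: sum_distrib_left Const_simps mult_ac)
  have "Fir s (dl s * f) = 2 * (dD s * Eu s (dl s) * f + dD s * dl s * Eu s f)
      - 2 * ((\<Sum>\<alpha>\<in>B. Const (of_nat (mu \<alpha>)) * dR s \<alpha> * lf (\<not> s) \<alpha>) * dl s * f)"
    unfolding Fir_def 2 Eu_mult by (simp only: distrib_left mult.assoc)
  then show ?thesis unfolding 1 by (simp add: distrib_left)
qed

text \<open>These are numerators over \<delta>, so the starting function \<delta> appears as its
  square. The chosen \<open>Q'\<close> is unique, because \<open>dD False\<close> can be
  cancelled.\<close>

primrec Qs :: "nat \<Rightarrow> idx pfun" where
  "Qs 0 = dl False ^ 2"
| "Qs (Suc n) = (SOME Q'. dD False * Q' = Op False (Qs n) \<and> QI False Q')"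

lemma QI_Qs: "QI False (Qs n)"
proof (induction n)
  case 0
  show ?case unfolding QI_def
  proof
    fix \<alpha> assume \<alpha>: "\<alpha> \<in> B"
    have "dl False = lf False \<alpha> ^ mu \<alpha> * (\<Prod>\<beta>\<in>B - {\<alpha>}. lf False \<beta> ^ mu \<beta>)"
      unfolding dl_def using finite_B \<alpha> by (rule prod.remove)
    then have "Qs 0 = lf False \<alpha> ^ (2 * mu \<alpha>) * (\<Prod>\<beta>\<in>B - {\<alpha>}. lf False \<beta> ^ mu \<beta>) ^ 2"
      by (simp add: power_mult_distrib power_mult[symmetric] mult.commute)
    then show "qi False \<alpha> (mu \<alpha>) (Qs 0)" by (simp only: qi_lf_power)
  qed
next
  case (Suc n)
  from someI_ex[OF QI_step[OF Suc]] show ?case by simp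
qed

lemma Qs_Suc: "dD False * Qs (Suc n) = Op False (Qs n)"
  using someI_ex[OF QI_step[OF QI_Qs]] by simp

text \<open>The cofactor of \<open>dl False\<close> in the leading form of \<open>Qs n\<close>: in
  top degree only \<open>Fir\<close> acts, and by \<open>Fir_dl\<close> it acts on the cofactor as
  \<open>2 * Eu False\<close>.\<close>

primrec tp :: "nat \<Rightarrow> idx pfun" where
  "tp 0 = dl False"
| "tp (Suc n) = 2 * Eu False (tp n)"

text \<open>\<open>Fir\<close> lowers the degree in \<open>x\<close> by one per step and governs the
  leading form; \<open>Sec\<close> lowers it by two and enters only the remainder.\<close>

lemma Qs_lower: "lower (own False) (2 * deg + 1 - int n) (Qs n)"
  and Qs_top: "lower (own False) (2 * deg - int n) (Qs n - dl False * tp n)"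
proof (induction n)
  case 0
  { case 1
    have "hom (own False) (deg + deg) (Qs 0)"
      unfolding Qs.simps power2_eq_square by (intro hom_mult hom_dl)
    then show ?case by (rule lower_hom) simp
  next
    case 2
    show ?case by (simp add: power2_eq_square lower_0) }
next
  case (Suc n)
  have S: "lower (own False) (2 * deg + 1 - int n + (int (card B) - 2)) (Sec False (Qs n))"
    using lower_Sec[OF Suc(1), of False] by simp
  have F: "lower (own False) (2 * deg + 1 - int n + (int (card B) - 1)) (Fir False (Qs n))"
    using lower_Fir[OF Suc(1), of False] by simp
  { case 1
    have "lower (own False) (2 * deg + 1 - int (Suc n) + int (card B)) (dD False * Qs (Suc n))"
      unfolding Qs_Suc Op_eq by (intro lower_add lower_mono[OF S] lower_mono[OF F]) simp_all
    then show ?case by (rule lower_div[OF hom_dD dD_neq_0])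
  next
    case 2
    have F': "lower (own False) (2 * deg - int n + (int (card B) - 1)) (Fir False (Qs n - dl False * tp n))"
      using lower_Fir[OF Suc(2), of False] by simp
    have "dD False * (Qs (Suc n) - dl False * tp (Suc n)) = Sec False (Qs n) + Fir False (Qs n - dl False * tp n)"
      unfolding right_diff_distrib Qs_Suc Op_eq Fir_diff Fir_dl by (simp add: mult_ac)
    moreover have "lower (own False) (2 * deg - int (Suc n) + int (card B)) \<dots>"
      by (intro lower_add lower_mono[OF S] lower_mono[OF F']) simp_all
    ultimately have "lower (own False) (2 * deg - int (Suc n) + int (card B)) (dD False * (Qs (Suc n) - dl False * tp (Suc n)))"
      by simp
    then show ?case by (rule lower_div[OF hom_dD dD_neq_0]) }
qed

definition N where "N = (\<Sum>\<alpha>\<in>B. mu \<alpha>)"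

lemma int_N: "int N = deg"
  by (simp add: N_def deg_def)

abbreviation Qf :: "idx pfun" where "Qf \<equiv> Qs N"

text \<open>After \<open>Suc N\<close> steps the degree in \<open>x\<close> is less than
  \<open>2 * deg + 1 - Suc N\<close>, which is \<open>deg\<close>, and a quasi-invariant of degree
  below that of \<delta> vanishes.\<close>

lemma Op_Qf: "Op False Qf = 0"
proof -
  have "lower (own False) (int N) (Qs (Suc N))"
    using Qs_lower[of "Suc N"] by (rule lower_mono) (simp add: int_N[symmetric])
  then have "Qs (Suc N) = 0" by (rule QI_lower_0[OF QI_Qs]) (simp add: int_N)
  then show ?thesis using Qs_Suc[of N] by simp
qed

lemma Eu_funpow_prod:
  assumes "(Eu False ^^ n) f = of_nat (fact n) * g" "(Eu False ^^ Suc n) f = 0"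
  shows "(Eu False ^^ Suc n) (lf False \<alpha> * f) = of_nat (fact (Suc n)) * (lf True \<alpha> * g)
    \<and> (Eu False ^^ Suc (Suc n)) (lf False \<alpha> * f) = 0"
proof -
  have *: "(Eu False ^^ k) (lf False \<alpha> * f)
      = lf False \<alpha> * (Eu False ^^ k) f + of_nat k * lf True \<alpha> * (Eu False ^^ (k - 1)) f" for k
  proof (induction k)
    case (Suc k)
    have "of_nat k * lf True \<alpha> * Eu False ((Eu False ^^ (k - 1)) f) = of_nat k * lf True \<alpha> * (Eu False ^^ k) f"
      by (cases k) simp_all
    moreover have "Eu False (of_nat k) = 0" using Eu_Const[of False "of_nat k"] by (simp add: Const_simps)
    ultimately show ?case using Suc by (simp add: Eu_add Eu_mult Eu_lf algebra_simps)
  qed simp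
  have "(Eu False ^^ Suc (Suc n)) f = 0" using assms(2) by simp
  then show ?thesis
    unfolding *[of "Suc n"] *[of "Suc (Suc n)"] assms(2) diff_Suc_1 using assms(1) by (simp add: algebra_simps)
qed

text \<open>Each of the \<open>N\<close> linear factors absorbs one derivative and becomes the same
  form in \<open>z\<close>; the derivatives can be distributed in \<open>fact N\<close> orders. That
  one more derivative gives zero has to be carried through the induction.\<close>

lemma Eu_funpow_dl: "(Eu False ^^ N) (dl False) = of_nat (fact N) * dl True"
proof -
  have pow: "(Eu False ^^ (k + n)) (lf False \<alpha> ^ k * f) = of_nat (fact (k + n)) * (lf True \<alpha> ^ k * g)
      \<and> (Eu False ^^ Suc (k + n)) (lf False \<alpha> ^ k * f) = 0"
    if "(Eu False ^^ n) f = of_nat (fact n) * g" "(Eu False ^^ Suc n) f = 0" for k n \<alpha> f g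
  proof (induction k)
    case (Suc k)
    from Eu_funpow_prod[OF conjunct1[OF Suc] conjunct2[OF Suc], of \<alpha>]
    show ?case unfolding power_Suc mult.assoc add_Suc .
  qed (use that in simp)
  have "(Eu False ^^ (\<Sum>\<alpha>\<in>C. mu \<alpha>)) (\<Prod>\<alpha>\<in>C. lf False \<alpha> ^ mu \<alpha>)
        = of_nat (fact (\<Sum>\<alpha>\<in>C. mu \<alpha>)) * (\<Prod>\<alpha>\<in>C. lf True \<alpha> ^ mu \<alpha>)
      \<and> (Eu False ^^ Suc (\<Sum>\<alpha>\<in>C. mu \<alpha>)) (\<Prod>\<alpha>\<in>C. lf False \<alpha> ^ mu \<alpha>) = 0" if "finite C" for C
    using that
  proof (induction C)
    case (insert \<alpha> C)
    from pow[OF conjunct1[OF insert.IH] conjunct2[OF insert.IH], of "mu \<alpha>" \<alpha>]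
    show ?case by (simp only: sum.insert[OF insert.hyps] prod.insert[OF insert.hyps])
  qed simp
  from this[OF finite_B] show ?thesis by (simp add: N_def dl_def)
qed

definition cN :: complex where "cN = 2 ^ N * of_nat (fact N)"

lemma tp_N: "tp N = Const cN * dl True"
proof -
  have "Eu False (2 * p) = 2 * Eu False p" for p
    by (simp add: Eu_def algebra_simps pdiff_mult)
  then have E: "Eu False (2 ^ n * p) = 2 ^ n * Eu False p" for n p
    by (induction n) (simp_all add: mult.assoc)
  have "tp n = 2 ^ n * (Eu False ^^ n) (dl False)" for n
    by (induction n) (simp_all add: E)
  then show ?thesis
    by (simp only: Eu_funpow_dl cN_def Const_simps mult.assoc)
qed

lemma Qf_top: "lower (own False) deg (Qf - Const cN * dl False * dl True)"
  using Qs_top[of N] by (simp add: int_N tp_N mult_ac)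

text \<open>Both parts of \<open>Op\<close>, divided by \<open>dD\<close>, have weight -2. Starting
  from the weight \<open>2 * deg\<close> of the squared \<delta>, weight 0 is reached exactly at
  \<open>n = N\<close>.\<close>

lemma bal_Qs: "whom balw (2 * deg - 2 * int n) (Qs n)"
proof (induction n)
  case 0
  have "whom balw (deg * 1) (dl False)"
    using whom_dl[of balw "\<lambda>s. if s then - 1 else 1" False] by (simp add: balw_def)
  from hom_power[OF this, of 2] show ?case by simp
next
  case (Suc n)
  have w: "balw (s, b) = (if s then - 1 else 1)" for s b by (simp add: balw_def)
  have "whom balw (2 * deg - 2 * int n + (int (card B) - 2)) (Op False (Qs n))"
    unfolding Op_eq using whom_Sec[OF w Suc, of False] whom_Fir[OF w Suc, of False]
    by (intro hom_add) (simp_all add: algebra_simps)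
  moreover have "whom balw (int (card B)) (dD False)"
    using whom_dD[of balw "\<lambda>s. if s then - 1 else 1" False] w by simp
  ultimately have "whom balw (2 * deg - 2 * int n + (int (card B) - 2) - int (card B)) (Qs (Suc n))"
    unfolding Qs_Suc[symmetric] by (intro hom_factor[OF _ dD_neq_0])
  then show ?case by (simp add: algebra_simps)
qed

lemma bal_top_part: "whom balw 0 (Const cN * dl False * dl True)"
proof -
  have "whom balw (deg * (if s then - 1 else 1)) (dl s)" for s
    using whom_dl[of balw "\<lambda>s. if s then - 1 else 1" s] by (simp add: balw_def)
  from hom_mult_eq[OF hom_Const_mult[OF this[of False]] this[of True]] show ?thesis by simp
qed

lemma Qf_top_dual: "lower (own True) deg (Qf - Const cN * dl False * dl True)"
proof -
  have "whom balw 0 (Qf - Const cN * dl False * dl True)"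
    using hom_diff[OF _ bal_top_part] bal_Qs[of N] by (simp add: int_N)
  then show ?thesis using bal_lower[of N] Qf_top by (simp add: int_N)
qed

lemma swap_dD: "swap (dD s) = dD (\<not> s)" "swap (dR s \<alpha>) = dR (\<not> s) \<alpha>" "swap (dl s) = dl (\<not> s)"
proof -
  have "swap (prod f A) = (\<Prod>a\<in>A. swap (f a))" for f and A :: "complex set"
    by (simp add: swap_def subst_prod)
  then show "swap (dD s) = dD (\<not> s)" "swap (dR s \<alpha>) = dR (\<not> s) \<alpha>" "swap (dl s) = dl (\<not> s)"
    by (simp_all add: dD_def dR_def dl_def)
qed

lemma swap_sum: "swap (sum f A) = (\<Sum>a\<in>A. swap (f a))"
  by (simp add: swap_def subst_sum)

lemma swap_Sec: "swap (Sec s Q) = Sec (\<not> s) (swap Q)"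
  by (simp add: Sec_def swap_dD swap_sum lap0_def gdn_def swap_pdiff)

lemma swap_Fir: "swap (Fir s Q) = Fir (\<not> s) (swap Q)"
  by (simp add: Fir_def swap_dD swap_sum Eu_def swap_pdiff)

text \<open>By \<open>Op_0_imp_QI\<close> it suffices that the dual operator annihilates
  \<open>Qf\<close>. The value is quasi-invariant in \<open>x\<close> of degree at most
  \<open>deg\<close>, so by \<open>QI_diag_0\<close> only the restriction of its leading form
  \<open>h\<close> to the diagonal has to vanish.\<close>

theorem QI_dual: "QI True Qf"
proof (cases "N = 0")
  case True
  then have "B = {}" using mu_pos finite_B by (force simp: N_def)
  then show ?thesis unfolding QI_def by blast
next
  case False
  define Q0 where "Q0 = Const cN * dl False * dl True"
  define R where "R = Qf - Q0"
  have Qf: "Qf = Q0 + R" by (simp add: R_def)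
  have dl0: "hom (own g) (deg * (if s = g then 1 else 0)) (dl s)" for s g
    using whom_dl[of "\<lambda>i. if own g i then 1 else 0" "\<lambda>s. if s = g then 1 else 0" s] by simp
  have Q0: "hom (own False) deg Q0"
    unfolding Q0_def using hom_mult[OF hom_Const_mult[OF dl0[of False False]] dl0[of False True]] by simp
  have R: "lower (own False) deg R" using Qf_top by (simp add: R_def Q0_def)
  have Rbal: "whom balw 0 R"
    unfolding R_def Q0_def using hom_diff[OF _ bal_top_part] bal_Qs[of N] by (simp add: int_N)
  \<comment> \<open>Two layers of \<open>Qf\<close> are needed, \<open>Q0\<close> of degree
    \<open>deg\<close> and \<open>Q1\<close> of degree \<open>deg - 1\<close>; by balance these are
    also their degrees in \<open>z\<close>.\<close>
  obtain Q1 R2 where Q1: "hom (own False) (deg - 1) Q1" and R2: "lower (own False) (deg - 1) R2" and R_eq: "R = Q1 + R2"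
    using lower_top[of "own False" "deg - 1" R] R by auto
  have Q1_dual: "hom (own True) (deg - 1) Q1"
    using bal_hom[OF Q1] bal_top(1)[OF Q1 R2] Rbal R_eq by simp
  have Fir0: "Fir s Q0 = 0" for s
  proof -
    have "Q0 = dl s * (Const cN * dl (\<not> s))" unfolding Q0_def by (cases s) (simp_all add: mult_ac)
    moreover have "Eu s (dl (\<not> s)) = 0"
      by (simp add: Eu_def pdiff_dl)
    ultimately show ?thesis by (simp add: Fir_dl Eu_mult)
  qed
  \<comment> \<open>\<open>Sec True\<close> keeps the degree in \<open>x\<close> and
    \<open>Fir True\<close> raises it by one. As \<open>Fir True Q0 = 0\<close>, the part of degree
    \<open>deg\<close> comes from \<open>Q0\<close> and \<open>Q1\<close> alone.\<close>
  define h where "h = Sec True Q0 + Fir True Q1"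
  define r where "r = Sec True R + Fir True R2"
  have "Op True Qf = h + r"
    by (simp add: Op_eq Qf Sec_add Fir_add Fir0 R_eq h_def r_def)
  moreover have "hom (own False) deg h"
    unfolding h_def using hom_Sec[OF Q0, of True] hom_Fir[OF Q1, of True] by (intro hom_add) simp_all
  moreover have "lower (own False) deg r"
    unfolding r_def using lower_Sec[OF R, of True] lower_Fir[OF R2, of True] by (intro lower_add) simp_all
  \<comment> \<open>The top part of \<open>Op False Qf = 0\<close> relates \<open>Q0\<close> and
    \<open>Q1\<close>; exchanging the variables gives the relation for \<open>True\<close>, with
    \<open>swap Q1\<close> in place of \<open>Q1\<close>. So \<open>h\<close> is
    \<open>Fir True\<close> of the antisymmetric \<open>Y = Q1 - swap Q1\<close>, which vanishes on
    the diagonal. There \<open>Eu True\<close> agrees with the Euler field in \<open>z\<close>,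
    which multiplies the homogeneous \<open>Y\<close> by its degree, so \<open>Eu True Y\<close>
    vanishes too.\<close>
  moreover have "diag False h = 0"
  proof -
    let ?X = "Sec False Q0 + Fir False Q1"
    have hX: "hom (own False) (deg + (int (card B) - 2)) ?X"
      using hom_Sec[OF Q0, of False] hom_Fir[OF Q1, of False] by (intro hom_add) (simp_all add: algebra_simps)
    have "?X = - (Sec False R + Fir False R2)"
      using Op_Qf by (simp add: Op_eq Qf Sec_add Fir_add Fir0 R_eq algebra_simps eq_neg_iff_add_eq_0)
    moreover have "lower (own False) (deg + (int (card B) - 2)) (- (Sec False R + Fir False R2))"
      using lower_Sec[OF R, of False] lower_Fir[OF R2, of False]
      by (intro lower_uminus lower_add) (simp_all add: algebra_simps)
    ultimately have "?X = 0" using hom_lower_0[OF hX] by simp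
    moreover have "swap Q0 = Q0" by (simp add: Q0_def swap_dD mult_ac)
    ultimately have "Sec True Q0 + Fir True (swap Q1) = 0"
    proof -
      have "swap ?X = 0" using \<open>?X = 0\<close> by (simp only: swap_simps(1))
      then show ?thesis using \<open>swap Q0 = Q0\<close> by (simp add: swap_Sec swap_Fir)
    qed
    then have h: "h = Fir True (Q1 - swap Q1)" by (simp add: h_def Fir_diff algebra_simps eq_neg_iff_add_eq_0)
    define Y where "Y = Q1 - swap Q1"
    have Y: "hom (own True) (deg - 1) Y"
      unfolding Y_def by (intro hom_diff Q1_dual hom_swap Q1)
    have Y0: "diag False Y = 0" by (simp add: Y_def diag_swap)
    have "{i. own True i} = {(True, False), (True, True)}" by (auto simp: own_iff)
    then have "Var (True, False) * pdiff (True, False) Y + Var (True, True) * pdiff (True, True) Y = of_int (deg - 1) * Y"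
      using euler[OF Y] by simp
    then have "diag False (Var (True, False) * pdiff (True, False) Y + Var (True, True) * pdiff (True, True) Y) = 0"
      by (simp add: Y0 del: diag_simps(2))
    then have "diag False (Eu True Y) = 0" by (simp add: Eu_def)
    then show ?thesis unfolding h Y_def[symmetric] Fir_def by (simp add: Y0)
  qed
  moreover have "QI False (Op True Qf)" using QI_Op_dual[OF QI_Qs[of N]] by simp
  ultimately have "Op True Qf = 0" using QI_diag_0 by blast
  then show ?thesis by (rule Op_0_imp_QI)
qed

end

subsection \<open>Polynomial functions on the plane\<close>

definition vanish :: "nat \<Rightarrow> (complex \<Rightarrow> complex) \<Rightarrow> bool" where
  "vanish M f \<longleftrightarrow> (\<exists>g. g holomorphic_on UNIV \<and> (\<forall>z. f z = z ^ M * g z))"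

lemma vanish_mult: "vanish M f \<Longrightarrow> g holomorphic_on UNIV \<Longrightarrow> vanish M (\<lambda>z. f z * g z)"
proof -
  assume "vanish M f" and g: "g holomorphic_on UNIV"
  then obtain h where h: "h holomorphic_on UNIV" "\<And>z. f z = z ^ M * h z" by (auto simp: vanish_def)
  show ?thesis
    unfolding vanish_def by (intro exI[of _ "\<lambda>z. h z * g z"]) (use g h in \<open>auto intro: holomorphic_intros\<close>)
qed

lemma vanish_add: "vanish M f \<Longrightarrow> vanish M g \<Longrightarrow> vanish M (\<lambda>z. f z + g z)"
proof -
  assume "vanish M f" "vanish M g"
  then obtain h h' where "h holomorphic_on UNIV" "\<And>z. f z = z ^ M * h z"
    "h' holomorphic_on UNIV" "\<And>z. g z = z ^ M * h' z" by (auto simp: vanish_def)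
  then show ?thesis
    unfolding vanish_def by (intro exI[of _ "\<lambda>z. h z + h' z"]) (auto intro: holomorphic_intros simp: algebra_simps)
qed

lemma entire_factor:
  assumes f: "f holomorphic_on UNIV" and "f 0 = 0"
  shows "\<exists>g. g holomorphic_on UNIV \<and> (\<forall>z. f z = z * g z)"
proof -
  have "(\<lambda>z. if z = 0 then deriv f 0 else f z / z) holomorphic_on UNIV"
    using pole_lemma_open[OF f open_UNIV, of 0] unfolding assms(2) diff_zero .
  moreover have "f z = z * (if z = 0 then deriv f 0 else f z / z)" for z using assms(2) by simp
  ultimately show ?thesis by blast
qed

lemma higher_deriv_times_ident:
  assumes g: "g holomorphic_on UNIV"
  shows "(deriv ^^ n) (\<lambda>z. z * g z) z = z * (deriv ^^ n) g z + of_nat n * (deriv ^^ (n - 1)) g z"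
proof (induction n arbitrary: z)
  case (Suc n)
  have hol: "(deriv ^^ k) g field_differentiable at z" for k z
    using holomorphic_higher_deriv[OF g open_UNIV] by (simp add: holomorphic_on_def)
  have "deriv (\<lambda>z. z * (deriv ^^ n) g z + of_nat n * (deriv ^^ (n - 1)) g z) z
      = z * deriv ((deriv ^^ n) g) z + (deriv ^^ n) g z + of_nat n * deriv ((deriv ^^ (n - 1)) g) z"
    by (subst deriv_add, (intro derivative_intros field_differentiable_mult hol field_differentiable_ident field_differentiable_const)+)
      (simp add: hol deriv_mult)
  moreover have "of_nat n * deriv ((deriv ^^ (n - 1)) g) z = of_nat n * (deriv ^^ n) g z" by (cases n) simp_all
  moreover have "(deriv ^^ n) (\<lambda>z. z * g z) = (\<lambda>z. z * (deriv ^^ n) g z + of_nat n * (deriv ^^ (n - 1)) g z)"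
    using Suc by (simp add: fun_eq_iff)
  ultimately show ?case by (simp add: algebra_simps)
qed simp

lemma vanish_iff_higher_deriv:
  assumes "f holomorphic_on UNIV"
  shows "vanish M f \<longleftrightarrow> (\<forall>n<M. (deriv ^^ n) f 0 = 0)"
  using assms
proof (induction M arbitrary: f)
  case 0
  then show ?case by (auto simp: vanish_def)
next
  case (Suc M)
  show ?case
  proof (cases "f 0 = 0")
    case False
    then show ?thesis by (force simp: vanish_def)
  next
    case True
    then obtain g where g: "g holomorphic_on UNIV" and f: "f = (\<lambda>z. z * g z)"
      using entire_factor[OF Suc.prems] by blast
    have "vanish (Suc M) f \<longleftrightarrow> vanish M g"
    proof
      assume "vanish (Suc M) f"
      then obtain h where h: "h holomorphic_on UNIV" "\<And>z. z * g z = z * (z ^ M * h z)"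
        by (auto simp: vanish_def f mult_ac)
      \<comment> \<open>At \<open>z = 0\<close> the common factor \<open>z\<close> cannot be
        cancelled; the equality is extended there by continuity.\<close>
      have "g z = z ^ M * h z" for z
      proof -
        have "((\<lambda>w. g w - w ^ M * h w) \<longlongrightarrow> g z - z ^ M * h z) (at z)"
          using continuous_on_interior holomorphic_on_imp_continuous_on g h(1)
          by (intro tendsto_intros) (auto simp: continuous_on_def)
        moreover have "eventually (\<lambda>w. g w - w ^ M * h w = 0) (at z)"
        proof -
          have "eventually (\<lambda>w. w \<noteq> 0) (at z)" by (rule eventually_neq_at_within)
          then show ?thesis by eventually_elim (use h(2) in auto)
        qed
        then have "((\<lambda>w. g w - w ^ M * h w) \<longlongrightarrow> 0) (at z)" by (rule tendsto_eventually)
        ultimately have "g z - z ^ M * h z = 0" by (rule tendsto_unique[rotated]) simp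
        then show ?thesis by simp
      qed
      then show "vanish M g" using h(1) by (auto simp: vanish_def)
    next
      assume "vanish M g"
      then show "vanish (Suc M) f" by (auto simp: vanish_def f mult_ac)
    qed
    also have "\<dots> \<longleftrightarrow> (\<forall>n<M. (deriv ^^ n) g 0 = 0)" by (rule Suc.IH[OF g])
    also have "\<dots> \<longleftrightarrow> (\<forall>n<Suc M. (deriv ^^ n) f 0 = 0)"
    proof -
      have "(deriv ^^ n) f 0 = of_nat n * (deriv ^^ (n - 1)) g 0" for n
        unfolding f using higher_deriv_times_ident[OF g, of n 0] by simp
      then show ?thesis by (force simp: less_Suc_eq_0_disj)
    qed
    finally show ?thesis .
  qed
qed

text \<open>At 0 the difference has twice the odd derivatives of \<open>F\<close>, while its even
  derivatives vanish.\<close>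

lemma odd_derivs_iff_vanish:
  assumes F: "F holomorphic_on UNIV"
  shows "(\<forall>l. 1 \<le> l \<and> l \<le> k \<longrightarrow> (deriv ^^ (2 * l - 1)) F 0 = 0) \<longleftrightarrow> vanish (2 * k) (\<lambda>z. F z - F (- z))"
proof -
  have F': "(\<lambda>z. F (- z)) holomorphic_on UNIV"
  proof -
    have "(\<lambda>z::complex. - z) holomorphic_on UNIV" by (intro holomorphic_intros)
    from holomorphic_on_compose_gen[OF this F] show ?thesis by (simp add: o_def)
  qed
  have D: "(deriv ^^ n) (\<lambda>z. F z - F (- z)) 0 = (1 - (- 1) ^ n) * (deriv ^^ n) F 0" for n
  proof -
    have "(deriv ^^ n) (\<lambda>z. F (- z)) 0 = (- 1) ^ n * (deriv ^^ n) F 0"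
      using higher_deriv_compose_linear[OF F open_UNIV open_UNIV, of 0 "- 1" n] by simp
    moreover have "(deriv ^^ n) (\<lambda>z. F z - F (- z)) 0 = (deriv ^^ n) F 0 - (deriv ^^ n) (\<lambda>z. F (- z)) 0"
      by (rule higher_deriv_diff[OF F F' open_UNIV]) simp
    ultimately show ?thesis by (simp add: algebra_simps)
  qed
  have "vanish (2 * k) (\<lambda>z. F z - F (- z)) \<longleftrightarrow> (\<forall>n<2 * k. (1 - (- 1) ^ n) * (deriv ^^ n) F 0 = 0)"
    by (subst vanish_iff_higher_deriv) (use F F' D in \<open>auto intro: holomorphic_intros\<close>)
  also have "\<dots> \<longleftrightarrow> (\<forall>n. odd n \<and> n < 2 * k \<longrightarrow> (deriv ^^ n) F 0 = 0)"
  proof -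
    have "(1 - (- 1) ^ n) * c = 0 \<longleftrightarrow> (odd n \<longrightarrow> c = 0)" for n and c :: complex
      by (cases "even n") simp_all
    then show ?thesis by blast
  qed
  also have "\<dots> \<longleftrightarrow> (\<forall>l. 1 \<le> l \<and> l \<le> k \<longrightarrow> (deriv ^^ (2 * l - 1)) F 0 = 0)"
  proof (intro iffI allI impI)
    fix l assume "\<forall>n. odd n \<and> n < 2 * k \<longrightarrow> (deriv ^^ n) F 0 = 0" "1 \<le> l \<and> l \<le> k"
    then show "(deriv ^^ (2 * l - 1)) F 0 = 0" by auto
  next
    fix n assume *: "\<forall>l. 1 \<le> l \<and> l \<le> k \<longrightarrow> (deriv ^^ (2 * l - 1)) F 0 = 0" "odd n \<and> n < 2 * k"
    then obtain j where "n = 2 * j + 1" by (auto elim: oddE)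
    then show "(deriv ^^ n) F 0 = 0" using *(1)[rule_format, of "j + 1"] *(2) by simp
  qed
  finally show ?thesis by simp
qed

definition exprem :: "nat \<Rightarrow> complex \<Rightarrow> complex" where
  "exprem M w = exp w - (\<Sum>j<M. w ^ j / fact j)"

lemma holomorphic_exprem [holomorphic_intros]: "f holomorphic_on S \<Longrightarrow> (\<lambda>z. exprem M (f z)) holomorphic_on S"
  unfolding exprem_def by (intro holomorphic_intros) auto

lemma deriv_exprem: "(exprem (Suc M) has_field_derivative exprem M z) (at z)"
proof -
  have "((\<lambda>w. \<Sum>j<Suc M. w ^ j / fact j) has_field_derivative (\<Sum>j<M. z ^ j / fact j)) (at z)"
  proof -
    have "((\<lambda>w. \<Sum>j<Suc M. w ^ j / fact j) has_field_derivative (\<Sum>j<Suc M. of_nat j * z ^ (j - 1) / fact j)) (at z)"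
      by (auto intro!: derivative_eq_intros)
    also have "(\<Sum>j<Suc M. of_nat j * z ^ (j - 1) / fact j) = (\<Sum>j<M. z ^ j / fact j)"
      by (subst sum.lessThan_Suc_shift) (simp add: divide_simps del: of_nat_Suc)
    finally show ?thesis .
  qed
  then show ?thesis unfolding exprem_def by (intro derivative_intros DERIV_exp)
qed

lemma vanish_exprem: "vanish M (exprem M)"
proof -
  have hol: "exprem M holomorphic_on UNIV" for M
    using holomorphic_exprem[of "\<lambda>z. z" UNIV M] by simp
  have "n < M \<Longrightarrow> (deriv ^^ n) (exprem M) 0 = 0" for n
  proof (induction n arbitrary: M)
    case 0
    then obtain m where m: "M = Suc m" by (cases M) auto
    have "exprem M 0 = 0" unfolding exprem_def m sum.lessThan_Suc_shift by simp
    then show ?case by simp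
  next
    case (Suc n)
    then obtain m where m: "M = Suc m" by (cases M) auto
    have "deriv (exprem M) = exprem m" unfolding m using DERIV_imp_deriv[OF deriv_exprem] by blast
    then show ?case using Suc m by (simp only: funpow_Suc_right o_def)
  qed
  then show ?thesis using vanish_iff_higher_deriv[OF hol] by blast
qed

lemma holomorphic_ev:
  assumes "\<And>i. (\<lambda>t. \<gamma> t i) holomorphic_on S"
  shows "(\<lambda>t. ev p (\<gamma> t)) holomorphic_on S"
  by (induction p rule: pfun_induct) (auto intro!: holomorphic_intros assms)

section \<open>Passage between the ring type and curried functions of \<open>z1\<close> and
  \<open>z2\<close>\<close>

definition fn2 :: "bool pfun \<Rightarrow> cfun2" where
  "fn2 p = (\<lambda>z1 z2. ev p (\<lambda>b. if b then z2 else z1))"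

lemma fn2_inject: "fn2 p = fn2 q \<Longrightarrow> p = q"
proof (rule pfun_eqI)
  fix v assume "fn2 p = fn2 q"
  then have "fn2 p (v False) (v True) = fn2 q (v False) (v True)" by simp
  moreover have "(\<lambda>b. if b then v True else v False) = v" by auto
  ultimately show "ev p v = ev q v" by (simp add: fn2_def)
qed

lemma poly2_const: "poly2 (\<lambda>z1 z2. c)"
  unfolding poly2_def by (intro exI[of _ "{(0, 0)}"] exI[of _ "\<lambda>_. c"]) simp

lemma poly2_monom: "poly2 (\<lambda>z1 z2. c * z1 ^ i * z2 ^ j)"
  unfolding poly2_def by (intro exI[of _ "{(i, j)}"] exI[of _ "\<lambda>_. c"]) simp

lemma poly2_add:
  assumes "poly2 f" "poly2 g"
  shows "poly2 (\<lambda>z1 z2. f z1 z2 + g z1 z2)"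
proof -
  obtain S c where S: "finite S" "f = (\<lambda>z1 z2. \<Sum>(i,j)\<in>S. c (i,j) * z1 ^ i * z2 ^ j)"
    using assms(1) by (auto simp: poly2_def)
  obtain T d where T: "finite T" "g = (\<lambda>z1 z2. \<Sum>(i,j)\<in>T. d (i,j) * z1 ^ i * z2 ^ j)"
    using assms(2) by (auto simp: poly2_def)
  let ?e = "\<lambda>p. (if p \<in> S then c p else 0) + (if p \<in> T then d p else 0)"
  have "f z1 z2 + g z1 z2 = (\<Sum>(i,j)\<in>S \<union> T. ?e (i,j) * z1 ^ i * z2 ^ j)" for z1 z2
  proof -
    have "(\<Sum>(i,j)\<in>S \<union> T. ?e (i,j) * z1 ^ i * z2 ^ j)
        = (\<Sum>(i,j)\<in>S \<union> T. (if (i,j) \<in> S then c (i,j) * z1 ^ i * z2 ^ j else 0))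
        + (\<Sum>(i,j)\<in>S \<union> T. (if (i,j) \<in> T then d (i,j) * z1 ^ i * z2 ^ j else 0))"
      unfolding sum.distrib[symmetric] by (intro sum.cong) (auto simp: algebra_simps)
    also have "(\<Sum>(i,j)\<in>S \<union> T. (if (i,j) \<in> S then c (i,j) * z1 ^ i * z2 ^ j else 0)) = f z1 z2"
      unfolding S(2) using S T by (intro sum.mono_neutral_cong_right) auto
    also have "(\<Sum>(i,j)\<in>S \<union> T. (if (i,j) \<in> T then d (i,j) * z1 ^ i * z2 ^ j else 0)) = g z1 z2"
      unfolding T(2) using S T by (intro sum.mono_neutral_cong_right) auto
    finally show ?thesis by simp
  qed
  then show ?thesis unfolding poly2_def using S(1) T(1) by (intro exI[of _ "S \<union> T"] exI[of _ ?e]) (simp add: fun_eq_iff)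
qed

lemma poly2_sum: "(\<And>a. a \<in> A \<Longrightarrow> poly2 (f a)) \<Longrightarrow> poly2 (\<lambda>z1 z2. \<Sum>a\<in>A. f a z1 z2)"
  by (induction A rule: infinite_finite_induct) (auto intro: poly2_const poly2_add)

lemma poly2_mult:
  assumes "poly2 f" "poly2 g"
  shows "poly2 (\<lambda>z1 z2. f z1 z2 * g z1 z2)"
proof -
  obtain S c where S: "finite S" "f = (\<lambda>z1 z2. \<Sum>(i,j)\<in>S. c (i,j) * z1 ^ i * z2 ^ j)"
    using assms(1) by (auto simp: poly2_def)
  obtain T d where T: "finite T" "g = (\<lambda>z1 z2. \<Sum>(i,j)\<in>T. d (i,j) * z1 ^ i * z2 ^ j)"
    using assms(2) by (auto simp: poly2_def)
  have "f z1 z2 * g z1 z2 = (\<Sum>p\<in>S. \<Sum>q\<in>T. (c p * d q) * z1 ^ (fst p + fst q) * z2 ^ (snd p + snd q))" for z1 z2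
    unfolding S(2) T(2) sum_product by (intro sum.cong) (auto simp: power_add)
  then show ?thesis by (simp add: poly2_sum poly2_monom)
qed

lemma poly2_fn2: "poly2 (fn2 p)"
proof (induction p rule: pfun_induct)
  case (Const c)
  then show ?case by (simp add: fn2_def poly2_const)
next
  case (Var i)
  show ?case using poly2_monom[of 1 1 0] poly2_monom[of 1 0 1] by (cases i) (simp_all add: fn2_def)
qed (auto simp: fn2_def intro: poly2_add poly2_mult)

lemma poly2_expand:
  assumes "poly2 f"
  shows "\<exists>S c. finite S \<and> f = fn2 (\<Sum>(i, j)\<in>S. Const (c (i, j)) * Var False ^ i * Var True ^ j)"
proof -
  obtain S c where S: "finite S" "f = (\<lambda>z1 z2. \<Sum>(i,j)\<in>S. c (i,j) * z1 ^ i * z2 ^ j)"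
    using assms by (auto simp: poly2_def)
  then have "f = fn2 (\<Sum>(i, j)\<in>S. Const (c (i, j)) * Var False ^ i * Var True ^ j)"
    by (simp add: fn2_def case_prod_unfold)
  then show ?thesis using S(1) by blast
qed

lemma poly2_iff: "poly2 f \<longleftrightarrow> (\<exists>p. f = fn2 p)"
  using poly2_fn2 poly2_expand by blast

lemma fn2_simps:
  "fn2 (p + q) = (\<lambda>z1 z2. fn2 p z1 z2 + fn2 q z1 z2)"
  "fn2 (p * q) = (\<lambda>z1 z2. fn2 p z1 z2 * fn2 q z1 z2)"
  "fn2 (p - q) = (\<lambda>z1 z2. fn2 p z1 z2 - fn2 q z1 z2)"
  "fn2 (Const c) = (\<lambda>z1 z2. c)" "fn2 1 = (\<lambda>z1 z2. 1)" "fn2 (p ^ n) = (\<lambda>z1 z2. fn2 p z1 z2 ^ n)"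
  by (simp_all add: fn2_def)

abbreviation l2 :: "complex \<Rightarrow> bool pfun" where "l2 \<equiv> glf (\<lambda>b. b)"
abbreviation refl2 :: "complex \<Rightarrow> bool pfun \<Rightarrow> bool pfun" where "refl2 \<equiv> refl (\<lambda>b. b)"
abbreviation qc2 :: "complex \<Rightarrow> bool pfun \<Rightarrow> nat \<Rightarrow> bool pfun \<Rightarrow> bool" where "qc2 \<equiv> qc (\<lambda>b. b)"

lemma qc2_iff: "qc2 \<alpha> \<kappa> k p \<longleftrightarrow> l2 \<alpha> ^ (2 * k) dvd p - texp (2 * k) (- (2 * \<kappa>) * l2 \<alpha>) * refl2 \<alpha> p"
  by (rule qc_def) simp

lemma fn2_lin: "fn2 (l2 \<alpha>) = lin \<alpha>"
  by (simp add: fn2_def glf_def lin_def)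

lemma fn2_refl: "fn2 (refl2 \<alpha> p) = refl_fun \<alpha> (fn2 p)"
proof -
  have "(\<lambda>i. ev (if i = False then Const (cos (2 * \<alpha>)) * Var False + Const (sin (2 * \<alpha>)) * Var True
     else if i = True then Const (sin (2 * \<alpha>)) * Var False - Const (cos (2 * \<alpha>)) * Var True else Var i)
        (\<lambda>b. if b then z2 else z1))
      = (\<lambda>b. if b then sin (2 * \<alpha>) * z1 - cos (2 * \<alpha>) * z2 else cos (2 * \<alpha>) * z1 + sin (2 * \<alpha>) * z2)" for z1 z2
    by (auto simp: fun_eq_iff)
  then show ?thesis by (simp only: fn2_def refl_fun_def refl_def ev_subst)
qed

lemma ringA_iff:
  "fn2 p \<in> ringA Pa \<mu> \<longleftrightarrow> (\<forall>\<alpha>\<in>Pa. l2 \<alpha> ^ (2 * \<mu> \<alpha> + 1) dvd p - refl2 \<alpha> p)"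
proof -
  have "(\<exists>g. poly2 g \<and> (\<forall>z1 z2. fn2 p z1 z2 - refl_fun \<alpha> (fn2 p) z1 z2 = (lin \<alpha> z1 z2) ^ (2 * \<mu> \<alpha> + 1) * g z1 z2))
    \<longleftrightarrow> l2 \<alpha> ^ (2 * \<mu> \<alpha> + 1) dvd p - refl2 \<alpha> p" for \<alpha>
  proof
    assume "\<exists>g. poly2 g \<and> (\<forall>z1 z2. fn2 p z1 z2 - refl_fun \<alpha> (fn2 p) z1 z2 = (lin \<alpha> z1 z2) ^ (2 * \<mu> \<alpha> + 1) * g z1 z2)"
    then obtain q where "\<forall>z1 z2. fn2 p z1 z2 - refl_fun \<alpha> (fn2 p) z1 z2 = (lin \<alpha> z1 z2) ^ (2 * \<mu> \<alpha> + 1) * fn2 q z1 z2"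
      unfolding poly2_iff by blast
    then have "fn2 (p - refl2 \<alpha> p) = fn2 (l2 \<alpha> ^ (2 * \<mu> \<alpha> + 1) * q)"
      unfolding fn2_simps fn2_lin fn2_refl by (simp only: fun_eq_iff) simp
    then have "p - refl2 \<alpha> p = l2 \<alpha> ^ (2 * \<mu> \<alpha> + 1) * q" by (rule fn2_inject)
    then show "l2 \<alpha> ^ (2 * \<mu> \<alpha> + 1) dvd p - refl2 \<alpha> p" by (rule dvdI)
  next
    assume "l2 \<alpha> ^ (2 * \<mu> \<alpha> + 1) dvd p - refl2 \<alpha> p"
    then obtain q where "p - refl2 \<alpha> p = l2 \<alpha> ^ (2 * \<mu> \<alpha> + 1) * q" by (elim dvdE)
    then have "fn2 (p - refl2 \<alpha> p) = fn2 (l2 \<alpha> ^ (2 * \<mu> \<alpha> + 1) * q)" by simp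
    then show "\<exists>g. poly2 g \<and> (\<forall>z1 z2. fn2 p z1 z2 - refl_fun \<alpha> (fn2 p) z1 z2 = (lin \<alpha> z1 z2) ^ (2 * \<mu> \<alpha> + 1) * g z1 z2)"
      unfolding fn2_simps fn2_lin fn2_refl by (intro exI[of _ "fn2 q"] conjI poly2_fn2) (simp only: fun_eq_iff, simp)
  qed
  then show ?thesis by (simp add: ringA_def poly2_fn2)
qed

text \<open>Polar coordinates centred at the angle \<alpha>: the linear form becomes
  \<open>\<rho> * sin \<psi>\<close>, and the reflection becomes the sign change of \<psi>.\<close>

definition pt :: "complex \<Rightarrow> complex \<Rightarrow> complex \<Rightarrow> bool \<Rightarrow> complex" where
  "pt \<alpha> \<rho> \<psi> = (\<lambda>b. if b then \<rho> * sin (\<alpha> + \<psi>) else \<rho> * cos (\<alpha> + \<psi>))"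

lemma holomorphic_pt: "f holomorphic_on S \<Longrightarrow> (\<lambda>\<psi>. ev p (pt \<alpha> \<rho> (f \<psi>))) holomorphic_on S"
proof (rule holomorphic_ev)
  fix b assume "f holomorphic_on S"
  then show "(\<lambda>\<psi>. pt \<alpha> \<rho> (f \<psi>) b) holomorphic_on S"
    by (cases b) (auto simp: pt_def intro!: holomorphic_intros)
qed

lemma ev_l2_pt: "ev (l2 \<alpha>) (pt \<alpha> \<rho> \<psi>) = \<rho> * sin \<psi>"
proof -
  have "ev (l2 \<alpha>) (pt \<alpha> \<rho> \<psi>) = \<rho> * (cos \<alpha> * sin (\<alpha> + \<psi>) - sin \<alpha> * cos (\<alpha> + \<psi>))"
    by (simp add: glf_def pt_def algebra_simps)
  also have "cos \<alpha> * sin (\<alpha> + \<psi>) - sin \<alpha> * cos (\<alpha> + \<psi>) = sin ((\<alpha> + \<psi>) - \<alpha>)" by (simp only: sin_diff mult.commute)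
  finally show ?thesis by simp
qed

lemma ev_refl2_pt: "ev (refl2 \<alpha> p) (pt \<alpha> \<rho> \<psi>) = ev p (pt \<alpha> \<rho> (- \<psi>))"
proof -
  have 1: "cos (2 * \<alpha>) * (\<rho> * cos (\<alpha> + \<psi>)) + sin (2 * \<alpha>) * (\<rho> * sin (\<alpha> + \<psi>)) = \<rho> * cos (\<alpha> - \<psi>)"
    using cos_diff[of "2 * \<alpha>" "\<alpha> + \<psi>"] by (simp add: algebra_simps)
  have 2: "sin (2 * \<alpha>) * (\<rho> * cos (\<alpha> + \<psi>)) - cos (2 * \<alpha>) * (\<rho> * sin (\<alpha> + \<psi>)) = \<rho> * sin (\<alpha> - \<psi>)"
  proof -
    have "sin (2 * \<alpha>) * cos (\<alpha> + \<psi>) - cos (2 * \<alpha>) * sin (\<alpha> + \<psi>) = sin (2 * \<alpha> - (\<alpha> + \<psi>))"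
      by (rule sin_diff[symmetric])
    also have "2 * \<alpha> - (\<alpha> + \<psi>) = \<alpha> - \<psi>" by simp
    finally show ?thesis by (simp add: right_diff_distrib[symmetric] mult.left_commute)
  qed
  have "(\<lambda>i. ev (if i = False then Const (cos (2 * \<alpha>)) * Var False + Const (sin (2 * \<alpha>)) * Var True
     else if i = True then Const (sin (2 * \<alpha>)) * Var False - Const (cos (2 * \<alpha>)) * Var True else Var i) (pt \<alpha> \<rho> \<psi>))
     = pt \<alpha> \<rho> (- \<psi>)"
    by (rule ext) (simp add: pt_def 1 2)
  then show ?thesis by (simp only: refl_def ev_subst)
qed

lemma sin_factor: "\<exists>s. s holomorphic_on UNIV \<and> (\<forall>z::complex. sin z = z * s z)"
  by (rule entire_factor[OF holomorphic_on_sin]) simp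

lemma vanish_sin: "vanish M (\<lambda>\<psi>. (\<rho> * sin \<psi>) ^ M)"
proof -
  obtain s where s: "s holomorphic_on UNIV" "\<And>z. sin z = z * s z"
    using sin_factor by blast
  then show ?thesis
    unfolding vanish_def by (intro exI[of _ "\<lambda>z. (\<rho> * s z) ^ M"])
      (auto intro!: holomorphic_intros simp: power_mult_distrib)
qed

text \<open>Linear factors are split off one at a time. After cancellation of
  \<open>\<psi> ^ k\<close> the value at \<psi> = 0 is \<open>\<rho> ^ k\<close> times the cofactor
  on the line, because \<open>sin \<psi>\<close> is \<psi> times a function with value 1 at 0; so
  the cofactor vanishes on the line.\<close>

lemma vanish_pt_iff_dvd:
  "(\<forall>\<rho>. vanish M (\<lambda>\<psi>. ev p (pt \<alpha> \<rho> \<psi>))) \<longleftrightarrow> l2 \<alpha> ^ M dvd p"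
proof
  assume "l2 \<alpha> ^ M dvd p"
  then obtain q where q: "p = l2 \<alpha> ^ M * q" by (elim dvdE)
  show "\<forall>\<rho>. vanish M (\<lambda>\<psi>. ev p (pt \<alpha> \<rho> \<psi>))"
    unfolding q using vanish_mult[OF vanish_sin holomorphic_pt[of "\<lambda>\<psi>. \<psi>"]]
    by (simp add: ev_l2_pt holomorphic_intros)
next
  assume van: "\<forall>\<rho>. vanish M (\<lambda>\<psi>. ev p (pt \<alpha> \<rho> \<psi>))"
  have "k \<le> M \<Longrightarrow> l2 \<alpha> ^ k dvd p" for k
  proof (induction k)
    case (Suc k)
    then obtain q where q: "p = l2 \<alpha> ^ k * q" by (auto elim: dvdE)
    obtain s where s: "s holomorphic_on UNIV" "\<And>z. sin z = z * s z"
      using sin_factor by blast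
    have s0: "s 0 = 1"
    proof -
      have "((\<lambda>z. z * s z) has_field_derivative (1 * s 0 + deriv s 0 * 0)) (at 0)"
        using holomorphic_derivI[OF s(1) open_UNIV, of 0] by (auto intro!: derivative_eq_intros)
      moreover have "(sin has_field_derivative cos 0) (at (0::complex))" by (rule DERIV_sin)
      moreover have "sin = (\<lambda>z. z * s z)" using s(2) by auto
      ultimately show ?thesis using DERIV_unique by fastforce
    qed
    have zero: "ev q (pt \<alpha> \<rho> 0) = 0" if "\<rho> \<noteq> 0" for \<rho>
    proof -
      obtain g where g: "g holomorphic_on UNIV" "\<And>\<psi>. ev p (pt \<alpha> \<rho> \<psi>) = \<psi> ^ M * g \<psi>"
        using van by (auto simp: vanish_def)
      let ?f = "\<lambda>\<psi>. (\<rho> * s \<psi>) ^ k * ev q (pt \<alpha> \<rho> \<psi>) - \<psi> ^ (M - k) * g \<psi>"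
      have *: "\<psi> ^ k * ?f \<psi> = 0" for \<psi>
      proof -
        have "\<psi> ^ M = \<psi> ^ k * \<psi> ^ (M - k)" using Suc.prems by (simp add: power_add[symmetric])
        then show ?thesis using g(2)[of \<psi>]
          by (simp add: q ev_l2_pt s(2) power_mult_distrib algebra_simps)
      qed
      have f0: "?f \<psi> = 0" if "\<psi> \<noteq> 0" for \<psi> using *[of \<psi>] that by simp
      have "?f holomorphic_on UNIV" by (intro holomorphic_intros holomorphic_pt s g)
      then have "continuous_on UNIV ?f" by (rule holomorphic_on_imp_continuous_on)
      then have "(?f \<longlongrightarrow> ?f 0) (at 0)" by (simp add: continuous_on_def)
      moreover have "(?f \<longlongrightarrow> 0) (at 0)"
        by (rule tendsto_eventually) (use f0 in \<open>auto simp: eventually_at intro!: exI[of _ 1]\<close>)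
      ultimately have "?f 0 = 0" by (rule tendsto_unique[rotated]) simp
      moreover have "(0 :: complex) ^ (M - k) = 0" using Suc.prems by (simp add: power_0_left)
      ultimately show ?thesis using that s0 by simp
    qed
    \<comment> \<open>The factor \<open>Var False\<close> takes care of the point \<rho> = 0, about
      which \<open>zero\<close> says nothing.\<close>
    have "Var False * grs (\<lambda>b. b) \<alpha> q = 0"
    proof (rule pfun_eqI)
      fix v :: "bool \<Rightarrow> complex"
      have "(\<lambda>i. ev (if i = False then Const (cos \<alpha>) * Var False else if i = True then Const (sin \<alpha>) * Var False else Var i) v)
          = pt \<alpha> (v False) 0" by (auto simp: pt_def fun_eq_iff)
      then have "ev (grs (\<lambda>b. b) \<alpha> q) v = ev q (pt \<alpha> (v False) 0)" by (simp only: grs_def ev_subst)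
      then show "ev (Var False * grs (\<lambda>b. b) \<alpha> q) v = ev 0 v" using zero[of "v False"] by (cases "v False = 0") simp_all
    qed
    moreover have "Var False \<noteq> (0 :: bool pfun)"
    proof
      assume "Var False = (0 :: bool pfun)"
      from arg_cong[OF this, of "\<lambda>p. ev p (\<lambda>_. 1)"] show False by simp
    qed
    ultimately have "grs (\<lambda>b. b) \<alpha> q = 0" by simp
    then have "l2 \<alpha> dvd q" by (subst glf_dvd_iff) simp_all
    then have "l2 \<alpha> ^ k * l2 \<alpha> dvd p" unfolding q by (rule mult_dvd_mono[OF dvd_refl])
    then show ?case by (simp add: mult.commute)
  qed simp
  then show "l2 \<alpha> ^ M dvd p" by blast
qed

lemma ev_texp: "ev (texp M p) v = (\<Sum>j<M. ev p v ^ j / fact j)"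
  by (simp add: texp_def)

text \<open>With \<psi> the angle from the line, only the normal part \<kappa> of the exponent is
  odd in \<psi>. So \<open>F \<psi> - F (- \<psi>)\<close> is a nowhere vanishing exponential times
  \<open>p - exp (-2 \<kappa> l) s(p)\<close>, and truncating the exponential changes this by a
  function vanishing to order \<open>2 * k\<close>.\<close>

lemma angular_iff:
  fixes p :: "bool pfun" and \<alpha> \<xi>1 \<xi>2 :: complex
  defines "g \<equiv> \<lambda>z1 z2. exp (- \<xi>1 * z1 - \<xi>2 * z2) * fn2 p z1 z2"
  shows "(\<forall>l. 1 \<le> l \<and> l \<le> k \<longrightarrow> (\<forall>\<rho>. (deriv ^^ (2 * l - 1)) (\<lambda>\<phi>. g (\<rho> * cos \<phi>) (\<rho> * sin \<phi>)) \<alpha> = 0))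
    \<longleftrightarrow> qc2 \<alpha> (Const (lin \<alpha> (- \<xi>1) (- \<xi>2))) k p"
proof -
  define \<kappa> where "\<kappa> = lin \<alpha> (- \<xi>1) (- \<xi>2)"
  define h where "h = (\<lambda>\<rho> \<phi>. g (\<rho> * cos \<phi>) (\<rho> * sin \<phi>))"
  define F where "F = (\<lambda>\<rho> \<psi>. h \<rho> (\<alpha> + \<psi>))"
  define Y where "Y = p - texp (2 * k) (- (2 * Const \<kappa>) * l2 \<alpha>) * refl2 \<alpha> p"
  define e where "e = (\<lambda>\<rho> \<psi>. - \<xi>1 * (\<rho> * cos (\<alpha> + \<psi>)) - \<xi>2 * (\<rho> * sin (\<alpha> + \<psi>)))"
  have F_eq: "F \<rho> \<psi> = exp (e \<rho> \<psi>) * ev p (pt \<alpha> \<rho> \<psi>)" for \<rho> \<psi>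
    by (simp add: F_def h_def g_def fn2_def pt_def e_def)
  have hol_e: "e \<rho> holomorphic_on UNIV" for \<rho>
    unfolding e_def by (intro holomorphic_intros)
  have F_hol: "F \<rho> holomorphic_on UNIV" for \<rho>
    unfolding F_eq[abs_def] by (intro holomorphic_intros holomorphic_pt hol_e)
  have h_hol: "h \<rho> holomorphic_on UNIV" for \<rho>
  proof -
    have "h \<rho> = (\<lambda>\<phi>. F \<rho> (\<phi> - \<alpha>))" by (simp add: F_def fun_eq_iff)
    moreover have "(\<lambda>\<phi>. F \<rho> (\<phi> - \<alpha>)) holomorphic_on UNIV"
    proof -
      have "(\<lambda>\<phi>. \<phi> - \<alpha>) holomorphic_on UNIV" by (intro holomorphic_intros)
      from holomorphic_on_compose_gen[OF this F_hol[of \<rho>]] show ?thesis by (simp add: o_def)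
    qed
    ultimately show ?thesis by simp
  qed
  have shift: "(deriv ^^ n) (h \<rho>) \<alpha> = (deriv ^^ n) (F \<rho>) 0" for n \<rho>
    using higher_deriv_compose_linear'[OF h_hol open_UNIV open_UNIV, of 0 1 \<alpha> n \<rho>]
    by (simp add: F_def add.commute)
  have e_neg: "e \<rho> (- \<psi>) = e \<rho> \<psi> - 2 * \<kappa> * (\<rho> * sin \<psi>)" for \<rho> \<psi>
    by (simp add: e_def \<kappa>_def lin_def cos_add sin_add cos_diff sin_diff algebra_simps)
  have odd_part: "F \<rho> \<psi> - F \<rho> (- \<psi>)
      = (ev Y (pt \<alpha> \<rho> \<psi>) - exprem (2 * k) (- 2 * \<kappa> * (\<rho> * sin \<psi>)) * ev p (pt \<alpha> \<rho> (- \<psi>))) * exp (e \<rho> \<psi>)" for \<rho> \<psi>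
  proof -
    have 1: "ev Y (pt \<alpha> \<rho> \<psi>) = ev p (pt \<alpha> \<rho> \<psi>)
        - (exp (- 2 * \<kappa> * (\<rho> * sin \<psi>)) - exprem (2 * k) (- 2 * \<kappa> * (\<rho> * sin \<psi>))) * ev p (pt \<alpha> \<rho> (- \<psi>))"
      by (simp add: Y_def ev_texp ev_l2_pt ev_refl2_pt exprem_def)
    have 2: "exp (e \<rho> (- \<psi>)) = exp (e \<rho> \<psi>) * exp (- 2 * \<kappa> * (\<rho> * sin \<psi>))"
      unfolding e_neg exp_add[symmetric] by (simp add: algebra_simps)
    show ?thesis unfolding F_eq 1 2 by (simp add: algebra_simps)
  qed
  have rem: "vanish (2 * k) (\<lambda>\<psi>. exprem (2 * k) (- 2 * \<kappa> * (\<rho> * sin \<psi>)) * ev p (pt \<alpha> \<rho> (- \<psi>)))" for \<rho>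
  proof -
    obtain r where r: "r holomorphic_on UNIV" "\<And>w. exprem (2 * k) w = w ^ (2 * k) * r w"
      using vanish_exprem[of "2 * k"] by (auto simp: vanish_def)
    have "(\<lambda>\<psi>. r (- 2 * \<kappa> * (\<rho> * sin \<psi>))) holomorphic_on UNIV"
    proof -
      have "(\<lambda>\<psi>. - 2 * \<kappa> * (\<rho> * sin \<psi>)) holomorphic_on UNIV" by (intro holomorphic_intros)
      from holomorphic_on_compose_gen[OF this r(1)] show ?thesis by (simp add: o_def)
    qed
    then have "vanish (2 * k) (\<lambda>\<psi>. ((- 2 * \<kappa> * \<rho>) * sin \<psi>) ^ (2 * k) * (r (- 2 * \<kappa> * (\<rho> * sin \<psi>)) * ev p (pt \<alpha> \<rho> (- \<psi>))))"
      by (intro vanish_mult[OF vanish_sin] holomorphic_intros holomorphic_pt)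
    then show ?thesis by (simp only: r(2) mult.assoc)
  qed
  have "vanish (2 * k) (\<lambda>\<psi>. F \<rho> \<psi> - F \<rho> (- \<psi>)) \<longleftrightarrow> vanish (2 * k) (\<lambda>\<psi>. ev Y (pt \<alpha> \<rho> \<psi>))" for \<rho>
  proof
    assume "vanish (2 * k) (\<lambda>\<psi>. F \<rho> \<psi> - F \<rho> (- \<psi>))"
    moreover have "(\<lambda>\<psi>. exp (- e \<rho> \<psi>)) holomorphic_on UNIV" by (intro holomorphic_intros hol_e)
    ultimately have "vanish (2 * k) (\<lambda>\<psi>. (F \<rho> \<psi> - F \<rho> (- \<psi>)) * exp (- e \<rho> \<psi>)
        + exprem (2 * k) (- 2 * \<kappa> * (\<rho> * sin \<psi>)) * ev p (pt \<alpha> \<rho> (- \<psi>)))"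
      by (intro vanish_add vanish_mult rem)
    then show "vanish (2 * k) (\<lambda>\<psi>. ev Y (pt \<alpha> \<rho> \<psi>))"
      by (simp add: odd_part mult.assoc exp_add[symmetric])
  next
    assume "vanish (2 * k) (\<lambda>\<psi>. ev Y (pt \<alpha> \<rho> \<psi>))"
    moreover have "vanish (2 * k) (\<lambda>\<psi>. (exprem (2 * k) (- 2 * \<kappa> * (\<rho> * sin \<psi>)) * ev p (pt \<alpha> \<rho> (- \<psi>))) * - 1)"
      by (rule vanish_mult[OF rem]) (intro holomorphic_intros)
    ultimately have "vanish (2 * k) (\<lambda>\<psi>. ev Y (pt \<alpha> \<rho> \<psi>) + (exprem (2 * k) (- 2 * \<kappa> * (\<rho> * sin \<psi>)) * ev p (pt \<alpha> \<rho> (- \<psi>))) * - 1)"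
      by (rule vanish_add)
    moreover have "(\<lambda>\<psi>. exp (e \<rho> \<psi>)) holomorphic_on UNIV" by (intro holomorphic_intros hol_e)
    ultimately have "vanish (2 * k) (\<lambda>\<psi>. (ev Y (pt \<alpha> \<rho> \<psi>) + (exprem (2 * k) (- 2 * \<kappa> * (\<rho> * sin \<psi>)) * ev p (pt \<alpha> \<rho> (- \<psi>))) * - 1) * exp (e \<rho> \<psi>))"
      by (rule vanish_mult)
    then show "vanish (2 * k) (\<lambda>\<psi>. F \<rho> \<psi> - F \<rho> (- \<psi>))" by (simp add: odd_part)
  qed
  then have "(\<forall>\<rho>. vanish (2 * k) (\<lambda>\<psi>. F \<rho> \<psi> - F \<rho> (- \<psi>))) \<longleftrightarrow> l2 \<alpha> ^ (2 * k) dvd Y"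
    by (simp add: vanish_pt_iff_dvd)
  then have "(\<forall>\<rho> l. 1 \<le> l \<and> l \<le> k \<longrightarrow> (deriv ^^ (2 * l - 1)) (F \<rho>) 0 = 0) \<longleftrightarrow> l2 \<alpha> ^ (2 * k) dvd Y"
    by (simp add: odd_derivs_iff_vanish[OF F_hol, symmetric])
  moreover have "(\<forall>l. A l \<longrightarrow> (\<forall>r. D r l)) \<longleftrightarrow> (\<forall>r l. A l \<longrightarrow> D r l)"
    for A :: "nat \<Rightarrow> bool" and D :: "complex \<Rightarrow> nat \<Rightarrow> bool" by blast
  moreover have "(\<lambda>\<phi>. g (\<rho> * cos \<phi>) (\<rho> * sin \<phi>)) = h \<rho>" for \<rho> by (simp add: h_def)
  ultimately show ?thesis
    unfolding qc2_iff Y_def \<kappa>_def[symmetric] by (simp only: shift)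
qed

lemma Pmod_iff:
  "fn2 p \<in> Pmod Pa \<mu> \<xi>1 \<xi>2 \<longleftrightarrow> (\<forall>\<alpha>\<in>Pa. qc2 \<alpha> (Const (lin \<alpha> (- \<xi>1) (- \<xi>2))) (\<mu> \<alpha>) p)"
  unfolding Pmod_def quasi_invariant_def mem_Collect_eq angular_iff[symmetric]
  by (auto simp: poly2_fn2)

subsection \<open>The spectral module\<close>

definition specx :: "complex \<Rightarrow> complex \<Rightarrow> idx pfun \<Rightarrow> bool pfun" where
  "specx y1 y2 = subst (\<lambda>i. if fst i then Var (snd i) else Const (if snd i then y2 else y1))"

lemma specx_simps [simp]:
  "specx y1 y2 0 = 0" "specx y1 y2 1 = 1" "specx y1 y2 (p + q) = specx y1 y2 p + specx y1 y2 q"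
  "specx y1 y2 (p * q) = specx y1 y2 p * specx y1 y2 q" "specx y1 y2 (p - q) = specx y1 y2 p - specx y1 y2 q"
  "specx y1 y2 (Const c) = Const c" "specx y1 y2 (p ^ n) = specx y1 y2 p ^ n"
  "specx y1 y2 (Var i) = (if fst i then Var (snd i) else Const (if snd i then y2 else y1))"
  by (simp_all add: specx_def)

lemma specx_pdiff: "specx y1 y2 (pdiff (True, b) p) = pdiff b (specx y1 y2 p)"
proof -
  have "pdiff b (specx y1 y2 p) = (\<Sum>i\<in>UNIV. if i = (True, b) then specx y1 y2 (pdiff i p) else 0)"
    unfolding specx_def pdiff_subst by (intro sum.cong) (auto simp: pdiff_Var)
  then show ?thesis by simp
qed

lemma specx_lf: "specx y1 y2 (lf True \<alpha>) = l2 \<alpha>" "specx y1 y2 (lf False \<alpha>) = Const (lin \<alpha> y1 y2)"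
  by (auto simp: glf_def lin_def intro!: pfun_eqI)

lemma specx_nd: "specx y1 y2 (nd True \<alpha> p) = nt (\<lambda>b. b) \<alpha> (Const (lin \<alpha> y1 y2)) (specx y1 y2 p)"
  by (simp add: nd_eq_nt nt_def gdn_def specx_pdiff specx_lf)

lemma specx_ndn: "specx y1 y2 ((nd True \<alpha> ^^ n) p) = (nt (\<lambda>b. b) \<alpha> (Const (lin \<alpha> y1 y2)) ^^ n) (specx y1 y2 p)"
  by (induction n) (simp_all add: specx_nd)

lemma specx_rs: "grs (\<lambda>b. b) \<alpha> (specx y1 y2 p) = specx y1 y2 (rs True \<alpha> p)"
  unfolding grs_def specx_def subst_subst
  by (rule arg_cong[of _ _ "\<lambda>\<theta>. subst \<theta> p"]) (auto simp: fun_eq_iff intro!: pfun_eqI)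

lemma qi_specx: "qi True \<alpha> k p \<Longrightarrow> qc2 \<alpha> (Const (lin \<alpha> y1 y2)) k (specx y1 y2 p)"
  by (rule qcI) (auto simp: specx_ndn[symmetric] specx_rs qi_def)

abbreviation all_vars :: "bool \<Rightarrow> bool" where "all_vars \<equiv> (\<lambda>_. True)"

lemma hom_specx: "hom (own True) k p \<Longrightarrow> hom all_vars k (specx y1 y2 p)"
proof -
  assume p: "hom (own True) k p"
  have "scale (\<lambda>i. if all_vars i then 1 else 0) t (specx y1 y2 p) = specx y1 y2 (scale (\<lambda>i. if own True i then 1 else 0) t p)" for t
    unfolding scale_def specx_def subst_subst
    by (rule arg_cong[of _ _ "\<lambda>\<theta>. subst \<theta> p"]) (auto simp: fun_eq_iff intro!: pfun_eqI)
  then show ?thesis using p by (simp add: whom_def)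
qed

lemma lower_specx: "lower (own True) n p \<Longrightarrow> lower all_vars n (specx y1 y2 p)"
proof (induction rule: lower.induct)
  case (lower_hom k p)
  then show ?case using lower.lower_hom[OF hom_specx] by blast
qed (simp_all add: lower.intros)

context ba
begin

text \<open>Up to the factor \<open>r\<close>, each term is \<open>cot (\<alpha> - \<beta>)\<close>
  times the difference of the quotients \<open>m / l\<close> at \<alpha> and \<beta>; summing over
  the other index first leaves the cotangent sum with \<open>j = 1\<close>. In the application
  \<open>l\<close> and \<open>m\<close> are the normal and tangential coordinates of a point and
  \<open>r\<close> is its squared length.\<close>

lemma cross_sum:
  fixes l m :: "complex \<Rightarrow> complex" and r :: complex
  assumes lm: "\<And>\<alpha> \<beta>. \<alpha> \<in> B \<Longrightarrow> \<beta> \<in> B \<Longrightarrow> m \<alpha> * l \<beta> - m \<beta> * l \<alpha> = sin (\<alpha> - \<beta>) * r"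
    and l: "\<And>\<alpha>. \<alpha> \<in> B \<Longrightarrow> l \<alpha> \<noteq> 0" and r: "r \<noteq> 0"
  shows "(\<Sum>\<alpha>\<in>B. \<Sum>\<beta>\<in>B - {\<alpha>}. of_nat (mu \<alpha>) * of_nat (mu \<beta>) * cos (\<alpha> - \<beta>) / (l \<alpha> * l \<beta>)) = 0"
proof -
  define q where "q = (\<lambda>\<alpha>. m \<alpha> / l \<alpha>)"
  have cot1: "(\<Sum>\<beta>\<in>B - {\<alpha>}. of_nat (mu \<beta>) * cot (\<alpha> - \<beta>)) = 0" if "\<alpha> \<in> B" for \<alpha>
    using cot_sum[OF that, of 1] mu_pos[OF that] by simp
  have tm: "r * (of_nat (mu \<alpha>) * of_nat (mu \<beta>) * cos (\<alpha> - \<beta>) / (l \<alpha> * l \<beta>))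
      = of_nat (mu \<alpha>) * q \<alpha> * (of_nat (mu \<beta>) * cot (\<alpha> - \<beta>)) + of_nat (mu \<beta>) * q \<beta> * (of_nat (mu \<alpha>) * cot (\<beta> - \<alpha>))"
    if "\<alpha> \<in> B" "\<beta> \<in> B - {\<alpha>}" for \<alpha> \<beta>
  proof -
    have s: "sin (\<alpha> - \<beta>) \<noteq> 0" using sin_neq_0 that by auto
    have "q \<alpha> - q \<beta> = sin (\<alpha> - \<beta>) * r / (l \<alpha> * l \<beta>)"
      using lm[of \<alpha> \<beta>] l[of \<alpha>] l[of \<beta>] that by (simp add: q_def field_simps)
    then have "cot (\<alpha> - \<beta>) * (q \<alpha> - q \<beta>) = cos (\<alpha> - \<beta>) * r / (l \<alpha> * l \<beta>)"
      using s by (simp add: cot_def)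
    then have "r * (of_nat (mu \<alpha>) * of_nat (mu \<beta>) * cos (\<alpha> - \<beta>) / (l \<alpha> * l \<beta>))
        = of_nat (mu \<alpha>) * of_nat (mu \<beta>) * (cot (\<alpha> - \<beta>) * (q \<alpha> - q \<beta>))" by simp
    moreover have "cot (\<beta> - \<alpha>) = - cot (\<alpha> - \<beta>)"
      using cot_minus[of "\<alpha> - \<beta>"] by simp
    ultimately show ?thesis by (simp add: algebra_simps)
  qed
  have "r * (\<Sum>\<alpha>\<in>B. \<Sum>\<beta>\<in>B - {\<alpha>}. of_nat (mu \<alpha>) * of_nat (mu \<beta>) * cos (\<alpha> - \<beta>) / (l \<alpha> * l \<beta>))
      = (\<Sum>\<alpha>\<in>B. \<Sum>\<beta>\<in>B - {\<alpha>}. of_nat (mu \<alpha>) * q \<alpha> * (of_nat (mu \<beta>) * cot (\<alpha> - \<beta>))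
          + of_nat (mu \<beta>) * q \<beta> * (of_nat (mu \<alpha>) * cot (\<beta> - \<alpha>)))"
    unfolding sum_distrib_left by (intro sum.cong HOL.refl tm)
  also have "\<dots> = (\<Sum>\<alpha>\<in>B. of_nat (mu \<alpha>) * q \<alpha> * (\<Sum>\<beta>\<in>B - {\<alpha>}. of_nat (mu \<beta>) * cot (\<alpha> - \<beta>)))
      + (\<Sum>\<alpha>\<in>B. \<Sum>\<beta>\<in>B - {\<alpha>}. of_nat (mu \<beta>) * q \<beta> * (of_nat (mu \<alpha>) * cot (\<beta> - \<alpha>)))"
    by (simp only: sum.distrib sum_distrib_left)
  also have "(\<Sum>\<alpha>\<in>B. \<Sum>\<beta>\<in>B - {\<alpha>}. of_nat (mu \<beta>) * q \<beta> * (of_nat (mu \<alpha>) * cot (\<beta> - \<alpha>)))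
      = (\<Sum>\<beta>\<in>B. \<Sum>\<alpha>\<in>B - {\<beta>}. of_nat (mu \<beta>) * q \<beta> * (of_nat (mu \<alpha>) * cot (\<beta> - \<alpha>)))"
  proof -
    have *: "(\<Sum>\<alpha>\<in>B. \<Sum>\<beta>\<in>B - {\<alpha>}. f \<alpha> \<beta>) = (\<Sum>\<alpha>\<in>B. \<Sum>\<beta>\<in>B. if \<alpha> = \<beta> then 0 else f \<alpha> \<beta>)"
      for f :: "complex \<Rightarrow> complex \<Rightarrow> complex"
    proof (rule sum.cong[OF HOL.refl])
      fix \<alpha> assume "\<alpha> \<in> B"
      show "(\<Sum>\<beta>\<in>B - {\<alpha>}. f \<alpha> \<beta>) = (\<Sum>\<beta>\<in>B. if \<alpha> = \<beta> then 0 else f \<alpha> \<beta>)"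
        using finite_B by (intro sum.mono_neutral_cong_left) auto
    qed
    show ?thesis unfolding * by (subst sum.swap) (intro sum.cong HOL.refl, auto)
  qed
  also have "\<dots> = (\<Sum>\<beta>\<in>B. of_nat (mu \<beta>) * q \<beta> * (\<Sum>\<alpha>\<in>B - {\<beta>}. of_nat (mu \<alpha>) * cot (\<beta> - \<alpha>)))"
    by (simp only: sum_distrib_left)
  finally show ?thesis using r by (simp add: cot1)
qed

lemma ev_pdiff_prod:
  assumes "finite C" and l: "\<And>\<alpha>. \<alpha> \<in> C \<Longrightarrow> ev (lf s \<alpha>) v \<noteq> 0"
  defines "n \<equiv> \<lambda>b \<alpha>. if b then cos \<alpha> else - sin \<alpha>"
  shows "ev (pdiff (s, b) (\<Prod>\<alpha>\<in>C. lf s \<alpha> ^ mu \<alpha>)) v = ev (\<Prod>\<alpha>\<in>C. lf s \<alpha> ^ mu \<alpha>) v * (\<Sum>\<alpha>\<in>C. of_nat (mu \<alpha>) * n b \<alpha> / ev (lf s \<alpha>) v)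
   \<and> ev (pdiff (s, b) (pdiff (s, b) (\<Prod>\<alpha>\<in>C. lf s \<alpha> ^ mu \<alpha>))) v = ev (\<Prod>\<alpha>\<in>C. lf s \<alpha> ^ mu \<alpha>) v *
      ((\<Sum>\<alpha>\<in>C. of_nat (mu \<alpha>) * n b \<alpha> / ev (lf s \<alpha>) v) ^ 2 - (\<Sum>\<alpha>\<in>C. of_nat (mu \<alpha>) * n b \<alpha> ^ 2 / ev (lf s \<alpha>) v ^ 2))"
  using assms(1) l
proof (induction C)
  case (insert \<alpha> C)
  let ?l = "ev (lf s \<alpha>) v" and ?P = "\<Prod>\<alpha>\<in>C. lf s \<alpha> ^ mu \<alpha>"
  have l: "?l \<noteq> 0" using insert.prems by simp
  have pl: "pdiff (s, b) (lf s \<alpha>) = Const (n b \<alpha>)"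
    by (cases b) (simp_all add: n_def glf_def pdiff_mult pdiff_Var Const_simps)
  have pow: "ev (pdiff (s, b) (lf s \<alpha> ^ k)) v = ?l ^ k * (of_nat k * n b \<alpha> / ?l)
     \<and> ev (pdiff (s, b) (pdiff (s, b) (lf s \<alpha> ^ k))) v = ?l ^ k * (of_nat k * (of_nat k - 1) * n b \<alpha> ^ 2 / ?l ^ 2)" for k
  proof (induction k)
    case (Suc k)
    then show ?case using l
      by (simp add: pdiff_mult pl) (simp add: field_simps power2_eq_square)
  qed simp
  define G S where "G = (\<Sum>\<alpha>\<in>C. of_nat (mu \<alpha>) * n b \<alpha> / ev (lf s \<alpha>) v)"
    and "S = (\<Sum>\<alpha>\<in>C. of_nat (mu \<alpha>) * n b \<alpha> ^ 2 / ev (lf s \<alpha>) v ^ 2)"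
  have IH: "ev (pdiff (s, b) ?P) v = ev ?P v * G" "ev (pdiff (s, b) (pdiff (s, b) ?P)) v = ev ?P v * (G ^ 2 - S)"
    using insert unfolding G_def S_def by auto
  have prod: "(\<Prod>\<alpha>\<in>insert \<alpha> C. lf s \<alpha> ^ mu \<alpha>) = lf s \<alpha> ^ mu \<alpha> * ?P" using insert.hyps by simp
  have sum1: "(\<Sum>\<alpha>\<in>insert \<alpha> C. of_nat (mu \<alpha>) * n b \<alpha> / ev (lf s \<alpha>) v) = of_nat (mu \<alpha>) * n b \<alpha> / ?l + G"
    and sum2: "(\<Sum>\<alpha>\<in>insert \<alpha> C. of_nat (mu \<alpha>) * n b \<alpha> ^ 2 / ev (lf s \<alpha>) v ^ 2) = of_nat (mu \<alpha>) * n b \<alpha> ^ 2 / ?l ^ 2 + S"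
    using insert.hyps by (simp_all add: G_def S_def)
  have "ev (pdiff (s, b) (lf s \<alpha> ^ mu \<alpha> * ?P)) v = ev (lf s \<alpha> ^ mu \<alpha> * ?P) v * (of_nat (mu \<alpha>) * n b \<alpha> / ?l + G)"
    unfolding pdiff_mult ev_simps IH conjunct1[OF pow] ev_power by (simp add: algebra_simps)
  moreover have "ev (pdiff (s, b) (pdiff (s, b) (lf s \<alpha> ^ mu \<alpha> * ?P))) v = ev (lf s \<alpha> ^ mu \<alpha> * ?P) v *
      ((of_nat (mu \<alpha>) * n b \<alpha> / ?l + G) ^ 2 - (of_nat (mu \<alpha>) * n b \<alpha> ^ 2 / ?l ^ 2 + S))"
    unfolding pdiff_mult pdiff_simps ev_simps IH conjunct1[OF pow] conjunct2[OF pow] ev_power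
    using l by (simp add: field_simps power2_eq_square)
  ultimately show ?case unfolding prod sum1 sum2 by blast
qed simp

text \<open>The first fraction is the quotient rule for the second derivatives of
  \<open>Q / \<delta>\<close>. Expressed by the logarithmic data \<open>G\<close> and
  \<open>S\<close> of \<delta>, its coefficient of \<open>Q\<close> is the sum of
  \<open>G b ^ 2 + S b\<close>; this equals the potential, because the mixed terms of the squares
  cancel by \<open>cross_sum\<close>.\<close>

lemma Op_eval:
  assumes l: "\<And>\<alpha>. \<alpha> \<in> B \<Longrightarrow> ev (lf s \<alpha>) v \<noteq> 0" and r: "ev (nsq s) v \<noteq> 0"
    and Q': "dD s * Q' = Op s Q"
  defines "d \<equiv> ev (dl s) v" and "p \<equiv> \<lambda>b. ev (pdiff (s, b) (dl s)) v" and "pp \<equiv> \<lambda>b. ev (pdiff (s, b) (pdiff (s, b) (dl s))) v"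
  shows "(\<Sum>b\<in>UNIV. d ^ 2 * ev (tw s b (tw s b Q)) v - 2 * d * p b * ev (tw s b Q) v + (2 * p b ^ 2 - d * pp b) * ev Q v) / d ^ 3
     - (\<Sum>\<alpha>\<in>B. of_nat (mu \<alpha> * (mu \<alpha> + 1)) / ev (lf s \<alpha>) v ^ 2) * (ev Q v / d) - ev (nsq (\<not> s)) v * (ev Q v / d)
     = ev Q' v / d"
proof -
  define n where "n = (\<lambda>b \<alpha> :: complex. if b then cos \<alpha> else - sin \<alpha>)"
  define L where "L = (\<lambda>\<alpha>. ev (lf s \<alpha>) v)"
  define G where "G = (\<lambda>b. \<Sum>\<alpha>\<in>B. of_nat (mu \<alpha>) * n b \<alpha> / L \<alpha>)"
  define S where "S = (\<lambda>b. \<Sum>\<alpha>\<in>B. of_nat (mu \<alpha>) * n b \<alpha> ^ 2 / L \<alpha> ^ 2)"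
  have L: "L \<alpha> \<noteq> 0" if "\<alpha> \<in> B" for \<alpha> using l that by (simp add: L_def)
  have d: "d \<noteq> 0" unfolding d_def dl_def using l finite_B by simp
  have p: "p b = d * G b" and pp: "pp b = d * (G b ^ 2 - S b)" for b
    using ev_pdiff_prod[of B s v b] finite_B l unfolding p_def pp_def d_def dl_def G_def S_def n_def L_def by blast+
  have trig: "cos \<alpha> * cos \<beta> + sin \<alpha> * sin \<beta> = cos (\<alpha> - \<beta>)" for \<alpha> \<beta> :: complex by (simp add: cos_diff)
  have SS: "S False + S True = (\<Sum>\<alpha>\<in>B. of_nat (mu \<alpha>) / L \<alpha> ^ 2)"
    unfolding S_def sum.distrib[symmetric] n_def
    by (intro sum.cong HOL.refl) (simp add: add_divide_distrib[symmetric] distrib_left[symmetric])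
  have GG: "G False ^ 2 + G True ^ 2 = (\<Sum>\<alpha>\<in>B. of_nat (mu \<alpha>) ^ 2 / L \<alpha> ^ 2)"
  proof -
    have "G False ^ 2 + G True ^ 2 = (\<Sum>\<alpha>\<in>B. \<Sum>\<beta>\<in>B. of_nat (mu \<alpha>) * of_nat (mu \<beta>) * cos (\<alpha> - \<beta>) / (L \<alpha> * L \<beta>))"
      unfolding G_def power2_eq_square sum_product sum.distrib[symmetric] trig[symmetric]
      by (intro sum.cong HOL.refl) (simp add: n_def add_divide_distrib algebra_simps)
    also have "\<dots> = (\<Sum>\<alpha>\<in>B. of_nat (mu \<alpha>) ^ 2 / L \<alpha> ^ 2 + (\<Sum>\<beta>\<in>B - {\<alpha>}. of_nat (mu \<alpha>) * of_nat (mu \<beta>) * cos (\<alpha> - \<beta>) / (L \<alpha> * L \<beta>)))"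
      by (intro sum.cong HOL.refl) (subst sum.remove[OF finite_B], auto simp: power2_eq_square)
    also have "\<dots> = (\<Sum>\<alpha>\<in>B. of_nat (mu \<alpha>) ^ 2 / L \<alpha> ^ 2)
        + (\<Sum>\<alpha>\<in>B. \<Sum>\<beta>\<in>B - {\<alpha>}. of_nat (mu \<alpha>) * of_nat (mu \<beta>) * cos (\<alpha> - \<beta>) / (L \<alpha> * L \<beta>))"
      by (rule sum.distrib)
    also have "(\<Sum>\<alpha>\<in>B. \<Sum>\<beta>\<in>B - {\<alpha>}. of_nat (mu \<alpha>) * of_nat (mu \<beta>) * cos (\<alpha> - \<beta>) / (L \<alpha> * L \<beta>)) = 0"
    proof (rule cross_sum)
      fix \<alpha> \<beta> :: complex
      show "ev (tf s \<alpha>) v * L \<beta> - ev (tf s \<beta>) v * L \<alpha> = sin (\<alpha> - \<beta>) * ev (nsq s) v"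
        by (simp add: L_def glf_def gtf_def nsq_def sin_diff power2_eq_square algebra_simps)
    qed (use L r in auto)
    finally show ?thesis by simp
  qed
  have u: "(\<Sum>\<alpha>\<in>B. of_nat (mu \<alpha> * (mu \<alpha> + 1)) / ev (lf s \<alpha>) v ^ 2) = G False ^ 2 + G True ^ 2 + (S False + S True)"
    unfolding SS GG sum.distrib[symmetric] L_def
    by (intro sum.cong HOL.refl) (simp add: add_divide_distrib[symmetric] algebra_simps power2_eq_square)
  have first: "(\<Sum>\<alpha>\<in>B. of_nat (mu \<alpha>) * ev (nd s \<alpha> Q) v / L \<alpha>) = G False * ev (tw s False Q) v + G True * ev (tw s True Q) v"
    unfolding G_def sum_distrib_right sum.distrib[symmetric]
    by (intro sum.cong HOL.refl) (simp add: n_def nd_def divide_simps, simp add: algebra_simps)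
  have "ev Q' v = ev (lapl s Q) v - ev (nsq (\<not> s)) v * ev Q v - 2 * (\<Sum>\<alpha>\<in>B. of_nat (mu \<alpha>) * ev (nd s \<alpha> Q) v / L \<alpha>)"
  proof -
    have D: "ev (dD s) v \<noteq> 0" unfolding dD_def using l finite_B by simp
    have "ev (dD s) v * ev Q' v = ev (Op s Q) v" using arg_cong[OF Q', of "\<lambda>p. ev p v"] by simp
    also have "\<dots> = ev (dD s) v * (ev (lapl s Q) v - ev (nsq (\<not> s)) v * ev Q v)
        - (\<Sum>\<alpha>\<in>B. 2 * of_nat (mu \<alpha>) * ev (dR s \<alpha>) v * ev (nd s \<alpha> Q) v)"
      by (simp add: Op_def)
    also have "(\<Sum>\<alpha>\<in>B. 2 * of_nat (mu \<alpha>) * ev (dR s \<alpha>) v * ev (nd s \<alpha> Q) v)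
        = ev (dD s) v * (2 * (\<Sum>\<alpha>\<in>B. of_nat (mu \<alpha>) * ev (nd s \<alpha> Q) v / L \<alpha>))"
      unfolding sum_distrib_left
    proof (intro sum.cong HOL.refl)
      fix \<alpha> assume \<alpha>: "\<alpha> \<in> B"
      have "ev (dD s) v = L \<alpha> * ev (dR s \<alpha>) v" unfolding dD_eq[OF \<alpha>] L_def by simp
      then show "2 * of_nat (mu \<alpha>) * ev (dR s \<alpha>) v * ev (nd s \<alpha> Q) v
          = ev (dD s) v * (2 * (of_nat (mu \<alpha>) * ev (nd s \<alpha> Q) v / L \<alpha>))" using L[OF \<alpha>] by simp
    qed
    finally show ?thesis using D by (simp add: right_diff_distrib[symmetric])
  qed
  then have Q'_eq: "ev Q' v = (ev (tw s False (tw s False Q)) v + ev (tw s True (tw s True Q)) v) - ev (nsq (\<not> s)) v * ev Q v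
      - 2 * (G False * ev (tw s False Q) v + G True * ev (tw s True Q) v)"
    unfolding first lapl_def by simp
  have per: "(d ^ 2 * x - 2 * d * (d * g) * y + (2 * (d * g) ^ 2 - d * (d * (g ^ 2 - t))) * q) / d ^ 3
      = (x - 2 * g * y + (g ^ 2 + t) * q) / d" for x g y t q :: complex
    using d by (simp add: field_simps power2_eq_square power3_eq_cube)
  have "(\<Sum>b\<in>UNIV. d ^ 2 * ev (tw s b (tw s b Q)) v - 2 * d * p b * ev (tw s b Q) v + (2 * p b ^ 2 - d * pp b) * ev Q v) / d ^ 3
      = (\<Sum>b\<in>UNIV. ev (tw s b (tw s b Q)) v - 2 * G b * ev (tw s b Q) v + (G b ^ 2 + S b) * ev Q v) / d"
    unfolding sum_divide_distrib p pp per ..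
  then show ?thesis
    unfolding u Q'_eq by (simp add: UNIV_bool diff_divide_distrib add_divide_distrib algebra_simps)
qed

end

text \<open>The last two conditions concern the point \<open>x = 0\<close> where the derivatives are
  taken: it lies on no shifted line of \<open>B\<close>, and the vector to \<xi> is not isotropic,
  since \<open>cross_sum\<close> divides by its squared length.\<close>

locale ba_shift = ba B mu for B :: "complex set" and mu :: "complex \<Rightarrow> nat" +
  fixes Pa :: "complex set" and \<xi>1 \<xi>2 :: complex
  assumes finite_Pa: "finite Pa" and B_eq: "B = {\<alpha> \<in> Pa. mu \<alpha> > 0}"
    and xi_lin: "\<And>\<alpha>. \<alpha> \<in> B \<Longrightarrow> lin \<alpha> (- \<xi>1) (- \<xi>2) \<noteq> 0"
    and xi_nsq: "\<xi>1 ^ 2 + \<xi>2 ^ 2 \<noteq> 0"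
begin

definition val :: "complex \<Rightarrow> complex \<Rightarrow> complex \<Rightarrow> complex \<Rightarrow> idx \<Rightarrow> complex" where
  "val z1 z2 x1 x2 = (\<lambda>i. if fst i then (if snd i then z2 else z1) else (if snd i then x2 - \<xi>2 else x1 - \<xi>1))"

definition reg :: "complex \<Rightarrow> complex \<Rightarrow> bool" where
  "reg x1 x2 \<longleftrightarrow> (\<forall>\<alpha>\<in>B. lin \<alpha> (x1 - \<xi>1) (x2 - \<xi>2) \<noteq> 0) \<and> (x1 - \<xi>1) ^ 2 + (x2 - \<xi>2) ^ 2 \<noteq> 0"

text \<open>A class of functions closed under both partial derivatives. Each derivative raises
  \<open>k\<close> by one and replaces the numerator by \<open>stp\<close>, in which the exponential
  has turned the derivative into \<open>tw\<close>.\<close>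

definition quot :: "complex \<Rightarrow> complex \<Rightarrow> idx pfun \<Rightarrow> nat \<Rightarrow> cfun2" where
  "quot z1 z2 A k = (\<lambda>x1 x2. exp (x1 * z1 + x2 * z2) * ev A (val z1 z2 x1 x2) / ev (dl False) (val z1 z2 x1 x2) ^ k)"

definition stp :: "bool \<Rightarrow> idx pfun \<Rightarrow> nat \<Rightarrow> idx pfun" where
  "stp b A k = dl False * tw False b A - of_nat k * pdiff (False, b) (dl False) * A"

lemma ev_lf_val: "ev (lf False \<alpha>) (val z1 z2 x1 x2) = lin \<alpha> (x1 - \<xi>1) (x2 - \<xi>2)"
  by (simp add: glf_def lin_def val_def)

lemma ev_dl_val: "ev (dl False) (val z1 z2 x1 x2) = (\<Prod>\<alpha>\<in>B. lin \<alpha> (x1 - \<xi>1) (x2 - \<xi>2) ^ mu \<alpha>)"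
  by (simp add: dl_def ev_lf_val)

lemma ev_nsq_val: "ev (nsq False) (val z1 z2 x1 x2) = (x1 - \<xi>1) ^ 2 + (x2 - \<xi>2) ^ 2"
  "ev (nsq True) (val z1 z2 x1 x2) = z1 ^ 2 + z2 ^ 2"
  by (simp_all add: nsq_def val_def)

lemma reg_dl: "reg x1 x2 \<Longrightarrow> ev (dl False) (val z1 z2 x1 x2) \<noteq> 0"
  unfolding ev_dl_val using finite_B by (simp add: reg_def)

lemma reg_0: "reg 0 0"
  using xi_lin xi_nsq by (simp add: reg_def)

lemma ev_val_deriv:
  "((\<lambda>t. ev A (val z1 z2 t x2)) has_field_derivative ev (pdiff (False, False) A) (val z1 z2 x1 x2)) (at x1)"
  "((\<lambda>t. ev A (val z1 z2 x1 t)) has_field_derivative ev (pdiff (False, True) A) (val z1 z2 x1 x2)) (at x2)"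
proof -
  have "((\<lambda>t. val z1 z2 t x2 i) has_field_derivative (if i = (False, False) then 1 else 0)) (at x1)" for i
    unfolding val_def by (cases "fst i"; cases "snd i"; cases i) (auto intro!: derivative_eq_intros)
  from ev_chain[OF this, of A]
  have "((\<lambda>t. ev A (val z1 z2 t x2)) has_field_derivative
    (\<Sum>i\<in>UNIV. ev (pdiff i A) (val z1 z2 x1 x2) * (if i = (False, False) then 1 else 0))) (at x1)" .
  also have "(\<Sum>i\<in>UNIV. ev (pdiff i A) (val z1 z2 x1 x2) * (if i = (False, False) then 1 else 0))
      = (\<Sum>i\<in>UNIV. if i = (False, False) then ev (pdiff i A) (val z1 z2 x1 x2) else 0)"
    by (intro sum.cong) auto
  finally show "((\<lambda>t. ev A (val z1 z2 t x2)) has_field_derivative ev (pdiff (False, False) A) (val z1 z2 x1 x2)) (at x1)"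
    by simp
  have "((\<lambda>t. val z1 z2 x1 t i) has_field_derivative (if i = (False, True) then 1 else 0)) (at x2)" for i
    unfolding val_def by (cases "fst i"; cases "snd i"; cases i) (auto intro!: derivative_eq_intros)
  from ev_chain[OF this, of A]
  have "((\<lambda>t. ev A (val z1 z2 x1 t)) has_field_derivative
    (\<Sum>i\<in>UNIV. ev (pdiff i A) (val z1 z2 x1 x2) * (if i = (False, True) then 1 else 0))) (at x2)" .
  also have "(\<Sum>i\<in>UNIV. ev (pdiff i A) (val z1 z2 x1 x2) * (if i = (False, True) then 1 else 0))
      = (\<Sum>i\<in>UNIV. if i = (False, True) then ev (pdiff i A) (val z1 z2 x1 x2) else 0)"
    by (intro sum.cong) auto
  finally show "((\<lambda>t. ev A (val z1 z2 x1 t)) has_field_derivative ev (pdiff (False, True) A) (val z1 z2 x1 x2)) (at x2)"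
    by simp
qed

lemma reg_eventually:
  assumes "reg x1 x2"
  shows "eventually (\<lambda>t. reg t x2) (nhds x1)" "eventually (\<lambda>t. reg x1 t) (nhds x2)"
proof -
  define P where "P = dD False * nsq False"
  have P: "reg a b \<longleftrightarrow> ev P (val 0 0 a b) \<noteq> 0" for a b
    using finite_B by (simp add: P_def dD_def ev_lf_val ev_nsq_val reg_def)
  have "isCont (\<lambda>t. ev P (val 0 0 t x2)) x1" "isCont (\<lambda>t. ev P (val 0 0 x1 t)) x2"
    using ev_val_deriv DERIV_isCont by blast+
  then have "((\<lambda>t. ev P (val 0 0 t x2)) \<longlongrightarrow> ev P (val 0 0 x1 x2)) (nhds x1)"
    "((\<lambda>t. ev P (val 0 0 x1 t)) \<longlongrightarrow> ev P (val 0 0 x1 x2)) (nhds x2)"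
    using tendsto_at_iff_tendsto_nhds[of "\<lambda>t. ev P (val 0 0 t x2)" x1]
      tendsto_at_iff_tendsto_nhds[of "\<lambda>t. ev P (val 0 0 x1 t)" x2]
    by (simp_all add: isCont_def)
  then show "eventually (\<lambda>t. reg t x2) (nhds x1)" "eventually (\<lambda>t. reg x1 t) (nhds x2)"
    using assms tendsto_imp_eventually_ne unfolding P by blast+
qed

lemma quot_deriv:
  assumes "reg x1 x2"
  shows "((\<lambda>t. quot z1 z2 A k t x2) has_field_derivative quot z1 z2 (stp False A k) (Suc k) x1 x2) (at x1)"
    and "((\<lambda>t. quot z1 z2 A k x1 t) has_field_derivative quot z1 z2 (stp True A k) (Suc k) x1 x2) (at x2)"
proof -
  let ?v = "val z1 z2 x1 x2" and ?d = "ev (dl False) (val z1 z2 x1 x2)"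
  have d: "?d \<noteq> 0" by (rule reg_dl[OF assms])
  have V: "ev (Var (True, b)) ?v = (if b then z2 else z1)" for b by (simp add: val_def)
  have calc: "((E * z) * a + E * a') * (1 / ?d ^ k) + E * a * (- of_nat k * d' / ?d ^ Suc k)
      = E * (?d * (a' + z * a) - of_nat k * d' * a) / ?d ^ Suc k" for E z a a' d' :: complex
    using d by (simp add: field_simps)
  have inv: "((\<lambda>t. 1 / f t ^ k) has_field_derivative (- of_nat k * d' / ?d ^ Suc k)) (at x)"
    if "(f has_field_derivative d') (at x)" "f x = ?d" for f d' x
  proof -
    have 1: "((\<lambda>t. inverse (f t) ^ k) has_field_derivative
        of_nat k * inverse (f x) ^ (k - Suc 0) * (- (inverse (f x) * d' * inverse (f x)))) (at x)"
      using that d by (auto intro!: derivative_eq_intros)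
    have 2: "of_nat k * inverse (f x) ^ (k - Suc 0) * (- (inverse (f x) * d' * inverse (f x)))
        = - of_nat k * d' / ?d ^ Suc k"
      using d that(2) by (cases k) (simp_all add: field_simps)
    have "(\<lambda>t. 1 / f t ^ k) = (\<lambda>t. inverse (f t) ^ k)"
      by (simp add: fun_eq_iff divide_inverse power_inverse)
    then show ?thesis using DERIV_cong[OF 1 2] by (simp only:)
  qed
  have "((\<lambda>t. exp (t * z1 + x2 * z2) * ev A (val z1 z2 t x2) * (1 / ev (dl False) (val z1 z2 t x2) ^ k)) has_field_derivative
      ((exp (x1 * z1 + x2 * z2) * z1) * ev A ?v + exp (x1 * z1 + x2 * z2) * ev (pdiff (False, False) A) ?v) * (1 / ?d ^ k)
      + exp (x1 * z1 + x2 * z2) * ev A ?v * (- of_nat k * ev (pdiff (False, False) (dl False)) ?v / ?d ^ Suc k)) (at x1)"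
    by (rule DERIV_mult'[THEN DERIV_cong, OF DERIV_mult' inv])
      (auto intro!: derivative_eq_intros ev_val_deriv)
  then show "((\<lambda>t. quot z1 z2 A k t x2) has_field_derivative quot z1 z2 (stp False A k) (Suc k) x1 x2) (at x1)"
    unfolding calc quot_def stp_def tw_def using V[of False] by simp
  have "((\<lambda>t. exp (x1 * z1 + t * z2) * ev A (val z1 z2 x1 t) * (1 / ev (dl False) (val z1 z2 x1 t) ^ k)) has_field_derivative
      ((exp (x1 * z1 + x2 * z2) * z2) * ev A ?v + exp (x1 * z1 + x2 * z2) * ev (pdiff (False, True) A) ?v) * (1 / ?d ^ k)
      + exp (x1 * z1 + x2 * z2) * ev A ?v * (- of_nat k * ev (pdiff (False, True) (dl False)) ?v / ?d ^ Suc k)) (at x2)"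
    by (rule DERIV_mult'[THEN DERIV_cong, OF DERIV_mult' inv])
      (auto intro!: derivative_eq_intros ev_val_deriv)
  then show "((\<lambda>t. quot z1 z2 A k x1 t) has_field_derivative quot z1 z2 (stp True A k) (Suc k) x1 x2) (at x2)"
    unfolding calc quot_def stp_def tw_def using V[of True] by simp
qed

text \<open>Agreement is asked at regular points only, since on the singular lines the quotients
  have arbitrary values. Along each coordinate axis regularity persists near the point, which is all
  that \<open>deriv\<close> sees.\<close>

lemma pd_quot:
  assumes u: "\<And>a b. reg a b \<Longrightarrow> u a b = quot z1 z2 A k a b" and r: "reg x1 x2"
  shows "pd1 u x1 x2 = quot z1 z2 (stp False A k) (Suc k) x1 x2"
    and "pd2 u x1 x2 = quot z1 z2 (stp True A k) (Suc k) x1 x2"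
proof -
  have "eventually (\<lambda>t. u t x2 = quot z1 z2 A k t x2) (nhds x1)"
    using reg_eventually(1)[OF r] by eventually_elim (rule u)
  from DERIV_cong_ev[OF HOL.refl this HOL.refl] quot_deriv(1)[OF r]
  show "pd1 u x1 x2 = quot z1 z2 (stp False A k) (Suc k) x1 x2"
    unfolding pd1_def by (intro DERIV_imp_deriv) blast
  have "eventually (\<lambda>t. u x1 t = quot z1 z2 A k x1 t) (nhds x2)"
    using reg_eventually(2)[OF r] by eventually_elim (rule u)
  from DERIV_cong_ev[OF HOL.refl this HOL.refl] quot_deriv(2)[OF r]
  show "pd2 u x1 x2 = quot z1 z2 (stp True A k) (Suc k) x1 x2"
    unfolding pd2_def by (intro DERIV_imp_deriv) blast
qed

lemma opL_quot:
  assumes u: "\<And>a b. reg a b \<Longrightarrow> u a b = quot z1 z2 Q 1 a b" and r: "reg x1 x2"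
    and Q': "dD False * Q' = Op False Q"
  shows "opL Pa mu \<xi>1 \<xi>2 z1 z2 u x1 x2 = quot z1 z2 Q' 1 x1 x2"
proof -
  let ?v = "val z1 z2 x1 x2" and ?E = "exp (x1 * z1 + x2 * z2)"
  define d where "d = ev (dl False) ?v"
  have 1: "pd1 (pd1 u) x1 x2 = quot z1 z2 (stp False (stp False Q 1) 2) 3 x1 x2"
    using pd_quot(1)[of "pd1 u" z1 z2 "stp False Q 1" 2 x1 x2] pd_quot(1)[OF u] r by (simp add: numeral_eq_Suc)
  have 2: "pd2 (pd2 u) x1 x2 = quot z1 z2 (stp True (stp True Q 1) 2) 3 x1 x2"
    using pd_quot(2)[of "pd2 u" z1 z2 "stp True Q 1" 2 x1 x2] pd_quot(2)[OF u] r by (simp add: numeral_eq_Suc)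
  have stp2: "stp b (stp b Q 1) 2 = dl False ^ 2 * tw False b (tw False b Q) - 2 * dl False * pdiff (False, b) (dl False) * tw False b Q
      + (2 * pdiff (False, b) (dl False) ^ 2 - dl False * pdiff (False, b) (pdiff (False, b) (dl False))) * Q" for b
    by (simp add: stp_def tw_def pdiff_mult pdiff_Var power2_eq_square algebra_simps)
  have u3: "u x1 x2 = ?E * (ev Q ?v / d)" using u[OF r] by (simp add: quot_def d_def)
  have pot: "(\<Sum>\<alpha>\<in>Pa. of_nat (mu \<alpha> * (mu \<alpha> + 1)) / lin \<alpha> (x1 - \<xi>1) (x2 - \<xi>2) ^ 2)
      = (\<Sum>\<alpha>\<in>B. of_nat (mu \<alpha> * (mu \<alpha> + 1)) / ev (lf False \<alpha>) ?v ^ 2)"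
    unfolding ev_lf_val by (rule sum.mono_neutral_right) (use finite_Pa B_eq in auto)
  have key: "(\<Sum>b\<in>UNIV. d ^ 2 * ev (tw False b (tw False b Q)) ?v - 2 * d * ev (pdiff (False, b) (dl False)) ?v * ev (tw False b Q) ?v
       + (2 * ev (pdiff (False, b) (dl False)) ?v ^ 2 - d * ev (pdiff (False, b) (pdiff (False, b) (dl False))) ?v) * ev Q ?v) / d ^ 3
     - (\<Sum>\<alpha>\<in>B. of_nat (mu \<alpha> * (mu \<alpha> + 1)) / ev (lf False \<alpha>) ?v ^ 2) * (ev Q ?v / d) - (z1 ^ 2 + z2 ^ 2) * (ev Q ?v / d)
     = ev Q' ?v / d"
    using Op_eval[of False ?v Q' Q] r Q' unfolding d_def
    by (simp add: ev_lf_val ev_nsq_val reg_def)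
  have q3: "quot z1 z2 (stp b (stp b Q 1) 2) 3 x1 x2 = ?E * ((d ^ 2 * ev (tw False b (tw False b Q)) ?v
       - 2 * d * ev (pdiff (False, b) (dl False)) ?v * ev (tw False b Q) ?v
       + (2 * ev (pdiff (False, b) (dl False)) ?v ^ 2 - d * ev (pdiff (False, b) (pdiff (False, b) (dl False))) ?v) * ev Q ?v) / d ^ 3)" for b
    unfolding quot_def stp2 d_def by simp
  have gen: "e * (a / c) + e * (b / c) - w * (e * q) - y * (e * q) = e * ((a + b) / c - w * q - y * q)"
    for e a b c w q y :: complex by (simp add: add_divide_distrib algebra_simps)
  have sum_bool: "(\<Sum>b\<in>UNIV. f b) = f False + f True" for f :: "bool \<Rightarrow> complex"
    by (simp add: UNIV_bool)
  have "opL Pa mu \<xi>1 \<xi>2 z1 z2 u x1 x2 = ?E * (ev Q' ?v / d)"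
    unfolding opL_def 1 2 pot u3 q3 key[symmetric] sum_bool by (rule gen)
  then show ?thesis by (simp add: quot_def d_def)
qed

lemma opL_funpow:
  assumes "reg x1 x2"
  shows "(opL Pa mu \<xi>1 \<xi>2 z1 z2 ^^ n)
      (\<lambda>y1 y2. (\<Prod>\<alpha>\<in>Pa. lin \<alpha> (y1 - \<xi>1) (y2 - \<xi>2) ^ mu \<alpha>) * exp (y1 * z1 + y2 * z2)) x1 x2
    = quot z1 z2 (Qs n) 1 x1 x2"
  using assms
proof (induction n arbitrary: x1 x2)
  case 0
  have "(\<Prod>\<alpha>\<in>Pa. lin \<alpha> (x1 - \<xi>1) (x2 - \<xi>2) ^ mu \<alpha>) = ev (dl False) (val z1 z2 x1 x2)"
    unfolding ev_dl_val by (rule prod.mono_neutral_right) (use finite_Pa B_eq in auto)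
  then show ?case using reg_dl[OF 0, of z1 z2] by (simp add: quot_def power2_eq_square)
next
  case (Suc n)
  show ?case
    unfolding funpow.simps o_def by (rule opL_quot[OF Suc.IH Suc.prems Qs_Suc])
qed

lemma cN_neq_0: "cN \<noteq> 0"
  by (simp add: cN_def)

lemma Psi_quot:
  assumes "reg x1 x2"
  shows "Psi Pa mu \<xi>1 \<xi>2 z1 z2 x1 x2 = quot z1 z2 (Const (1 / cN) * Qf) 1 x1 x2"
proof -
  have "(\<Sum>\<alpha>\<in>Pa. mu \<alpha>) = N"
    unfolding N_def by (rule sum.mono_neutral_right) (use finite_Pa B_eq in auto)
  then show ?thesis
    using opL_funpow[OF assms, where n = N] by (simp add: Psi_def Let_def quot_def cN_def)
qed

text \<open>What derivatives in \<open>x\<close> preserve: quasi-invariance in \<open>z\<close>, and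
  a leading form in \<open>z\<close> whose coefficient is the power of \<open>dl False\<close>
  standing in the denominator, so that it cancels in the quotient.\<close>

definition good :: "nat \<Rightarrow> nat \<Rightarrow> idx pfun \<Rightarrow> nat \<Rightarrow> bool" where
  "good i j A k \<longleftrightarrow> QI True A \<and>
    lower (own True) (deg + int i + int j) (A - Var (True, False) ^ i * Var (True, True) ^ j * dl True * dl False ^ k)"

lemma hom_own_Var: "hom (own True) 1 (Var (True, b))" "hom (own True) 0 (Var (False, b))"
  using hom_Var[of "\<lambda>i. if own True i then 1 else 0" "(True, b)"] hom_Var[of "\<lambda>i. if own True i then 1 else 0" "(False, b)"]
  by simp_all

lemma hom_dl_own: "hom (own True) deg (dl True)" "hom (own True) 0 (dl False)"
  using hom_dl[of True] whom_dl[of "\<lambda>i. if own True i then 1 else 0" "\<lambda>s. if s = True then 1 else 0" False] by simp_all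

lemma good_0: "good 0 0 (Const (1 / cN) * Qf) 1"
proof -
  have "lower (own True) deg (Const (1 / cN) * (Qf - Const cN * dl False * dl True))"
    by (rule lower_Const_mult[OF Qf_top_dual])
  moreover have "Const (1 / cN) * (Qf - Const cN * dl False * dl True) = Const (1 / cN) * Qf - dl True * dl False"
    using cN_neq_0 by (intro pfun_eqI) (simp add: field_simps)
  ultimately show ?thesis
    using QI_mult_free[OF QI_dual, of "Const (1 / cN)"] by (simp add: good_def)
qed

text \<open>Among the terms of \<open>stp\<close>, only the multiplication by a coordinate of
  \<open>z\<close> inside \<open>tw\<close> raises the degree in \<open>z\<close>. Seen from
  \<open>z\<close>, \<open>tw False b\<close> is a dual derivative and the other coefficients are
  constants, so quasi-invariance survives.\<close>

lemma good_stp: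
  assumes "good i j A k"
  shows "good (if b then i else Suc i) (if b then Suc j else j) (stp b A k) (Suc k)"
proof -
  let ?n = "deg + int i + int j" and ?M = "Var (True, False) ^ i * Var (True, True) ^ j * dl True * dl False ^ k"
  have QA: "QI True A" and low: "lower (own True) ?n (A - ?M)" using assms by (simp_all add: good_def)
  have x_free: "pdiff (True, c) (dl False) = 0" "pdiff (True, c) (pdiff (False, b) (dl False)) = 0" for c
    using pdiff_dl[of True c] by (simp_all add: pdiff_commute[of "(True, c)"])
  have "QI True (tw False b A)" using QI_tw_dual[OF QA] by simp
  then have Q: "QI True (stp b A k)"
    unfolding stp_def by (intro QI_diff QI_mult_free QA) (simp_all add: x_free pdiff_mult)
  have hd: "hom (own True) 0 (pdiff (False, b) (dl False))"
    using hom_pdiff[OF hom_dl_own(2), of "(False, b)"] by simp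
  have hM: "hom (own True) ?n ?M"
  proof -
    have "hom (own True) (int i * 1 + int j * 1 + deg + int k * 0) ?M"
      by (intro hom_mult hom_power hom_own_Var hom_dl_own)
    then show ?thesis by (simp add: algebra_simps)
  qed
  have "lower (own True) (?n + 1) ((A - ?M) + ?M)"
    by (intro lower_add lower_mono[OF low] lower_hom[OF hM]) simp_all
  then have lA: "lower (own True) (?n + 1) A" by simp
  have l1: "lower (own True) (?n + 1) (dl False * (Var (True, b) * (A - ?M)))"
    by (intro lower_hom_mult[OF lower_hom_mult[OF low hom_own_Var(1)] hom_dl_own(2)]) simp_all
  have l2: "lower (own True) (?n + 1) (dl False * pdiff (False, b) A)"
    by (rule lower_hom_mult[OF _ hom_dl_own(2)]) (use lower_pdiff[OF lA, of "(False, b)"] in simp_all)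
  have l3: "lower (own True) (?n + 1) (of_nat k * pdiff (False, b) (dl False) * A)"
    by (rule lower_hom_mult[OF lA]) (use hom_mult[OF hom_of_nat hd] in simp_all)
  have "lower (own True) (?n + 1) (dl False * (Var (True, b) * (A - ?M)) + dl False * pdiff (False, b) A - of_nat k * pdiff (False, b) (dl False) * A)"
    by (intro lower_diff lower_add l1 l2 l3)
  moreover have "dl False * (Var (True, b) * (A - ?M)) + dl False * pdiff (False, b) A - of_nat k * pdiff (False, b) (dl False) * A
      = stp b A k - Var (True, b) * ?M * dl False"
    by (simp add: stp_def tw_def algebra_simps)
  ultimately show ?thesis
    using Q by (cases b) (simp_all add: good_def algebra_simps)
qed

text \<open>The order of quantifiers matters: one numerator \<open>A\<close> serves all
  \<open>z\<close>, which makes the value at \<open>x = 0\<close> a polynomial in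
  \<open>z\<close>.\<close>

lemma wfun_quot:
  "\<exists>A k. good i j A k \<and> (\<forall>z1 z2 x1 x2. reg x1 x2 \<longrightarrow> (pd1 ^^ i) ((pd2 ^^ j) (Psi Pa mu \<xi>1 \<xi>2 z1 z2)) x1 x2 = quot z1 z2 A k x1 x2)"
proof (induction i)
  case 0
  show ?case
  proof (induction j)
    case 0
    show ?case using good_0 Psi_quot by (intro exI[of _ "Const (1 / cN) * Qf"] exI[of _ 1]) simp
  next
    case (Suc j)
    then obtain A k where A: "good 0 j A k"
      "\<And>z1 z2 x1 x2. reg x1 x2 \<Longrightarrow> (pd1 ^^ 0) ((pd2 ^^ j) (Psi Pa mu \<xi>1 \<xi>2 z1 z2)) x1 x2 = quot z1 z2 A k x1 x2" by blast
    show ?case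
      using good_stp[OF A(1), of True] pd_quot(2)[OF A(2)]
      by (intro exI[of _ "stp True A k"] exI[of _ "Suc k"]) simp
  qed
next
  case (Suc i)
  then obtain A k where A: "good i j A k"
    "\<And>z1 z2 x1 x2. reg x1 x2 \<Longrightarrow> (pd1 ^^ i) ((pd2 ^^ j) (Psi Pa mu \<xi>1 \<xi>2 z1 z2)) x1 x2 = quot z1 z2 A k x1 x2" by blast
  show ?case
    using good_stp[OF A(1), of False] pd_quot(1)[OF A(2)]
    by (intro exI[of _ "stp False A k"] exI[of _ "Suc k"]) simp
qed

definition dl2 :: "bool pfun" where "dl2 = (\<Prod>\<alpha>\<in>B. l2 \<alpha> ^ mu \<alpha>)"

lemma wfun_form:
  "\<exists>w. wfun Pa mu \<xi>1 \<xi>2 (i, j) = fn2 w \<and> (\<forall>\<alpha>\<in>B. qc2 \<alpha> (Const (lin \<alpha> (- \<xi>1) (- \<xi>2))) (mu \<alpha>) w) \<and>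
    lower all_vars (deg + int i + int j) (w - Var False ^ i * Var True ^ j * dl2)"
proof -
  obtain A k where A: "good i j A k"
    "\<And>z1 z2 x1 x2. reg x1 x2 \<Longrightarrow> (pd1 ^^ i) ((pd2 ^^ j) (Psi Pa mu \<xi>1 \<xi>2 z1 z2)) x1 x2 = quot z1 z2 A k x1 x2"
    using wfun_quot by blast
  define d where "d = (\<Prod>\<alpha>\<in>B. lin \<alpha> (- \<xi>1) (- \<xi>2) ^ mu \<alpha>)"
  have d: "d \<noteq> 0" unfolding d_def using finite_B xi_lin by simp
  let ?S = "specx (- \<xi>1) (- \<xi>2)"
  have prod: "?S (prod f C) = (\<Prod>a\<in>C. ?S (f a))" for f and C :: "complex set"
    by (simp add: specx_def subst_prod)
  have S_dl: "?S (dl False) = Const d" "?S (dl True) = dl2"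
    by (simp_all add: dl_def dl2_def d_def prod specx_lf) (rule pfun_eqI, simp)
  define w where "w = Const (1 / d ^ k) * ?S A"
  have "wfun Pa mu \<xi>1 \<xi>2 (i, j) z1 z2 = fn2 w z1 z2" for z1 z2
  proof -
    have "wfun Pa mu \<xi>1 \<xi>2 (i, j) z1 z2 = quot z1 z2 A k 0 0" using A(2)[OF reg_0] by (simp add: wfun_def)
    also have "\<dots> = ev A (val z1 z2 0 0) / d ^ k" by (simp add: quot_def ev_dl_val d_def)
    also have "ev A (val z1 z2 0 0) = ev (?S A) (\<lambda>b. if b then z2 else z1)"
      unfolding specx_def ev_subst val_def by (rule arg_cong[of _ _ "ev A"]) (auto simp: fun_eq_iff)
    finally show ?thesis by (simp add: w_def fn2_def)
  qed
  moreover have "qc2 \<alpha> (Const (lin \<alpha> (- \<xi>1) (- \<xi>2))) (mu \<alpha>) w" if "\<alpha> \<in> B" for \<alpha>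
  proof -
    have "qi True \<alpha> (mu \<alpha>) (Const (1 / d ^ k) * A)"
      using A(1) that by (intro qi_mult_free) (simp_all add: good_def QI_def)
    from qi_specx[OF this] show ?thesis by (simp add: w_def)
  qed
  moreover have "lower all_vars (deg + int i + int j) (w - Var False ^ i * Var True ^ j * dl2)"
  proof -
    have "lower (own True) (deg + int i + int j) (A - Var (True, False) ^ i * Var (True, True) ^ j * dl True * dl False ^ k)"
      using A(1) by (simp add: good_def)
    from lower_Const_mult[OF lower_specx[OF this, of "- \<xi>1" "- \<xi>2"], of "1 / d ^ k"]
    have "lower all_vars (deg + int i + int j) (Const (1 / d ^ k) * (?S A - Var False ^ i * Var True ^ j * dl2 * Const d ^ k))"
      by (simp add: S_dl)
    moreover have "Const (1 / d ^ k) * (?S A - Var False ^ i * Var True ^ j * dl2 * Const d ^ k) = w - Var False ^ i * Var True ^ j * dl2"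
      unfolding w_def using d by (intro pfun_eqI) (simp add: field_simps)
    ultimately show ?thesis by simp
  qed
  ultimately show ?thesis by (intro exI[of _ w]) (auto simp: fun_eq_iff)
qed

end

lemma qc2_add: "qc2 \<alpha> \<kappa> k p \<Longrightarrow> qc2 \<alpha> \<kappa> k q \<Longrightarrow> qc2 \<alpha> \<kappa> k (p + q)"
proof -
  assume "qc2 \<alpha> \<kappa> k p" "qc2 \<alpha> \<kappa> k q"
  then have "l2 \<alpha> ^ (2 * k) dvd (p - texp (2 * k) (- (2 * \<kappa>) * l2 \<alpha>) * refl2 \<alpha> p) + (q - texp (2 * k) (- (2 * \<kappa>) * l2 \<alpha>) * refl2 \<alpha> q)"
    unfolding qc2_iff by (rule dvd_add)
  moreover have "(p - T * refl2 \<alpha> p) + (q - T * refl2 \<alpha> q) = (p + q) - T * refl2 \<alpha> (p + q)" for T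
    by (simp add: algebra_simps)
  ultimately show ?thesis unfolding qc2_iff by (simp only:)
qed

lemma qc2_Const_mult: "qc2 \<alpha> \<kappa> k p \<Longrightarrow> qc2 \<alpha> \<kappa> k (Const c * p)"
proof -
  assume "qc2 \<alpha> \<kappa> k p"
  then have "l2 \<alpha> ^ (2 * k) dvd Const c * (p - texp (2 * k) (- (2 * \<kappa>) * l2 \<alpha>) * refl2 \<alpha> p)"
    unfolding qc2_iff by (rule dvd_mult)
  moreover have "Const c * (p - T * refl2 \<alpha> p) = Const c * p - T * refl2 \<alpha> (Const c * p)" for T
    by (simp add: algebra_simps)
  ultimately show ?thesis unfolding qc2_iff by (simp only:)
qed

lemma qc2_0: "qc2 \<alpha> \<kappa> k 0"
  unfolding qc2_iff by simp

lemma qc2_sum: "(\<And>a. a \<in> A \<Longrightarrow> qc2 \<alpha> \<kappa> k (f a)) \<Longrightarrow> qc2 \<alpha> \<kappa> k (sum f A)"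
  by (induction A rule: infinite_finite_induct) (simp_all add: qc2_0 qc2_add)

lemma qc2_diff: "qc2 \<alpha> \<kappa> k p \<Longrightarrow> qc2 \<alpha> \<kappa> k q \<Longrightarrow> qc2 \<alpha> \<kappa> k (p - q)"
proof -
  assume "qc2 \<alpha> \<kappa> k p" "qc2 \<alpha> \<kappa> k q"
  then have "qc2 \<alpha> \<kappa> k (p + Const (- 1) * q)" by (intro qc2_add qc2_Const_mult)
  then show ?thesis by (simp add: Const_simps)
qed

lemma hom_top_Var: "hom all_vars 1 (Var b)"
  using hom_Var[of "\<lambda>i. if all_vars i then 1 else 0" b] by simp

lemma hom_monomials:
  assumes q: "hom all_vars d q" and S: "finite S" "q = (\<Sum>(i, j)\<in>S. Const (c (i, j)) * Var False ^ i * Var True ^ j)"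
  shows "q = (\<Sum>(i, j)\<in>{p \<in> S. int (fst p) + int (snd p) = d}. Const (c (i, j)) * Var False ^ i * Var True ^ j)"
proof -
  let ?m = "\<lambda>p. Const (c p) * Var False ^ fst p * Var True ^ snd p"
  let ?deg = "\<lambda>p. int (fst p) + int (snd p)"
  let ?A = "insert d (?deg ` S)"
  define f where "f = (\<lambda>k. (\<Sum>p\<in>{p \<in> S. ?deg p = k}. ?m p) - (if k = d then q else 0))"
  have m: "hom all_vars (?deg p) (?m p)" for p
  proof -
    have "hom all_vars (0 + int (fst p) * 1 + int (snd p) * 1) (?m p)"
      by (intro hom_mult hom_power hom_top_Var hom_Const)
    then show ?thesis by simp
  qed
  have "f d = 0"
  proof (rule hom_unique[of ?A all_vars])
    show "hom all_vars k (f k)" for k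
      unfolding f_def by (intro hom_diff hom_sum) (use m q in auto)
    have "(\<Sum>k\<in>?A. \<Sum>p\<in>{p \<in> S. ?deg p = k}. ?m p) = (\<Sum>p\<in>S. ?m p)"
      by (rule sum.group) (use S(1) in auto)
    moreover have "(\<Sum>k\<in>?A. if k = d then q else 0) = q" using S(1) by simp
    ultimately show "(\<Sum>k\<in>?A. f k) = 0"
      unfolding f_def sum_subtractf using S(2) by (simp add: case_prod_unfold)
  qed (use S(1) in auto)
  then show ?thesis by (simp add: f_def case_prod_unfold)
qed

definition (in ba) Pxi :: "complex \<Rightarrow> complex \<Rightarrow> bool pfun set" where
  "Pxi \<xi>1 \<xi>2 = {p. \<forall>\<alpha>\<in>B. qc2 \<alpha> (Const (lin \<alpha> (- \<xi>1) (- \<xi>2))) (mu \<alpha>) p}"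

context ba_shift
begin

definition W :: "nat \<times> nat \<Rightarrow> bool pfun" where
  "W p = (SOME w. wfun Pa mu \<xi>1 \<xi>2 p = fn2 w \<and> (\<forall>\<alpha>\<in>B. qc2 \<alpha> (Const (lin \<alpha> (- \<xi>1) (- \<xi>2))) (mu \<alpha>) w) \<and>
    lower all_vars (deg + int (fst p) + int (snd p)) (w - Var False ^ fst p * Var True ^ snd p * dl2))"

lemma W:
  "wfun Pa mu \<xi>1 \<xi>2 p = fn2 (W p)"
  "\<alpha> \<in> B \<Longrightarrow> qc2 \<alpha> (Const (lin \<alpha> (- \<xi>1) (- \<xi>2))) (mu \<alpha>) (W p)"
  "lower all_vars (deg + int (fst p) + int (snd p)) (W p - Var False ^ fst p * Var True ^ snd p * dl2)"
  using someI_ex[OF wfun_form[of "fst p" "snd p"]] by (simp_all add: W_def)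

lemma Pmod_eq: "Pmod Pa mu \<xi>1 \<xi>2 = fn2 ` Pxi \<xi>1 \<xi>2"
proof -
  have "fn2 p \<in> Pmod Pa mu \<xi>1 \<xi>2 \<longleftrightarrow> p \<in> Pxi \<xi>1 \<xi>2" for p
  proof -
    have 0: "qc2 \<alpha> \<kappa> 0 p" for \<alpha> \<kappa> by (simp add: qc2_iff)
    have "qc2 \<alpha> (Const (lin \<alpha> (- \<xi>1) (- \<xi>2))) (mu \<alpha>) p" if "p \<in> Pxi \<xi>1 \<xi>2" "\<alpha> \<in> Pa" for \<alpha>
    proof (cases "mu \<alpha> = 0")
      case False
      then have "\<alpha> \<in> B" using that B_eq by simp
      then show ?thesis using that by (simp add: Pxi_def)
    qed (simp only: 0)
    moreover have "B \<subseteq> Pa" using B_eq by blast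
    ultimately show ?thesis unfolding Pmod_iff by (auto simp: Pxi_def)
  qed
  note iff = this
  have poly: "\<exists>p. f = fn2 p" if "f \<in> Pmod Pa mu \<xi>1 \<xi>2" for f
    using that by (simp add: Pmod_def poly2_iff)
  show ?thesis
  proof (intro set_eqI iffI)
    fix f assume f: "f \<in> Pmod Pa mu \<xi>1 \<xi>2"
    then obtain p where "f = fn2 p" using poly by blast
    then show "f \<in> fn2 ` Pxi \<xi>1 \<xi>2" using f iff by simp
  next
    fix f assume "f \<in> fn2 ` Pxi \<xi>1 \<xi>2"
    then obtain p where "f = fn2 p" "p \<in> Pxi \<xi>1 \<xi>2" by blast
    then show "f \<in> Pmod Pa mu \<xi>1 \<xi>2" using iff by simp
  qed
qed

definition span :: "bool pfun \<Rightarrow> bool" where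
  "span p \<longleftrightarrow> (\<exists>S c. finite S \<and> p = (\<Sum>q\<in>S. Const (c q) * W q))"

lemma spectral_eq: "spectral_module Pa mu \<xi>1 \<xi>2 = fn2 ` {p. span p}"
proof -
  have fn2_sum: "fn2 (\<Sum>q\<in>S. Const (c q) * W q) = (\<lambda>z1 z2. \<Sum>p\<in>S. c p * wfun Pa mu \<xi>1 \<xi>2 p z1 z2)" for S c
    by (simp add: W(1)) (simp add: fn2_def)
  show ?thesis
    unfolding spectral_module_def span_def fn2_sum[symmetric] by blast
qed

lemma span_add:
  assumes "span p" "span q"
  shows "span (p + q)"
proof -
  obtain S c where S: "finite S" "p = (\<Sum>q\<in>S. Const (c q) * W q)" using assms(1) by (auto simp: span_def)
  obtain T d where T: "finite T" "q = (\<Sum>q\<in>T. Const (d q) * W q)" using assms(2) by (auto simp: span_def)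
  let ?e = "\<lambda>r. (if r \<in> S then c r else 0) + (if r \<in> T then d r else 0)"
  have "(\<Sum>r\<in>S \<union> T. Const (?e r) * W r)
      = (\<Sum>r\<in>S \<union> T. if r \<in> S then Const (c r) * W r else 0) + (\<Sum>r\<in>S \<union> T. if r \<in> T then Const (d r) * W r else 0)"
    unfolding sum.distrib[symmetric] by (intro sum.cong) (auto simp: Const_simps algebra_simps)
  also have "(\<Sum>r\<in>S \<union> T. if r \<in> S then Const (c r) * W r else 0) = p"
    unfolding S(2) using S T by (intro sum.mono_neutral_cong_right) auto
  also have "(\<Sum>r\<in>S \<union> T. if r \<in> T then Const (d r) * W r else 0) = q"
    unfolding T(2) using S T by (intro sum.mono_neutral_cong_right) auto
  finally show ?thesis unfolding span_def using S(1) T(1) by (intro exI[of _ "S \<union> T"] exI[of _ ?e]) simp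
qed

lemma span_imp_Pxi: "span p \<Longrightarrow> p \<in> Pxi \<xi>1 \<xi>2"
  unfolding span_def Pxi_def by (auto intro!: qc2_sum qc2_Const_mult W(2))

lemma hom_dl2: "hom all_vars deg dl2"
proof -
  have "hom all_vars 1 (l2 \<alpha>)" for \<alpha> by (rule hom_glf) auto
  then have "hom all_vars (int (mu \<alpha>)) (l2 \<alpha> ^ mu \<alpha>)" for \<alpha> using hom_power[of _ 1 "l2 \<alpha>" "mu \<alpha>"] by simp
  then show ?thesis unfolding dl2_def deg_def by (intro hom_prod)
qed

lemma dl2_neq_0: "dl2 \<noteq> 0"
  unfolding dl2_def using finite_B by simp

lemma Pxi_top:
  assumes p: "p \<in> Pxi \<xi>1 \<xi>2" and h: "hom all_vars n h" "lower all_vars n r" "p = h + r"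
  shows "dl2 dvd h"
  unfolding dl2_def
proof (rule prod_glf_power_dvd)
  fix \<alpha> assume \<alpha>: "\<alpha> \<in> B"
  define c where "c = lin \<alpha> (- \<xi>1) (- \<xi>2)"
  have c: "c \<noteq> 0" unfolding c_def by (rule xi_lin[OF \<alpha>])
  have "qc2 \<alpha> (Const c) (mu \<alpha>) p" using p \<alpha> by (simp add: Pxi_def c_def)
  from qc_leading_form[OF _ _ free_Const this h]
  have "l2 \<alpha> ^ mu \<alpha> dvd Const c ^ mu \<alpha> * h" by simp
  then have "l2 \<alpha> ^ mu \<alpha> dvd Const (1 / c ^ mu \<alpha>) * (Const c ^ mu \<alpha> * h)" by (rule dvd_mult)
  moreover have "Const (1 / c ^ mu \<alpha>) * (Const c ^ mu \<alpha> * h) = h"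
    using c by (intro pfun_eqI) simp
  ultimately show "l2 \<alpha> ^ mu \<alpha> dvd h" by (simp only:)
qed (use finite_B sin_neq_0 in auto)

text \<open>The leading form is \<open>dl2 * q\<close>, and the combination of the
  \<open>W p\<close> with the coefficients of \<open>q\<close> has the same leading form; the
  difference has smaller degree.\<close>

lemma Pxi_imp_span:
  assumes "lower all_vars (int n) p" "p \<in> Pxi \<xi>1 \<xi>2"
  shows "span p"
  using assms
proof (induction n arbitrary: p)
  case 0
  then have "p = 0" using lower_nonpos[of all_vars "int 0" p] by simp
  then show ?case unfolding span_def by (intro exI[of _ "{}"]) simp
next
  case (Suc n)
  have "lower all_vars (int n + 1) p" using Suc.prems(1) by (simp add: add.commute)
  then obtain h r where h: "hom all_vars (int n) h" "lower all_vars (int n) r" "p = h + r"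
    using lower_top[of all_vars "int n" p] by auto
  obtain q where q: "h = dl2 * q" using Pxi_top[OF Suc.prems(2) h] by (elim dvdE)
  have hq: "hom all_vars (int n - deg) q"
    by (rule hom_factor[OF hom_dl2 dl2_neq_0]) (use h(1) q in simp)
  obtain S c where S: "finite S" "q = (\<Sum>(i, j)\<in>S. Const (c (i, j)) * Var False ^ i * Var True ^ j)"
  proof -
    obtain S c where "finite S" "fn2 q = fn2 (\<Sum>(i, j)\<in>S. Const (c (i, j)) * Var False ^ i * Var True ^ j)"
      using poly2_expand[OF poly2_fn2[of q]] by blast
    then show ?thesis using that[OF _ fn2_inject] by blast
  qed
  \<comment> \<open>The expansion is cut down to the monomials of the degree of \<open>q\<close>, so
    that no \<open>W p\<close> of higher degree enters.\<close>
  let ?S = "{p \<in> S. int (fst p) + int (snd p) = int n - deg}"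
  have q_eq: "q = (\<Sum>p\<in>?S. Const (c p) * Var False ^ fst p * Var True ^ snd p)"
    using hom_monomials[OF hq S] by (simp add: case_prod_unfold)
  define w where "w = (\<Sum>p\<in>?S. Const (c p) * W p)"
  have span_w: "span w" unfolding span_def w_def using S(1) by (intro exI[of _ ?S]) auto
  have "p - w \<in> Pxi \<xi>1 \<xi>2"
    using Suc.prems(2) span_imp_Pxi[OF span_w] by (auto simp: Pxi_def intro: qc2_diff)
  moreover have "lower all_vars (int n) (p - w)"
  proof -
    have "lower all_vars (int n) (Const (c p) * (W p - Var False ^ fst p * Var True ^ snd p * dl2))" if "p \<in> ?S" for p
      using lower_Const_mult[OF W(3)[of p]] that by (simp add: algebra_simps)
    then have "lower all_vars (int n) (\<Sum>p\<in>?S. Const (c p) * (W p - Var False ^ fst p * Var True ^ snd p * dl2))"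
      by (rule lower_sum)
    moreover have "(\<Sum>p\<in>?S. Const (c p) * (W p - Var False ^ fst p * Var True ^ snd p * dl2)) = w - dl2 * q"
      unfolding w_def q_eq sum_distrib_left sum_subtractf[symmetric]
      by (intro sum.cong) (simp_all add: algebra_simps)
    ultimately have "lower all_vars (int n) (w - dl2 * q)" by (simp only:)
    from lower_diff[OF h(2) this] have "lower all_vars (int n) (r - (w - dl2 * q))" .
    then show ?thesis by (simp add: h(3) q algebra_simps)
  qed
  ultimately have "span (p - w)" using Suc.IH by blast
  from span_add[OF this span_w] show ?case by simp
qed

theorem spectral_eq_Pmod: "spectral_module Pa mu \<xi>1 \<xi>2 = Pmod Pa mu \<xi>1 \<xi>2"
proof -
  have "span p" if "p \<in> Pxi \<xi>1 \<xi>2" for p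
  proof -
    obtain m where "lower all_vars m p" using lower_exists by blast
    then have "lower all_vars (int (nat m)) p" by (rule lower_mono) simp
    then show ?thesis using Pxi_imp_span that by blast
  qed
  then have "{p. span p} = Pxi \<xi>1 \<xi>2" using span_imp_Pxi by blast
  then show ?thesis by (simp add: spectral_eq Pmod_eq)
qed

end

subsection \<open>Invertibility of the module of quasi-invariants\<close>

abbreviation t2 :: "complex \<Rightarrow> bool pfun" where "t2 \<equiv> gtf (\<lambda>b. b)"
abbreviation r2 :: "complex \<Rightarrow> bool pfun \<Rightarrow> bool pfun" where "r2 \<equiv> grs (\<lambda>b. b)"

lemma refl2_even_power: "refl2 \<alpha> (l2 \<alpha> ^ (2 * k)) = l2 \<alpha> ^ (2 * k)"
  by (simp add: power_mult)

lemma l2_dvd_iff: "l2 \<alpha> dvd p \<longleftrightarrow> r2 \<alpha> p = 0"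
  by (rule glf_dvd_iff) simp

lemma dvd_imp_dvd_refl2: "l2 \<alpha> ^ (2 * k) dvd p \<Longrightarrow> l2 \<alpha> ^ (2 * k) dvd refl2 \<alpha> p"
  by (elim dvdE) (simp only: refl_simps(4) refl2_even_power dvd_triv_left)

lemma qc2_of_dvd: "l2 \<alpha> ^ (2 * k) dvd p \<Longrightarrow> qc2 \<alpha> \<kappa> k p"
  unfolding qc2_iff by (intro dvd_diff dvd_mult dvd_imp_dvd_refl2)

lemma refl2_texp: "refl2 \<alpha> (texp M p) = texp M (refl2 \<alpha> p)"
proof -
  have "refl2 \<alpha> (sum f A) = (\<Sum>a\<in>A. refl2 \<alpha> (f a))" for f and A :: "nat set"
    by (simp add: refl_def subst_sum)
  then show ?thesis by (simp add: texp_def)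
qed

text \<open>The model element along one line, an exponential times an invariant factor: the
  reflection turns \<open>exp (- c l)\<close> into \<open>exp (c l)\<close>, and the factor
  \<open>exp (-2 c l)\<close> turns it back.\<close>

lemma qc2_texp:
  assumes "refl2 \<alpha> e = e"
  shows "qc2 \<alpha> (Const c) k (texp (2 * k) (Const (- c) * l2 \<alpha>) * e)"
proof -
  have 1: "- (2 * Const c) = (Const (- (2 * c)) :: bool pfun)" by (simp add: Const_simps)
  have "l2 \<alpha> ^ (2 * k) dvd texp (2 * k) (Const (- (2 * c)) * l2 \<alpha>) * texp (2 * k) (Const c * l2 \<alpha>)
      - texp (2 * k) ((Const (- (2 * c)) + Const c) * l2 \<alpha>)"
    by (rule texp_mult_dvd)
  moreover have "Const (- (2 * c)) + Const c = (Const (- c) :: bool pfun)" by (rule pfun_eqI) simp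
  ultimately have "l2 \<alpha> ^ (2 * k) dvd - e * (texp (2 * k) (Const (- (2 * c)) * l2 \<alpha>) * texp (2 * k) (Const c * l2 \<alpha>)
      - texp (2 * k) (Const (- c) * l2 \<alpha>))"
    by (intro dvd_mult) simp
  moreover have "- e * (a * b - d) = d * e - a * (b * e)" for a b d :: "bool pfun" by (simp add: algebra_simps)
  moreover have "refl2 \<alpha> (Const (- c) * l2 \<alpha>) = Const c * l2 \<alpha>" by (simp add: Const_simps)
  ultimately show ?thesis
    unfolding qc2_iff 1 refl_simps(4) refl2_texp assms by (simp only:)
qed

lemma qc2_mult:
  assumes p: "qc2 \<alpha> (Const c) k p" and q: "qc2 \<alpha> (Const d) k q"
  shows "qc2 \<alpha> (Const (c + d)) k (p * q)"
proof -
  let ?L = "l2 \<alpha> ^ (2 * k)" and ?T = "\<lambda>c. texp (2 * k) (- (2 * Const c) * l2 \<alpha>)"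
  let ?p = "refl2 \<alpha> p" and ?q = "refl2 \<alpha> q"
  have "?L dvd (p - ?T c * ?p) * q" "?L dvd (?T c * ?p) * (q - ?T d * ?q)"
    using p q unfolding qc2_iff by (simp_all only: dvd_mult dvd_mult2)
  moreover have "?L dvd (?T c * ?T d - ?T (c + d)) * (?p * ?q)"
  proof -
    have "- (2 * Const c) + - (2 * Const d) = (- (2 * Const (c + d)) :: bool pfun)" by (simp add: Const_simps)
    then show ?thesis using texp_mult_dvd[of "l2 \<alpha>" "2 * k" "- (2 * Const c)" "- (2 * Const d)"]
      by (simp only: dvd_mult2)
  qed
  ultimately have "?L dvd (p - ?T c * ?p) * q + (?T c * ?p) * (q - ?T d * ?q) + (?T c * ?T d - ?T (c + d)) * (?p * ?q)"
    by (simp only: dvd_add)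
  moreover have "(p - a * ?p) * q + (a * ?p) * (q - b * ?q) + (a * b - ab) * (?p * ?q) = p * q - ab * refl2 \<alpha> (p * q)" for a b ab
    by (simp add: algebra_simps)
  ultimately show ?thesis unfolding qc2_iff by (simp only:)
qed

lemma qc2_zero_iff: "k > 0 \<Longrightarrow> qc2 \<alpha> (Const 0) k p \<longleftrightarrow> l2 \<alpha> ^ (2 * k) dvd p - refl2 \<alpha> p"
proof -
  assume "k > 0"
  then obtain m where "2 * k = Suc m" by (cases "2 * k") auto
  then have "texp (2 * k) (- (2 * Const 0) * l2 \<alpha>) = 1" by (simp add: Const_simps texp_0)
  then show ?thesis unfolding qc2_iff by simp
qed

text \<open>The difference changes sign under the reflection and even powers of the form do not, so
  the cofactor is antisymmetric and vanishes on the line. This accounts for the odd exponent in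
  \<open>ringA\<close>.\<close>

lemma odd_dvd_Suc:
  assumes "l2 \<alpha> ^ (2 * k) dvd p - refl2 \<alpha> p"
  shows "l2 \<alpha> ^ (2 * k + 1) dvd p - refl2 \<alpha> p"
proof -
  obtain r where r: "p - refl2 \<alpha> p = l2 \<alpha> ^ (2 * k) * r" using assms by (elim dvdE)
  have "refl2 \<alpha> (p - refl2 \<alpha> p) = - (p - refl2 \<alpha> p)" by simp
  then have "l2 \<alpha> ^ (2 * k) * refl2 \<alpha> r = l2 \<alpha> ^ (2 * k) * - r"
    unfolding r refl_simps(4) refl2_even_power by simp
  then have "refl2 \<alpha> r = - r" by (subst (asm) mult_left_cancel) simp_all
  then have "r2 \<alpha> (refl2 \<alpha> r) = r2 \<alpha> (- r)" by simp
  then have "2 * r2 \<alpha> r = 0" by simp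
  then have "l2 \<alpha> dvd r" unfolding l2_dvd_iff by simp
  then have "l2 \<alpha> ^ (2 * k) * l2 \<alpha> dvd l2 \<alpha> ^ (2 * k) * r" by (rule mult_dvd_mono[OF dvd_refl])
  then show ?thesis unfolding r by (simp add: mult.commute)
qed

section \<open>Ideals generated by two elements, and powers of elements vanishing at the
  origin\<close>

definition idl :: "'a::comm_ring_1 \<Rightarrow> 'a \<Rightarrow> 'a \<Rightarrow> bool" where
  "idl q L p \<longleftrightarrow> (\<exists>b g. p = q * b + L * g)"

lemma idl_add: "idl q L p \<Longrightarrow> idl q L p' \<Longrightarrow> idl q L (p + p')"
proof -
  assume "idl q L p" "idl q L p'"
  then obtain b g b' g' where "p = q * b + L * g" "p' = q * b' + L * g'" by (auto simp: idl_def)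
  then have "p + p' = q * (b + b') + L * (g + g')" by (simp add: algebra_simps)
  then show ?thesis unfolding idl_def by blast
qed

lemma idl_mult: "idl q L p \<Longrightarrow> idl q L (a * p)"
proof -
  assume "idl q L p"
  then obtain b g where "p = q * b + L * g" by (auto simp: idl_def)
  then have "a * p = q * (a * b) + L * (a * g)" by (simp add: algebra_simps)
  then show ?thesis unfolding idl_def by blast
qed

lemma idl_0: "idl q L 0"
  unfolding idl_def by (intro exI[of _ 0]) simp

lemma idl_dvd: "L dvd p \<Longrightarrow> idl q L p"
  unfolding idl_def dvd_def by (metis add_0 mult_zero_right)

lemma idl_sum: "(\<And>a. a \<in> A \<Longrightarrow> idl q L (f a)) \<Longrightarrow> idl q L (sum f A)"
  by (induction A rule: infinite_finite_induct) (simp_all add: idl_0 idl_add)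

text \<open>A large total degree forces either the power of \<open>l\<close> to reach
  \<open>m\<close> or the power of \<open>t\<close> to reach \<open>K\<close>.\<close>

lemma idl_power_term:
  assumes t: "idl q (l ^ m) (t ^ K)" and "m + K \<le> i + j"
  shows "idl q (l ^ m) (a * (l ^ i * t ^ j))"
proof (cases "m \<le> i")
  case True
  then have "l ^ m dvd l ^ i" by (rule le_imp_power_dvd)
  then have "l ^ m dvd a * (l ^ i * t ^ j)" by (intro dvd_mult dvd_mult2)
  then show ?thesis by (rule idl_dvd)
next
  case False
  then have "t ^ j = t ^ (j - K) * t ^ K" using assms(2) by (simp add: power_add[symmetric])
  then have "a * (l ^ i * t ^ j) = (a * l ^ i * t ^ (j - K)) * t ^ K" by (simp add: mult_ac)
  then show ?thesis using idl_mult[OF t] by simp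
qed

text \<open>On the line \<open>l2 \<alpha> = 0\<close> the polynomial \<open>q\<close> is a nonzero multiple of a power of \<open>t2 \<alpha>\<close>; hence
  a power of \<open>t2 \<alpha>\<close> lies in the ideal generated by \<open>q\<close> and any given power of \<open>l2 \<alpha>\<close>.\<close>

lemma idl_t2_power:
  assumes q: "r2 \<alpha> q = Const c * Var False ^ d" and c: "c \<noteq> 0"
  shows "idl q (l2 \<alpha> ^ m) (t2 \<alpha> ^ (d * m))"
proof -
  have "r2 \<alpha> (t2 \<alpha>) = Var False"
    by (rule pfun_eqI, simp add: grs_def gtf_def, use sin_squared_eq[of \<alpha>] in algebra)
  then have "r2 \<alpha> (q - Const c * t2 \<alpha> ^ d) = 0" by (simp add: q)
  then have "l2 \<alpha> dvd q - Const c * t2 \<alpha> ^ d" unfolding l2_dvd_iff .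
  then obtain g where g: "q - Const c * t2 \<alpha> ^ d = l2 \<alpha> * g" by (elim dvdE)
  have "idl q (l2 \<alpha> ^ n) ((Const c * t2 \<alpha> ^ d) ^ n)" for n
  proof (induction n)
    case 0
    show ?case by (rule idl_dvd) simp
  next
    case (Suc n)
    then obtain b h where h: "(Const c * t2 \<alpha> ^ d) ^ n = q * b + l2 \<alpha> ^ n * h" by (auto simp: idl_def)
    have ct: "Const c * t2 \<alpha> ^ d = q - l2 \<alpha> * g" using g by (simp add: algebra_simps)
    have "(Const c * t2 \<alpha> ^ d) ^ Suc n = (q - l2 \<alpha> * g) * (q * b + l2 \<alpha> ^ n * h)"
      unfolding power_Suc h unfolding ct ..
    also have "\<dots> = q * (q * b + l2 \<alpha> ^ n * h - l2 \<alpha> * g * b) + l2 \<alpha> ^ Suc n * (- g * h)"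
      by (simp add: algebra_simps)
    finally show ?case unfolding idl_def by blast
  qed
  from idl_mult[OF this[of m], of "Const (1 / c ^ m)"]
  have "idl q (l2 \<alpha> ^ m) (Const (1 / c ^ m) * (Const c * t2 \<alpha> ^ d) ^ m)" .
  moreover have "Const (1 / c ^ m) * (Const c * t2 \<alpha> ^ d) ^ m = t2 \<alpha> ^ (d * m)"
    using c by (intro pfun_eqI) (simp add: power_mult_distrib power_mult)
  ultimately show ?thesis by simp
qed

text \<open>\<open>l2 \<alpha>\<close> and \<open>t2 \<alpha>\<close> are rotated coordinates, so
  they generate the maximal ideal of the origin.\<close>

lemma vanish_at_0_decomp:
  assumes "ev n (\<lambda>_. 0) = 0"
  shows "\<exists>a b. n = l2 \<alpha> * a + t2 \<alpha> * b"
proof -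
  have Vars: "Var False = t2 \<alpha> * Const (cos \<alpha>) - l2 \<alpha> * Const (sin \<alpha>)" "Var True = t2 \<alpha> * Const (sin \<alpha>) + l2 \<alpha> * Const (cos \<alpha>)"
    by (rule pfun_eqI, simp add: glf_def gtf_def, use sin_squared_eq[of \<alpha>] in algebra)+
  have "\<exists>a b. p - Const (ev p (\<lambda>_. 0)) = l2 \<alpha> * a + t2 \<alpha> * b" for p
  proof (induction p rule: pfun_induct)
    case (Const c)
    show ?case by (intro exI[of _ 0]) simp
  next
    case (Var i)
    have "Var i - Const (ev (Var i) (\<lambda>_. 0)) = Var i" by (simp add: Const_simps)
    moreover have "\<exists>a b. Var i = l2 \<alpha> * a + t2 \<alpha> * b"
    proof (cases i)
      case True
      then show ?thesis using Vars(2) by (intro exI[of _ "Const (cos \<alpha>)"] exI[of _ "Const (sin \<alpha>)"]) simp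
    next
      case False
      then show ?thesis using Vars(1) by (intro exI[of _ "- Const (sin \<alpha>)"] exI[of _ "Const (cos \<alpha>)"]) simp
    qed
    ultimately show ?case by (simp only:)
  next
    case (add p q)
    then obtain a b a' b' where 1: "p - Const (ev p (\<lambda>_. 0)) = l2 \<alpha> * a + t2 \<alpha> * b"
      "q - Const (ev q (\<lambda>_. 0)) = l2 \<alpha> * a' + t2 \<alpha> * b'" by blast
    have "p + q - Const (ev (p + q) (\<lambda>_. 0)) = (p - Const (ev p (\<lambda>_. 0))) + (q - Const (ev q (\<lambda>_. 0)))"
      by (simp add: Const_simps)
    also have "\<dots> = l2 \<alpha> * (a + a') + t2 \<alpha> * (b + b')"
      unfolding 1 by (simp add: algebra_simps)
    finally have "p + q - Const (ev (p + q) (\<lambda>_. 0)) = l2 \<alpha> * (a + a') + t2 \<alpha> * (b + b')" .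
    then show ?case by blast
  next
    case (mult p q)
    then obtain a b a' b' where 1: "p - Const (ev p (\<lambda>_. 0)) = l2 \<alpha> * a + t2 \<alpha> * b"
      "q - Const (ev q (\<lambda>_. 0)) = l2 \<alpha> * a' + t2 \<alpha> * b'" by blast
    have "p * q - Const (ev (p * q) (\<lambda>_. 0)) = (p - Const (ev p (\<lambda>_. 0))) * q + Const (ev p (\<lambda>_. 0)) * (q - Const (ev q (\<lambda>_. 0)))"
      by (simp add: Const_simps algebra_simps)
    also have "\<dots> = l2 \<alpha> * (a * q + Const (ev p (\<lambda>_. 0)) * a') + t2 \<alpha> * (b * q + Const (ev p (\<lambda>_. 0)) * b')"
      unfolding 1 by (simp add: algebra_simps)
    finally show ?case by blast
  qed
  from this[of n] show ?thesis using assms by (simp add: Const_simps)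
qed

lemma idl_power_vanish:
  assumes n: "ev n (\<lambda>_. 0) = 0" and t: "idl q (l2 \<alpha> ^ m) (t2 \<alpha> ^ K)" and N: "m + K \<le> N"
  shows "idl q (l2 \<alpha> ^ m) (n ^ N)"
proof -
  obtain a b where ab: "n = l2 \<alpha> * a + t2 \<alpha> * b" using vanish_at_0_decomp[OF n] by blast
  have "idl q (l2 \<alpha> ^ m) (of_nat (N choose i) * (l2 \<alpha> * a) ^ i * (t2 \<alpha> * b) ^ (N - i))" if "i \<le> N" for i
  proof -
    have "of_nat (N choose i) * (l2 \<alpha> * a) ^ i * (t2 \<alpha> * b) ^ (N - i)
        = (of_nat (N choose i) * a ^ i * b ^ (N - i)) * (l2 \<alpha> ^ i * t2 \<alpha> ^ (N - i))"
      by (simp add: power_mult_distrib mult_ac)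
    moreover have "m + K \<le> i + (N - i)" using N that by simp
    ultimately show ?thesis using idl_power_term[OF t] by (simp only:)
  qed
  then show ?thesis unfolding ab binomial_ring by (intro idl_sum) simp
qed

definition monomial_on_line :: "bool pfun \<Rightarrow> bool" where
  "monomial_on_line p \<longleftrightarrow> (\<exists>c d. c \<noteq> 0 \<and> p = Const c * Var False ^ d)"

lemma monomial_on_line_mult: "monomial_on_line p \<Longrightarrow> monomial_on_line q \<Longrightarrow> monomial_on_line (p * q)"
proof -
  assume "monomial_on_line p" "monomial_on_line q"
  then obtain c d c' d' where "c \<noteq> 0" "p = Const c * Var False ^ d" "c' \<noteq> 0" "q = Const c' * Var False ^ d'"
    by (auto simp: monomial_on_line_def)
  then have "c * c' \<noteq> 0" "p * q = Const (c * c') * Var False ^ (d + d')"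
    by (simp_all add: Const_simps power_add mult_ac)
  then show ?thesis unfolding monomial_on_line_def by blast
qed

lemma monomial_on_line_1: "monomial_on_line 1"
  unfolding monomial_on_line_def by (intro exI[of _ 1] exI[of _ 0]) (simp add: Const_simps)

lemma monomial_on_line_Var: "c \<noteq> 0 \<Longrightarrow> monomial_on_line (Const c * Var False)"
  unfolding monomial_on_line_def by (intro exI[of _ c] exI[of _ 1]) simp

lemma monomial_on_line_power: "monomial_on_line p \<Longrightarrow> monomial_on_line (p ^ n)"
  by (induction n) (simp_all add: monomial_on_line_1 monomial_on_line_mult)

lemma monomial_on_line_prod: "(\<And>a. a \<in> A \<Longrightarrow> monomial_on_line (f a)) \<Longrightarrow> monomial_on_line (prod f A)"
  by (induction A rule: infinite_finite_induct) (simp_all add: monomial_on_line_1 monomial_on_line_mult)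

context ba
begin

definition Aring :: "bool pfun set" where
  "Aring = {p. \<forall>\<alpha>\<in>B. qc2 \<alpha> (Const 0) (mu \<alpha>) p}"

text \<open>An ideal of the full polynomial ring inside \<open>Aring\<close> and inside every
  \<open>Pxi a b\<close>: errors that fall into it may carry arbitrary polynomial
  coefficients.\<close>

definition conductor :: "bool pfun set" where
  "conductor = {p. \<forall>\<alpha>\<in>B. l2 \<alpha> ^ (2 * mu \<alpha>) dvd p}"

lemma lin_neg: "lin \<alpha> (- (- a)) (- (- b)) = - lin \<alpha> (- a) (- b)"
  by (simp add: lin_def)

lemma conductor_Pxi: "conductor \<subseteq> Pxi a b" and conductor_Aring: "conductor \<subseteq> Aring"
  by (auto simp: conductor_def Pxi_def Aring_def intro: qc2_of_dvd)

lemma conductor_mult: "p \<in> conductor \<Longrightarrow> r * p \<in> conductor" "p \<in> conductor \<Longrightarrow> p * r \<in> conductor"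
  by (simp_all add: conductor_def)

lemma Aring_Pxi: "p \<in> Aring \<Longrightarrow> q \<in> Pxi a b \<Longrightarrow> p * q \<in> Pxi a b"
  using qc2_mult[of _ 0] by (simp add: Aring_def Pxi_def)

lemma Aring_mult: "p \<in> Aring \<Longrightarrow> q \<in> Aring \<Longrightarrow> p * q \<in> Aring"
  using qc2_mult[of _ 0 _ _ 0] by (simp add: Aring_def)

lemma Aring_add: "p \<in> Aring \<Longrightarrow> q \<in> Aring \<Longrightarrow> p + q \<in> Aring"
  and Aring_diff: "p \<in> Aring \<Longrightarrow> q \<in> Aring \<Longrightarrow> p - q \<in> Aring"
  by (simp_all add: Aring_def qc2_add qc2_diff)

lemma Pxi_Pxi: "p \<in> Pxi a b \<Longrightarrow> q \<in> Pxi (- a) (- b) \<Longrightarrow> p * q \<in> Aring"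
proof -
  assume pq: "p \<in> Pxi a b" "q \<in> Pxi (- a) (- b)"
  have "qc2 \<alpha> (Const 0) (mu \<alpha>) (p * q)" if "\<alpha> \<in> B" for \<alpha>
  proof -
    have "qc2 \<alpha> (Const (lin \<alpha> (- a) (- b) + lin \<alpha> (- (- a)) (- (- b)))) (mu \<alpha>) (p * q)"
      using pq that by (intro qc2_mult) (simp_all add: Pxi_def)
    moreover have "lin \<alpha> (- a) (- b) + lin \<alpha> (- (- a)) (- (- b)) = 0" unfolding lin_neg by simp
    ultimately show ?thesis by (simp only:)
  qed
  then show ?thesis by (simp add: Aring_def)
qed

lemma Aring_even: "(\<And>\<alpha>. \<alpha> \<in> B \<Longrightarrow> refl2 \<alpha> p = p \<or> l2 \<alpha> ^ (2 * mu \<alpha>) dvd p) \<Longrightarrow> p \<in> Aring"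
proof -
  assume *: "\<And>\<alpha>. \<alpha> \<in> B \<Longrightarrow> refl2 \<alpha> p = p \<or> l2 \<alpha> ^ (2 * mu \<alpha>) dvd p"
  have "qc2 \<alpha> (Const 0) (mu \<alpha>) p" if "\<alpha> \<in> B" for \<alpha>
    using *[OF that]
  proof
    assume "refl2 \<alpha> p = p"
    then show ?thesis unfolding qc2_zero_iff[OF mu_pos[OF that]] by simp
  qed (rule qc2_of_dvd)
  then show ?thesis by (simp add: Aring_def)
qed

lemma Aring_1: "1 \<in> Aring"
  by (rule Aring_even) simp

lemma Aring_power: "p \<in> Aring \<Longrightarrow> p ^ n \<in> Aring"
  by (induction n) (simp_all add: Aring_1 Aring_mult)

lemma Aring_sum: "(\<And>a. a \<in> A \<Longrightarrow> f a \<in> Aring) \<Longrightarrow> sum f A \<in> Aring"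
proof (induction A rule: infinite_finite_induct)
  case (insert a A)
  then show ?case by (simp add: Aring_add)
qed (auto intro: Aring_even)

text \<open>A localiser for the line \<alpha>: it vanishes to high order on all other lines,
  restricts to a monomial on \<alpha>, and is invariant under the reflection because each factor
  comes with its mirror image. The factor \<open>t2 \<alpha>\<close> makes it vanish at the
  origin.\<close>

definition qe :: "complex \<Rightarrow> bool pfun" where
  "qe \<alpha> = t2 \<alpha> * (\<Prod>\<beta>\<in>B - {\<alpha>}. (l2 \<beta> * refl2 \<alpha> (l2 \<beta>)) ^ (2 * mu \<beta>))"

lemma refl2_qe: "refl2 \<alpha> (qe \<alpha>) = qe \<alpha>"
proof -
  have "refl2 \<alpha> (prod f A) = (\<Prod>a\<in>A. refl2 \<alpha> (f a))" for f and A :: "complex set"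
    by (simp add: refl_def subst_prod)
  then show ?thesis by (simp add: qe_def mult.commute)
qed

lemma qe_dvd: "\<beta> \<in> B \<Longrightarrow> \<beta> \<noteq> \<alpha> \<Longrightarrow> l2 \<beta> ^ (2 * mu \<beta>) dvd qe \<alpha>"
proof -
  assume \<beta>: "\<beta> \<in> B" "\<beta> \<noteq> \<alpha>"
  have "(l2 \<beta> * refl2 \<alpha> (l2 \<beta>)) ^ (2 * mu \<beta>) dvd (\<Prod>\<beta>\<in>B - {\<alpha>}. (l2 \<beta> * refl2 \<alpha> (l2 \<beta>)) ^ (2 * mu \<beta>))"
    by (rule dvd_prodI) (use finite_B \<beta> in auto)
  then have "l2 \<beta> ^ (2 * mu \<beta>) dvd (\<Prod>\<beta>\<in>B - {\<alpha>}. (l2 \<beta> * refl2 \<alpha> (l2 \<beta>)) ^ (2 * mu \<beta>))"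
    unfolding power_mult_distrib by (rule dvd_mult_left)
  then show ?thesis unfolding qe_def by (rule dvd_mult)
qed

lemma r2_qe: "\<alpha> \<in> B \<Longrightarrow> monomial_on_line (r2 \<alpha> (qe \<alpha>))"
proof -
  assume \<alpha>: "\<alpha> \<in> B"
  have prod: "r2 \<alpha> (prod f A) = (\<Prod>a\<in>A. r2 \<alpha> (f a))" for f and A :: "complex set"
    by (simp add: grs_def subst_prod)
  have "r2 \<alpha> (t2 \<alpha>) = Const 1 * Var False"
    by (rule pfun_eqI, simp add: grs_def gtf_def, use sin_squared_eq[of \<alpha>] in algebra)
  moreover have "r2 \<alpha> (l2 \<beta>) = Const (sin (\<alpha> - \<beta>)) * Var False" for \<beta> by (simp add: grs_glf)
  ultimately show ?thesis
    unfolding qe_def grs_simps prod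
    by (auto intro!: monomial_on_line_mult monomial_on_line_prod monomial_on_line_power monomial_on_line_Var
        simp: sin_neq_0[OF \<alpha>] simp del: mult_1 Const_simps)
qed

lemma idl_qe:
  assumes "\<alpha> \<in> B"
  shows "\<exists>K. idl (qe \<alpha> ^ 3) (l2 \<alpha> ^ (2 * mu \<alpha>)) (t2 \<alpha> ^ K)"
proof -
  have "monomial_on_line (r2 \<alpha> (qe \<alpha> ^ 3))"
    using monomial_on_line_power[OF r2_qe[OF assms], of 3] by simp
  then obtain c d where "c \<noteq> 0" "r2 \<alpha> (qe \<alpha> ^ 3) = Const c * Var False ^ d"
    unfolding monomial_on_line_def by blast
  from idl_t2_power[OF this(2,1)] show ?thesis by blast
qed

text \<open>One exponent serves all lines. The cube is chosen for \<open>product_span_1\<close>,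
  where \<open>product_span_qe\<close> consumes two factors \<open>qe \<alpha>\<close> and a third
  one puts the remaining coefficient into \<open>Aring\<close>.\<close>

lemma common_exponent:
  "\<exists>M>0. \<forall>\<alpha>\<in>B. 2 * mu \<alpha> \<le> M \<and> (\<exists>K. 2 * mu \<alpha> + K \<le> M \<and> idl (qe \<alpha> ^ 3) (l2 \<alpha> ^ (2 * mu \<alpha>)) (t2 \<alpha> ^ K))"
proof -
  have "\<forall>\<alpha>\<in>B. \<exists>K. idl (qe \<alpha> ^ 3) (l2 \<alpha> ^ (2 * mu \<alpha>)) (t2 \<alpha> ^ K)" using idl_qe by blast
  from bchoice[OF this] obtain K where K: "\<And>\<alpha>. \<alpha> \<in> B \<Longrightarrow> idl (qe \<alpha> ^ 3) (l2 \<alpha> ^ (2 * mu \<alpha>)) (t2 \<alpha> ^ K \<alpha>)"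
    by blast
  define M where "M = Suc (\<Sum>\<alpha>\<in>B. 2 * mu \<alpha> + K \<alpha>)"
  have "2 * mu \<alpha> + K \<alpha> \<le> M" if "\<alpha> \<in> B" for \<alpha>
    using member_le_sum[of \<alpha> B "\<lambda>\<alpha>. 2 * mu \<alpha> + K \<alpha>"] finite_B that by (simp add: M_def)
  then have "2 * mu \<alpha> + K \<alpha> \<le> M \<and> 2 * mu \<alpha> \<le> M" if "\<alpha> \<in> B" for \<alpha>
    using that by (meson add_leD1)
  moreover have "M > 0" by (simp add: M_def)
  ultimately show ?thesis using K by blast
qed

lemma idl_qe_imp:
  assumes "idl (qe \<alpha> ^ 3) L p"
  shows "\<exists>b g. p = qe \<alpha> * b + L * g"
proof -
  obtain b g where "p = qe \<alpha> ^ 3 * b + L * g" using assms by (auto simp: idl_def)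
  then have "p = qe \<alpha> * (qe \<alpha> ^ 2 * b) + L * g" by (simp add: power3_eq_cube power2_eq_square mult_ac)
  then show ?thesis by blast
qed

lemma glue:
  assumes "\<And>\<alpha>. \<alpha> \<in> B \<Longrightarrow> l2 \<alpha> ^ (2 * mu \<alpha>) dvd p - qe \<alpha> * b \<alpha>" and "\<alpha> \<in> B"
  shows "l2 \<alpha> ^ (2 * mu \<alpha>) dvd p - (\<Sum>\<alpha>\<in>B. qe \<alpha> * b \<alpha>)"
proof -
  have "l2 \<alpha> ^ (2 * mu \<alpha>) dvd (\<Sum>\<beta>\<in>B - {\<alpha>}. qe \<beta> * b \<beta>)"
    using assms(2) by (intro dvd_sum dvd_mult2 qe_dvd) auto
  from dvd_diff[OF assms(1)[OF assms(2)] this]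
  have "l2 \<alpha> ^ (2 * mu \<alpha>) dvd p - qe \<alpha> * b \<alpha> - (\<Sum>\<beta>\<in>B - {\<alpha>}. qe \<beta> * b \<beta>)" .
  moreover have "(\<Sum>\<beta>\<in>B. qe \<beta> * b \<beta>) = qe \<alpha> * b \<alpha> + (\<Sum>\<beta>\<in>B - {\<alpha>}. qe \<beta> * b \<beta>)"
    by (rule sum.remove[OF finite_B assms(2)])
  ultimately show ?thesis by (simp only: diff_diff_add)
qed

lemma ev_qe_0: "ev (qe \<alpha>) (\<lambda>_. 0) = 0"
  by (simp add: qe_def gtf_def)

text \<open>Near the origin \<open>Pxi\<close> is generated by \<open>exp (a z1 + b z2)\<close>. We take a truncation of this series and correct
  its tail separately along every line.\<close>

lemma Pxi_unit_at_0: "\<exists>f\<in>Pxi a b. ev f (\<lambda>_. 0) = 1"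
proof -
  obtain M where M: "M > 0" "\<And>\<alpha>. \<alpha> \<in> B \<Longrightarrow> 2 * mu \<alpha> \<le> M"
    "\<And>\<alpha>. \<alpha> \<in> B \<Longrightarrow> \<exists>K. 2 * mu \<alpha> + K \<le> M \<and> idl (qe \<alpha> ^ 3) (l2 \<alpha> ^ (2 * mu \<alpha>)) (t2 \<alpha> ^ K)"
    using common_exponent by blast
  define F where "F = texp M (Const a * Var False + Const b * Var True)"
  define c where "c = (\<lambda>\<alpha>. lin \<alpha> (- a) (- b))"
  define w where "w = (\<lambda>\<alpha>. cos \<alpha> * a + sin \<alpha> * b)"
  \<comment> \<open>The model along \<alpha>: in its coordinates the exponent is
    \<open>- c l + w t\<close>, and the tangential factor is invariant, so \<open>qc2_texp\<close>
    applies. \<open>F\<close> and \<open>G \<alpha>\<close> differ by terms of high total degree or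
    high order in \<open>l\<close>, all in the ideal of \<open>qe \<alpha> ^ 3\<close> and the power
    of \<open>l\<close>.\<close>
  define G where "G = (\<lambda>\<alpha>. texp (2 * mu \<alpha>) (Const (- c \<alpha>) * l2 \<alpha>) * texp M (Const (w \<alpha>) * t2 \<alpha>))"
  have lin: "Const a * Var False + Const b * Var True = Const (- c \<alpha>) * l2 \<alpha> + Const (w \<alpha>) * t2 \<alpha>" for \<alpha>
    by (rule pfun_eqI, simp add: c_def w_def lin_def glf_def gtf_def, use sin_squared_eq[of \<alpha>] in algebra)
  have "\<exists>b. l2 \<alpha> ^ (2 * mu \<alpha>) dvd (F - G \<alpha>) - qe \<alpha> * b" if \<alpha>: "\<alpha> \<in> B" for \<alpha>
  proof -
    let ?L = "l2 \<alpha> ^ (2 * mu \<alpha>)" and ?y = "Const (- c \<alpha>) * l2 \<alpha>" and ?w = "Const (w \<alpha>) * t2 \<alpha>"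
    obtain K where K: "2 * mu \<alpha> + K \<le> M" "idl (qe \<alpha> ^ 3) ?L (t2 \<alpha> ^ K)" using M(3) \<alpha> by blast
    have "idl (qe \<alpha> ^ 3) ?L (\<Sum>(i, j)\<in>{(i, j). i < M \<and> j < M \<and> M \<le> i + j}. Const (1 / (fact i * fact j)) * ?y ^ i * ?w ^ j)"
    proof (rule idl_sum, clarify)
      fix i j assume "i < M" "j < M" "M \<le> i + j"
      then have "idl (qe \<alpha> ^ 3) ?L (Const (1 / (fact i * fact j) * (- c \<alpha>) ^ i * w \<alpha> ^ j) * (l2 \<alpha> ^ i * t2 \<alpha> ^ j))"
        using K(1) by (intro idl_power_term[OF K(2)]) simp
      moreover have "Const (1 / (fact i * fact j) * (- c \<alpha>) ^ i * w \<alpha> ^ j) * (l2 \<alpha> ^ i * t2 \<alpha> ^ j)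
          = Const (1 / (fact i * fact j)) * ?y ^ i * ?w ^ j"
        by (rule pfun_eqI) (simp add: power_mult_distrib)
      ultimately show "idl (qe \<alpha> ^ 3) ?L (Const (1 / (fact i * fact j)) * ?y ^ i * ?w ^ j)" by (simp only:)
    qed
    then have "idl (qe \<alpha> ^ 3) ?L (texp M ?y * texp M ?w - F)"
      unfolding F_def lin[of \<alpha>] texp_mult .
    moreover have "idl (qe \<alpha> ^ 3) ?L ((texp M ?y - texp (2 * mu \<alpha>) ?y) * texp M ?w)"
    proof (rule idl_dvd, rule dvd_mult2)
      show "?L dvd texp M ?y - texp (2 * mu \<alpha>) ?y"
        using texp_dvd[of "\<lambda>b. b" \<alpha> "2 * mu \<alpha>" "M - 2 * mu \<alpha>" "Const (- c \<alpha>)"] M(2)[OF \<alpha>] by simp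
    qed
    ultimately have "idl (qe \<alpha> ^ 3) ?L (- 1 * (texp M ?y * texp M ?w - F) + (texp M ?y - texp (2 * mu \<alpha>) ?y) * texp M ?w)"
      by (intro idl_add[OF idl_mult])
    moreover have "- 1 * (texp M ?y * texp M ?w - F) + (texp M ?y - texp (2 * mu \<alpha>) ?y) * texp M ?w = F - G \<alpha>"
      by (simp add: G_def algebra_simps)
    ultimately have "idl (qe \<alpha> ^ 3) ?L (F - G \<alpha>)" by (simp only:)
    from idl_qe_imp[OF this] obtain b' g where "F - G \<alpha> = qe \<alpha> * b' + ?L * g" by blast
    then have "(F - G \<alpha>) - qe \<alpha> * b' = ?L * g" by simp
    then show ?thesis by (metis dvd_triv_left)
  qed
  then have "\<forall>\<alpha>\<in>B. \<exists>b. l2 \<alpha> ^ (2 * mu \<alpha>) dvd (F - G \<alpha>) - qe \<alpha> * b" by blast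
  from bchoice[OF this] obtain b' where b': "\<And>\<alpha>. \<alpha> \<in> B \<Longrightarrow> l2 \<alpha> ^ (2 * mu \<alpha>) dvd (F - G \<alpha>) - qe \<alpha> * b' \<alpha>" by blast
  define f where "f = F - (\<Sum>\<alpha>\<in>B. qe \<alpha> * b' \<alpha>)"
  have "f \<in> Pxi a b"
  proof -
    have "qc2 \<alpha> (Const (c \<alpha>)) (mu \<alpha>) f" if \<alpha>: "\<alpha> \<in> B" for \<alpha>
    proof -
      have "l2 \<alpha> ^ (2 * mu \<alpha>) dvd (\<Sum>\<beta>\<in>B - {\<alpha>}. qe \<beta> * b' \<beta>)"
        using \<alpha> by (intro dvd_sum dvd_mult2 qe_dvd) auto
      from dvd_diff[OF b'[OF \<alpha>] this]
      have "l2 \<alpha> ^ (2 * mu \<alpha>) dvd F - G \<alpha> - qe \<alpha> * b' \<alpha> - (\<Sum>\<beta>\<in>B - {\<alpha>}. qe \<beta> * b' \<beta>)" .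
      moreover have "f = F - (qe \<alpha> * b' \<alpha> + (\<Sum>\<beta>\<in>B - {\<alpha>}. qe \<beta> * b' \<beta>))"
        unfolding f_def by (simp only: sum.remove[OF finite_B \<alpha>])
      then have "F - G \<alpha> - qe \<alpha> * b' \<alpha> - (\<Sum>\<beta>\<in>B - {\<alpha>}. qe \<beta> * b' \<beta>) = f - G \<alpha>"
        by (simp add: algebra_simps)
      ultimately have "qc2 \<alpha> (Const (c \<alpha>)) (mu \<alpha>) (f - G \<alpha>)" by (intro qc2_of_dvd) (simp only:)
      moreover have "qc2 \<alpha> (Const (c \<alpha>)) (mu \<alpha>) (G \<alpha>)"
        unfolding G_def
      proof (rule qc2_texp)
        show "refl2 \<alpha> (texp M (Const (w \<alpha>) * t2 \<alpha>)) = texp M (Const (w \<alpha>) * t2 \<alpha>)"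
          by (simp add: refl2_texp)
      qed
      ultimately have "qc2 \<alpha> (Const (c \<alpha>)) (mu \<alpha>) ((f - G \<alpha>) + G \<alpha>)" by (rule qc2_add)
      then show ?thesis by simp
    qed
    then show ?thesis by (simp add: Pxi_def c_def)
  qed
  moreover have "ev f (\<lambda>_. 0) = 1"
  proof -
    obtain m where "M = Suc m" using M(1) by (cases M) auto
    then have "ev F (\<lambda>_. 0) = 1" by (simp add: F_def ev_texp sum.lessThan_Suc_shift del: sum.lessThan_Suc)
    then show ?thesis by (simp add: f_def ev_qe_0)
  qed
  ultimately show ?thesis by blast
qed

text \<open>The ideal of the full polynomial ring generated by \<open>Pxi a b\<close>; an
  intermediate stage before \<open>product_span\<close>, the image of the pairing with
  \<open>Pxi (- a) (- b)\<close>, where coefficients are restricted to \<open>Aring\<close>.\<close>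

inductive ideal_span :: "complex \<Rightarrow> complex \<Rightarrow> bool pfun \<Rightarrow> bool" for a b where
  ideal_span_prod: "q \<in> Pxi a b \<Longrightarrow> ideal_span a b (r * q)"
| ideal_span_add: "ideal_span a b x \<Longrightarrow> ideal_span a b y \<Longrightarrow> ideal_span a b (x + y)"

inductive product_span :: "complex \<Rightarrow> complex \<Rightarrow> bool pfun \<Rightarrow> bool" for a b where
  product_span_prod: "p \<in> Pxi a b \<Longrightarrow> q \<in> Pxi (- a) (- b) \<Longrightarrow> product_span a b (p * q)"
| product_span_add: "product_span a b x \<Longrightarrow> product_span a b y \<Longrightarrow> product_span a b (x + y)"

lemma Pxi_0: "0 \<in> Pxi a b"
  by (simp add: Pxi_def qc2_0)

lemma product_span_mult: "product_span a b x \<Longrightarrow> r \<in> Aring \<Longrightarrow> product_span a b (r * x)"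
proof (induction rule: product_span.induct)
  case (product_span_prod p q)
  then show ?case using product_span.product_span_prod[OF Aring_Pxi[OF product_span_prod(3,1)] product_span_prod(2)] by (simp add: mult.assoc)
next
  case (product_span_add x y)
  then show ?case by (simp add: distrib_left product_span.product_span_add)
qed

lemma ideal_span_sum: "(\<And>x. x \<in> X \<Longrightarrow> ideal_span a b (f x)) \<Longrightarrow> ideal_span a b (sum f X)"
  using ideal_span_prod[OF Pxi_0, of a b 0]
  by (induction X rule: infinite_finite_induct) (simp_all add: ideal_span_add)

lemma product_span_sum: "(\<And>x. x \<in> X \<Longrightarrow> product_span a b (f x)) \<Longrightarrow> product_span a b (sum f X)"
  using product_span_prod[OF Pxi_0 Pxi_0, of a b]
  by (induction X rule: infinite_finite_induct) (simp_all add: product_span_add)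

lemma ideal_span_conductor: "p \<in> conductor \<Longrightarrow> ideal_span a b p"
  using ideal_span_prod[of p a b 1] conductor_Pxi by auto

lemma sum_powers_times: "(\<Sum>i<m. n ^ i) * (1 - n) = 1 - n ^ m" for n :: "bool pfun"
  using one_diff_power_eq[of n m] by (simp only: mult.commute)

lemma texp_qe_Pxi:
  assumes "\<alpha> \<in> B"
  shows "texp (2 * mu \<alpha>) (Const (- lin \<alpha> (- a) (- b)) * l2 \<alpha>) * qe \<alpha> \<in> Pxi a b"
proof -
  have "qc2 \<beta> (Const (lin \<beta> (- a) (- b))) (mu \<beta>) (texp (2 * mu \<alpha>) (Const (- lin \<alpha> (- a) (- b)) * l2 \<alpha>) * qe \<alpha>)"
    if "\<beta> \<in> B" for \<beta>
  proof (cases "\<beta> = \<alpha>")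
    case True
    then show ?thesis using qc2_texp[OF refl2_qe] by simp
  next
    case False
    show ?thesis by (intro qc2_of_dvd dvd_mult qe_dvd that False)
  qed
  then show ?thesis by (simp add: Pxi_def)
qed

lemma texp_inverse_dvd:
  assumes "k > 0"
  shows "l2 \<alpha> ^ (2 * k) dvd - (texp (2 * k) (Const (- c) * l2 \<alpha>) * texp (2 * k) (Const c * l2 \<alpha>) - 1)"
proof -
  obtain m where "2 * k = Suc m" using assms by (cases "2 * k") auto
  then have "texp (2 * k) ((Const (- c) + Const c) * l2 \<alpha>) = 1" by (simp add: Const_simps texp_0)
  then show ?thesis using texp_mult_dvd[of "l2 \<alpha>" "2 * k" "Const (- c)" "Const c"]
    unfolding dvd_minus_iff by (simp only:)
qed

lemma qe_conductor: "\<alpha> \<in> B \<Longrightarrow> l2 \<alpha> ^ (2 * mu \<alpha>) dvd r \<Longrightarrow> qe \<alpha> * r \<in> conductor"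
  unfolding conductor_def
proof (clarify)
  fix \<beta> assume "\<alpha> \<in> B" "l2 \<alpha> ^ (2 * mu \<alpha>) dvd r" "\<beta> \<in> B"
  then show "l2 \<beta> ^ (2 * mu \<beta>) dvd qe \<alpha> * r"
    by (cases "\<beta> = \<alpha>") (simp_all add: qe_dvd)
qed

text \<open>\<open>?E (- c) * qe \<alpha>\<close> lies in \<open>Pxi a b\<close>, and multiplication
  by \<open>?E c\<close> undoes the exponential up to a power of the linear form; multiplied by
  \<open>qe \<alpha>\<close>, this error falls into the conductor.\<close>

lemma ideal_span_qe: "\<alpha> \<in> B \<Longrightarrow> ideal_span a b (qe \<alpha> * r)"
proof -
  assume \<alpha>: "\<alpha> \<in> B"
  define c where "c = lin \<alpha> (- a) (- b)"
  let ?E = "\<lambda>c. texp (2 * mu \<alpha>) (Const c * l2 \<alpha>)"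
  have "ideal_span a b ((r * ?E c) * (?E (- c) * qe \<alpha>))"
    unfolding c_def by (rule ideal_span_prod[OF texp_qe_Pxi[OF \<alpha>]])
  moreover have "ideal_span a b (qe \<alpha> * (- (?E (- c) * ?E c - 1) * r))"
    by (intro ideal_span_conductor qe_conductor \<alpha> dvd_mult2) (rule texp_inverse_dvd[OF mu_pos[OF \<alpha>]])
  ultimately have "ideal_span a b ((r * ?E c) * (?E (- c) * qe \<alpha>) + qe \<alpha> * (- (?E (- c) * ?E c - 1) * r))"
    by (rule ideal_span_add)
  moreover have "(r * ?E c) * (?E (- c) * qe \<alpha>) + qe \<alpha> * (- (?E (- c) * ?E c - 1) * r) = qe \<alpha> * r"
    by (simp add: algebra_simps)
  ultimately show ?thesis by (simp only:)
qed

text \<open>As \<open>n = 1 - f\<close> vanishes at the origin, a power of \<open>n\<close> is a combination of the \<open>qe \<alpha>\<close> modulo \<open>conductor\<close>.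
  Both of these are in the ideal generated by \<open>Pxi a b\<close>, hence so is \<open>1\<close>.\<close>

lemma ideal_span_1: "ideal_span a b 1"
proof -
  obtain f where f: "f \<in> Pxi a b" "ev f (\<lambda>_. 0) = 1" using Pxi_unit_at_0 by blast
  define n where "n = 1 - f"
  have n0: "ev n (\<lambda>_. 0) = 0" by (simp add: n_def f(2))
  obtain M where M: "\<And>\<alpha>. \<alpha> \<in> B \<Longrightarrow> \<exists>K. 2 * mu \<alpha> + K \<le> M \<and> idl (qe \<alpha> ^ 3) (l2 \<alpha> ^ (2 * mu \<alpha>)) (t2 \<alpha> ^ K)"
    using common_exponent by blast
  have "\<exists>b. l2 \<alpha> ^ (2 * mu \<alpha>) dvd n ^ M - qe \<alpha> * b" if \<alpha>: "\<alpha> \<in> B" for \<alpha>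
  proof -
    obtain K where K: "2 * mu \<alpha> + K \<le> M" "idl (qe \<alpha> ^ 3) (l2 \<alpha> ^ (2 * mu \<alpha>)) (t2 \<alpha> ^ K)" using M \<alpha> by blast
    from idl_qe_imp[OF idl_power_vanish[OF n0 K(2) K(1)]]
    obtain b g where "n ^ M = qe \<alpha> * b + l2 \<alpha> ^ (2 * mu \<alpha>) * g" by blast
    then have "n ^ M - qe \<alpha> * b = l2 \<alpha> ^ (2 * mu \<alpha>) * g" by simp
    then show ?thesis by (metis dvd_triv_left)
  qed
  then have "\<forall>\<alpha>\<in>B. \<exists>b. l2 \<alpha> ^ (2 * mu \<alpha>) dvd n ^ M - qe \<alpha> * b" by blast
  from bchoice[OF this] obtain b' where b': "\<And>\<alpha>. \<alpha> \<in> B \<Longrightarrow> l2 \<alpha> ^ (2 * mu \<alpha>) dvd n ^ M - qe \<alpha> * b' \<alpha>" by blast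
  have "n ^ M - (\<Sum>\<alpha>\<in>B. qe \<alpha> * b' \<alpha>) \<in> conductor" using glue[OF b'] by (simp add: conductor_def)
  then have "ideal_span a b ((n ^ M - (\<Sum>\<alpha>\<in>B. qe \<alpha> * b' \<alpha>)) + (\<Sum>\<alpha>\<in>B. qe \<alpha> * b' \<alpha>))"
    by (intro ideal_span_add ideal_span_conductor ideal_span_sum ideal_span_qe)
  then have "ideal_span a b (n ^ M)" by simp
  moreover have "ideal_span a b ((\<Sum>i<M. n ^ i) * (1 - n))" by (rule ideal_span_prod) (simp add: n_def f(1))
  then have "ideal_span a b (1 - n ^ M)" unfolding sum_powers_times .
  ultimately have "ideal_span a b ((1 - n ^ M) + n ^ M)" by (intro ideal_span_add)
  then show ?thesis by simp
qed

text \<open>By \<open>ideal_span_1\<close>, the element 1 is a combination of members of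
  \<open>Pxi (- a) (- b)\<close> with arbitrary coefficients; the factor \<open>p\<close> absorbs
  these coefficients, since its multiples stay in the conductor and hence in
  \<open>Pxi a b\<close>.\<close>

lemma product_span_conductor: "p \<in> conductor \<Longrightarrow> product_span a b p"
proof -
  assume p: "p \<in> conductor"
  have "product_span a b (p * x)" if "ideal_span (- a) (- b) x" for x
    using that
  proof (induction rule: ideal_span.induct)
    case (ideal_span_prod q r)
    have "p * r \<in> Pxi a b" using conductor_mult(2)[OF p] conductor_Pxi by blast
    from product_span_prod[OF this ideal_span_prod] show ?case by (simp add: mult.assoc)
  next
    case (ideal_span_add x y)
    then show ?case by (simp add: distrib_left product_span_add)
  qed
  from this[OF ideal_span_1] show ?thesis by simp
qed

text \<open>Opposite truncated exponentials, one in each module, multiply to 1 up to the conductor;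
  each needs its own factor \<open>qe \<alpha>\<close> to satisfy the conditions on the other lines,
  hence the square.\<close>

lemma product_span_qe:
  assumes \<alpha>: "\<alpha> \<in> B" and r: "r \<in> Aring"
  shows "product_span a b (qe \<alpha> ^ 2 * r)"
proof -
  define c where "c = lin \<alpha> (- a) (- b)"
  let ?E = "\<lambda>c. texp (2 * mu \<alpha>) (Const c * l2 \<alpha>)"
  have "?E (- c) * qe \<alpha> \<in> Pxi a b" unfolding c_def by (rule texp_qe_Pxi[OF \<alpha>])
  moreover have "?E c * qe \<alpha> \<in> Pxi (- a) (- b)"
    using texp_qe_Pxi[OF \<alpha>, of "- a" "- b"] unfolding lin_neg[of \<alpha> a b] c_def[symmetric] minus_minus[of c] .
  then have "r * (?E c * qe \<alpha>) \<in> Pxi (- a) (- b)" by (rule Aring_Pxi[OF r])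
  ultimately have "product_span a b ((?E (- c) * qe \<alpha>) * (r * (?E c * qe \<alpha>)))" by (rule product_span_prod)
  moreover have "product_span a b (qe \<alpha> * (- (?E (- c) * ?E c - 1) * (qe \<alpha> * r)))"
    by (intro product_span_conductor qe_conductor \<alpha> dvd_mult2) (rule texp_inverse_dvd[OF mu_pos[OF \<alpha>]])
  ultimately have "product_span a b ((?E (- c) * qe \<alpha>) * (r * (?E c * qe \<alpha>)) + qe \<alpha> * (- (?E (- c) * ?E c - 1) * (qe \<alpha> * r)))"
    by (rule product_span_add)
  moreover have "(?E (- c) * qe \<alpha>) * (r * (?E c * qe \<alpha>)) + qe \<alpha> * (- (?E (- c) * ?E c - 1) * (qe \<alpha> * r)) = qe \<alpha> ^ 2 * r"
    by (simp add: algebra_simps power2_eq_square)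
  ultimately show ?thesis by (simp only:)
qed

lemma refl2_half: "refl2 \<alpha> (Const (1 / 2) * (p + refl2 \<alpha> p)) = Const (1 / 2) * (p + refl2 \<alpha> p)"
  by (simp add: add.commute)

text \<open>The argument of \<open>ideal_span_1\<close>, with coefficients in \<open>Aring\<close> instead of arbitrary polynomials; this is why the
  coefficients have to be made invariant under the reflections.\<close>

lemma product_span_1: "product_span a b 1"
proof -
  obtain f where f: "f \<in> Pxi a b" "ev f (\<lambda>_. 0) = 1" using Pxi_unit_at_0 by blast
  obtain f' where f': "f' \<in> Pxi (- a) (- b)" "ev f' (\<lambda>_. 0) = 1" using Pxi_unit_at_0 by blast
  define n where "n = 1 - f * f'"
  have nA: "n \<in> Aring" unfolding n_def by (intro Aring_diff Aring_1 Pxi_Pxi[OF f(1) f'(1)])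
  obtain M where M: "\<And>\<alpha>. \<alpha> \<in> B \<Longrightarrow> \<exists>K. 2 * mu \<alpha> + K \<le> M \<and> idl (qe \<alpha> ^ 3) (l2 \<alpha> ^ (2 * mu \<alpha>)) (t2 \<alpha> ^ K)"
    using common_exponent by blast
  have "\<exists>b. refl2 \<alpha> b = b \<and> l2 \<alpha> ^ (2 * mu \<alpha>) dvd n ^ M - qe \<alpha> ^ 3 * b" if \<alpha>: "\<alpha> \<in> B" for \<alpha>
  proof -
    let ?L = "l2 \<alpha> ^ (2 * mu \<alpha>)"
    \<comment> \<open>\<open>n\<close> is invariant only modulo \<open>?L\<close>; its average under
      the reflection is exactly invariant and agrees with \<open>n\<close> modulo
      \<open>?L\<close>.\<close>
    define e where "e = Const (1 / 2) * (n + refl2 \<alpha> n)"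
    have even: "refl2 \<alpha> e = e" unfolding e_def by (rule refl2_half)
    have "ev (refl2 \<alpha> p) (\<lambda>_. 0) = ev p (\<lambda>_. 0)" for p
      unfolding refl_def ev_subst by (rule arg_cong[of _ _ "ev p"]) (simp add: fun_eq_iff)
    then have e0: "ev e (\<lambda>_. 0) = 0" by (simp add: e_def n_def f f')
    obtain K where K: "2 * mu \<alpha> + K \<le> M" "idl (qe \<alpha> ^ 3) ?L (t2 \<alpha> ^ K)" using M \<alpha> by blast
    obtain b g where b: "e ^ M = qe \<alpha> ^ 3 * b + ?L * g"
      using idl_power_vanish[OF e0 K(2) K(1)] by (auto simp: idl_def)
    \<comment> \<open>As \<open>e\<close> and \<open>qe \<alpha>\<close> are invariant, the
      reflected representation of \<open>e ^ M\<close> holds as well, and averaging both makes the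
      coefficient invariant.\<close>
    define b' where "b' = Const (1 / 2) * (b + refl2 \<alpha> b)"
    have "e ^ M = refl2 \<alpha> (e ^ M)" by (simp add: even)
    also have "\<dots> = qe \<alpha> ^ 3 * refl2 \<alpha> b + ?L * refl2 \<alpha> g"
      unfolding b refl_simps(3,4) refl2_even_power refl_simps(8)[of _ _ "qe \<alpha>"] refl2_qe ..
    finally have b2: "e ^ M = qe \<alpha> ^ 3 * refl2 \<alpha> b + ?L * refl2 \<alpha> g" .
    have "e ^ M = Const (1 / 2) * (e ^ M + e ^ M)" by (rule pfun_eqI) simp
    also have "\<dots> = Const (1 / 2) * ((qe \<alpha> ^ 3 * b + ?L * g) + (qe \<alpha> ^ 3 * refl2 \<alpha> b + ?L * refl2 \<alpha> g))"
      using b b2 by simp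
    also have "\<dots> = qe \<alpha> ^ 3 * b' + ?L * (Const (1 / 2) * (g + refl2 \<alpha> g))"
      by (simp add: b'_def algebra_simps)
    finally have "?L dvd e ^ M - qe \<alpha> ^ 3 * b'" by simp
    moreover have "?L dvd n ^ M - e ^ M"
    proof -
      have "?L dvd n - refl2 \<alpha> n" using nA \<alpha> unfolding Aring_def qc2_zero_iff[OF mu_pos[OF \<alpha>], symmetric] by blast
      then have "?L dvd Const (1 / 2) * (n - refl2 \<alpha> n)" by (rule dvd_mult)
      moreover have "Const (1 / 2) * (n - refl2 \<alpha> n) = n - e" unfolding e_def by (rule pfun_eqI) (simp add: field_simps)
      ultimately have "?L dvd n - e" by (simp only:)
      then show ?thesis by (simp add: power_diff_sumr2)
    qed
    ultimately have "?L dvd (e ^ M - qe \<alpha> ^ 3 * b') + (n ^ M - e ^ M)" by (rule dvd_add)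
    then have "?L dvd n ^ M - qe \<alpha> ^ 3 * b'" by simp
    moreover have "refl2 \<alpha> b' = b'" unfolding b'_def by (rule refl2_half)
    ultimately show ?thesis by blast
  qed
  then have "\<forall>\<alpha>\<in>B. \<exists>b. refl2 \<alpha> b = b \<and> l2 \<alpha> ^ (2 * mu \<alpha>) dvd n ^ M - qe \<alpha> ^ 3 * b" by blast
  from bchoice[OF this] obtain b' where b': "\<And>\<alpha>. \<alpha> \<in> B \<Longrightarrow> refl2 \<alpha> (b' \<alpha>) = b' \<alpha>"
    "\<And>\<alpha>. \<alpha> \<in> B \<Longrightarrow> l2 \<alpha> ^ (2 * mu \<alpha>) dvd n ^ M - qe \<alpha> ^ 3 * b' \<alpha>" by blast
  have eq: "qe \<alpha> ^ 3 * b' \<alpha> = qe \<alpha> * (qe \<alpha> ^ 2 * b' \<alpha>)" "qe \<alpha> ^ 3 * b' \<alpha> = qe \<alpha> ^ 2 * (qe \<alpha> * b' \<alpha>)" for \<alpha>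
    by (simp_all add: power2_eq_square power3_eq_cube mult_ac)
  have "qe \<alpha> * b' \<alpha> \<in> Aring" if \<alpha>: "\<alpha> \<in> B" for \<alpha>
  proof (rule Aring_even)
    fix \<beta> assume "\<beta> \<in> B"
    then show "refl2 \<beta> (qe \<alpha> * b' \<alpha>) = qe \<alpha> * b' \<alpha> \<or> l2 \<beta> ^ (2 * mu \<beta>) dvd qe \<alpha> * b' \<alpha>"
      by (cases "\<beta> = \<alpha>") (simp_all add: refl2_qe b'(1) qe_dvd)
  qed
  then have "product_span a b (\<Sum>\<alpha>\<in>B. qe \<alpha> ^ 3 * b' \<alpha>)" unfolding eq(2) by (intro product_span_sum product_span_qe)
  moreover have "n ^ M - (\<Sum>\<alpha>\<in>B. qe \<alpha> ^ 3 * b' \<alpha>) \<in> conductor"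
    using glue[of "n ^ M" "\<lambda>\<alpha>. qe \<alpha> ^ 2 * b' \<alpha>"] b'(2) unfolding eq(1) by (simp add: conductor_def)
  then have "product_span a b (n ^ M - (\<Sum>\<alpha>\<in>B. qe \<alpha> ^ 3 * b' \<alpha>))" by (rule product_span_conductor)
  ultimately have "product_span a b ((n ^ M - (\<Sum>\<alpha>\<in>B. qe \<alpha> ^ 3 * b' \<alpha>)) + (\<Sum>\<alpha>\<in>B. qe \<alpha> ^ 3 * b' \<alpha>))" by (intro product_span_add)
  then have "product_span a b (n ^ M)" by simp
  moreover have "product_span a b ((\<Sum>i<M. n ^ i) * (f * f'))"
    by (intro product_span_mult product_span_prod f f' Aring_sum Aring_power nA)
  moreover have "f * f' = 1 - n" by (simp add: n_def)
  ultimately have "product_span a b (1 - n ^ M)" "product_span a b (n ^ M)" by (simp_all only: sum_powers_times)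
  then have "product_span a b ((1 - n ^ M) + n ^ M)" by (rule product_span_add)
  then show ?thesis by simp
qed

lemma dual_basis:
  "\<exists>xs. (\<forall>(f, g)\<in>set xs. f \<in> Pxi a b \<and> g \<in> Pxi (- a) (- b)) \<and> (\<Sum>(f, g)\<leftarrow>xs. f * g) = 1"
proof -
  have "\<exists>xs. (\<forall>(f, g)\<in>set xs. f \<in> Pxi a b \<and> g \<in> Pxi (- a) (- b)) \<and> (\<Sum>(f, g)\<leftarrow>xs. f * g) = x" if "product_span a b x" for x
    using that
  proof (induction rule: product_span.induct)
    case (product_span_prod p q)
    then show ?case by (intro exI[of _ "[(p, q)]"]) simp
  next
    case (product_span_add x y)
    then obtain xs ys where "\<forall>(f, g)\<in>set xs. f \<in> Pxi a b \<and> g \<in> Pxi (- a) (- b)" "(\<Sum>(f, g)\<leftarrow>xs. f * g) = x"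
      "\<forall>(f, g)\<in>set ys. f \<in> Pxi a b \<and> g \<in> Pxi (- a) (- b)" "(\<Sum>(f, g)\<leftarrow>ys. f * g) = y" by blast
    then show ?case by (intro exI[of _ "xs @ ys"]) auto
  qed
  from this[OF product_span_1] show ?thesis .
qed

end

subsection \<open>Projectivity\<close>

lemma sum_list_additive:
  fixes h :: "'a::ab_group_add \<Rightarrow> 'b::ab_group_add"
  assumes "0 \<in> M" "\<And>x y. x \<in> M \<Longrightarrow> y \<in> M \<Longrightarrow> x + y \<in> M"
    and add: "\<And>x y. x \<in> M \<Longrightarrow> y \<in> M \<Longrightarrow> h (x + y) = h x + h y"
    and "\<And>i. i \<in> set xs \<Longrightarrow> f i \<in> M"
  shows "(\<Sum>i\<leftarrow>xs. f i) \<in> M" "h (\<Sum>i\<leftarrow>xs. f i) = (\<Sum>i\<leftarrow>xs. h (f i))"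
proof -
  have h0: "h 0 = 0" using add[OF assms(1,1)] by simp
  have "(\<Sum>i\<leftarrow>xs. f i) \<in> M \<and> h (\<Sum>i\<leftarrow>xs. f i) = (\<Sum>i\<leftarrow>xs. h (f i))"
    using assms(4) by (induction xs) (simp_all add: assms(1,2) add h0)
  then show "(\<Sum>i\<leftarrow>xs. f i) \<in> M" "h (\<Sum>i\<leftarrow>xs. f i) = (\<Sum>i\<leftarrow>xs. h (f i))" by blast+
qed

text \<open>Dual basis argument: \<open>w\<close> is the sum of \<open>(w * g) * f\<close> over the
  pairs, with coefficients \<open>w * g\<close> in \<open>A\<close>. So it suffices to lift the
  values \<open>h f\<close> for the finitely many \<open>f\<close> and to extend by these
  coefficients, which depend linearly on \<open>w\<close>.\<close>

lemma A_projective_of_dual_basis: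
  fixes A W :: "cfun2 set" and xs :: "(cfun2 \<times> cfun2) list"
  assumes W_0: "0 \<in> W" and W_add: "\<And>u v. u \<in> W \<Longrightarrow> v \<in> W \<Longrightarrow> u + v \<in> W"
    and W_act: "\<And>a w. a \<in> A \<Longrightarrow> w \<in> W \<Longrightarrow> (\<lambda>z1 z2. a z1 z2 * w z1 z2) \<in> W"
    and f: "\<And>i. i \<in> set xs \<Longrightarrow> fst i \<in> W"
    and g: "\<And>i w. i \<in> set xs \<Longrightarrow> w \<in> W \<Longrightarrow> (\<lambda>z1 z2. w z1 z2 * snd i z1 z2) \<in> A"
    and dual: "\<And>z1 z2. (\<Sum>i\<leftarrow>xs. snd i z1 z2 * fst i z1 z2) = 1"
  shows "A_projective TYPE('b::ab_group_add) A W"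
  unfolding A_projective_def
proof (intro allI impI, elim conjE)
  fix M :: "'b set" and actM and N :: "'b set" and actN p h
  assume M: "is_A_module A M actM" and N: "is_A_module A N actN"
    and p: "is_A_hom A M actM N actN p" and surj: "p ` M = N"
    and h: "is_A_hom A W (\<lambda>a u z1 z2. a z1 z2 * u z1 z2) N actN h"
  have M_0: "0 \<in> M" and M_add: "\<And>x y. x \<in> M \<Longrightarrow> y \<in> M \<Longrightarrow> x + y \<in> M"
    and M_act: "\<And>a x. a \<in> A \<Longrightarrow> x \<in> M \<Longrightarrow> actM a x \<in> M"
    and act_add: "\<And>a x y. a \<in> A \<Longrightarrow> x \<in> M \<Longrightarrow> y \<in> M \<Longrightarrow> actM a (x + y) = actM a x + actM a y"
    and add_act: "\<And>a b x. a \<in> A \<Longrightarrow> b \<in> A \<Longrightarrow> x \<in> M \<Longrightarrow> actM (\<lambda>z1 z2. a z1 z2 + b z1 z2) x = actM a x + actM b x"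
    and act_act: "\<And>a b x. a \<in> A \<Longrightarrow> b \<in> A \<Longrightarrow> x \<in> M \<Longrightarrow> actM (\<lambda>z1 z2. a z1 z2 * b z1 z2) x = actM a (actM b x)"
    using M by (simp_all add: is_A_module_def)
  have p_add: "\<And>x y. x \<in> M \<Longrightarrow> y \<in> M \<Longrightarrow> p (x + y) = p x + p y"
    and p_act: "\<And>a x. a \<in> A \<Longrightarrow> x \<in> M \<Longrightarrow> p (actM a x) = actN a (p x)"
    using p by (simp_all add: is_A_hom_def)
  have h_N: "\<And>w. w \<in> W \<Longrightarrow> h w \<in> N"
    and h_add: "\<And>u v. u \<in> W \<Longrightarrow> v \<in> W \<Longrightarrow> h (u + v) = h u + h v"
    and h_act: "\<And>a w. a \<in> A \<Longrightarrow> w \<in> W \<Longrightarrow> h (\<lambda>z1 z2. a z1 z2 * w z1 z2) = actN a (h w)"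
    using h by (simp_all add: is_A_hom_def)
  have "\<forall>w\<in>W. \<exists>x. x \<in> M \<and> p x = h w"
  proof
    fix w assume "w \<in> W"
    then have "h w \<in> p ` M" using h_N surj by simp
    then obtain x where "h w = p x" "x \<in> M" by (rule imageE)
    then show "\<exists>x. x \<in> M \<and> p x = h w" by auto
  qed
  from bchoice[OF this] obtain m where m: "\<And>w. w \<in> W \<Longrightarrow> m w \<in> M" "\<And>w. w \<in> W \<Longrightarrow> p (m w) = h w" by blast
  define c :: "cfun2 \<Rightarrow> cfun2 \<times> cfun2 \<Rightarrow> cfun2" where "c = (\<lambda>w i z1 z2. w z1 z2 * snd i z1 z2)"
  define G where "G = (\<lambda>w. \<Sum>i\<leftarrow>xs. actM (c w i) (m (fst i)))"
  have c: "c w i \<in> A" if "i \<in> set xs" "w \<in> W" for w i using g[OF that] by (simp add: c_def)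
  have term_M: "actM (c w i) (m (fst i)) \<in> M" if "i \<in> set xs" "w \<in> W" for w i
    by (intro M_act c m f that)
  have "G w \<in> M" if "w \<in> W" for w
    unfolding G_def by (rule sum_list_additive(1)[OF M_0 M_add p_add]) (use term_M that in auto)
  moreover have "G (u + v) = G u + G v" if "u \<in> W" "v \<in> W" for u v
  proof -
    have "c (u + v) i = (\<lambda>z1 z2. c u i z1 z2 + c v i z1 z2)" for i
      by (simp add: c_def fun_eq_iff distrib_right)
    then have "actM (c (u + v) i) (m (fst i)) = actM (c u i) (m (fst i)) + actM (c v i) (m (fst i))"
      if "i \<in> set xs" for i
      using add_act[OF c[OF that \<open>u \<in> W\<close>] c[OF that \<open>v \<in> W\<close>] m(1)[OF f[OF that]]] by simp
    then have "G (u + v) = (\<Sum>i\<leftarrow>xs. actM (c u i) (m (fst i)) + actM (c v i) (m (fst i)))"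
      unfolding G_def by (intro arg_cong[of _ _ sum_list] map_cong) auto
    then show ?thesis by (simp add: G_def sum_list_addf)
  qed
  moreover have "G (\<lambda>z1 z2. a z1 z2 * w z1 z2) = actM a (G w)" if "a \<in> A" "w \<in> W" for a w
  proof -
    have "c (\<lambda>z1 z2. a z1 z2 * w z1 z2) i = (\<lambda>z1 z2. a z1 z2 * c w i z1 z2)" for i
      by (simp add: c_def fun_eq_iff mult.assoc)
    then have "actM (c (\<lambda>z1 z2. a z1 z2 * w z1 z2) i) (m (fst i)) = actM a (actM (c w i) (m (fst i)))"
      if "i \<in> set xs" for i
      using act_act[OF \<open>a \<in> A\<close> c[OF that \<open>w \<in> W\<close>] m(1)[OF f[OF that]]] by simp
    then have "G (\<lambda>z1 z2. a z1 z2 * w z1 z2) = (\<Sum>i\<leftarrow>xs. actM a (actM (c w i) (m (fst i))))"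
      unfolding G_def by (intro arg_cong[of _ _ sum_list] map_cong) auto
    also have "\<dots> = actM a (G w)"
      unfolding G_def
      by (rule sum_list_additive(2)[OF M_0 M_add act_add, symmetric]) (use term_M that in auto)
    finally show ?thesis .
  qed
  moreover have "p (G w) = h w" if w: "w \<in> W" for w
  proof -
    have "p (G w) = (\<Sum>i\<leftarrow>xs. p (actM (c w i) (m (fst i))))"
      unfolding G_def by (rule sum_list_additive(2)[OF M_0 M_add p_add]) (use term_M w in auto)
    also have "\<dots> = (\<Sum>i\<leftarrow>xs. h (\<lambda>z1 z2. c w i z1 z2 * fst i z1 z2))"
      using c[OF _ w] f m by (intro arg_cong[of _ _ sum_list] map_cong) (simp_all add: p_act h_act)
    also have "\<dots> = h (\<Sum>i\<leftarrow>xs. (\<lambda>z1 z2. c w i z1 z2 * fst i z1 z2))"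
      by (rule sum_list_additive(2)[where M = W and h = h, OF W_0 W_add h_add, symmetric]) (use W_act c[OF _ w] f in auto)
    also have "(\<Sum>i\<leftarrow>xs. (\<lambda>z1 z2. c w i z1 z2 * fst i z1 z2)) = w"
    proof (intro ext)
      fix z1 z2
      have "(\<Sum>i\<leftarrow>ys. F i) z1 z2 = (\<Sum>i\<leftarrow>ys. F i z1 z2)" for F :: "cfun2 \<times> cfun2 \<Rightarrow> cfun2" and ys
        by (induction ys) simp_all
      then have "(\<Sum>i\<leftarrow>xs. (\<lambda>z1 z2. c w i z1 z2 * fst i z1 z2)) z1 z2 = (\<Sum>i\<leftarrow>xs. w z1 z2 * (snd i z1 z2 * fst i z1 z2))"
        by (simp add: c_def mult.assoc)
      also have "\<dots> = w z1 z2" unfolding sum_list_const_mult dual by simp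
      finally show "(\<Sum>i\<leftarrow>xs. (\<lambda>z1 z2. c w i z1 z2 * fst i z1 z2)) z1 z2 = w z1 z2" .
    qed
    finally show ?thesis .
  qed
  ultimately show "\<exists>g. is_A_hom A W (\<lambda>a u z1 z2. a z1 z2 * u z1 z2) M actM g \<and> (\<forall>w\<in>W. p (g w) = h w)"
    unfolding is_A_hom_def by (intro exI[of _ G]) blast
qed

context ba_shift
begin

lemma ringA_eq: "ringA Pa mu = fn2 ` Aring"
proof -
  have "fn2 p \<in> ringA Pa mu \<longleftrightarrow> p \<in> Aring" for p
  proof -
    \<comment> \<open>\<open>p\<close> and its reflection always agree on the line, so multiplicity
      0 imposes no condition on the ring.\<close>
    have 0: "l2 \<alpha> ^ (2 * mu \<alpha> + 1) dvd p - refl2 \<alpha> p" if "mu \<alpha> = 0" for \<alpha>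
    proof -
      have "r2 \<alpha> (p - refl2 \<alpha> p) = 0" by simp
      then have "l2 \<alpha> dvd p - refl2 \<alpha> p" unfolding l2_dvd_iff .
      then show ?thesis using that by simp
    qed
    have 1: "l2 \<alpha> ^ (2 * mu \<alpha> + 1) dvd p - refl2 \<alpha> p \<longleftrightarrow> qc2 \<alpha> (Const 0) (mu \<alpha>) p" if "mu \<alpha> > 0" for \<alpha>
      unfolding qc2_zero_iff[OF that] using odd_dvd_Suc power_le_dvd le_add1 by blast
    show ?thesis unfolding ringA_iff
    proof
      assume *: "\<forall>\<alpha>\<in>Pa. l2 \<alpha> ^ (2 * mu \<alpha> + 1) dvd p - refl2 \<alpha> p"
      have "qc2 \<alpha> (Const 0) (mu \<alpha>) p" if "\<alpha> \<in> B" for \<alpha>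
        using 1[OF mu_pos[OF that]] * that B_eq by blast
      then show "p \<in> Aring" by (simp add: Aring_def)
    next
      assume *: "p \<in> Aring"
      show "\<forall>\<alpha>\<in>Pa. l2 \<alpha> ^ (2 * mu \<alpha> + 1) dvd p - refl2 \<alpha> p"
      proof
        fix \<alpha> assume "\<alpha> \<in> Pa"
        show "l2 \<alpha> ^ (2 * mu \<alpha> + 1) dvd p - refl2 \<alpha> p"
        proof (cases "mu \<alpha> = 0")
          case False
          then have "\<alpha> \<in> B" using \<open>\<alpha> \<in> Pa\<close> B_eq by simp
          then show ?thesis using * 1[of \<alpha>] False by (simp add: Aring_def)
        qed (rule 0)
      qed
    qed
  qed
  note iff = this
  show ?thesis
  proof (intro set_eqI iffI)
    fix f assume f: "f \<in> ringA Pa mu"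
    then obtain p where "f = fn2 p" unfolding ringA_def poly2_iff by blast
    then show "f \<in> fn2 ` Aring" using f iff by simp
  next
    fix f assume "f \<in> fn2 ` Aring"
    then obtain p where "f = fn2 p" "p \<in> Aring" by blast
    then show "f \<in> ringA Pa mu" using iff by simp
  qed
qed

theorem projective: "A_projective TYPE('b::ab_group_add) (ringA Pa mu) (Pmod Pa mu \<xi>1 \<xi>2)"
proof -
  obtain xs where xs: "\<forall>(f, g)\<in>set xs. f \<in> Pxi \<xi>1 \<xi>2 \<and> g \<in> Pxi (- \<xi>1) (- \<xi>2)" "(\<Sum>(f, g)\<leftarrow>xs. f * g) = 1"
    using dual_basis by blast
  show ?thesis
    unfolding ringA_eq Pmod_eq
  proof (rule A_projective_of_dual_basis[where xs = "map (map_prod fn2 fn2) xs"])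
    have "fn2 0 = 0" by (simp add: fn2_def fun_eq_iff)
    then show "0 \<in> fn2 ` Pxi \<xi>1 \<xi>2" using Pxi_0 by (metis imageI)
  next
    fix u v assume "u \<in> fn2 ` Pxi \<xi>1 \<xi>2" "v \<in> fn2 ` Pxi \<xi>1 \<xi>2"
    then obtain p q where pq: "u = fn2 p" "v = fn2 q" "p \<in> Pxi \<xi>1 \<xi>2" "q \<in> Pxi \<xi>1 \<xi>2" by blast
    then have "p + q \<in> Pxi \<xi>1 \<xi>2" by (simp add: Pxi_def qc2_add)
    moreover have "u + v = fn2 (p + q)" by (simp add: fn2_simps pq fun_eq_iff)
    ultimately show "u + v \<in> fn2 ` Pxi \<xi>1 \<xi>2" by blast
  next
    fix a w assume "a \<in> fn2 ` Aring" "w \<in> fn2 ` Pxi \<xi>1 \<xi>2"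
    then show "(\<lambda>z1 z2. a z1 z2 * w z1 z2) \<in> fn2 ` Pxi \<xi>1 \<xi>2"
      using Aring_Pxi by (auto simp: fn2_simps(2)[symmetric])
  next
    fix i assume "i \<in> set (map (map_prod fn2 fn2) xs)"
    then show "fst i \<in> fn2 ` Pxi \<xi>1 \<xi>2" using xs(1) by auto
  next
    fix i w assume "i \<in> set (map (map_prod fn2 fn2) xs)" "w \<in> fn2 ` Pxi \<xi>1 \<xi>2"
    then show "(\<lambda>z1 z2. w z1 z2 * snd i z1 z2) \<in> fn2 ` Aring"
      using xs(1) Pxi_Pxi by (auto simp: fn2_simps(2)[symmetric])
  next
    fix z1 z2
    have "(\<Sum>i\<leftarrow>map (map_prod fn2 fn2) ys. snd i z1 z2 * fst i z1 z2) = fn2 (\<Sum>(f, g)\<leftarrow>ys. f * g) z1 z2" for ys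
      by (induction ys) (auto simp: fn2_def mult.commute)
    then show "(\<Sum>i\<leftarrow>map (map_prod fn2 fn2) xs. snd i z1 z2 * fst i z1 z2) = 1"
      by (simp add: xs(2) fn2_simps)
  qed
qed

end

section \<open>Translation of the Baker--Akhieser hypotheses into sines and cotangents\<close>

lemma arrangement_sin_neq_0:
  assumes "arrangement Pa" "\<alpha> \<in> Pa" "\<beta> \<in> Pa" "\<alpha> \<noteq> \<beta>"
  shows "sin (\<alpha> - \<beta>) \<noteq> 0"
proof
  assume "sin (\<alpha> - \<beta>) = 0"
  then obtain n :: int where "\<alpha> - \<beta> = of_real (of_int n * pi)" unfolding sin_eq_0 by blast
  then have "\<alpha> - \<beta> = of_int n * of_real pi" by simp
  then show False using assms unfolding arrangement_def by blast
qed

text \<open>Both exponentials share the factor \<open>exp (\<i> * (\<alpha> + \<beta>))\<close>;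
  what remains is a cosine over a sine, up to the factor \<open>\<i>\<close>.\<close>

lemma eA_quotient:
  assumes "sin (\<alpha> - \<beta>) \<noteq> 0"
  shows "(eA \<beta> + eA \<alpha>) / (eA \<beta> - eA \<alpha>) = \<i> * cot (\<alpha> - \<beta>)"
proof -
  let ?u = "exp (\<i> * (\<alpha> - \<beta>))" and ?v = "exp (- (\<i> * (\<alpha> - \<beta>)))" and ?s = "exp (\<i> * (\<alpha> + \<beta>))"
  have e: "eA \<alpha> = ?s * ?u" "eA \<beta> = ?s * ?v"
    unfolding eA_def exp_add[symmetric] by (simp_all add: algebra_simps)
  have cs: "cos (\<alpha> - \<beta>) = (?u + ?v) / 2" "sin (\<alpha> - \<beta>) = (?u - ?v) / (2 * \<i>)"
    by (rule cos_exp_eq, rule sin_exp_eq)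
  have "?u - ?v \<noteq> 0" using assms unfolding cs by auto
  then have "?v - ?u \<noteq> 0" by auto
  have "(eA \<beta> + eA \<alpha>) / (eA \<beta> - eA \<alpha>) = (?s * (?u + ?v)) / (?s * (?v - ?u))"
    unfolding e by (simp add: algebra_simps)
  also have "\<dots> = (?u + ?v) / (?v - ?u)" by simp
  also have "\<dots> = \<i> * cot (\<alpha> - \<beta>)"
    unfolding cot_def cs using \<open>?u - ?v \<noteq> 0\<close> \<open>?v - ?u \<noteq> 0\<close> by (simp add: field_simps)
  finally show ?thesis .
qed

text \<open>The first identity is taken at index \<open>Suc k\<close> for
  \<open>j = 2 * k + 1\<close>; the nonzero factor \<open>\<i> ^ j\<close> is common to all terms,
  and lines of multiplicity 0 contribute zero.\<close>

lemma baker_akhieser_cot_sum: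
  assumes ba: "baker_akhieser Pa \<mu>" and \<alpha>: "\<alpha> \<in> Pa" and "odd j" "j < 2 * \<mu> \<alpha>"
  shows "(\<Sum>\<beta>\<in>{\<beta> \<in> Pa. \<mu> \<beta> > 0} - {\<alpha>}. of_nat (\<mu> \<beta>) * cot (\<alpha> - \<beta>) ^ j) = 0"
proof -
  have fin: "finite Pa" and arr: "arrangement Pa"
    using ba by (simp_all add: baker_akhieser_def arrangement_def)
  obtain k where k: "j = 2 * k + 1" using \<open>odd j\<close> by (elim oddE)
  have "(\<Sum>\<beta>\<in>Pa - {\<alpha>}. of_nat (\<mu> \<beta>) * (eA \<beta> + eA \<alpha>) ^ (2 * Suc k - 1) / (eA \<beta> - eA \<alpha>) ^ (2 * Suc k - 1)) = 0"
    if "1 \<le> Suc k" "Suc k \<le> \<mu> \<alpha>"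
    using ba[unfolded baker_akhieser_def, THEN conjunct2, rule_format, OF \<alpha>, OF conjI[OF that], THEN conjunct1] .
  moreover have "2 * Suc k - 1 = j" "1 \<le> Suc k" "Suc k \<le> \<mu> \<alpha>" using k assms(4) by simp_all
  ultimately have "0 = (\<Sum>\<beta>\<in>Pa - {\<alpha>}. of_nat (\<mu> \<beta>) * (eA \<beta> + eA \<alpha>) ^ j / (eA \<beta> - eA \<alpha>) ^ j)" by (simp only:)
  also have "\<dots> = (\<Sum>\<beta>\<in>Pa - {\<alpha>}. \<i> ^ j * (of_nat (\<mu> \<beta>) * cot (\<alpha> - \<beta>) ^ j))"
  proof (rule sum.cong[OF refl])
    fix \<beta> assume "\<beta> \<in> Pa - {\<alpha>}"
    then have "((eA \<beta> + eA \<alpha>) / (eA \<beta> - eA \<alpha>)) ^ j = (\<i> * cot (\<alpha> - \<beta>)) ^ j"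
      using eA_quotient arrangement_sin_neq_0[OF arr \<alpha>] by auto
    then show "of_nat (\<mu> \<beta>) * (eA \<beta> + eA \<alpha>) ^ j / (eA \<beta> - eA \<alpha>) ^ j = \<i> ^ j * (of_nat (\<mu> \<beta>) * cot (\<alpha> - \<beta>) ^ j)"
      by (simp add: power_divide power_mult_distrib times_divide_eq_right[symmetric] del: times_divide_eq_right)
  qed
  also have "\<dots> = \<i> ^ j * (\<Sum>\<beta>\<in>Pa - {\<alpha>}. of_nat (\<mu> \<beta>) * cot (\<alpha> - \<beta>) ^ j)"
    by (rule sum_distrib_left[symmetric])
  finally have "(\<Sum>\<beta>\<in>Pa - {\<alpha>}. of_nat (\<mu> \<beta>) * cot (\<alpha> - \<beta>) ^ j) = 0" by simp
  moreover have "(\<Sum>\<beta>\<in>{\<beta> \<in> Pa. \<mu> \<beta> > 0} - {\<alpha>}. of_nat (\<mu> \<beta>) * cot (\<alpha> - \<beta>) ^ j)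
      = (\<Sum>\<beta>\<in>Pa - {\<alpha>}. of_nat (\<mu> \<beta>) * cot (\<alpha> - \<beta>) ^ j)"
    using fin by (intro sum.mono_neutral_left) auto
  ultimately show ?thesis by simp
qed

theorem theorem4p13:
  fixes Pa :: "complex set" and \<mu> :: "complex \<Rightarrow> nat"
    and \<rho>0 \<phi>0 \<xi>1 \<xi>2 :: complex
  assumes "baker_akhieser Pa \<mu>"
    and "\<rho>0 \<noteq> 0"
    and "\<xi>1 = \<rho>0 * cos \<phi>0" and "\<xi>2 = \<rho>0 * sin \<phi>0"
    and "\<forall>\<alpha>\<in>Pa. sin (2 * (\<alpha> - \<phi>0)) \<noteq> 0"
  shows "A_mod_iso (ringA Pa \<mu>) (spectral_module Pa \<mu> \<xi>1 \<xi>2) (Pmod Pa \<mu> \<xi>1 \<xi>2)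
       \<and> A_projective TYPE('b::ab_group_add) (ringA Pa \<mu>) (spectral_module Pa \<mu> \<xi>1 \<xi>2)"
proof -
  have arr: "arrangement Pa" using assms(1) by (simp add: baker_akhieser_def)
  interpret ba_shift "{\<alpha> \<in> Pa. \<mu> \<alpha> > 0}" \<mu> Pa \<xi>1 \<xi>2
  proof unfold_locales
    show "finite Pa" using arr by (simp add: arrangement_def)
    then show "finite {\<alpha> \<in> Pa. \<mu> \<alpha> > 0}" by simp
  next
    fix \<alpha> \<beta> assume "\<alpha> \<in> {\<alpha> \<in> Pa. \<mu> \<alpha> > 0}" "\<beta> \<in> {\<alpha> \<in> Pa. \<mu> \<alpha> > 0}" "\<alpha> \<noteq> \<beta>"
    then show "sin (\<alpha> - \<beta>) \<noteq> 0" using arrangement_sin_neq_0[OF arr] by simp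
  next
    fix \<alpha> j assume "\<alpha> \<in> {\<alpha> \<in> Pa. \<mu> \<alpha> > 0}" "odd j" "j < 2 * \<mu> \<alpha>"
    then show "(\<Sum>\<beta>\<in>{\<alpha> \<in> Pa. \<mu> \<alpha> > 0} - {\<alpha>}. of_nat (\<mu> \<beta>) * cot (\<alpha> - \<beta>) ^ j) = 0"
      using baker_akhieser_cot_sum[OF assms(1)] by simp
  next
    fix \<alpha> assume "\<alpha> \<in> {\<alpha> \<in> Pa. \<mu> \<alpha> > 0}"
    then have "sin (\<alpha> - \<phi>0) \<noteq> 0" using assms(5) sin_double[of "\<alpha> - \<phi>0"] by auto
    moreover have "lin \<alpha> (- \<xi>1) (- \<xi>2) = \<rho>0 * sin (\<alpha> - \<phi>0)"
      by (simp add: lin_def assms(3,4) sin_diff algebra_simps)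
    ultimately show "lin \<alpha> (- \<xi>1) (- \<xi>2) \<noteq> 0" using assms(2) by simp
  next
    have "\<xi>1 ^ 2 + \<xi>2 ^ 2 = \<rho>0 ^ 2 * (sin \<phi>0 ^ 2 + cos \<phi>0 ^ 2)"
      by (simp only: assms(3,4) power_mult_distrib distrib_left add.commute)
    then show "\<xi>1 ^ 2 + \<xi>2 ^ 2 \<noteq> 0" using assms(2) by simp
  qed simp_all
  show ?thesis
    unfolding spectral_eq_Pmod by (intro conjI projective, unfold A_mod_iso_def, intro exI[of _ id]) simp
qed

end
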